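(* Let $k\ge2$ and let $P$ be a one-vertex $k$-cube complex. Then the $k$-graph $\Lambda(P)$ is left and right rigid, and satisfies the aperiodicity condition. In particular, $C^*(\Lambda(P))$ is simple.
   Context: A $k$-cube structure in a group $G$ is an ordered $k$-tuple $(A_1,\dots,A_k)$ of finite subsets such that for all $i\ne j$: (1) taking inverses induces fixed point free involutions on $A_i$; (2) $\bigcup A_i$ generates $G$; (3) $A_iA_j$ and $A_jA_i$ have size $\#A_i\cdot\#A_j$ and $A_iA_j=A_jA_i$; (4) $A_iA_j$ contains no $2$-torsion; (5) $G$ acts simply transitively on (the vertices of) a Cartesian product of $k$ trees. A one-vertex $k$-cube complex $P=P_{A_1,\dots,A_k}$ is the quotient of such a product of trees by such a $G$: its oriented edges of colour $i$ are labelled by $A_i$ ($a^{-1}$ is the reverse of $a$), and its geometric squares are given by the relations $ab=b'a'$ in $G$ with $a,a'\in A_i$, $b,b'\in A_j$, $i\neq j$. $\Lambda(P)$ is the $k$-graph with one object whose degree-$e_i$ morphisms form a set $E_i$ containing one morphism $\mathfrak{a}$ for each $a\in A_i$: it is the free monoid on $E_1\sqcup\dots\sqcup E_k$ modulo the relations $\mathfrak{b}\circ\mathfrak{a}=\mathfrak{a}'\circ\mathfrak{b}'$ for all relations $ab=b'a'$ in $G$ with $a,a'\in A_i$, $b,b'\in A_j$, $i\ne j$ (the path "$\mathfrak a$ then $\mathfrak b$" being the composition $\mathfrak{b}\circ\mathfrak{a}$), with degree functor $d$ to $\mathbb{N}^k$ sending $E_i$ to $e_i$. A $k$-graph is a countable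 small category with a functor $d$ to $\mathbb{N}^k$ such that $d(\pi)=m+n$ implies $\pi=\mu\nu$ for unique $\mu,\nu$ with $d(\mu)=m$, $d(\nu)=n$. Rigidity: $\Lambda(P)$ is right rigid if for all $x'\in E_i$, $y'\in E_j$, $i\neq j$, there are unique $x\in E_i$, $y\in E_j$ with $y'\circ x=x'\circ y$; it is left rigid if for all $x\in E_i$, $y\in E_j$, $i\ne j$, there are unique $x'\in E_i$, $y'\in E_j$ with $y'\circ x=x'\circ y$. Aperiodicity: $\Omega_k$ is the $k$-graph with vertices $\mathbb{N}^k$ and morphisms the pairs $(m,n)$, $m\le n$ coordinatewise, with $d(m,n)=n-m$. An infinite path in a $k$-graph $\Lambda$ is a degree preserving functor $\omega:\Omega_k\to\Lambda$, with range $r(\omega)=\omega(0)$. It is aperiodic if for every $q\in\mathbb{N}^k$ and $p\in\mathbb{Z}^k\setminus\{0\}$ there is $(m,n)\in\Omega_k$ with $m+p\ge0$ and $\omega(m+p+q,n+p+q)\ne\omega(m+q,n+q)$. $\Lambda$ satisfies the aperiodicity condition if every vertex $v$ is the range of an aperiodic infinite path. $C^*(\Lambda)$, for a row-finite source-free $k$-graph $\Lambda$, is the universal $C^*$-algebra generated by partial isometries $\{\mathbf{s}_\mu:\mu\in\Lambda\}$ such that: $\{\mathbf s_v: v\in\Lambda^0\}$ are mutually orthogonal projections; $\mathbf s_\mu\mathbf s_\nu=\mathbf s_{\mu\nu}$ when $s(\mu)=r(\nu)$; $\mathbf s_\mu^*\mathbf s_\mu=\mathbf s_{s(\mu)}$;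 and $\mathbf s_v=\sum_{\mu\in v\Lambda^n}\mathbf s_\mu\mathbf s_\mu^*$ for all vertices $v$ and $n\in\mathbb{N}^k$, where $v\Lambda^n$ is the set of morphisms of degree $n$ with range $v$. *)

theory Defs
  imports
    "HOL-Analysis.Finite_Cartesian_Product"
    "HOL-Algebra.Group_Action"
    "HOL-Algebra.Generated_Groups"
    "HOL-Library.Poly_Mapping"
    "HOL-Library.Countable_Set"
begin

section \<open>Cube structures in groups\<close>

text \<open>A simple graph is given by its vertex set and its symmetric irreflexive adjacency
  relation.\<close>

definition is_tree :: "'t set \<Rightarrow> ('t \<times> 't) set \<Rightarrow> bool" where
  "is_tree V E \<longleftrightarrow>
     V \<noteq> {} \<and> E \<subseteq> V \<times> V \<and> sym E \<and> irrefl E \<and>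
     (\<forall>u\<in>V. \<forall>v\<in>V. (u, v) \<in> E\<^sup>*) \<and>
     \<not> (\<exists>c. 3 \<le> length c \<and> distinct c \<and> successively (\<lambda>u v. (u, v) \<in> E) c \<and> (last c, hd c) \<in> E)"

definition tree_prod :: "('k \<Rightarrow> 't set) \<Rightarrow> ('k \<Rightarrow> 't) set" where
  "tree_prod V = {x. \<forall>i. x i \<in> V i}"

definition colour_adj :: "('k \<Rightarrow> ('t \<times> 't) set) \<Rightarrow> 'k \<Rightarrow> ('k \<Rightarrow> 't) \<Rightarrow> ('k \<Rightarrow> 't) \<Rightarrow> bool" where
  "colour_adj E i x y \<longleftrightarrow> (x i, y i) \<in> E i \<and> (\<forall>j. j \<noteq> i \<longrightarrow> x j = y j)"

text \<open>The index type \<^typ>\<open>'k\<close> plays the role of the set of the \<open>k\<close> colours.  The action is on the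
  vertices of the product of the trees \<open>(V i, E i)\<close>, by automorphisms that preserve the
  product structure, that is, the coloured edges.\<close>

locale k_cube_structure = group G
  for G (structure) +
  fixes A :: "'k::finite \<Rightarrow> 'a set"
    and V :: "'k \<Rightarrow> 't set" and E :: "'k \<Rightarrow> ('t \<times> 't) set"
    and \<phi> :: "'a \<Rightarrow> ('k \<Rightarrow> 't) \<Rightarrow> ('k \<Rightarrow> 't)"
  assumes A_carrier: "A i \<subseteq> carrier G"
    and A_finite: "finite (A i)"
    and A_nonempty: "A i \<noteq> {}"
    and A_inv: "a \<in> A i \<Longrightarrow> inv a \<in> A i"
    and A_inv_free: "a \<in> A i \<Longrightarrow> inv a \<noteq> a"
    and A_generate: "generate G (\<Union>i. A i) = carrier G"
    and A_card: "i \<noteq> j \<Longrightarrow> card (A i <#> A j) = card (A i) * card (A j)"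
    and A_commute: "i \<noteq> j \<Longrightarrow> A i <#> A j = A j <#> A i"
    and A_no_2_torsion: "\<lbrakk>i \<noteq> j; g \<in> A i <#> A j; g \<otimes> g = \<one>\<rbrakk> \<Longrightarrow> g = \<one>"
    and tree: "is_tree (V i) (E i)"
    and action: "group_action G (tree_prod V) \<phi>"
    and action_colour_adj:
      "\<lbrakk>g \<in> carrier G; x \<in> tree_prod V; y \<in> tree_prod V\<rbrakk>
        \<Longrightarrow> colour_adj E i (\<phi> g x) (\<phi> g y) \<longleftrightarrow> colour_adj E i x y"
    and simply_transitive:
      "\<lbrakk>x \<in> tree_prod V; y \<in> tree_prod V\<rbrakk> \<Longrightarrow> \<exists>!g. g \<in> carrier G \<and> \<phi> g x = y"

text \<open>The oriented edges of colour \<open>i\<close> of the quotient are the \<open>G\<close>-orbits of ordered pairs of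
  vertices adjacent in direction \<open>i\<close>.  Each orbit has a unique representative that starts at
  \<open>base\<close>; the edge labelled by \<open>a \<in> A i\<close> is the orbit of the pair from \<open>base\<close> to \<open>\<phi> a base\<close>.  So
  the \<open>1\<close>-skeleton of the product of trees is the Cayley graph of \<open>G\<close>, and the path
  \<open>a\<close> then \<open>b\<close> from \<open>base\<close> ends in \<open>\<phi> (a \<otimes> b) base\<close>.\<close>

locale one_vertex_cube_complex = k_cube_structure +
  fixes base
  assumes base: "base \<in> tree_prod V"
    and edge_labels: "{y \<in> tree_prod V. colour_adj E i base y} = (\<lambda>a. \<phi> a base) ` A i"


section \<open>Higher-rank graphs\<close>

text \<open>Objects are identified with their identity morphisms.  The composition \<open>kg_comp \<Lambda> \<mu> \<nu>\<close> is
  meaningful when \<open>kg_src \<Lambda> \<mu> = kg_rng \<Lambda> \<nu>\<close>.\<close>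

record ('m, 'k) kgraph_data =
  kg_mor :: "'m set"
  kg_src :: "'m \<Rightarrow> 'm"
  kg_rng :: "'m \<Rightarrow> 'm"
  kg_comp :: "'m \<Rightarrow> 'm \<Rightarrow> 'm"
  kg_deg :: "'m \<Rightarrow> nat ^ 'k"

definition kg_obj :: "('m, 'k::finite) kgraph_data \<Rightarrow> 'm set" where
  "kg_obj \<Lambda> = {v \<in> kg_mor \<Lambda>. kg_src \<Lambda> v = v \<and> kg_rng \<Lambda> v = v}"

locale kgraph =
  fixes \<Lambda> :: "('m, 'k::finite) kgraph_data"
  assumes countable_mor: "countable (kg_mor \<Lambda>)"
    and src_obj: "\<mu> \<in> kg_mor \<Lambda> \<Longrightarrow> kg_src \<Lambda> \<mu> \<in> kg_obj \<Lambda>"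
    and rng_obj: "\<mu> \<in> kg_mor \<Lambda> \<Longrightarrow> kg_rng \<Lambda> \<mu> \<in> kg_obj \<Lambda>"
    and comp_mor: "\<lbrakk>\<mu> \<in> kg_mor \<Lambda>; \<nu> \<in> kg_mor \<Lambda>; kg_src \<Lambda> \<mu> = kg_rng \<Lambda> \<nu>\<rbrakk>
        \<Longrightarrow> kg_comp \<Lambda> \<mu> \<nu> \<in> kg_mor \<Lambda>"
    and src_comp: "\<lbrakk>\<mu> \<in> kg_mor \<Lambda>; \<nu> \<in> kg_mor \<Lambda>; kg_src \<Lambda> \<mu> = kg_rng \<Lambda> \<nu>\<rbrakk>
        \<Longrightarrow> kg_src \<Lambda> (kg_comp \<Lambda> \<mu> \<nu>) = kg_src \<Lambda> \<nu>"
    and rng_comp: "\<lbrakk>\<mu> \<in> kg_mor \<Lambda>; \<nu> \<in> kg_mor \<Lambda>; kg_src \<Lambda> \<mu> = kg_rng \<Lambda> \<nu>\<rbrakk>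
        \<Longrightarrow> kg_rng \<Lambda> (kg_comp \<Lambda> \<mu> \<nu>) = kg_rng \<Lambda> \<mu>"
    and comp_src: "\<mu> \<in> kg_mor \<Lambda> \<Longrightarrow> kg_comp \<Lambda> \<mu> (kg_src \<Lambda> \<mu>) = \<mu>"
    and comp_rng: "\<mu> \<in> kg_mor \<Lambda> \<Longrightarrow> kg_comp \<Lambda> (kg_rng \<Lambda> \<mu>) \<mu> = \<mu>"
    and comp_assoc: "\<lbrakk>\<kappa> \<in> kg_mor \<Lambda>; \<mu> \<in> kg_mor \<Lambda>; \<nu> \<in> kg_mor \<Lambda>;
          kg_src \<Lambda> \<kappa> = kg_rng \<Lambda> \<mu>; kg_src \<Lambda> \<mu> = kg_rng \<Lambda> \<nu>\<rbrakk>
        \<Longrightarrow> kg_comp \<Lambda> (kg_comp \<Lambda> \<kappa> \<mu>) \<nu> = kg_comp \<Lambda> \<kappa> (kg_comp \<Lambda> \<mu> \<nu>)"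
    and deg_obj: "v \<in> kg_obj \<Lambda> \<Longrightarrow> kg_deg \<Lambda> v = 0"
    and deg_comp: "\<lbrakk>\<mu> \<in> kg_mor \<Lambda>; \<nu> \<in> kg_mor \<Lambda>; kg_src \<Lambda> \<mu> = kg_rng \<Lambda> \<nu>\<rbrakk>
        \<Longrightarrow> kg_deg \<Lambda> (kg_comp \<Lambda> \<mu> \<nu>) = kg_deg \<Lambda> \<mu> + kg_deg \<Lambda> \<nu>"
    and factorization: "\<lbrakk>\<pi> \<in> kg_mor \<Lambda>; kg_deg \<Lambda> \<pi> = m + n\<rbrakk>
        \<Longrightarrow> \<exists>!p. p \<in> kg_mor \<Lambda> \<times> kg_mor \<Lambda> \<and> kg_src \<Lambda> (fst p) = kg_rng \<Lambda> (snd p) \<and>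
              kg_deg \<Lambda> (fst p) = m \<and> kg_deg \<Lambda> (snd p) = n \<and>
              \<pi> = kg_comp \<Lambda> (fst p) (snd p)"

definition kg_edges :: "('m, 'k::finite) kgraph_data \<Rightarrow> 'k \<Rightarrow> 'm set" where
  "kg_edges \<Lambda> i = {\<mu> \<in> kg_mor \<Lambda>. kg_deg \<Lambda> \<mu> = axis i 1}"

text \<open>Rigidity is used for \<open>k\<close>-graphs with one object, where all morphisms are composable.\<close>

definition right_rigid :: "('m, 'k::finite) kgraph_data \<Rightarrow> bool" where
  "right_rigid \<Lambda> \<longleftrightarrow>
     (\<forall>i j. i \<noteq> j \<longrightarrow> (\<forall>x'\<in>kg_edges \<Lambda> i. \<forall>y'\<in>kg_edges \<Lambda> j.
        \<exists>!p. p \<in> kg_edges \<Lambda> i \<times> kg_edges \<Lambda> j \<and>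
             kg_comp \<Lambda> y' (fst p) = kg_comp \<Lambda> x' (snd p)))"

definition left_rigid :: "('m, 'k::finite) kgraph_data \<Rightarrow> bool" where
  "left_rigid \<Lambda> \<longleftrightarrow>
     (\<forall>i j. i \<noteq> j \<longrightarrow> (\<forall>x\<in>kg_edges \<Lambda> i. \<forall>y\<in>kg_edges \<Lambda> j.
        \<exists>!p. p \<in> kg_edges \<Lambda> i \<times> kg_edges \<Lambda> j \<and>
             kg_comp \<Lambda> (snd p) x = kg_comp \<Lambda> (fst p) y))"

text \<open>A morphism \<open>(m, n)\<close> of \<open>\<Omega>\<^sub>k\<close> has range \<open>m\<close> and source \<open>n\<close>; the order on \<^typ>\<open>nat ^ 'k\<close> is
  the coordinatewise one, and the object \<open>m\<close> is the morphism \<open>(m, m)\<close>.\<close>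

definition Omega :: "((nat ^ 'k) \<times> (nat ^ 'k), 'k::finite) kgraph_data" where
  "Omega = \<lparr>kg_mor = {(m, n). m \<le> n},
            kg_src = (\<lambda>(m, n). (n, n)),
            kg_rng = (\<lambda>(m, n). (m, m)),
            kg_comp = (\<lambda>(l, m) (m', n). (l, n)),
            kg_deg = (\<lambda>(m, n). n - m)\<rparr>"

definition infinite_path ::
    "('m, 'k::finite) kgraph_data \<Rightarrow> ((nat ^ 'k) \<times> (nat ^ 'k) \<Rightarrow> 'm) \<Rightarrow> bool" where
  "infinite_path \<Lambda> \<omega> \<longleftrightarrow>
     (\<forall>\<mu>\<in>kg_mor Omega. \<omega> \<mu> \<in> kg_mor \<Lambda> \<and>
        \<omega> (kg_src Omega \<mu>) = kg_src \<Lambda> (\<omega> \<mu>) \<and> \<omega> (kg_rng Omega \<mu>) = kg_rng \<Lambda> (\<omega> \<mu>) \<and>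
        kg_deg \<Lambda> (\<omega> \<mu>) = kg_deg Omega \<mu>) \<and>
     (\<forall>\<mu>\<in>kg_mor Omega. \<forall>\<nu>\<in>kg_mor Omega. kg_src Omega \<mu> = kg_rng Omega \<nu> \<longrightarrow>
        \<omega> (kg_comp Omega \<mu> \<nu>) = kg_comp \<Lambda> (\<omega> \<mu>) (\<omega> \<nu>))"

text \<open>\<open>shift m p\<close> is \<open>m + p\<close>, provided that this is nonnegative.\<close>

definition shift :: "nat ^ 'k \<Rightarrow> int ^ 'k \<Rightarrow> nat ^ 'k::finite" where
  "shift m p = (\<chi> i. nat (int (m $ i) + p $ i))"

definition aperiodic_path :: "((nat ^ 'k::finite) \<times> (nat ^ 'k) \<Rightarrow> 'm) \<Rightarrow> bool" where
  "aperiodic_path \<omega> \<longleftrightarrow>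
     (\<forall>q p. p \<noteq> 0 \<longrightarrow> (\<exists>m n. m \<le> n \<and> (\<forall>i. 0 \<le> int (m $ i) + p $ i) \<and>
        \<omega> (shift m p + q, shift n p + q) \<noteq> \<omega> (m + q, n + q)))"

definition aperiodicity_condition :: "('m, 'k::finite) kgraph_data \<Rightarrow> bool" where
  "aperiodicity_condition \<Lambda> \<longleftrightarrow>
     (\<forall>v\<in>kg_obj \<Lambda>. \<exists>\<omega>. infinite_path \<Lambda> \<omega> \<and> aperiodic_path \<omega> \<and> \<omega> (0, 0) = v)"


section \<open>The \<open>k\<close>-graph of a one-vertex cube complex\<close>

text \<open>The letter \<open>(i, a)\<close> is the morphism of degree \<open>e\<^sub>i\<close> attached to \<open>a \<in> A i\<close>, and a word is the
  composition of its letters read from left to right; hence the path \<open>a\<close> then \<open>b\<close> is the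
  word \<open>[(j, b), (i, a)]\<close>.\<close>

definition cube_letters :: "('k \<Rightarrow> 'g set) \<Rightarrow> ('k \<times> 'g) set" where
  "cube_letters A = (SIGMA i : UNIV. A i)"

definition square_steps ::
    "('g, 'x) monoid_scheme \<Rightarrow> ('k \<Rightarrow> 'g set) \<Rightarrow> (('k \<times> 'g) list \<times> ('k \<times> 'g) list) set" where
  "square_steps G A =
     {(u @ [(j, b), (i, a)] @ v, u @ [(i, a'), (j, b')] @ v) | u v i j a a' b b'.
        u \<in> lists (cube_letters A) \<and> v \<in> lists (cube_letters A) \<and> i \<noteq> j \<and>
        a \<in> A i \<and> a' \<in> A i \<and> b \<in> A j \<and> b' \<in> A j \<and> a \<otimes>\<^bsub>G\<^esub> b = b' \<otimes>\<^bsub>G\<^esub> a'}"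

definition square_cong ::
    "('g, 'x) monoid_scheme \<Rightarrow> ('k \<Rightarrow> 'g set) \<Rightarrow> (('k \<times> 'g) list \<times> ('k \<times> 'g) list) set" where
  "square_cong G A = (square_steps G A \<union> (square_steps G A)\<inverse>)\<^sup>*"

definition word_deg :: "('k \<times> 'g) list \<Rightarrow> nat ^ 'k::finite" where
  "word_deg w = (\<chi> i. count_list (map fst w) i)"

definition cube_kgraph ::
    "('g, 'x) monoid_scheme \<Rightarrow> ('k::finite \<Rightarrow> 'g set) \<Rightarrow> (('k \<times> 'g) list set, 'k) kgraph_data" where
  "cube_kgraph G A =
     \<lparr>kg_mor = lists (cube_letters A) // square_cong G A,
      kg_src = (\<lambda>_. square_cong G A `` {[]}),
      kg_rng = (\<lambda>_. square_cong G A `` {[]}),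
      kg_comp = (\<lambda>X Y. \<Union>u\<in>X. \<Union>v\<in>Y. square_cong G A `` {u @ v}),
      kg_deg = (\<lambda>X. THE n. \<forall>w\<in>X. word_deg w = n)\<rparr>"


section \<open>\<open>C\<^sup>*\<close>-algebras\<close>

text \<open>\<open>C\<^sup>*\<close>-algebras are complex and not necessarily unital.\<close>

record 'a cstar_data = "'a partial_object" +
  czero :: 'a
  cadd :: "'a \<Rightarrow> 'a \<Rightarrow> 'a"
  cscale :: "complex \<Rightarrow> 'a \<Rightarrow> 'a"
  cmult :: "'a \<Rightarrow> 'a \<Rightarrow> 'a"
  cadj :: "'a \<Rightarrow> 'a"
  cnorm :: "'a \<Rightarrow> real"

definition cdist :: "('a, 'x) cstar_data_scheme \<Rightarrow> 'a \<Rightarrow> 'a \<Rightarrow> real" where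
  "cdist B x y = cnorm B (cadd B x (cscale B (-1) y))"

locale cstar_algebra =
  fixes B :: "('a, 'x) cstar_data_scheme"
  assumes zero_closed: "czero B \<in> carrier B"
    and add_closed: "\<lbrakk>x \<in> carrier B; y \<in> carrier B\<rbrakk> \<Longrightarrow> cadd B x y \<in> carrier B"
    and scale_closed: "x \<in> carrier B \<Longrightarrow> cscale B c x \<in> carrier B"
    and mult_closed: "\<lbrakk>x \<in> carrier B; y \<in> carrier B\<rbrakk> \<Longrightarrow> cmult B x y \<in> carrier B"
    and adj_closed: "x \<in> carrier B \<Longrightarrow> cadj B x \<in> carrier B"
    and add_assoc: "\<lbrakk>x \<in> carrier B; y \<in> carrier B; z \<in> carrier B\<rbrakk>
        \<Longrightarrow> cadd B (cadd B x y) z = cadd B x (cadd B y z)"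
    and add_commute: "\<lbrakk>x \<in> carrier B; y \<in> carrier B\<rbrakk> \<Longrightarrow> cadd B x y = cadd B y x"
    and add_zero: "x \<in> carrier B \<Longrightarrow> cadd B x (czero B) = x"
    and add_neg: "x \<in> carrier B \<Longrightarrow> cadd B x (cscale B (-1) x) = czero B"
    and scale_one: "x \<in> carrier B \<Longrightarrow> cscale B 1 x = x"
    and scale_scale: "x \<in> carrier B \<Longrightarrow> cscale B c (cscale B d x) = cscale B (c * d) x"
    and scale_add_right: "\<lbrakk>x \<in> carrier B; y \<in> carrier B\<rbrakk>
        \<Longrightarrow> cscale B c (cadd B x y) = cadd B (cscale B c x) (cscale B c y)"
    and scale_add_left: "x \<in> carrier B
        \<Longrightarrow> cscale B (c + d) x = cadd B (cscale B c x) (cscale B d x)"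
    and mult_assoc: "\<lbrakk>x \<in> carrier B; y \<in> carrier B; z \<in> carrier B\<rbrakk>
        \<Longrightarrow> cmult B (cmult B x y) z = cmult B x (cmult B y z)"
    and mult_add_left: "\<lbrakk>x \<in> carrier B; y \<in> carrier B; z \<in> carrier B\<rbrakk>
        \<Longrightarrow> cmult B (cadd B x y) z = cadd B (cmult B x z) (cmult B y z)"
    and mult_add_right: "\<lbrakk>x \<in> carrier B; y \<in> carrier B; z \<in> carrier B\<rbrakk>
        \<Longrightarrow> cmult B x (cadd B y z) = cadd B (cmult B x y) (cmult B x z)"
    and mult_scale_left: "\<lbrakk>x \<in> carrier B; y \<in> carrier B\<rbrakk>
        \<Longrightarrow> cmult B (cscale B c x) y = cscale B c (cmult B x y)"
    and mult_scale_right: "\<lbrakk>x \<in> carrier B; y \<in> carrier B\<rbrakk>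
        \<Longrightarrow> cmult B x (cscale B c y) = cscale B c (cmult B x y)"
    and adj_adj: "x \<in> carrier B \<Longrightarrow> cadj B (cadj B x) = x"
    and adj_add: "\<lbrakk>x \<in> carrier B; y \<in> carrier B\<rbrakk>
        \<Longrightarrow> cadj B (cadd B x y) = cadd B (cadj B x) (cadj B y)"
    and adj_scale: "x \<in> carrier B \<Longrightarrow> cadj B (cscale B c x) = cscale B (cnj c) (cadj B x)"
    and adj_mult: "\<lbrakk>x \<in> carrier B; y \<in> carrier B\<rbrakk>
        \<Longrightarrow> cadj B (cmult B x y) = cmult B (cadj B y) (cadj B x)"
    and norm_nonneg: "x \<in> carrier B \<Longrightarrow> 0 \<le> cnorm B x"
    and norm_eq_zero: "x \<in> carrier B \<Longrightarrow> cnorm B x = 0 \<longleftrightarrow> x = czero B"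
    and norm_triangle: "\<lbrakk>x \<in> carrier B; y \<in> carrier B\<rbrakk>
        \<Longrightarrow> cnorm B (cadd B x y) \<le> cnorm B x + cnorm B y"
    and norm_scale: "x \<in> carrier B \<Longrightarrow> cnorm B (cscale B c x) = cmod c * cnorm B x"
    and norm_mult: "\<lbrakk>x \<in> carrier B; y \<in> carrier B\<rbrakk>
        \<Longrightarrow> cnorm B (cmult B x y) \<le> cnorm B x * cnorm B y"
    and cstar_identity: "x \<in> carrier B \<Longrightarrow> cnorm B (cmult B (cadj B x) x) = (cnorm B x)\<^sup>2"
    and complete: "\<lbrakk>\<And>n. u n \<in> carrier B; \<And>e. 0 < e \<Longrightarrow> \<exists>N. \<forall>m\<ge>N. \<forall>n\<ge>N. cdist B (u m) (u n) < e\<rbrakk>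
        \<Longrightarrow> \<exists>x\<in>carrier B. (\<lambda>n. cdist B (u n) x) \<longlonglongrightarrow> 0"

definition closed_ideal :: "'a set \<Rightarrow> ('a, 'x) cstar_data_scheme \<Rightarrow> bool" where
  "closed_ideal I B \<longleftrightarrow>
     I \<subseteq> carrier B \<and> czero B \<in> I \<and>
     (\<forall>x\<in>I. \<forall>y\<in>I. cadd B x y \<in> I) \<and> (\<forall>c. \<forall>x\<in>I. cscale B c x \<in> I) \<and>
     (\<forall>x\<in>I. \<forall>y\<in>carrier B. cmult B x y \<in> I \<and> cmult B y x \<in> I) \<and>
     (\<forall>u x. (\<forall>n. u n \<in> I) \<and> x \<in> carrier B \<and> (\<lambda>n. cdist B (u n) x) \<longlonglongrightarrow> 0 \<longrightarrow> x \<in> I)"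

definition simple_cstar_algebra :: "('a, 'x) cstar_data_scheme \<Rightarrow> bool" where
  "simple_cstar_algebra B \<longleftrightarrow>
     cstar_algebra B \<and> carrier B \<noteq> {czero B} \<and>
     (\<forall>I. closed_ideal I B \<longrightarrow> I = {czero B} \<or> I = carrier B)"


section \<open>The free \<open>*\<close>-algebra on a set of generators\<close>

text \<open>A word is a finite sequence of generators; the flag marks an adjoint.\<close>

datatype 'm star_word = Star_Word (star_letters: "('m \<times> bool) list")

instantiation star_word :: (type) monoid_add
begin

definition zero_star_word :: "'a star_word" where
  "0 = Star_Word []"

definition plus_star_word :: "'a star_word \<Rightarrow> 'a star_word \<Rightarrow> 'a star_word" where
  "v + w = Star_Word (star_letters v @ star_letters w)"

instance
  by standard (simp_all add: zero_star_word_def plus_star_word_def)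

end

definition adj_word :: "'m star_word \<Rightarrow> 'm star_word" where
  "adj_word w = Star_Word (rev (map (\<lambda>(\<mu>, b). (\<mu>, \<not> b)) (star_letters w)))"

text \<open>\<^typ>\<open>'m star_word \<Rightarrow>\<^sub>0 complex\<close> is the ring of noncommutative \<open>*\<close>-polynomials.  The words in
  \<open>free_star_alg M\<close> are required to be nonempty: the universal \<open>C\<^sup>*\<close>-algebra is not to be given an
  additional unit.\<close>

type_synonym 'm star_poly = "'m star_word \<Rightarrow>\<^sub>0 complex"

definition free_star_alg :: "'m set \<Rightarrow> 'm star_poly set" where
  "free_star_alg M =
     {x. \<forall>w\<in>Poly_Mapping.keys x. star_letters w \<noteq> [] \<and> fst ` set (star_letters w) \<subseteq> M}"

definition fscale :: "complex \<Rightarrow> 'm star_poly \<Rightarrow> 'm star_poly" where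
  "fscale c x = Poly_Mapping.map ((*) c) x"

definition fadj :: "'m star_poly \<Rightarrow> 'm star_poly" where
  "fadj x = Poly_Mapping.map cnj (Poly_Mapping.map_key adj_word x)"

definition fgen :: "'m \<Rightarrow> 'm star_poly" where
  "fgen \<mu> = Poly_Mapping.single (Star_Word [(\<mu>, False)]) 1"

definition cstar_seminorm :: "'m set \<Rightarrow> ('m star_poly \<Rightarrow> real) \<Rightarrow> bool" where
  "cstar_seminorm M q \<longleftrightarrow>
     (\<forall>x\<in>free_star_alg M. 0 \<le> q x \<and> q (fadj x * x) = (q x)\<^sup>2 \<and> (\<forall>c. q (fscale c x) = cmod c * q x)) \<and>
     (\<forall>x\<in>free_star_alg M. \<forall>y\<in>free_star_alg M. q (x + y) \<le> q x + q y \<and> q (x * y) \<le> q x * q y)"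


section \<open>The \<open>C\<^sup>*\<close>-algebra of a row-finite source-free \<open>k\<close>-graph\<close>

text \<open>The relations are the equations \<open>r = 0\<close> for the following \<open>r\<close>.\<close>

definition ck_relators :: "('m, 'k::finite) kgraph_data \<Rightarrow> 'm star_poly set" where
  "ck_relators \<Lambda> =
     {fadj (fgen v) - fgen v | v. v \<in> kg_obj \<Lambda>} \<union>
     {fgen v * fgen v - fgen v | v. v \<in> kg_obj \<Lambda>} \<union>
     {fgen v * fgen w | v w. v \<in> kg_obj \<Lambda> \<and> w \<in> kg_obj \<Lambda> \<and> v \<noteq> w} \<union>
     {fgen \<mu> * fgen \<nu> - fgen (kg_comp \<Lambda> \<mu> \<nu>) | \<mu> \<nu>.
        \<mu> \<in> kg_mor \<Lambda> \<and> \<nu> \<in> kg_mor \<Lambda> \<and> kg_src \<Lambda> \<mu> = kg_rng \<Lambda> \<nu>} \<union>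
     {fadj (fgen \<mu>) * fgen \<mu> - fgen (kg_src \<Lambda> \<mu>) | \<mu>. \<mu> \<in> kg_mor \<Lambda>} \<union>
     {fgen v - (\<Sum>\<mu> \<in> {\<mu> \<in> kg_mor \<Lambda>. kg_deg \<Lambda> \<mu> = n \<and> kg_rng \<Lambda> \<mu> = v}. fgen \<mu> * fadj (fgen \<mu>)) | v n.
        v \<in> kg_obj \<Lambda>}"

text \<open>\<open>C\<^sup>*\<close>-seminorms that vanish on the relators correspond to families in \<open>C\<^sup>*\<close>-algebras that
  satisfy the relations, so the universal \<open>C\<^sup>*\<close>-algebra is the separated completion of the free
  \<open>*\<close>-algebra in the largest such seminorm.  It is finite, as the generators are mapped to partial
  isometries.\<close>

definition ck_seminorm :: "('m, 'k::finite) kgraph_data \<Rightarrow> 'm star_poly \<Rightarrow> real" where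
  "ck_seminorm \<Lambda> x =
     (SUP q \<in> {q. cstar_seminorm (kg_mor \<Lambda>) q \<and> (\<forall>r\<in>ck_relators \<Lambda>. q r = 0)}. q x)"

definition seminorm_cauchy :: "'m star_poly set \<Rightarrow> ('m star_poly \<Rightarrow> real) \<Rightarrow> (nat \<Rightarrow> 'm star_poly) set" where
  "seminorm_cauchy F p =
     {u. (\<forall>n. u n \<in> F) \<and> (\<forall>e>0. \<exists>N. \<forall>m\<ge>N. \<forall>n\<ge>N. p (u m - u n) < e)}"

definition seminorm_rel ::
    "'m star_poly set \<Rightarrow> ('m star_poly \<Rightarrow> real) \<Rightarrow> ((nat \<Rightarrow> 'm star_poly) \<times> (nat \<Rightarrow> 'm star_poly)) set" where
  "seminorm_rel F p =
     {(u, v). u \<in> seminorm_cauchy F p \<and> v \<in> seminorm_cauchy F p \<and> (\<lambda>n. p (u n - v n)) \<longlonglongrightarrow> 0}"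

definition seminorm_completion ::
    "'m star_poly set \<Rightarrow> ('m star_poly \<Rightarrow> real) \<Rightarrow> (nat \<Rightarrow> 'm star_poly) set cstar_data" where
  "seminorm_completion F p =
     \<lparr>carrier = seminorm_cauchy F p // seminorm_rel F p,
      czero = seminorm_rel F p `` {\<lambda>n. 0},
      cadd = (\<lambda>X Y. \<Union>u\<in>X. \<Union>v\<in>Y. seminorm_rel F p `` {\<lambda>n. u n + v n}),
      cscale = (\<lambda>c X. \<Union>u\<in>X. seminorm_rel F p `` {\<lambda>n. fscale c (u n)}),
      cmult = (\<lambda>X Y. \<Union>u\<in>X. \<Union>v\<in>Y. seminorm_rel F p `` {\<lambda>n. u n * v n}),
      cadj = (\<lambda>X. \<Union>u\<in>X. seminorm_rel F p `` {\<lambda>n. fadj (u n)}),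
      cnorm = (\<lambda>X. THE r. \<forall>u\<in>X. (\<lambda>n. p (u n)) \<longlonglongrightarrow> r)\<rparr>"

definition kgraph_cstar :: "('m, 'k::finite) kgraph_data \<Rightarrow> (nat \<Rightarrow> 'm star_poly) set cstar_data" where
  "kgraph_cstar \<Lambda> = seminorm_completion (free_star_alg (kg_mor \<Lambda>)) (ck_seminorm \<Lambda>)"

section \<open>The universal property of \<open>kgraph_cstar\<close>\<close>

text \<open>The rest of this theory shows that \<open>kgraph_cstar \<Lambda>\<close> is a \<open>C\<^sup>*\<close>-algebra, that the images of the
  generators satisfy the relations and generate a dense \<open>*\<close>-subalgebra, and that
  \<open>*\<close>-homomorphisms from the free \<open>*\<close>-algebra to any \<open>C\<^sup>*\<close>-algebra that respect the relations
  factor through it.\<close>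

definition cstar_hom ::
    "('a, 'x) cstar_data_scheme \<Rightarrow> ('b, 'y) cstar_data_scheme \<Rightarrow> ('a \<Rightarrow> 'b) \<Rightarrow> bool" where
  "cstar_hom A D h \<longleftrightarrow>
     (\<forall>x\<in>carrier A. h x \<in> carrier D \<and> (\<forall>c. h (cscale A c x) = cscale D c (h x)) \<and>
        h (cadj A x) = cadj D (h x)) \<and>
     (\<forall>x\<in>carrier A. \<forall>y\<in>carrier A.
        h (cadd A x y) = cadd D (h x) (h y) \<and> h (cmult A x y) = cmult D (h x) (h y))"

definition free_star_hom ::
    "'m set \<Rightarrow> ('b, 'y) cstar_data_scheme \<Rightarrow> ('m star_poly \<Rightarrow> 'b) \<Rightarrow> bool" where
  "free_star_hom M D h \<longleftrightarrow>
     (\<forall>x\<in>free_star_alg M. h x \<in> carrier D \<and> (\<forall>c. h (fscale c x) = cscale D c (h x)) \<and>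
        h (fadj x) = cadj D (h x)) \<and>
     (\<forall>x\<in>free_star_alg M. \<forall>y\<in>free_star_alg M.
        h (x + y) = cadd D (h x) (h y) \<and> h (x * y) = cmult D (h x) (h y))"

definition kgraph_cstar_of :: "('m, 'k::finite) kgraph_data \<Rightarrow> 'm star_poly \<Rightarrow> (nat \<Rightarrow> 'm star_poly) set" where
  "kgraph_cstar_of \<Lambda> x = seminorm_rel (free_star_alg (kg_mor \<Lambda>)) (ck_seminorm \<Lambda>) `` {\<lambda>n. x}"

lemma adj_word_adj_word [simp]: "adj_word (adj_word w) = w"
  by (cases w) (simp add: adj_word_def rev_map o_def case_prod_unfold)

lemma adj_word_plus: "adj_word (v + w) = adj_word w + adj_word v"
  by (simp add: adj_word_def plus_star_word_def)

lemma inj_adj_word: "inj adj_word"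
  by (metis adj_word_adj_word injI)

lemma lookup_fscale [simp]: "Poly_Mapping.lookup (fscale c x) w = c * Poly_Mapping.lookup x w"
  by (simp add: fscale_def Poly_Mapping.map.rep_eq when_def)

lemma lookup_fadj [simp]: "Poly_Mapping.lookup (fadj x) w = cnj (Poly_Mapping.lookup x (adj_word w))"
  by (simp add: fadj_def Poly_Mapping.map.rep_eq when_def map_key.rep_eq[OF inj_adj_word])

lemma fscale_conv_mult: "fscale c x = Poly_Mapping.single 0 c * x"
  by (simp add: fscale_def mult_map_scale_conv_mult)

lemma fscale_simps:
  "fscale 1 x = x" "fscale c (fscale d x) = fscale (c * d) x" "fscale (-1) x = - x"
  "fscale c (x + y) = fscale c x + fscale c y" "fscale (c + d) x = fscale c x + fscale d x"
  "fscale c (x - y) = fscale c x - fscale c y" "fscale c 0 = 0" "fscale 0 x = 0"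
  by (rule poly_mapping_eqI; simp add: lookup_add lookup_minus algebra_simps)+

lemma fscale_mult_left: "fscale c x * y = fscale c (x * y)"
  by (simp add: fscale_conv_mult mult.assoc)

lemma single_zero_commute: "x * Poly_Mapping.single 0 c = Poly_Mapping.single 0 c * (x :: 'm star_poly)"
proof (induction x rule: Poly_Mapping.update_induct)
  case const
  then show ?case by simp
next
  case (update f a b)
  have *: "Poly_Mapping.update a b f = f + Poly_Mapping.single a b"
    using update by (intro poly_mapping_eqI) (auto simp: lookup_add lookup_update lookup_single when_def in_keys_iff)
  show ?case
    unfolding * by (simp add: algebra_simps update mult_single)
qed

lemma fscale_mult_right: "x * fscale c y = fscale c (x * y)"
  by (metis fscale_conv_mult mult.assoc single_zero_commute)

lemma fadj_simps:
  "fadj (fadj x) = x" "fadj (x + y) = fadj x + fadj y" "fadj (x - y) = fadj x - fadj y"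
  "fadj 0 = 0" "fadj (fscale c x) = fscale (cnj c) (fadj x)"
  by (rule poly_mapping_eqI; simp add: lookup_add lookup_minus)+

lemma fadj_single: "fadj (Poly_Mapping.single w c) = Poly_Mapping.single (adj_word w) (cnj c)"
  by (rule poly_mapping_eqI) (auto simp: lookup_single when_def)

lemma star_poly_induct [case_names zero add_single]:
  fixes x :: "'m star_poly"
  assumes "P 0" and "\<And>f a b. P f \<Longrightarrow> a \<notin> Poly_Mapping.keys f \<Longrightarrow> b \<noteq> 0 \<Longrightarrow> P (f + Poly_Mapping.single a b)"
  shows "P x"
proof (induction x rule: Poly_Mapping.update_induct)
  case const
  then show ?case using assms by simp
next
  case (update f a b)
  have *: "Poly_Mapping.update a b f = f + Poly_Mapping.single a b"
    using update by (intro poly_mapping_eqI) (auto simp: lookup_add lookup_update lookup_single when_def in_keys_iff)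
  show ?case
    unfolding * by (rule assms) (use update in auto)
qed

lemma fadj_mult: "fadj (x * y) = fadj y * fadj x"
proof (induction x rule: star_poly_induct)
  case zero
  then show ?case by (simp add: fadj_simps)
next
  case (add_single f a b)
  have "fadj (Poly_Mapping.single a b * y) = fadj y * fadj (Poly_Mapping.single a b)"
    by (induction y rule: star_poly_induct)
      (simp_all add: fadj_simps algebra_simps mult_single fadj_single adj_word_plus)
  with add_single show ?case
    by (simp add: fadj_simps algebra_simps)
qed

lemma free_star_alg_closed_aux:
  assumes "x \<in> free_star_alg M" "y \<in> free_star_alg M"
  shows "x + y \<in> free_star_alg M" "x - y \<in> free_star_alg M" "x * y \<in> free_star_alg M"
    "fscale c x \<in> free_star_alg M" "fadj x \<in> free_star_alg M"
proof -
  show "x + y \<in> free_star_alg M"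
    using assms Poly_Mapping.keys_add[of x y] unfolding free_star_alg_def by blast
  show "x - y \<in> free_star_alg M"
    using assms keys_diff[of x y] unfolding free_star_alg_def by blast
  show "x * y \<in> free_star_alg M"
    using assms keys_mult[of x y] unfolding free_star_alg_def
    by (fastforce simp: plus_star_word_def)
  show "fscale c x \<in> free_star_alg M"
    using assms by (auto simp: free_star_alg_def in_keys_iff)
  show "fadj x \<in> free_star_alg M"
    unfolding free_star_alg_def
  proof (intro CollectI ballI)
    fix w assume "w \<in> Poly_Mapping.keys (fadj x)"
    then have "adj_word w \<in> Poly_Mapping.keys x"
      by (simp add: in_keys_iff)
    with assms(1) have "star_letters (adj_word w) \<noteq> [] \<and> fst ` set (star_letters (adj_word w)) \<subseteq> M"
      by (simp add: free_star_alg_def)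
    moreover have "fst ` set (star_letters (adj_word w)) = fst ` set (star_letters w)"
      by (simp add: adj_word_def image_image case_prod_unfold)
    ultimately show "star_letters w \<noteq> [] \<and> fst ` set (star_letters w) \<subseteq> M"
      by (simp add: adj_word_def)
  qed
qed

lemma free_star_alg_closed:
  "\<lbrakk>x \<in> free_star_alg M; y \<in> free_star_alg M\<rbrakk> \<Longrightarrow> x + y \<in> free_star_alg M"
  "\<lbrakk>x \<in> free_star_alg M; y \<in> free_star_alg M\<rbrakk> \<Longrightarrow> x - y \<in> free_star_alg M"
  "\<lbrakk>x \<in> free_star_alg M; y \<in> free_star_alg M\<rbrakk> \<Longrightarrow> x * y \<in> free_star_alg M"
  "x \<in> free_star_alg M \<Longrightarrow> fscale c x \<in> free_star_alg M"
  "x \<in> free_star_alg M \<Longrightarrow> fadj x \<in> free_star_alg M"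
  by (rule free_star_alg_closed_aux; assumption)+

lemma zero_free_star_alg: "0 \<in> free_star_alg M"
  by (simp add: free_star_alg_def)

lemma fgen_free_star_alg: "\<mu> \<in> M \<Longrightarrow> fgen \<mu> \<in> free_star_alg M"
  by (simp add: free_star_alg_def fgen_def)

locale cstar_seminormed =
  fixes M :: "'m set" and q :: "'m star_poly \<Rightarrow> real"
  assumes cstar_seminorm: "cstar_seminorm M q"
begin

abbreviation "F \<equiv> free_star_alg M"

lemmas F_closed = free_star_alg_closed[of _ M]

lemma q_nonneg: "x \<in> F \<Longrightarrow> 0 \<le> q x"
  and q_adj_mult: "x \<in> F \<Longrightarrow> q (fadj x * x) = (q x)\<^sup>2"
  and q_scale: "x \<in> F \<Longrightarrow> q (fscale c x) = cmod c * q x"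
  and q_add: "\<lbrakk>x \<in> F; y \<in> F\<rbrakk> \<Longrightarrow> q (x + y) \<le> q x + q y"
  and q_mult: "\<lbrakk>x \<in> F; y \<in> F\<rbrakk> \<Longrightarrow> q (x * y) \<le> q x * q y"
  using cstar_seminorm unfolding cstar_seminorm_def by blast+

lemma q_zero: "q 0 = 0"
  using q_scale[OF zero_free_star_alg, of 0] by (simp add: fscale_simps)

lemma q_minus: "x \<in> F \<Longrightarrow> q (- x) = q x"
  using q_scale[of x "-1"] by (simp add: fscale_simps)

lemma q_minus_commute: "\<lbrakk>x \<in> F; y \<in> F\<rbrakk> \<Longrightarrow> q (x - y) = q (y - x)"
  using q_minus[OF F_closed(2), of x y] by simp

lemma q_diff_triangle:
  assumes "x \<in> F" "y \<in> F" "z \<in> F"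
  shows "q (x - z) \<le> q (x - y) + q (y - z)"
  using q_add[OF F_closed(2)[OF assms(1,2)] F_closed(2)[OF assms(2,3)]] by simp

lemma q_abs_diff:
  assumes "x \<in> F" "y \<in> F"
  shows "\<bar>q x - q y\<bar> \<le> q (x - y)"
proof -
  have "q x \<le> q (x - y) + q y"
    using q_add[OF F_closed(2)[OF assms] assms(2)] by simp
  moreover have "q y \<le> q (y - x) + q x"
    using q_add[OF F_closed(2)[OF assms(2,1)] assms(1)] by simp
  ultimately show ?thesis
    unfolding q_minus_commute[OF assms(2,1)] by linarith
qed

lemma q_adj: assumes "x \<in> F" shows "q (fadj x) = q x"
proof -
  have *: "q y \<le> q (fadj y)" if y: "y \<in> F" for y
  proof (cases "q y = 0")
    case True
    then show ?thesis using q_nonneg[OF F_closed(5)[OF y]] by simp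
  next
    case False
    have "q y * q y \<le> q (fadj y) * q y"
      using q_adj_mult[OF y] q_mult[OF F_closed(5)[OF y] y] by (simp add: power2_eq_square)
    then show ?thesis using False q_nonneg[OF y] by simp
  qed
  show ?thesis using *[OF assms] *[OF F_closed(5)[OF assms]] by (simp add: fadj_simps)
qed

end

lemma ck_relators_adj: "v \<in> kg_obj \<Lambda> \<Longrightarrow> fadj (fgen v) - fgen v \<in> ck_relators \<Lambda>"
  unfolding ck_relators_def by blast

lemma ck_relators_idem: "v \<in> kg_obj \<Lambda> \<Longrightarrow> fgen v * fgen v - fgen v \<in> ck_relators \<Lambda>"
  unfolding ck_relators_def by blast

lemma ck_relators_src:
  "\<mu> \<in> kg_mor \<Lambda> \<Longrightarrow> fadj (fgen \<mu>) * fgen \<mu> - fgen (kg_src \<Lambda> \<mu>) \<in> ck_relators \<Lambda>"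
  unfolding ck_relators_def by blast

lemma ck_word_bound:
  assumes "kgraph \<Lambda>" "cstar_seminorm (kg_mor \<Lambda>) q" "\<forall>r\<in>ck_relators \<Lambda>. q r = 0"
    and "w \<noteq> []" "fst ` set w \<subseteq> kg_mor \<Lambda>"
  shows "q (Poly_Mapping.single (Star_Word w) 1) \<le> 1"
proof -
  interpret cstar_seminormed "kg_mor \<Lambda>" q by unfold_locales (rule assms)
  interpret kgraph \<Lambda> by fact
  have rel: "q r = 0" if "r \<in> ck_relators \<Lambda>" for r using assms that by blast
  have obj: "q (fgen v) \<le> 1" if v: "v \<in> kg_obj \<Lambda>" for v
  proof -
    have vF: "fgen v \<in> F" using v by (simp add: kg_obj_def fgen_free_star_alg)
    have r1: "q (fadj (fgen v) - fgen v) = 0" and r2: "q (fgen v * fgen v - fgen v) = 0"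
      using v by (auto intro!: rel ck_relators_adj ck_relators_idem)
    have "q (fadj (fgen v) * fgen v - fgen v * fgen v) \<le> q (fadj (fgen v) - fgen v) * q (fgen v)"
      using q_mult[of "fadj (fgen v) - fgen v" "fgen v"] vF F_closed by (simp add: algebra_simps)
    then have "q (fadj (fgen v) * fgen v) \<le> q (fgen v * fgen v)"
      using q_abs_diff[of "fadj (fgen v) * fgen v" "fgen v * fgen v"] vF F_closed r1 by auto
    also have "\<dots> \<le> q (fgen v)"
      using q_abs_diff[of "fgen v * fgen v" "fgen v"] vF F_closed r2 by auto
    finally have "q (fgen v) * q (fgen v) \<le> 1 * q (fgen v)"
      using q_adj_mult[OF vF] by (simp add: power2_eq_square)
    then show ?thesis using q_nonneg[OF vF] by (cases "q (fgen v) = 0") auto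
  qed
  have gen: "q (fgen \<mu>) \<le> 1" if \<mu>: "\<mu> \<in> kg_mor \<Lambda>" for \<mu>
  proof -
    have \<mu>F: "fgen \<mu> \<in> F" "fgen (kg_src \<Lambda> \<mu>) \<in> F"
      using \<mu> src_obj[OF \<mu>] by (auto simp: kg_obj_def fgen_free_star_alg)
    have r: "q (fadj (fgen \<mu>) * fgen \<mu> - fgen (kg_src \<Lambda> \<mu>)) = 0"
      using \<mu> by (intro rel ck_relators_src)
    have "(q (fgen \<mu>))\<^sup>2 \<le> q (fgen (kg_src \<Lambda> \<mu>))"
      using q_abs_diff[of "fadj (fgen \<mu>) * fgen \<mu>" "fgen (kg_src \<Lambda> \<mu>)"] q_adj_mult \<mu>F F_closed r by auto
    also have "\<dots> \<le> 1" using obj src_obj[OF \<mu>] .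
    finally show ?thesis using q_nonneg[OF \<mu>F(1)] by (simp add: power_le_one_iff abs_square_le_1)
  qed
  have letter: "q (Poly_Mapping.single (Star_Word [l]) 1) \<le> 1 \<and> Poly_Mapping.single (Star_Word [l]) 1 \<in> F"
    if l: "fst l \<in> kg_mor \<Lambda>" for l
  proof (cases l)
    case (Pair \<mu> b)
    have "Poly_Mapping.single (Star_Word [l]) 1 = (if b then fadj (fgen \<mu>) else fgen \<mu>)"
      by (simp add: Pair fgen_def fadj_single adj_word_def)
    then show ?thesis using gen l Pair q_adj F_closed by (simp add: fgen_free_star_alg)
  qed
  show ?thesis
    using assms(4,5)
  proof (induction w rule: list_nonempty_induct)
    case (single l)
    then show ?case using letter by simp
  next
    case (cons l w)
    have eq: "Poly_Mapping.single (Star_Word (l # w)) 1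
        = Poly_Mapping.single (Star_Word [l]) 1 * Poly_Mapping.single (Star_Word w) (1::complex)"
      by (simp add: mult_single plus_star_word_def)
    have wF: "Poly_Mapping.single (Star_Word w) 1 \<in> F"
      using cons by (simp add: free_star_alg_def)
    have "q (Poly_Mapping.single (Star_Word (l # w)) 1) \<le> 1 * 1"
      unfolding eq by (rule order_trans[OF q_mult]; (rule mult_mono)?)
        (use cons letter wF q_nonneg in auto)
    then show ?case by simp
  qed
qed

lemma ck_seminorm_bdd:
  fixes \<Lambda> :: "('a, 'k::finite) kgraph_data"
  assumes "kgraph \<Lambda>" "x \<in> free_star_alg (kg_mor \<Lambda>)"
  shows "\<exists>C. \<forall>q\<in>{q. cstar_seminorm (kg_mor \<Lambda>) q \<and> (\<forall>r\<in>ck_relators \<Lambda>. q r = 0)}. q x \<le> C"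
  using assms(2)
proof (induction x rule: star_poly_induct)
  case zero
  have "q 0 \<le> 0" if "cstar_seminorm (kg_mor \<Lambda>) q" for q :: "'a star_poly \<Rightarrow> real"
    using cstar_seminormed.q_zero[OF cstar_seminormed.intro[OF that]] by simp
  then show ?case by blast
next
  case (add_single f a b)
  have "Poly_Mapping.keys (f + Poly_Mapping.single a b) = insert a (Poly_Mapping.keys f)"
    using add_single by (auto simp: in_keys_iff lookup_add lookup_single when_def split: if_splits)
  then have f: "f \<in> free_star_alg (kg_mor \<Lambda>)"
    and a: "star_letters a \<noteq> []" "fst ` set (star_letters a) \<subseteq> kg_mor \<Lambda>"
    using add_single.prems by (auto simp: free_star_alg_def)
  obtain C where C: "\<And>q. \<lbrakk>cstar_seminorm (kg_mor \<Lambda>) q; \<forall>r\<in>ck_relators \<Lambda>. q r = 0\<rbrakk> \<Longrightarrow> q f \<le> C"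
    using add_single.IH f by blast
  have "q (f + Poly_Mapping.single a b) \<le> C + cmod b"
    if q: "cstar_seminorm (kg_mor \<Lambda>) q" "\<forall>r\<in>ck_relators \<Lambda>. q r = 0" for q
  proof -
    interpret cstar_seminormed "kg_mor \<Lambda>" q by unfold_locales (rule q)
    have 1: "Poly_Mapping.single a 1 \<in> F" using a by (simp add: free_star_alg_def)
    have 2: "Poly_Mapping.single a b = fscale b (Poly_Mapping.single a 1)"
      by (simp add: fscale_conv_mult mult_single)
    have "q (Poly_Mapping.single a 1) \<le> 1"
      using ck_word_bound[OF assms(1) q a] by simp
    then have "cmod b * q (Poly_Mapping.single a 1) \<le> cmod b"
      by (simp add: mult_left_le)
    then show ?thesis
      using q_add[OF f F_closed(4)[OF 1, of b]] C[OF q] unfolding 2 q_scale[OF 1] by linarith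
  qed
  then show ?case by blast
qed

lemma ck_seminorm_upper:
  assumes "kgraph \<Lambda>" "x \<in> free_star_alg (kg_mor \<Lambda>)"
    "cstar_seminorm (kg_mor \<Lambda>) q" "\<forall>r\<in>ck_relators \<Lambda>. q r = 0"
  shows "q x \<le> ck_seminorm \<Lambda> x"
  unfolding ck_seminorm_def
proof (rule cSUP_upper)
  show "bdd_above ((\<lambda>q. q x) ` {q. cstar_seminorm (kg_mor \<Lambda>) q \<and> (\<forall>r\<in>ck_relators \<Lambda>. q r = 0)})"
    using ck_seminorm_bdd[OF assms(1,2)] unfolding bdd_above_def by blast
qed (use assms in auto)

lemma ck_seminorm_least:
  assumes "\<And>q. \<lbrakk>cstar_seminorm (kg_mor \<Lambda>) q; \<forall>r\<in>ck_relators \<Lambda>. q r = 0\<rbrakk> \<Longrightarrow> q x \<le> C"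
  shows "ck_seminorm \<Lambda> x \<le> C"
  unfolding ck_seminorm_def
proof (rule cSUP_least)
  have "cstar_seminorm (kg_mor \<Lambda>) (\<lambda>_. 0)" by (simp add: cstar_seminorm_def)
  then show "{q. cstar_seminorm (kg_mor \<Lambda>) q \<and> (\<forall>r\<in>ck_relators \<Lambda>. q r = 0)} \<noteq> {}" by auto
qed (use assms in auto)

lemma cstar_seminorm_ck_seminorm:
  assumes "kgraph \<Lambda>"
  shows "cstar_seminorm (kg_mor \<Lambda>) (ck_seminorm \<Lambda>)"
proof -
  define F where "F = free_star_alg (kg_mor \<Lambda>)"
  define p where "p = ck_seminorm \<Lambda>"
  let ?S = "{q. cstar_seminorm (kg_mor \<Lambda>) q \<and> (\<forall>r\<in>ck_relators \<Lambda>. q r = 0)}"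
  note cl = free_star_alg_closed[of _ "kg_mor \<Lambda>", folded F_def]
  have up: "q x \<le> p x" if "q \<in> ?S" "x \<in> F" for q x
    using ck_seminorm_upper[OF assms] that by (simp add: F_def p_def)
  have least: "p x \<le> C" if "\<And>q. q \<in> ?S \<Longrightarrow> q x \<le> C" for x C
    unfolding p_def by (rule ck_seminorm_least) (use that in simp)
  have S: "0 \<le> q x" "q (fadj x * x) = (q x)\<^sup>2" "q (fscale c x) = cmod c * q x"
      "y \<in> F \<Longrightarrow> q (x + y) \<le> q x + q y" "y \<in> F \<Longrightarrow> q (x * y) \<le> q x * q y"
    if "q \<in> ?S" "x \<in> F" for q c x y
    using that by (auto simp: cstar_seminorm_def F_def)
  have "(\<lambda>_. 0) \<in> ?S" by (simp add: cstar_seminorm_def)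
  from up[OF this] have nonneg: "0 \<le> p x" if "x \<in> F" for x using that by simp
  have sc: "p (fscale c x) \<le> cmod c * p x" if x: "x \<in> F" for c x
  proof (rule least)
    fix q assume q: "q \<in> ?S"
    show "q (fscale c x) \<le> cmod c * p x"
      unfolding S(3)[OF q x] by (rule mult_left_mono[OF up[OF q x]]) simp
  qed
  have scale: "p (fscale c x) = cmod c * p x" if x: "x \<in> F" for c x
  proof (cases "c = 0")
    case True
    then show ?thesis using sc[OF x, of c] nonneg[OF cl(4)[OF x, of c]] by simp
  next
    case False
    have "cmod c * p x \<le> cmod c * (cmod (1 / c) * p (fscale c x))"
      using sc[OF cl(4)[OF x, of c], of "1 / c"] False by (intro mult_left_mono) (simp_all add: fscale_simps)
    also have "\<dots> = p (fscale c x)" using False by (simp add: norm_divide)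
    finally show ?thesis using sc[OF x, of c] by simp
  qed
  have add: "p (x + y) \<le> p x + p y" if "x \<in> F" "y \<in> F" for x y
  proof (rule least)
    fix q assume "q \<in> ?S"
    then show "q (x + y) \<le> p x + p y" using S(4)[of q x y] up[of q x] up[of q y] that by linarith
  qed
  have mult: "p (x * y) \<le> p x * p y" if "x \<in> F" "y \<in> F" for x y
  proof (rule least)
    fix q assume q: "q \<in> ?S"
    have "q x * q y \<le> p x * p y"
      by (rule mult_mono) (use q S(1) up nonneg that in auto)
    then show "q (x * y) \<le> p x * p y" using S(5)[OF q that] by linarith
  qed
  have star: "p (fadj x * x) = (p x)\<^sup>2" if x: "x \<in> F" for x
  proof (rule antisym)
    show "p (fadj x * x) \<le> (p x)\<^sup>2"
    proof (rule least)
      fix q assume q: "q \<in> ?S"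
      show "q (fadj x * x) \<le> (p x)\<^sup>2"
        using S(2)[OF q x] up[OF q x] S(1)[OF q x] by (simp add: power_mono)
    qed
    have "p x \<le> sqrt (p (fadj x * x))"
    proof (rule least)
      fix q assume q: "q \<in> ?S"
      have "(q x)\<^sup>2 \<le> p (fadj x * x)"
        using S(2)[OF q x] up[OF q, of "fadj x * x"] x cl by auto
      then show "q x \<le> sqrt (p (fadj x * x))" by (rule real_le_rsqrt)
    qed
    then have "(p x)\<^sup>2 \<le> (sqrt (p (fadj x * x)))\<^sup>2"
      using nonneg[OF x] by (intro power_mono)
    also have "\<dots> = p (fadj x * x)" using nonneg x cl by simp
    finally show "(p x)\<^sup>2 \<le> p (fadj x * x)" .
  qed
  show ?thesis
    unfolding cstar_seminorm_def using nonneg scale add mult star by (simp add: F_def p_def)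
qed

lemma ck_relators_subset:
  assumes "kgraph \<Lambda>" shows "ck_relators \<Lambda> \<subseteq> free_star_alg (kg_mor \<Lambda>)"
proof -
  interpret kgraph \<Lambda> by fact
  note cl = free_star_alg_closed[of _ "kg_mor \<Lambda>"] fgen_free_star_alg[of _ "kg_mor \<Lambda>"]
  have sum: "(\<Sum>\<mu>\<in>X. fgen \<mu> * fadj (fgen \<mu>)) \<in> free_star_alg (kg_mor \<Lambda>)" if "X \<subseteq> kg_mor \<Lambda>" for X
    using that by (induction X rule: infinite_finite_induct) (auto simp: zero_free_star_alg intro!: cl)
  have obj: "fgen v \<in> free_star_alg (kg_mor \<Lambda>)" if "v \<in> kg_obj \<Lambda>" for v
    using that by (simp add: kg_obj_def fgen_free_star_alg)
  show ?thesis
    unfolding ck_relators_def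
    by (intro Un_least; clarify; intro cl sum obj src_obj comp_mor; (assumption | blast))
qed

lemma ck_seminorm_relator:
  assumes "kgraph \<Lambda>" "r \<in> ck_relators \<Lambda>"
  shows "ck_seminorm \<Lambda> r = 0"
proof (rule antisym)
  show "ck_seminorm \<Lambda> r \<le> 0" by (rule ck_seminorm_least) (use assms in auto)
  show "0 \<le> ck_seminorm \<Lambda> r"
    using cstar_seminormed.q_nonneg[OF cstar_seminormed.intro[OF cstar_seminorm_ck_seminorm[OF assms(1)]]]
      ck_relators_subset assms by blast
qed

context cstar_seminormed
begin

abbreviation "C \<equiv> seminorm_cauchy F q"
abbreviation "R \<equiv> seminorm_rel F q"
abbreviation "B \<equiv> seminorm_completion F q"
abbreviation "cls u \<equiv> R `` {u}"

lemma C_F: "u \<in> C \<Longrightarrow> u n \<in> F"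
  by (simp add: seminorm_cauchy_def)

lemma C_D: "u \<in> C \<Longrightarrow> 0 < e \<Longrightarrow> \<exists>N. \<forall>m\<ge>N. \<forall>n\<ge>N. q (u m - u n) < e"
  by (simp add: seminorm_cauchy_def)

lemma C_I: "(\<And>n. u n \<in> F) \<Longrightarrow> (\<And>e. 0 < e \<Longrightarrow> \<exists>N. \<forall>m\<ge>N. \<forall>n\<ge>N. q (u m - u n) < e) \<Longrightarrow> u \<in> C"
  by (simp add: seminorm_cauchy_def)

lemma C_const: "x \<in> F \<Longrightarrow> (\<lambda>n. x) \<in> C"
  by (rule C_I) (simp_all add: q_zero)

lemma C_dominated:
  assumes u: "u \<in> C" and v: "\<And>n. v n \<in> F" and K: "0 \<le> K"
    and le: "\<And>m n. q (v m - v n) \<le> K * q (u m - u n)"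
  shows "v \<in> C"
proof (rule C_I[OF v])
  fix e :: real assume e: "0 < e"
  then obtain N where N: "\<And>m n. m \<ge> N \<Longrightarrow> n \<ge> N \<Longrightarrow> q (u m - u n) < e / (K + 1)"
    using C_D[OF u, of "e / (K + 1)"] K by auto
  have "q (v m - v n) < e" if "m \<ge> N" "n \<ge> N" for m n
  proof -
    have "q (v m - v n) \<le> K * (e / (K + 1))"
      using le[of m n] mult_left_mono[OF less_imp_le[OF N[OF that]] K] by linarith
    also have "\<dots> < e" using e K by (simp add: field_simps)
    finally show ?thesis .
  qed
  then show "\<exists>N. \<forall>m\<ge>N. \<forall>n\<ge>N. q (v m - v n) < e" by blast
qed

lemma C_add: assumes "u \<in> C" "v \<in> C" shows "(\<lambda>n. u n + v n) \<in> C"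
proof (rule C_I)
  fix e :: real assume e: "0 < e"
  obtain N1 where N1: "\<And>m n. m \<ge> N1 \<Longrightarrow> n \<ge> N1 \<Longrightarrow> q (u m - u n) < e / 2"
    using C_D[OF assms(1), of "e / 2"] e by auto
  obtain N2 where N2: "\<And>m n. m \<ge> N2 \<Longrightarrow> n \<ge> N2 \<Longrightarrow> q (v m - v n) < e / 2"
    using C_D[OF assms(2), of "e / 2"] e by auto
  have "q ((u m + v m) - (u n + v n)) < e" if "m \<ge> max N1 N2" "n \<ge> max N1 N2" for m n
  proof -
    have "q ((u m + v m) - (u n + v n)) \<le> q (u m - u n) + q (v m - v n)"
      using q_add[OF F_closed(2)[OF C_F C_F] F_closed(2)[OF C_F C_F], OF assms(1,1,2,2), of m n m n]
      by (simp add: algebra_simps)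
    then show ?thesis using N1[of m n] N2[of m n] that by simp
  qed
  then show "\<exists>N. \<forall>m\<ge>N. \<forall>n\<ge>N. q ((u m + v m) - (u n + v n)) < e" by blast
qed (use assms C_F F_closed(1) in auto)

lemma C_scale: assumes "u \<in> C" shows "(\<lambda>n. fscale c (u n)) \<in> C"
proof (rule C_dominated[OF assms, of _ "cmod c"])
  fix m n
  show "q (fscale c (u m) - fscale c (u n)) \<le> cmod c * q (u m - u n)"
    using q_scale[OF F_closed(2)[OF C_F C_F], OF assms assms, of c m n] by (simp add: fscale_simps)
qed (use C_F[OF assms] F_closed(4) in auto)

lemma C_adj: assumes "u \<in> C" shows "(\<lambda>n. fadj (u n)) \<in> C"
proof (rule C_dominated[OF assms, of _ 1])
  fix m n
  show "q (fadj (u m) - fadj (u n)) \<le> 1 * q (u m - u n)"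
    using q_adj[OF F_closed(2)[OF C_F C_F], OF assms assms, of m n] by (simp add: fadj_simps)
qed (use C_F[OF assms] F_closed(5) in auto)

lemma C_norm_Cauchy: assumes "u \<in> C" shows "convergent (\<lambda>n. q (u n))"
proof -
  have "Cauchy (\<lambda>n. q (u n))"
    unfolding Cauchy_def
  proof (intro allI impI)
    fix e :: real assume "0 < e"
    then obtain N where N: "\<And>m n. m \<ge> N \<Longrightarrow> n \<ge> N \<Longrightarrow> q (u m - u n) < e"
      using C_D[OF assms] by blast
    have "dist (q (u m)) (q (u n)) < e" if "m \<ge> N" "n \<ge> N" for m n
      using q_abs_diff[OF C_F C_F, OF assms assms, of m n] N[OF that] by (simp add: dist_real_def)
    then show "\<exists>M. \<forall>m\<ge>M. \<forall>n\<ge>M. dist (q (u m)) (q (u n)) < e" by blast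
  qed
  then show ?thesis by (simp add: Cauchy_convergent_iff)
qed

lemma C_bounded: assumes "u \<in> C" obtains K where "0 < K" "\<And>n. q (u n) \<le> K"
proof -
  have "Bseq (\<lambda>n. q (u n))"
    using C_norm_Cauchy[OF assms] by (rule convergent_imp_Bseq)
  then obtain K where "0 < K" "\<And>n. norm (q (u n)) \<le> K" by (auto elim: BseqE)
  then show ?thesis using that[of K] by (auto simp: abs_le_iff)
qed

lemma q_mult_diff:
  assumes "x \<in> F" "y \<in> F" "x' \<in> F" "y' \<in> F"
  shows "q (x * y - x' * y') \<le> q x * q (y - y') + q (x - x') * q y'"
proof -
  have "q (x * y - x' * y') = q (x * (y - y') + (x - x') * y')" by (simp add: algebra_simps)
  also have "\<dots> \<le> q (x * (y - y')) + q ((x - x') * y')"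
    by (rule q_add) (use assms F_closed(2,3) in auto)
  also have "\<dots> \<le> q x * q (y - y') + q (x - x') * q y'"
    by (intro add_mono q_mult) (use assms F_closed(2) in auto)
  finally show ?thesis .
qed

lemma C_mult: assumes "u \<in> C" "v \<in> C" shows "(\<lambda>n. u n * v n) \<in> C"
proof (rule C_I)
  obtain K where K: "0 < K" "\<And>n. q (u n) \<le> K" using C_bounded[OF assms(1)] by blast
  obtain L where L: "0 < L" "\<And>n. q (v n) \<le> L" using C_bounded[OF assms(2)] by blast
  note uF = C_F[OF assms(1)] and vF = C_F[OF assms(2)]
  fix e :: real assume e: "0 < e"
  obtain N1 where N1: "\<And>m n. m \<ge> N1 \<Longrightarrow> n \<ge> N1 \<Longrightarrow> q (u m - u n) < e / (2 * L)"
    using C_D[OF assms(1), of "e / (2 * L)"] e L by auto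
  obtain N2 where N2: "\<And>m n. m \<ge> N2 \<Longrightarrow> n \<ge> N2 \<Longrightarrow> q (v m - v n) < e / (2 * K)"
    using C_D[OF assms(2), of "e / (2 * K)"] e K by auto
  have "q (u m * v m - u n * v n) < e" if "m \<ge> max N1 N2" "n \<ge> max N1 N2" for m n
  proof -
    have 1: "q (v m - v n) < e / (2 * K)" "q (u m - u n) < e / (2 * L)"
      using N1 N2 that by auto
    have "q (u m) * q (v m - v n) \<le> K * q (v m - v n)"
      by (intro mult_right_mono K q_nonneg F_closed(2) uF vF)
    also have "\<dots> < e / 2" using 1(1) K by (simp add: field_simps)
    finally have 2: "q (u m) * q (v m - v n) < e / 2" .
    have "q (u m - u n) * q (v n) \<le> q (u m - u n) * L"
      by (intro mult_left_mono L q_nonneg F_closed(2) uF vF)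
    also have "\<dots> < e / 2" using 1(2) L by (simp add: field_simps)
    finally have 3: "q (u m - u n) * q (v n) < e / 2" .
    show ?thesis using q_mult_diff[OF uF vF uF vF, of m m n n] 2 3 by linarith
  qed
  then show "\<exists>N. \<forall>m\<ge>N. \<forall>n\<ge>N. q (u m * v m - u n * v n) < e" by blast
qed (use assms C_F F_closed(3) in auto)

lemma C_minus: "u \<in> C \<Longrightarrow> (\<lambda>n. - u n) \<in> C"
  using C_scale[of u "-1"] by (simp add: fscale_simps)

lemma C_diff: assumes "u \<in> C" "v \<in> C" shows "(\<lambda>n. u n - v n) \<in> C"
  using C_add[OF assms(1) C_scale[OF assms(2), of "-1"]] by (simp add: fscale_simps)

lemma R_iff: "(u, v) \<in> R \<longleftrightarrow> u \<in> C \<and> v \<in> C \<and> (\<lambda>n. q (u n - v n)) \<longlonglongrightarrow> 0"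
  by (simp add: seminorm_rel_def)

lemma null_dominated:
  assumes "w \<longlonglongrightarrow> 0" "\<And>n. u n \<in> F" "\<And>n. q (u n) \<le> w n"
  shows "(\<lambda>n. q (u n)) \<longlonglongrightarrow> 0"
  by (rule tendsto_sandwich[OF _ _ tendsto_const assms(1)]) (use assms q_nonneg in auto)

lemma equiv_R: "equiv C R"
proof (rule equivI)
  show "R \<subseteq> C \<times> C" by (auto simp: R_iff)
  show "refl_on C R" by (rule refl_onI) (simp add: R_iff q_zero)
  show "sym R"
  proof (rule symI)
    fix u v assume uv: "(u, v) \<in> R"
    then have "q (v n - u n) = q (u n - v n)" for n
      by (intro q_minus_commute C_F) (auto simp: R_iff)
    then show "(v, u) \<in> R" using uv by (simp add: R_iff)
  qed
  show "trans R"
  proof (rule transI)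
    fix u v w assume uv: "(u, v) \<in> R" and vw: "(v, w) \<in> R"
    have "(\<lambda>n. q (u n - v n) + q (v n - w n)) \<longlonglongrightarrow> 0"
      using tendsto_add[of _ 0 _ _ 0] uv vw by (simp add: R_iff tendsto_add_zero)
    then have "(\<lambda>n. q (u n - w n)) \<longlonglongrightarrow> 0"
    proof (rule null_dominated)
      fix n
      have "u n \<in> F" "v n \<in> F" "w n \<in> F" using uv vw by (simp_all add: R_iff C_F)
      then show "u n - w n \<in> F" "q (u n - w n) \<le> q (u n - v n) + q (v n - w n)"
        by (auto intro!: F_closed(2) q_diff_triangle)
    qed
    then show "(u, w) \<in> R" using uv vw by (simp add: R_iff)
  qed
qed

lemma R_add: assumes "(u, u') \<in> R" "(v, v') \<in> R" shows "(\<lambda>n. u n + v n, \<lambda>n. u' n + v' n) \<in> R"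
proof -
  note [simp] = assms[unfolded R_iff]
  have "(\<lambda>n. q (u n - u' n) + q (v n - v' n)) \<longlonglongrightarrow> 0"
    by (simp add: tendsto_add_zero)
  then have "(\<lambda>n. q ((u n + v n) - (u' n + v' n))) \<longlonglongrightarrow> 0"
  proof (rule null_dominated)
    fix n
    show "u n + v n - (u' n + v' n) \<in> F" by (intro F_closed(1,2) C_F) simp_all
    have "q ((u n - u' n) + (v n - v' n)) \<le> q (u n - u' n) + q (v n - v' n)"
      by (intro q_add F_closed(2) C_F) simp_all
    then show "q (u n + v n - (u' n + v' n)) \<le> q (u n - u' n) + q (v n - v' n)"
      by (simp add: algebra_simps)
  qed
  then show ?thesis by (simp add: R_iff C_add)
qed

lemma R_scale: assumes "(u, u') \<in> R" shows "(\<lambda>n. fscale c (u n), \<lambda>n. fscale c (u' n)) \<in> R"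
proof -
  note [simp] = assms[unfolded R_iff]
  have eq: "q (fscale c (u n) - fscale c (u' n)) = cmod c * q (u n - u' n)" for n
    using q_scale[OF F_closed(2)[OF C_F C_F], of u u' c n n] by (simp add: fscale_simps)
  have "(\<lambda>n. cmod c * q (u n - u' n)) \<longlonglongrightarrow> cmod c * 0"
    by (intro tendsto_mult tendsto_const) simp
  then show ?thesis by (simp add: R_iff C_scale eq)
qed

lemma R_adj: assumes "(u, u') \<in> R" shows "(\<lambda>n. fadj (u n), \<lambda>n. fadj (u' n)) \<in> R"
proof -
  note [simp] = assms[unfolded R_iff]
  have eq: "q (fadj (u n) - fadj (u' n)) = q (u n - u' n)" for n
    using q_adj[OF F_closed(2)[OF C_F C_F], of u u' n n] by (simp add: fadj_simps)
  show ?thesis by (simp add: R_iff C_adj eq)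
qed

lemma R_mult: assumes "(u, u') \<in> R" "(v, v') \<in> R" shows "(\<lambda>n. u n * v n, \<lambda>n. u' n * v' n) \<in> R"
proof -
  note [simp] = assms[unfolded R_iff]
  obtain K where K: "0 < K" "\<And>n. q (u n) \<le> K" using C_bounded[of u] by auto
  obtain L where L: "0 < L" "\<And>n. q (v' n) \<le> L" using C_bounded[of v'] by auto
  have uF: "u n \<in> F" "u' n \<in> F" "v n \<in> F" "v' n \<in> F" for n
    by (rule C_F, simp)+
  have "(\<lambda>n. K * q (v n - v' n) + q (u n - u' n) * L) \<longlonglongrightarrow> K * 0 + 0 * L"
    by (intro tendsto_add tendsto_mult tendsto_const) simp_all
  then have "(\<lambda>n. K * q (v n - v' n) + q (u n - u' n) * L) \<longlonglongrightarrow> 0" by simp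
  then have "(\<lambda>n. q (u n * v n - u' n * v' n)) \<longlonglongrightarrow> 0"
  proof (rule null_dominated)
    fix n
    show "u n * v n - u' n * v' n \<in> F" by (intro F_closed(2,3) uF)
    have "q (u n) * q (v n - v' n) \<le> K * q (v n - v' n)"
      by (intro mult_right_mono K q_nonneg F_closed(2) uF)
    moreover have "q (u n - u' n) * q (v' n) \<le> q (u n - u' n) * L"
      by (intro mult_left_mono L q_nonneg F_closed(2) uF)
    ultimately show "q (u n * v n - u' n * v' n) \<le> K * q (v n - v' n) + q (u n - u' n) * L"
      using q_mult_diff[OF uF(1,3,2,4), of n n n n] by linarith
  qed
  then show ?thesis by (simp add: R_iff C_mult)
qed

lemma cls_eq_iff: "u \<in> C \<Longrightarrow> v \<in> C \<Longrightarrow> cls u = cls v \<longleftrightarrow> (\<lambda>n. q (u n - v n)) \<longlonglongrightarrow> 0"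
  using eq_equiv_class_iff[OF equiv_R] by (simp add: R_iff)

lemma cls_self: "u \<in> C \<Longrightarrow> u \<in> cls u"
  using equiv_class_self[OF equiv_R] .

lemma cls_closed: "u \<in> C \<Longrightarrow> cls u \<in> carrier B"
  by (simp add: seminorm_completion_def quotientI)

lemma carrier_cases: assumes "X \<in> carrier B" obtains u where "u \<in> C" "X = cls u"
  using assms by (auto simp: seminorm_completion_def elim: quotientE)

lemma cls_zero: "czero B = cls (\<lambda>n. 0)"
  by (simp add: seminorm_completion_def)

lemma cls_add: assumes "u \<in> C" "v \<in> C" shows "cadd B (cls u) (cls v) = cls (\<lambda>n. u n + v n)"
proof -
  have "(\<lambda>u v. cls (\<lambda>n. u n + v n)) respects2 R"
    by (rule congruent2I'[OF equiv_class_eq[OF equiv_R]]) (rule R_add)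
  then show ?thesis
    by (simp add: seminorm_completion_def UN_equiv_class2[OF equiv_R equiv_R _ assms])
qed

lemma cls_mult: assumes "u \<in> C" "v \<in> C" shows "cmult B (cls u) (cls v) = cls (\<lambda>n. u n * v n)"
proof -
  have "(\<lambda>u v. cls (\<lambda>n. u n * v n)) respects2 R"
    by (rule congruent2I'[OF equiv_class_eq[OF equiv_R]]) (rule R_mult)
  then show ?thesis
    by (simp add: seminorm_completion_def UN_equiv_class2[OF equiv_R equiv_R _ assms])
qed

lemma cls_scale: assumes "u \<in> C" shows "cscale B c (cls u) = cls (\<lambda>n. fscale c (u n))"
proof -
  have "(\<lambda>u. cls (\<lambda>n. fscale c (u n))) respects R"
    by (rule congruentI[OF equiv_class_eq[OF equiv_R]]) (rule R_scale)
  then show ?thesis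
    by (simp add: seminorm_completion_def UN_equiv_class[OF equiv_R _ assms])
qed

lemma cls_adj: assumes "u \<in> C" shows "cadj B (cls u) = cls (\<lambda>n. fadj (u n))"
proof -
  have "(\<lambda>u. cls (\<lambda>n. fadj (u n))) respects R"
    by (rule congruentI[OF equiv_class_eq[OF equiv_R]]) (rule R_adj)
  then show ?thesis
    by (simp add: seminorm_completion_def UN_equiv_class[OF equiv_R _ assms])
qed

lemma cls_norm: assumes "u \<in> C" shows "(\<lambda>n. q (u n)) \<longlonglongrightarrow> cnorm B (cls u)"
proof -
  obtain r where r: "(\<lambda>n. q (u n)) \<longlonglongrightarrow> r"
    using C_norm_Cauchy[OF assms] by (auto simp: convergent_def)
  have "(\<lambda>n. q (v n)) \<longlonglongrightarrow> r" if "v \<in> cls u" for v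
  proof -
    have R: "(u, v) \<in> R" using that by simp
    have "(\<lambda>n. q (u n) - q (v n)) \<longlonglongrightarrow> 0"
    proof (rule tendsto_rabs_zero_cancel, rule tendsto_sandwich[OF _ _ tendsto_const])
      show "(\<lambda>n. q (u n - v n)) \<longlonglongrightarrow> 0" using R by (simp add: R_iff)
      show "\<forall>\<^sub>F n in sequentially. \<bar>q (u n) - q (v n)\<bar> \<le> q (u n - v n)"
        using R by (intro always_eventually allI q_abs_diff C_F) (simp_all add: R_iff)
    qed simp
    from tendsto_diff[OF r this] show ?thesis by simp
  qed
  then have "\<forall>v\<in>cls u. (\<lambda>n. q (v n)) \<longlonglongrightarrow> r" by blast
  then have "(THE r. \<forall>v\<in>cls u. (\<lambda>n. q (v n)) \<longlonglongrightarrow> r) = r"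
    using cls_self[OF assms] LIMSEQ_unique by (intro the_equality) blast+
  with r show ?thesis by (simp add: seminorm_completion_def)
qed

lemma cls_norm_eqI: "u \<in> C \<Longrightarrow> (\<lambda>n. q (u n)) \<longlonglongrightarrow> r \<Longrightarrow> cnorm B (cls u) = r"
  using cls_norm LIMSEQ_unique by blast

lemma cls_dist:
  assumes "u \<in> C" "v \<in> C" shows "(\<lambda>n. q (u n - v n)) \<longlonglongrightarrow> cdist B (cls u) (cls v)"
proof -
  have "cdist B (cls u) (cls v) = cnorm B (cls (\<lambda>n. u n + fscale (-1) (v n)))"
    unfolding cdist_def cls_scale[OF assms(2)] cls_add[OF assms(1) C_scale[OF assms(2)]] ..
  then show ?thesis using cls_norm[OF C_diff[OF assms]] by (simp add: fscale_simps)
qed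

lemma cls_dist_const: "x \<in> F \<Longrightarrow> y \<in> F \<Longrightarrow> cdist B (cls (\<lambda>n. x)) (cls (\<lambda>n. y)) = q (x - y)"
  by (rule LIMSEQ_unique[OF cls_dist[OF C_const C_const] tendsto_const])

lemma B_dist_triangle:
  assumes "X \<in> carrier B" "Y \<in> carrier B" "Z \<in> carrier B"
  shows "cdist B X Z \<le> cdist B X Y + cdist B Y Z"
proof -
  obtain u where u: "u \<in> C" "X = cls u" by (rule carrier_cases[OF assms(1)])
  obtain v where v: "v \<in> C" "Y = cls v" by (rule carrier_cases[OF assms(2)])
  obtain w where w: "w \<in> C" "Z = cls w" by (rule carrier_cases[OF assms(3)])
  note C = u(1) v(1) w(1) and eq = u(2) v(2) w(2)
  show ?thesis
    unfolding eq
  proof (rule LIMSEQ_le[OF cls_dist[OF C(1,3)] tendsto_add[OF cls_dist[OF C(1,2)] cls_dist[OF C(2,3)]]])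
    show "\<exists>N. \<forall>n\<ge>N. q (u n - w n) \<le> q (u n - v n) + q (v n - w n)"
      using C by (intro exI allI impI q_diff_triangle C_F)
  qed
qed

lemma B_dist_commute:
  assumes "X \<in> carrier B" "Y \<in> carrier B"
  shows "cdist B X Y = cdist B Y X"
proof -
  obtain u where u: "u \<in> C" "X = cls u" by (rule carrier_cases[OF assms(1)])
  obtain v where v: "v \<in> C" "Y = cls v" by (rule carrier_cases[OF assms(2)])
  note C = u(1) v(1) and eq = u(2) v(2)
  have "(\<lambda>n. q (u n - v n)) = (\<lambda>n. q (v n - u n))"
    using C by (intro ext q_minus_commute C_F)
  then have "(\<lambda>n. q (u n - v n)) \<longlonglongrightarrow> cdist B (cls v) (cls u)"
    by (simp only: cls_dist[OF C(2,1)])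
  from LIMSEQ_unique[OF cls_dist[OF C] this] show ?thesis unfolding eq .
qed

lemma B_dist_nonneg:
  assumes "X \<in> carrier B" "Y \<in> carrier B"
  shows "0 \<le> cdist B X Y"
proof -
  obtain u where u: "u \<in> C" "X = cls u" by (rule carrier_cases[OF assms(1)])
  obtain v where v: "v \<in> C" "Y = cls v" by (rule carrier_cases[OF assms(2)])
  note C = u(1) v(1) and eq = u(2) v(2)
  show ?thesis
    unfolding eq
  proof (rule LIMSEQ_le_const[OF cls_dist[OF C]])
    show "\<exists>N. \<forall>n\<ge>N. 0 \<le> q (u n - v n)"
      using C by (intro exI allI impI q_nonneg F_closed(2) C_F)
  qed
qed

lemma cls_approx:
  assumes u: "u \<in> C" and e: "0 < e"
  shows "\<exists>N. \<forall>n\<ge>N. cdist B (cls u) (cls (\<lambda>_. u n)) \<le> e"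
proof -
  obtain N where N: "\<And>m n. m \<ge> N \<Longrightarrow> n \<ge> N \<Longrightarrow> q (u m - u n) < e"
    using C_D[OF u e] by blast
  have "cdist B (cls u) (cls (\<lambda>_. u n)) \<le> e" if "n \<ge> N" for n
  proof (rule LIMSEQ_le_const2[OF cls_dist[OF u C_const[OF C_F[OF u]]]])
    have "q (u m - u n) \<le> e" if "m \<ge> N" for m using N[OF that \<open>n \<ge> N\<close>] by simp
    then show "\<exists>N. \<forall>m\<ge>N. q (u m - u n) \<le> e" by blast
  qed
  then show ?thesis by blast
qed

lemma B_complete:
  assumes X: "\<And>n. X n \<in> carrier B"
    and cauchy: "\<And>e. 0 < e \<Longrightarrow> \<exists>N. \<forall>m\<ge>N. \<forall>n\<ge>N. cdist B (X m) (X n) < e"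
  shows "\<exists>Y\<in>carrier B. (\<lambda>n. cdist B (X n) Y) \<longlonglongrightarrow> 0"
proof -
  have "\<exists>x\<in>F. cdist B (X n) (cls (\<lambda>_. x)) \<le> inverse (real (Suc n))" for n
  proof -
    obtain u where u: "u \<in> C" "X n = cls u" by (rule carrier_cases[OF X])
    then show ?thesis
      using cls_approx[OF u(1), of "inverse (real (Suc n))"] C_F[OF u(1)] by auto
  qed
  then obtain x where xF: "\<And>n. x n \<in> F"
    and x: "\<And>n. cdist B (X n) (cls (\<lambda>_. x n)) \<le> inverse (real (Suc n))" by metis
  have c: "cls (\<lambda>_. x n) \<in> carrier B" for n using cls_closed[OF C_const[OF xF]] .
  have xC: "x \<in> C"
  proof (rule C_I[OF xF])
    fix e :: real assume e: "0 < e"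
    obtain N1 where N1: "\<And>m n. m \<ge> N1 \<Longrightarrow> n \<ge> N1 \<Longrightarrow> cdist B (X m) (X n) < e / 3"
      using cauchy[of "e / 3"] e by auto
    obtain N2 where N2: "inverse (real (Suc N2)) < e / 3"
      using reals_Archimedean[of "e / 3"] e by auto
    have "q (x m - x n) < e" if "m \<ge> max N1 N2" "n \<ge> max N1 N2" for m n
    proof -
      have "inverse (real (Suc m)) \<le> inverse (real (Suc N2))" "inverse (real (Suc n)) \<le> inverse (real (Suc N2))"
        using that by (auto intro!: le_imp_inverse_le)
      then have "cdist B (X m) (cls (\<lambda>_. x m)) < e / 3" "cdist B (X n) (cls (\<lambda>_. x n)) < e / 3"
        using N2 x[of m] x[of n] by linarith+
      moreover have "cdist B (cls (\<lambda>_. x m)) (cls (\<lambda>_. x n))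
          \<le> cdist B (X m) (cls (\<lambda>_. x m)) + cdist B (X m) (X n) + cdist B (X n) (cls (\<lambda>_. x n))"
        using B_dist_triangle[OF c X c, of m n m] B_dist_triangle[OF X X c, of m n n]
          B_dist_commute[OF c X, of m m] by linarith
      ultimately show ?thesis
        using N1[of m n] that cls_dist_const[OF xF xF, of m n] by simp
    qed
    then show "\<exists>N. \<forall>m\<ge>N. \<forall>n\<ge>N. q (x m - x n) < e" by blast
  qed
  have "(\<lambda>n. cdist B (cls x) (cls (\<lambda>_. x n))) \<longlonglongrightarrow> 0"
  proof (rule LIMSEQ_I)
    fix r :: real assume "0 < r"
    then obtain N where "\<And>n. n \<ge> N \<Longrightarrow> cdist B (cls x) (cls (\<lambda>_. x n)) \<le> r / 2"
      using cls_approx[OF xC, of "r / 2"] by auto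
    then show "\<exists>no. \<forall>n\<ge>no. norm (cdist B (cls x) (cls (\<lambda>_. x n)) - 0) < r"
      using \<open>0 < r\<close> B_dist_nonneg[OF cls_closed[OF xC] c] by (intro exI[of _ N]) fastforce
  qed
  then have lim: "(\<lambda>n. inverse (real (Suc n)) + cdist B (cls x) (cls (\<lambda>_. x n))) \<longlonglongrightarrow> 0"
    using LIMSEQ_inverse_real_of_nat by (intro tendsto_add_zero)
  have "cdist B (X n) (cls x) \<le> inverse (real (Suc n)) + cdist B (cls x) (cls (\<lambda>_. x n))" for n
    using B_dist_triangle[OF X c cls_closed[OF xC], of n n] x[of n]
      B_dist_commute[OF c cls_closed[OF xC], of n] by linarith
  then have "(\<lambda>n. cdist B (X n) (cls x)) \<longlonglongrightarrow> 0"
    by (intro tendsto_sandwich[OF _ _ tendsto_const lim])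
      (simp_all add: B_dist_nonneg X cls_closed xC)
  then show ?thesis using cls_closed[OF xC] by blast
qed

theorem cstar_algebra_completion: "cstar_algebra B"
proof
  note S = C_add C_minus C_mult C_scale C_adj C_const[OF zero_free_star_alg]
    cls_add cls_mult cls_scale cls_adj cls_zero
  show "czero B \<in> carrier B" by (simp add: S cls_closed)
  fix X assume "X \<in> carrier B"
  then obtain u where u: "u \<in> C" and [simp]: "X = cls u" by (rule carrier_cases)
  show "cscale B c X \<in> carrier B" "cadj B X \<in> carrier B" for c
    using u by (simp_all add: S cls_closed)
  show "cadd B X (czero B) = X" "cscale B 1 X = X" "cscale B c (cscale B d X) = cscale B (c * d) X"
    "cscale B (c + d) X = cadd B (cscale B c X) (cscale B d X)" "cadd B X (cscale B (-1) X) = czero B"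
    "cadj B (cadj B X) = X" "cadj B (cscale B c X) = cscale B (cnj c) (cadj B X)" for c d
    using u by (simp_all add: S fscale_simps fadj_simps)
  show "0 \<le> cnorm B X"
    by (simp, rule LIMSEQ_le_const[OF cls_norm[OF u]]) (use u C_F q_nonneg in blast)
  show "cnorm B X = 0 \<longleftrightarrow> X = czero B"
    using cls_norm[OF u] LIMSEQ_unique
    by (auto simp: cls_zero cls_eq_iff[OF u C_const[OF zero_free_star_alg]])
  show "cnorm B (cscale B c X) = cmod c * cnorm B X" for c
    using u by (auto simp: S q_scale C_F intro!: cls_norm_eqI tendsto_mult cls_norm)
  show "cnorm B (cmult B (cadj B X) X) = (cnorm B X)\<^sup>2"
    using u by (auto simp: S q_adj_mult C_F intro!: cls_norm_eqI tendsto_power cls_norm)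
  fix Y assume "Y \<in> carrier B"
  then obtain v where v: "v \<in> C" and [simp]: "Y = cls v" by (rule carrier_cases)
  show "cadd B X Y \<in> carrier B" "cmult B X Y \<in> carrier B"
    using u v by (simp_all add: S cls_closed)
  show "cadd B X Y = cadd B Y X" "cscale B c (cadd B X Y) = cadd B (cscale B c X) (cscale B c Y)"
    "cmult B (cscale B c X) Y = cscale B c (cmult B X Y)"
    "cmult B X (cscale B c Y) = cscale B c (cmult B X Y)"
    "cadj B (cadd B X Y) = cadd B (cadj B X) (cadj B Y)"
    "cadj B (cmult B X Y) = cmult B (cadj B Y) (cadj B X)" for c
    using u v by (simp_all add: S fscale_simps fadj_simps fadj_mult fscale_mult_left fscale_mult_right add.commute)
  show "cnorm B (cadd B X Y) \<le> cnorm B X + cnorm B Y"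
    using LIMSEQ_le[OF cls_norm[OF C_add[OF u v]] tendsto_add[OF cls_norm[OF u] cls_norm[OF v]]]
      q_add[OF C_F[OF u] C_F[OF v]] u v by (auto simp: S)
  show "cnorm B (cmult B X Y) \<le> cnorm B X * cnorm B Y"
    using LIMSEQ_le[OF cls_norm[OF C_mult[OF u v]] tendsto_mult[OF cls_norm[OF u] cls_norm[OF v]]]
      q_mult[OF C_F[OF u] C_F[OF v]] u v by (auto simp: S)
  fix Z assume "Z \<in> carrier B"
  then obtain w where w: "w \<in> C" and [simp]: "Z = cls w" by (rule carrier_cases)
  show "cadd B (cadd B X Y) Z = cadd B X (cadd B Y Z)"
    "cmult B (cmult B X Y) Z = cmult B X (cmult B Y Z)"
    "cmult B (cadd B X Y) Z = cadd B (cmult B X Z) (cmult B Y Z)"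
    "cmult B X (cadd B Y Z) = cadd B (cmult B X Y) (cmult B X Z)"
    using u v w by (simp_all add: S add.assoc mult.assoc distrib_left distrib_right)
next
  fix X :: "nat \<Rightarrow> _" assume "\<And>n. X n \<in> carrier B" "\<And>e. 0 < e \<Longrightarrow> \<exists>N. \<forall>m\<ge>N. \<forall>n\<ge>N. cdist B (X m) (X n) < e"
  then show "\<exists>Y\<in>carrier B. (\<lambda>n. cdist B (X n) Y) \<longlonglongrightarrow> 0" by (rule B_complete)
qed

end

context cstar_algebra
begin

lemmas closed = zero_closed add_closed scale_closed mult_closed adj_closed

lemma add_left_commute:
  "\<lbrakk>x \<in> carrier B; y \<in> carrier B; z \<in> carrier B\<rbrakk> \<Longrightarrow> cadd B x (cadd B y z) = cadd B y (cadd B x z)"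
  by (metis add_assoc add_commute)

lemma zero_add: "x \<in> carrier B \<Longrightarrow> cadd B (czero B) x = x"
  using add_zero add_commute zero_closed by metis

lemma cancel_left:
  assumes "x \<in> carrier B" "y \<in> carrier B"
  shows "cadd B (cscale B (-1) x) (cadd B x y) = y" "cadd B x (cadd B (cscale B (-1) x) y) = y"
  using add_assoc[of "cscale B (-1) x" x y] add_assoc[of x "cscale B (-1) x" y]
    add_commute[of "cscale B (-1) x" x] assms
  by (simp_all add: closed add_neg zero_add)

lemma norm_neg: "x \<in> carrier B \<Longrightarrow> cnorm B (cscale B (-1) x) = cnorm B x"
  by (simp add: norm_scale)

lemma dist_nonneg: "\<lbrakk>x \<in> carrier B; y \<in> carrier B\<rbrakk> \<Longrightarrow> 0 \<le> cdist B x y"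
  by (simp add: cdist_def norm_nonneg closed)

lemma dist_commute:
  assumes "x \<in> carrier B" "y \<in> carrier B" shows "cdist B x y = cdist B y x"
proof -
  have "cscale B (-1) (cadd B y (cscale B (-1) x)) = cadd B x (cscale B (-1) y)"
    using assms by (simp add: scale_add_right scale_scale scale_one closed add_commute)
  then show ?thesis
    using norm_neg[of "cadd B y (cscale B (-1) x)"] assms by (simp add: cdist_def closed)
qed

lemma dist_triangle:
  assumes "x \<in> carrier B" "y \<in> carrier B" "z \<in> carrier B"
  shows "cdist B x z \<le> cdist B x y + cdist B y z"
proof -
  have "cadd B (cadd B x (cscale B (-1) y)) (cadd B y (cscale B (-1) z)) = cadd B x (cscale B (-1) z)"
    using assms by (simp add: add_assoc closed cancel_left)
  then show ?thesis
    using norm_triangle[of "cadd B x (cscale B (-1) y)" "cadd B y (cscale B (-1) z)"] assms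
    by (simp add: cdist_def closed)
qed

lemma dist_zero_iff:
  assumes "x \<in> carrier B" "y \<in> carrier B" shows "cdist B x y = 0 \<longleftrightarrow> x = y"
proof
  assume "cdist B x y = 0"
  then have "cadd B x (cscale B (-1) y) = czero B"
    using assms norm_eq_zero[of "cadd B x (cscale B (-1) y)"] by (simp add: cdist_def closed)
  moreover have "cadd B (cadd B x (cscale B (-1) y)) y = x"
    using assms add_commute[of "cscale B (-1) y" y] by (simp add: add_assoc closed add_neg add_zero)
  ultimately show "x = y" using zero_add assms by simp
next
  assume "x = y"
  then show "cdist B x y = 0" using assms by (simp add: cdist_def add_neg norm_eq_zero zero_closed)
qed

definition lim :: "(nat \<Rightarrow> 'a) \<Rightarrow> 'a \<Rightarrow> bool" where
  "lim u x \<longleftrightarrow> (\<forall>n. u n \<in> carrier B) \<and> x \<in> carrier B \<and> (\<lambda>n. cdist B (u n) x) \<longlonglongrightarrow> 0"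

lemma limI:
  assumes "\<And>n. u n \<in> carrier B" "x \<in> carrier B" "\<And>n. cdist B (u n) x \<le> w n" "w \<longlonglongrightarrow> 0"
  shows "lim u x"
  unfolding lim_def
  using assms by (auto intro!: tendsto_sandwich[OF _ _ tendsto_const assms(4)] simp: dist_nonneg)

lemma lim_unique: assumes "lim u x" "lim u y" shows "x = y"
proof -
  have c: "\<And>n. u n \<in> carrier B" "x \<in> carrier B" "y \<in> carrier B" using assms by (auto simp: lim_def)
  have "(\<lambda>n. cdist B (u n) x + cdist B (u n) y) \<longlonglongrightarrow> 0"
    using assms by (auto simp: lim_def intro: tendsto_add_zero)
  moreover have "cdist B x y \<le> cdist B (u n) x + cdist B (u n) y" for n
    using dist_triangle[OF c(2,1,3), of n] dist_commute[OF c(2,1), of n] by simp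
  ultimately have "cdist B x y \<le> 0" by (intro LIMSEQ_le_const) auto
  then show ?thesis using dist_nonneg[OF c(2,3)] dist_zero_iff[OF c(2,3)] by simp
qed

lemma lim_const: "x \<in> carrier B \<Longrightarrow> lim (\<lambda>n. x) x"
  using dist_zero_iff[of x x] by (simp add: lim_def)

lemma lim_add: assumes "lim u x" "lim v y" shows "lim (\<lambda>n. cadd B (u n) (v n)) (cadd B x y)"
proof (rule limI)
  note c = assms[unfolded lim_def, THEN conjunct1, rule_format]
    assms[unfolded lim_def, THEN conjunct2, THEN conjunct1]
  show "(\<lambda>n. cdist B (u n) x + cdist B (v n) y) \<longlonglongrightarrow> 0"
    using assms by (auto simp: lim_def intro: tendsto_add_zero)
  fix n
  show "cadd B (u n) (v n) \<in> carrier B" "cadd B x y \<in> carrier B" using c by (simp_all add: closed)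
  have "cadd B (cadd B (u n) (v n)) (cscale B (-1) (cadd B x y))
      = cadd B (cadd B (u n) (cscale B (-1) x)) (cadd B (v n) (cscale B (-1) y))"
    using c by (simp add: scale_add_right add_assoc add_left_commute closed)
  then show "cdist B (cadd B (u n) (v n)) (cadd B x y) \<le> cdist B (u n) x + cdist B (v n) y"
    using norm_triangle[of "cadd B (u n) (cscale B (-1) x)" "cadd B (v n) (cscale B (-1) y)"] c
    by (simp add: cdist_def closed)
qed

lemma lim_scale: assumes "lim u x" shows "lim (\<lambda>n. cscale B c (u n)) (cscale B c x)"
proof (rule limI)
  have c: "\<And>n. u n \<in> carrier B" "x \<in> carrier B" using assms by (auto simp: lim_def)
  have "(\<lambda>n. cmod c * cdist B (u n) x) \<longlonglongrightarrow> cmod c * 0"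
    using assms by (intro tendsto_mult tendsto_const) (simp add: lim_def)
  then show "(\<lambda>n. cmod c * cdist B (u n) x) \<longlonglongrightarrow> 0" by simp
  fix n
  show "cscale B c (u n) \<in> carrier B" "cscale B c x \<in> carrier B" using c by (simp_all add: closed)
  have "cadd B (cscale B c (u n)) (cscale B (-1) (cscale B c x)) = cscale B c (cadd B (u n) (cscale B (-1) x))"
    using c by (simp add: scale_add_right scale_scale closed)
  then show "cdist B (cscale B c (u n)) (cscale B c x) \<le> cmod c * cdist B (u n) x"
    using c by (simp add: cdist_def norm_scale closed)
qed

lemma norm_adj: assumes "x \<in> carrier B" shows "cnorm B (cadj B x) = cnorm B x"
proof -
  have *: "cnorm B y \<le> cnorm B (cadj B y)" if y: "y \<in> carrier B" for y
  proof (cases "cnorm B y = 0")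
    case True
    then show ?thesis using norm_nonneg[OF adj_closed[OF y]] by simp
  next
    case False
    have "cnorm B y * cnorm B y \<le> cnorm B (cadj B y) * cnorm B y"
      using cstar_identity[OF y] norm_mult[OF adj_closed[OF y] y] by (simp add: power2_eq_square)
    then show ?thesis using False norm_nonneg[OF y] by simp
  qed
  show ?thesis using *[OF assms] *[OF adj_closed[OF assms]] assms by (simp add: adj_adj)
qed

lemma lim_adj: assumes "lim u x" shows "lim (\<lambda>n. cadj B (u n)) (cadj B x)"
proof (rule limI)
  have c: "\<And>n. u n \<in> carrier B" "x \<in> carrier B" using assms by (auto simp: lim_def)
  show "(\<lambda>n. cdist B (u n) x) \<longlonglongrightarrow> 0" using assms by (simp add: lim_def)
  fix n
  show "cadj B (u n) \<in> carrier B" "cadj B x \<in> carrier B" using c by (simp_all add: closed)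
  have "cadd B (cadj B (u n)) (cscale B (-1) (cadj B x)) = cadj B (cadd B (u n) (cscale B (-1) x))"
    using c by (simp add: adj_add adj_scale closed)
  then show "cdist B (cadj B (u n)) (cadj B x) \<le> cdist B (u n) x"
    using c by (simp add: cdist_def norm_adj closed)
qed

lemma norm_le_dist:
  assumes "x \<in> carrier B" "y \<in> carrier B" shows "cnorm B x \<le> cdist B x y + cnorm B y"
proof -
  have "cadd B (cadd B x (cscale B (-1) y)) y = x"
    using assms add_commute[of "cscale B (-1) y" y] by (simp add: add_assoc closed add_neg add_zero)
  then show ?thesis
    using norm_triangle[of "cadd B x (cscale B (-1) y)" y] assms by (simp add: cdist_def closed)
qed

lemma lim_norm: assumes "lim u x" shows "(\<lambda>n. cnorm B (u n)) \<longlonglongrightarrow> cnorm B x"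
proof -
  have c: "\<And>n. u n \<in> carrier B" "x \<in> carrier B" using assms by (auto simp: lim_def)
  have "\<bar>cnorm B (u n) - cnorm B x\<bar> \<le> cdist B (u n) x" for n
    using norm_le_dist[OF c, of n] norm_le_dist[OF c(2,1), of n] dist_commute[OF c, of n] by linarith
  then have "\<forall>\<^sub>F n in sequentially. \<bar>cnorm B (u n) - cnorm B x\<bar> \<le> cdist B (u n) x"
    by (simp add: eventually_sequentially)
  moreover have "(\<lambda>n. cdist B (u n) x) \<longlonglongrightarrow> 0" using assms by (simp add: lim_def)
  ultimately have "(\<lambda>n. \<bar>cnorm B (u n) - cnorm B x\<bar>) \<longlonglongrightarrow> 0"
    by (rule tendsto_sandwich[OF _ _ tendsto_const, rotated]) simp
  then have "(\<lambda>n. cnorm B (u n) - cnorm B x) \<longlonglongrightarrow> 0" by (rule tendsto_rabs_zero_cancel)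
  then show ?thesis by (rule LIM_zero_cancel)
qed

lemma lim_mult: assumes "lim u x" "lim v y" shows "lim (\<lambda>n. cmult B (u n) (v n)) (cmult B x y)"
proof (rule limI)
  note c = assms[unfolded lim_def, THEN conjunct1, rule_format]
    assms[unfolded lim_def, THEN conjunct2, THEN conjunct1]
  have "(\<lambda>n. cnorm B (u n) * cdist B (v n) y + cdist B (u n) x * cnorm B y) \<longlonglongrightarrow> cnorm B x * 0 + 0 * cnorm B y"
    using assms lim_norm[OF assms(1)] by (intro tendsto_add tendsto_mult tendsto_const) (simp_all add: lim_def)
  then show "(\<lambda>n. cnorm B (u n) * cdist B (v n) y + cdist B (u n) x * cnorm B y) \<longlonglongrightarrow> 0" by simp
  fix n
  show "cmult B (u n) (v n) \<in> carrier B" "cmult B x y \<in> carrier B" using c by (simp_all add: closed)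
  have "cadd B (cmult B (u n) (cadd B (v n) (cscale B (-1) y))) (cmult B (cadd B (u n) (cscale B (-1) x)) y)
      = cadd B (cmult B (u n) (v n)) (cscale B (-1) (cmult B x y))"
    using c by (simp add: mult_add_left mult_add_right mult_scale_left mult_scale_right add_assoc closed cancel_left)
  then have "cdist B (cmult B (u n) (v n)) (cmult B x y)
     \<le> cnorm B (cmult B (u n) (cadd B (v n) (cscale B (-1) y))) + cnorm B (cmult B (cadd B (u n) (cscale B (-1) x)) y)"
    using norm_triangle[of "cmult B (u n) (cadd B (v n) (cscale B (-1) y))" "cmult B (cadd B (u n) (cscale B (-1) x)) y"] c
    by (simp add: cdist_def closed)
  also have "\<dots> \<le> cnorm B (u n) * cdist B (v n) y + cdist B (u n) x * cnorm B y"
    unfolding cdist_def by (intro add_mono norm_mult closed c)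
  finally show "cdist B (cmult B (u n) (v n)) (cmult B x y)
     \<le> cnorm B (u n) * cdist B (v n) y + cdist B (u n) x * cnorm B y" .
qed

end

theorem cstar_algebra_kgraph_cstar:
  assumes "kgraph \<Lambda>" shows "cstar_algebra (kgraph_cstar \<Lambda>)"
  unfolding kgraph_cstar_def
  by (rule cstar_seminormed.cstar_algebra_completion, rule cstar_seminormed.intro,
      rule cstar_seminorm_ck_seminorm[OF assms])

theorem kgraph_cstar_relations:
  assumes \<Lambda>: "kgraph \<Lambda>"
  shows "free_star_hom (kg_mor \<Lambda>) (kgraph_cstar \<Lambda>) (kgraph_cstar_of \<Lambda>)"
    and "r \<in> ck_relators \<Lambda> \<Longrightarrow> kgraph_cstar_of \<Lambda> r = czero (kgraph_cstar \<Lambda>)"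
    and "\<lbrakk>X \<in> carrier (kgraph_cstar \<Lambda>); 0 < e\<rbrakk>
      \<Longrightarrow> \<exists>x\<in>free_star_alg (kg_mor \<Lambda>). cdist (kgraph_cstar \<Lambda>) X (kgraph_cstar_of \<Lambda> x) \<le> e"
proof -
  define M where "M = kg_mor \<Lambda>"
  define p where "p = ck_seminorm \<Lambda>"
  interpret p: cstar_seminormed M p
    unfolding p_def M_def by (rule cstar_seminormed.intro, rule cstar_seminorm_ck_seminorm[OF \<Lambda>])
  have B_eq: "kgraph_cstar \<Lambda> = p.B" by (simp add: kgraph_cstar_def p_def M_def)
  have of_eq: "kgraph_cstar_of \<Lambda> = (\<lambda>x. p.cls (\<lambda>n. x))"
    by (simp add: kgraph_cstar_of_def p_def M_def fun_eq_iff)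
  show "free_star_hom (kg_mor \<Lambda>) (kgraph_cstar \<Lambda>) (kgraph_cstar_of \<Lambda>)"
    unfolding free_star_hom_def B_eq of_eq M_def[symmetric]
    by (simp add: p.cls_closed p.cls_scale p.cls_adj p.cls_add p.cls_mult p.C_const)
  show "kgraph_cstar_of \<Lambda> r = czero (kgraph_cstar \<Lambda>)" if r: "r \<in> ck_relators \<Lambda>"
  proof -
    have "r \<in> p.F" using ck_relators_subset[OF \<Lambda>] r by (auto simp: M_def)
    moreover have "p r = 0" using ck_seminorm_relator[OF \<Lambda> r] by (simp add: p_def)
    ultimately show ?thesis
      unfolding B_eq of_eq p.cls_zero
      by (subst p.cls_eq_iff) (simp_all add: p.C_const zero_free_star_alg)
  qed
  show "\<exists>x\<in>free_star_alg (kg_mor \<Lambda>). cdist (kgraph_cstar \<Lambda>) X (kgraph_cstar_of \<Lambda> x) \<le> e"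
    if X: "X \<in> carrier (kgraph_cstar \<Lambda>)" and e: "0 < e"
  proof -
    from X obtain u where u: "u \<in> p.C" and eq: "X = p.cls u"
      unfolding B_eq by (rule p.carrier_cases)
    obtain N where "cdist p.B (p.cls u) (p.cls (\<lambda>_. u N)) \<le> e"
      using p.cls_approx[OF u e] by blast
    then show ?thesis
      unfolding B_eq of_eq eq M_def[symmetric] using p.C_F[OF u] by blast
  qed
qed

theorem kgraph_cstar_universal:
  fixes \<Lambda> :: "('m, 'k::finite) kgraph_data" and D :: "('d, 'x) cstar_data_scheme"
  assumes \<Lambda>: "kgraph \<Lambda>" and D: "cstar_algebra D"
    and f: "free_star_hom (kg_mor \<Lambda>) D f" and rel: "\<And>r. r \<in> ck_relators \<Lambda> \<Longrightarrow> f r = czero D"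
  shows "\<exists>h. cstar_hom (kgraph_cstar \<Lambda>) D h \<and>
             (\<forall>X\<in>carrier (kgraph_cstar \<Lambda>). cnorm D (h X) \<le> cnorm (kgraph_cstar \<Lambda>) X) \<and>
             (\<forall>x\<in>free_star_alg (kg_mor \<Lambda>). h (kgraph_cstar_of \<Lambda> x) = f x)"
proof -
  interpret D: cstar_algebra D by fact
  define M where "M = kg_mor \<Lambda>"
  define p where "p = ck_seminorm \<Lambda>"
  interpret p: cstar_seminormed M p
    unfolding p_def M_def by (rule cstar_seminormed.intro, rule cstar_seminorm_ck_seminorm[OF \<Lambda>])
  have B_eq: "kgraph_cstar \<Lambda> = p.B" by (simp add: kgraph_cstar_def p_def M_def)
  have f1: "f x \<in> carrier D" "f (fscale c x) = cscale D c (f x)" "f (fadj x) = cadj D (f x)"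
    if "x \<in> p.F" for c x
    using f that unfolding free_star_hom_def M_def by blast+
  have f2: "f (x + y) = cadd D (f x) (f y)" "f (x * y) = cmult D (f x) (f y)"
    if "x \<in> p.F" "y \<in> p.F" for x y
    using f that unfolding free_star_hom_def M_def by blast+
  have "cstar_seminorm M (\<lambda>x. cnorm D (f x))"
    unfolding cstar_seminorm_def
    using f1 f2 p.F_closed(5)
    by (simp add: D.norm_nonneg D.norm_scale D.norm_triangle D.norm_mult D.cstar_identity)
  moreover have "\<forall>r\<in>ck_relators \<Lambda>. cnorm D (f r) = 0"
    using rel D.norm_eq_zero[OF D.zero_closed] by simp
  ultimately have le: "cnorm D (f x) \<le> p x" if "x \<in> p.F" for x
    using ck_seminorm_upper[OF \<Lambda>, of x "\<lambda>x. cnorm D (f x)"] that by (simp add: M_def p_def)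
  have dist: "cdist D (f x) (f y) \<le> p (x - y)" if "x \<in> p.F" "y \<in> p.F" for x y
  proof -
    have "f (x - y) = cadd D (f x) (cscale D (-1) (f y))"
      using f2(1)[OF that(1) p.F_closed(4)[OF that(2), of "-1"]] f1(2)[OF that(2), of "-1"]
      by (simp add: fscale_simps)
    then show ?thesis using le[OF p.F_closed(2)[OF that]] by (simp add: cdist_def)
  qed
  have ex: "\<exists>y. D.lim (\<lambda>n. f (u n)) y" if u: "u \<in> p.C" for u
  proof -
    have "\<exists>y\<in>carrier D. (\<lambda>n. cdist D (f (u n)) y) \<longlonglongrightarrow> 0"
    proof (rule D.complete)
      show "f (u n) \<in> carrier D" for n using f1(1) p.C_F[OF u] .
      fix e :: real assume "0 < e"
      then obtain N where "\<And>m n. m \<ge> N \<Longrightarrow> n \<ge> N \<Longrightarrow> p (u m - u n) < e" using p.C_D[OF u] by blast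
      then have "cdist D (f (u m)) (f (u n)) < e" if "m \<ge> N" "n \<ge> N" for m n
        using dist[OF p.C_F[OF u] p.C_F[OF u], of m n] that by (meson le_less_trans)
      then show "\<exists>N. \<forall>m\<ge>N. \<forall>n\<ge>N. cdist D (f (u m)) (f (u n)) < e" by blast
    qed
    then show ?thesis using f1(1) p.C_F[OF u] unfolding D.lim_def by blast
  qed
  define g where "g u = (SOME y. D.lim (\<lambda>n. f (u n)) y)" for u
  have g: "D.lim (\<lambda>n. f (u n)) (g u)" if "u \<in> p.C" for u
    unfolding g_def using ex[OF that] by (rule someI_ex)
  have g_eq: "g u = g v" if R: "(u, v) \<in> p.R" for u v
  proof -
    have C: "u \<in> p.C" "v \<in> p.C" and null: "(\<lambda>n. p (u n - v n)) \<longlonglongrightarrow> 0" using R by (auto simp: p.R_iff)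
    have c: "f (u n) \<in> carrier D" "f (v n) \<in> carrier D" "g v \<in> carrier D" for n
      using f1(1) p.C_F C g[OF C(2)] by (auto simp: D.lim_def)
    have "D.lim (\<lambda>n. f (u n)) (g v)"
    proof (rule D.limI)
      show "(\<lambda>n. p (u n - v n) + cdist D (f (v n)) (g v)) \<longlonglongrightarrow> 0"
        using null g[OF C(2)] by (auto simp: D.lim_def intro: tendsto_add_zero)
      show "cdist D (f (u n)) (g v) \<le> p (u n - v n) + cdist D (f (v n)) (g v)" for n
        using D.dist_triangle[OF c(1,2,3), of n n] dist[OF p.C_F[OF C(1)] p.C_F[OF C(2)], of n n]
        by linarith
    qed (use c in auto)
    then show ?thesis using D.lim_unique g[OF C(1)] by blast
  qed
  define h where "h X = (SOME y. \<exists>u\<in>X. y = g u)" for X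
  have h: "h (p.cls u) = g u" if u: "u \<in> p.C" for u
  proof -
    have "\<exists>y. \<exists>v\<in>p.cls u. y = g v" using p.cls_self[OF u] by blast
    then have "\<exists>v\<in>p.cls u. h (p.cls u) = g v" unfolding h_def by (rule someI_ex)
    then show ?thesis using g_eq by auto
  qed
  have hom: "cstar_hom p.B D h"
    unfolding cstar_hom_def
  proof (intro conjI ballI allI)
    fix X assume "X \<in> carrier p.B"
    then obtain u where u: "u \<in> p.C" and X: "X = p.cls u" by (rule p.carrier_cases)
    show "h X \<in> carrier D" using g[OF u] by (simp add: X h u D.lim_def)
    show "h (cscale p.B c X) = cscale D c (h X)" for c
      unfolding X p.cls_scale[OF u] h[OF u] h[OF p.C_scale[OF u]]
      by (rule D.lim_unique[OF g[OF p.C_scale[OF u]]])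
        (use D.lim_scale[OF g[OF u], of c] in \<open>simp add: f1 p.C_F[OF u]\<close>)
    show "h (cadj p.B X) = cadj D (h X)"
      unfolding X p.cls_adj[OF u] h[OF u] h[OF p.C_adj[OF u]]
      by (rule D.lim_unique[OF g[OF p.C_adj[OF u]]])
        (use D.lim_adj[OF g[OF u]] in \<open>simp add: f1 p.C_F[OF u]\<close>)
  next
    fix X Y assume "X \<in> carrier p.B" "Y \<in> carrier p.B"
    then obtain u v where u: "u \<in> p.C" and X: "X = p.cls u" and v: "v \<in> p.C" and Y: "Y = p.cls v"
      by (elim p.carrier_cases)
    show "h (cadd p.B X Y) = cadd D (h X) (h Y)"
      unfolding X Y p.cls_add[OF u v] h[OF u] h[OF v] h[OF p.C_add[OF u v]]
      by (rule D.lim_unique[OF g[OF p.C_add[OF u v]]])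
        (use D.lim_add[OF g[OF u] g[OF v]] in \<open>simp add: f2 p.C_F[OF u] p.C_F[OF v]\<close>)
    show "h (cmult p.B X Y) = cmult D (h X) (h Y)"
      unfolding X Y p.cls_mult[OF u v] h[OF u] h[OF v] h[OF p.C_mult[OF u v]]
      by (rule D.lim_unique[OF g[OF p.C_mult[OF u v]]])
        (use D.lim_mult[OF g[OF u] g[OF v]] in \<open>simp add: f2 p.C_F[OF u] p.C_F[OF v]\<close>)
  qed
  have bound: "cnorm D (h X) \<le> cnorm p.B X" if "X \<in> carrier p.B" for X
  proof -
    from that obtain u where u: "u \<in> p.C" and X: "X = p.cls u" by (rule p.carrier_cases)
    show ?thesis
      unfolding X h[OF u]
      by (rule LIMSEQ_le[OF D.lim_norm[OF g[OF u]] p.cls_norm[OF u]])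
        (use le p.C_F[OF u] in blast)
  qed
  have "h (p.cls (\<lambda>n. x)) = f x" if x: "x \<in> p.F" for x
    using h[OF p.C_const[OF x]] D.lim_unique[OF g[OF p.C_const[OF x]] D.lim_const[OF f1(1)[OF x]]]
    by simp
  then show ?thesis
    using hom bound unfolding B_eq kgraph_cstar_of_def M_def p_def by blast
qed

end

theory Submission
  imports Defs "HOL-Analysis.Urysohn"
begin

text \<open>
  The coloured edges of the product of trees make it the Cayley graph of \<open>G\<close>, so the action factors
  through the trees, and morphisms of the \<open>k\<close>-graph of degree \<open>n\<close> correspond to tuples of walks of
  length \<open>n\<^sub>i\<close> in the trees, where backtracking is allowed.  This gives the unique factorization, and
  squares are determined by any two adjacent sides.  The times at which the \<open>i\<close>-th walk backtracks are
  invariant under \<open>G\<close>; an infinite path that backtracks at the squares of the integers in every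
  colour is aperiodic.

  Its finite segments \<open>\<alpha>\<close> have the property that \<open>\<kappa> \<alpha>\<close> and \<open>\<mu> \<alpha>\<close> have no common extension when
  \<open>\<kappa>\<close> and \<open>\<mu>\<close> have different small degrees.  Compressing by \<open>\<Sum>\<^sub>\<kappa> s\<^sub>\<kappa> s\<^sub>\<alpha> s\<^sub>\<kappa>\<^sup>*\<close> then kills all terms of
  nonzero degree, so every nonzero \<open>C\<^sup>*\<close>-seminorm \<open>q\<close> that satisfies the relations dominates the
  degree \<open>0\<close> part, where it agrees with the largest such seminorm \<open>p\<close> because the algebra of
  every level is a matrix algebra.  Since \<open>(x\<^sup>* x)\<^sup>m\<close> has only polynomially many degrees in \<open>m\<close>, this
  gives \<open>p (x\<^sup>* x)\<^sup>m \<le> C m\<^sup>k q (x\<^sup>* x)\<^sup>m\<close>, hence \<open>p = q\<close>.  Applied to the quotient seminorm of a proper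
  closed ideal, this shows that the ideal is zero.
\<close>


section \<open>Seminorms on the free \<open>*\<close>-algebra\<close>

text \<open>The seminorms are known only through their axioms, so three standard facts need
  substitutes. Range projections of equal degree that sum to the unit are orthogonal: usually by
  positivity, here because the unit is an extreme point of the unit ball, which is a purely metric
  statement. The quotient by a closed ideal satisfies the C*-identity: usually by approximate units,
  here by resolvents of 1 + i r b, which are reached in small steps because they are contractive
  wherever they exist. The degree parts are continuous: usually by averaging over the gauge action,
  here by compression for degree 0, and the C*-identity reduces degree d to degree 0. The squares
  are chosen because the distance from K^2 to the next square exceeds K: a shift by d with 0 < d
  \<le> K moves the reversal at K^2 to a time that is no reversal, so one segment separates all
  degrees up to K. The largest seminorm could a priori vanish at the unit. This is excluded by an
  explicit representation on words that end in repetitions of a fixed morphism.\<close>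

lemma numeral_times:
  fixes x :: "'a::ring_1"
  shows "2 * x = x + x" "3 * x = x + x + x" "4 * x = x + x + x + x"
  by (simp_all only: numeral_Bit0 numeral_Bit1 numeral_One distrib_right mult_1_left add.assoc)

section \<open>Arithmetic modulo the null space of a C*-seminorm, and bicontractions\<close>

context cstar_seminormed
begin

text \<open>Equality in the quotient by the null space of \<open>q\<close>. Membership in
  \<open>F\<close> is built in, so a chain of such equalities also carries the closure
  conditions.\<close>

definition eqv :: "'m star_poly \<Rightarrow> 'm star_poly \<Rightarrow> bool" (infix "\<asymp>" 50) where
  "x \<asymp> y \<longleftrightarrow> x \<in> F \<and> y \<in> F \<and> q (x - y) = 0"

lemma eqvI: "\<lbrakk>x \<in> F; y \<in> F; q (x - y) = 0\<rbrakk> \<Longrightarrow> x \<asymp> y"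
  by (simp add: eqv_def)

lemma eqv_F: "x \<asymp> y \<Longrightarrow> x \<in> F" "x \<asymp> y \<Longrightarrow> y \<in> F"
  by (simp_all add: eqv_def)

lemma eqv_refl: "x \<in> F \<Longrightarrow> x \<asymp> x"
  by (simp add: eqv_def q_zero)

lemma eqv_sym: "x \<asymp> y \<Longrightarrow> y \<asymp> x"
  using q_minus_commute by (simp add: eqv_def)

lemma eqv_trans [trans]: assumes "x \<asymp> y" "y \<asymp> z" shows "x \<asymp> z"
  using q_diff_triangle[of x y z] q_nonneg[OF F_closed(2), of x z] assms by (simp add: eqv_def)

lemma eqv_add: assumes "x \<asymp> x'" "y \<asymp> y'" shows "x + y \<asymp> x' + y'"
proof (rule eqvI)
  have "q ((x - x') + (y - y')) \<le> q (x - x') + q (y - y')"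
    using assms by (intro q_add F_closed(2)) (auto simp: eqv_def)
  then show "q (x + y - (x' + y')) = 0"
    using assms q_nonneg[OF F_closed(2)[OF F_closed(1) F_closed(1)], of x y x' y']
    by (simp add: eqv_def algebra_simps)
qed (use assms in \<open>auto simp: eqv_def F_closed\<close>)

lemma eqv_mult: assumes "x \<asymp> x'" "y \<asymp> y'" shows "x * y \<asymp> x' * y'"
proof (rule eqvI)
  have "q (x * y - x' * y') \<le> q x * q (y - y') + q (x - x') * q y'"
    using assms by (intro q_mult_diff) (auto simp: eqv_def)
  then show "q (x * y - x' * y') = 0"
    using assms q_nonneg[OF F_closed(2)[OF F_closed(3) F_closed(3)], of x y x' y']
    by (simp add: eqv_def)
qed (use assms in \<open>auto simp: eqv_def F_closed\<close>)

lemma eqv_fscale: assumes "x \<asymp> x'" shows "fscale c x \<asymp> fscale c x'"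
  using assms q_scale[OF F_closed(2), of x x' c] by (simp add: eqv_def F_closed fscale_simps)

lemma eqv_fadj: assumes "x \<asymp> x'" shows "fadj x \<asymp> fadj x'"
  using assms q_adj[OF F_closed(2), of x x'] by (simp add: eqv_def F_closed fadj_simps)

lemma eqv_diff: assumes "x \<asymp> x'" "y \<asymp> y'" shows "x - y \<asymp> x' - y'"
  using eqv_add[OF assms(1) eqv_fscale[OF assms(2), of "-1"]] by (simp add: fscale_simps)

lemma sum_F: "(\<And>i. i \<in> I \<Longrightarrow> f i \<in> F) \<Longrightarrow> sum f I \<in> F"
  by (induction I rule: infinite_finite_induct) (auto simp: zero_free_star_alg F_closed)

lemma eqv_sum: "(\<And>i. i \<in> I \<Longrightarrow> f i \<asymp> g i) \<Longrightarrow> sum f I \<asymp> sum g I"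
  by (induction I rule: infinite_finite_induct)
    (auto simp: zero_free_star_alg intro: eqv_refl eqv_add)

lemma q_eqv: "x \<asymp> y \<Longrightarrow> q x = q y"
  using q_abs_diff[of x y] by (simp add: eqv_def)

lemma q_sum: "(\<And>i. i \<in> I \<Longrightarrow> f i \<in> F) \<Longrightarrow> q (sum f I) \<le> (\<Sum>i\<in>I. q (f i))"
proof (induction I rule: infinite_finite_induct)
  case (insert i I)
  then have "q (f i + sum f I) \<le> q (f i) + q (sum f I)" by (intro q_add sum_F) auto
  with insert show ?case by force
qed (simp_all add: q_zero)

lemma q_diff: assumes "x \<in> F" "y \<in> F" shows "q (x - y) \<le> q x + q y"
  using q_add[OF assms(1) F_closed(4)[OF assms(2), of "-1"]] q_minus[OF assms(2)]
  by (simp add: fscale_simps)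

lemma q_eqv_zero: "x \<in> F \<Longrightarrow> q x = 0 \<longleftrightarrow> x \<asymp> 0"
  by (auto simp: eqv_def zero_free_star_alg)

lemma eqv_zero_star: assumes "x \<in> F" "fadj x * x \<asymp> 0" shows "x \<asymp> 0"
  using assms q_adj_mult[of x] q_eqv[OF assms(2)] by (simp add: q_zero flip: q_eqv_zero)

lemma eqv_zero_left: "x \<asymp> 0 \<Longrightarrow> y \<in> F \<Longrightarrow> x * y \<asymp> 0"
  and eqv_zero_right: "y \<asymp> 0 \<Longrightarrow> x \<in> F \<Longrightarrow> x * y \<asymp> 0"
  using eqv_mult[of x 0 y y] eqv_mult[of x x y 0] by (simp_all add: eqv_refl)

text \<open>The bounds \<parallel>1 + h\<parallel> \<le> 1 and \<parallel>1 - h\<parallel> \<le> 1,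
  stated for left multiplication because 1 is the empty word and does not lie in
  \<open>F\<close>.\<close>

definition bicontraction :: "'m star_poly \<Rightarrow> bool" where
  "bicontraction h \<longleftrightarrow> h \<in> F \<and> (\<forall>x\<in>F. q (x + h * x) \<le> q x \<and> q (x - h * x) \<le> q x)"

lemma bicontractionD:
  "bicontraction h \<Longrightarrow> h \<in> F"
  "bicontraction h \<Longrightarrow> x \<in> F \<Longrightarrow> q (x + h * x) \<le> q x"
  "bicontraction h \<Longrightarrow> x \<in> F \<Longrightarrow> q (x - h * x) \<le> q x"
  by (simp_all add: bicontraction_def)

lemma q_numeral: assumes "x \<in> F" shows "q (numeral k * x) = numeral k * q x" "numeral k * x \<in> F"
proof -
  have *: "numeral k * x = fscale (numeral k) x"
    by (simp add: fscale_conv_mult)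
  show "q (numeral k * x) = numeral k * q x" "numeral k * x \<in> F"
    unfolding * using assms by (simp_all add: q_scale F_closed)
qed

text \<open>Because 4 h = (1 + h)^2 - (1 - h)^2, and each square is again a contraction.\<close>

lemma bicontraction_half:
  assumes "bicontraction h" "x \<in> F" shows "q (h * x) \<le> q x / 2"
proof -
  have h: "h \<in> F" using bicontractionD assms by blast
  define y where "y = x + h * x"
  define z where "z = x - h * x"
  have F: "y \<in> F" "z \<in> F" using h assms by (auto simp: y_def z_def F_closed)
  have "4 * (h * x) = (y + h * y) - (z - h * z)" by (simp add: y_def z_def numeral_times algebra_simps)
  moreover have "q ((y + h * y) - (z - h * z)) \<le> q (y + h * y) + q (z - h * z)"
    by (intro q_diff F_closed F h)
  moreover have "q (y + h * y) \<le> q x" "q (z - h * z) \<le> q x"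
    using bicontractionD(2,3)[OF assms(1)] F assms(2) unfolding y_def z_def by (meson order_trans)+
  ultimately show ?thesis using q_numeral[of "h * x" "num.Bit0 (num.Bit0 num.One)"] h assms by (simp add: F_closed)
qed

lemma bicontraction_cubic:
  assumes "bicontraction h"
  shows "bicontraction (fscale (1/2) (3 * h - h * h * h))"
proof -
  have h: "h \<in> F" using bicontractionD assms by blast
  define k where "k = 3 * h - h * h * h"
  have k: "k \<in> F" using h by (simp add: k_def F_closed q_numeral)
  have half: "q (x + fscale c k * x) \<le> q x" if x: "x \<in> F" and le: "q (2 * x + fscale (2 * c) k * x) \<le> 2 * q x" for x c
  proof -
    have eq: "2 * (x + fscale c k * x) = 2 * x + fscale (2 * c) k * x"
    proof -
      have "fscale (2 * c) k = fscale c k + fscale c k" by (simp only: fscale_simps(5) mult_2)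
      then show ?thesis by (simp add: algebra_simps numeral_times)
    qed
    have "2 * q (x + fscale c k * x) = q (2 * (x + fscale c k * x))"
      by (rule q_numeral(1)[symmetric]) (simp add: F_closed x k)
    then show ?thesis using le unfolding eq by simp
  qed
  have 1: "q (2 * x + k * x) \<le> 2 * q x" if x: "x \<in> F" for x
  proof -
    define y where "y = x + h * x"
    define z where "z = y + h * y"
    have F: "y \<in> F" "z \<in> F" using h x by (auto simp: y_def z_def F_closed)
    have "2 * x + k * x = z + (z - h * z)"
      by (simp add: k_def y_def z_def numeral_times algebra_simps)
    moreover have "q (z + (z - h * z)) \<le> q z + q (z - h * z)" by (intro q_add F_closed F h)
    moreover have "q z \<le> q x" "q (z - h * z) \<le> q x"
      using bicontractionD(2,3)[OF assms] F x unfolding y_def z_def by (meson order_trans)+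
    ultimately show ?thesis by simp
  qed
  have 2: "q (2 * x - k * x) \<le> 2 * q x" if x: "x \<in> F" for x
  proof -
    define y where "y = x - h * x"
    define z where "z = y - h * y"
    have F: "y \<in> F" "z \<in> F" using h x by (auto simp: y_def z_def F_closed)
    have "2 * x - k * x = z + (z + h * z)"
      by (simp add: k_def y_def z_def numeral_times algebra_simps)
    moreover have "q (z + (z + h * z)) \<le> q z + q (z + h * z)" by (intro q_add F_closed F h)
    moreover have "q z \<le> q x" "q (z + h * z) \<le> q x"
      using bicontractionD(2,3)[OF assms] F x unfolding y_def z_def by (meson order_trans)+
    ultimately show ?thesis by simp
  qed
  have neg: "fscale (- (1/2)) k = - fscale (1/2) k" for k :: "'m star_poly"
    by (rule poly_mapping_eqI) simp
  show ?thesis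
    unfolding bicontraction_def k_def[symmetric]
    using half[of _ "1/2"] half[of _ "-1/2"] 1 2 k
    by (simp add: F_closed fscale_simps neg)
qed

text \<open>The unit ball of a normed algebra has the unit as an extreme point.  The map
  \<open>h \<mapsto> (3 h - h\<^sup>3) / 2\<close> preserves bicontractions, since \<open>2 + 3 h - h\<^sup>3 = (1 + h)\<^sup>2 (2 - h)\<close>, and it
  stretches \<open>h\<close> by a factor of at least \<open>11 / 8\<close>.\<close>

lemma bicontraction_zero:
  assumes "bicontraction h" "x \<in> F" shows "q (h * x) = 0"
proof -
  have bound: "q (h * x) \<le> (8 / 11) ^ n * q x" if "bicontraction h" "x \<in> F" for h x n
    using that
  proof (induction n arbitrary: h x)
    case 0
    then show ?case using bicontraction_half[of h x] q_nonneg[of x] by simp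
  next
    case (Suc n)
    have h: "h \<in> F" using bicontractionD Suc.prems by blast
    define g where "g = fscale (1/2) (3 * h - h * h * h)"
    have F: "h * x \<in> F" "h * (h * x) \<in> F" "h * (h * (h * x)) \<in> F" using h Suc.prems by (auto simp: F_closed)
    have "q (g * x) \<le> (8 / 11) ^ n * q x"
      unfolding g_def using Suc.prems bicontraction_cubic by (intro Suc.IH) auto
    moreover have "q (g * x) = q (3 * (h * x) - h * (h * (h * x))) / 2"
      unfolding g_def fscale_mult_left using F
      by (subst q_scale) (auto simp: F_closed q_numeral h Suc.prems algebra_simps)
    moreover have "q (3 * (h * x)) \<le> q (3 * (h * x) - h * (h * (h * x))) + q (h * (h * (h * x)))"
      using q_add[of "3 * (h * x) - h * (h * (h * x))" "h * (h * (h * x))"] F by (simp add: F_closed q_numeral)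
    \<comment> \<open>Halving twice bounds the cubic term by a quarter of q (h x), so q (g x) is at
      least (3 - 1/4) / 2 = 11/8 times q (h x); this is where the ratio 8/11 comes from.\<close>
    moreover have "q (h * (h * (h * x))) \<le> q (h * x) / 4"
      using bicontraction_half[OF Suc.prems(1) F(1)] bicontraction_half[OF Suc.prems(1) F(2)] by linarith
    ultimately show ?case using q_numeral(1)[OF F(1), of "num.Bit1 num.One"] by simp
  qed
  have "(\<lambda>n. (8 / 11 :: real) ^ n * q x) \<longlonglongrightarrow> 0 * q x"
    by (intro tendsto_mult LIMSEQ_realpow_zero tendsto_const) auto
  then have "q (h * x) \<le> 0"
    using bound[OF assms] by (intro LIMSEQ_le_const[of _ 0]) auto
  then show ?thesis using q_nonneg[of "h * x"] bicontractionD(1)[OF assms(1)] assms(2) by (simp add: F_closed)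
qed

end

section \<open>Cuntz--Krieger families of a \<open>k\<close>-graph with one object\<close>

definition star_monom :: "('m \<times> bool) list \<Rightarrow> 'm star_poly" where
  "star_monom w = Poly_Mapping.single (Star_Word w) 1"

lemma star_monom_append: "star_monom (u @ v) = star_monom u * star_monom v"
  by (simp add: star_monom_def mult_single plus_star_word_def)

lemma star_monom_single: "star_monom [(\<mu>, b)] = (if b then fadj (fgen \<mu>) else fgen \<mu>)"
  by (simp add: star_monom_def fgen_def fadj_single adj_word_def)

lemma star_monom_Cons: "star_monom ((\<mu>, b) # w) = (if b then fadj (fgen \<mu>) else fgen \<mu>) * star_monom w"
  using star_monom_append[of "[(\<mu>, b)]" w] by (simp add: star_monom_single)

lemma star_monom_Nil: "star_monom [] = 1"
  by (simp add: star_monom_def flip: zero_star_word_def)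

lemma star_poly_sum:
  "x = (\<Sum>w\<in>Poly_Mapping.keys x. fscale (Poly_Mapping.lookup x w) (star_monom (star_letters w)))"
proof (rule poly_mapping_eqI)
  fix v
  have "Poly_Mapping.lookup (\<Sum>w\<in>Poly_Mapping.keys x. fscale (Poly_Mapping.lookup x w) (star_monom (star_letters w))) v
    = (\<Sum>w\<in>Poly_Mapping.keys x. if w = v then Poly_Mapping.lookup x w else 0)"
    unfolding lookup_sum star_monom_def
    by (intro sum.cong) (auto simp: lookup_single when_def)
  then show "Poly_Mapping.lookup x v = Poly_Mapping.lookup
      (\<Sum>w\<in>Poly_Mapping.keys x. fscale (Poly_Mapping.lookup x w) (star_monom (star_letters w))) v"
    by (simp add: in_keys_iff)
qed

lemma star_monom_in_free: "w \<noteq> [] \<Longrightarrow> fst ` set w \<subseteq> M \<Longrightarrow> star_monom w \<in> free_star_alg M"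
  by (simp add: star_monom_def free_star_alg_def)

lemma sum_fadj: "fadj (sum f I) = (\<Sum>i\<in>I. fadj (f i))"
  by (induction I rule: infinite_finite_induct) (simp_all add: fadj_simps)

locale one_object_kgraph = kgraph \<Lambda> for \<Lambda> :: "('m, 'k::finite) kgraph_data" +
  fixes e :: 'm
  assumes obj: "kg_obj \<Lambda> = {e}"
    and finite_deg: "finite {\<mu> \<in> kg_mor \<Lambda>. kg_deg \<Lambda> \<mu> = n}"
begin

abbreviation "M \<equiv> kg_mor \<Lambda>"
abbreviation "deg \<equiv> kg_deg \<Lambda>"
abbreviation times (infixl "\<cdot>" 70) where "\<mu> \<cdot> \<nu> \<equiv> kg_comp \<Lambda> \<mu> \<nu>"

definition L :: "nat ^ 'k \<Rightarrow> 'm set" where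
  "L n = {\<mu> \<in> M. deg \<mu> = n}"

lemma L_iff: "\<mu> \<in> L n \<longleftrightarrow> \<mu> \<in> M \<and> deg \<mu> = n"
  by (simp add: L_def)

lemma finite_L: "finite (L n)"
  unfolding L_def by (rule finite_deg)

lemma src_e: "\<mu> \<in> M \<Longrightarrow> kg_src \<Lambda> \<mu> = e" and rng_e: "\<mu> \<in> M \<Longrightarrow> kg_rng \<Lambda> \<mu> = e"
  using src_obj rng_obj obj by auto

lemma e_M: "e \<in> M"
  using obj by (auto simp: kg_obj_def)

lemma comp_M: "\<mu> \<in> M \<Longrightarrow> \<nu> \<in> M \<Longrightarrow> \<mu> \<cdot> \<nu> \<in> M"
  by (simp add: comp_mor src_e rng_e)

lemma e_comp: "\<mu> \<in> M \<Longrightarrow> e \<cdot> \<mu> = \<mu>" and comp_e: "\<mu> \<in> M \<Longrightarrow> \<mu> \<cdot> e = \<mu>"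
  using comp_rng[of \<mu>] comp_src[of \<mu>] by (simp_all add: src_e rng_e)

lemma comp_assoc': "\<kappa> \<in> M \<Longrightarrow> \<mu> \<in> M \<Longrightarrow> \<nu> \<in> M \<Longrightarrow> \<kappa> \<cdot> \<mu> \<cdot> \<nu> = \<kappa> \<cdot> (\<mu> \<cdot> \<nu>)"
  by (simp add: comp_assoc src_e rng_e)

lemma deg_comp': "\<mu> \<in> M \<Longrightarrow> \<nu> \<in> M \<Longrightarrow> deg (\<mu> \<cdot> \<nu>) = deg \<mu> + deg \<nu>"
  by (simp add: deg_comp src_e rng_e)

text \<open>Unique factorization as cancellation: once the first factors have equal degree,
  additivity forces the degrees of the second factors to agree.\<close>

lemma comp_eq_iff:
  assumes "\<mu> \<in> M" "\<nu> \<in> M" "\<mu>' \<in> M" "\<nu>' \<in> M" "deg \<mu> = deg \<mu>'"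
  shows "\<mu> \<cdot> \<nu> = \<mu>' \<cdot> \<nu>' \<longleftrightarrow> \<mu> = \<mu>' \<and> \<nu> = \<nu>'"
proof
  assume eq: "\<mu> \<cdot> \<nu> = \<mu>' \<cdot> \<nu>'"
  then have "deg \<nu> = deg \<nu>'" using assms deg_comp'[of \<mu> \<nu>] deg_comp'[of \<mu>' \<nu>'] by simp
  define Q where "Q p \<longleftrightarrow> p \<in> M \<times> M \<and> kg_src \<Lambda> (fst p) = kg_rng \<Lambda> (snd p) \<and>
    deg (fst p) = deg \<mu> \<and> deg (snd p) = deg \<nu> \<and> \<mu> \<cdot> \<nu> = fst p \<cdot> snd p" for p
  have "\<exists>!p. Q p" unfolding Q_def using factorization[OF comp_M[OF assms(1,2)] deg_comp'[OF assms(1,2)]] .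
  moreover have "Q (\<mu>, \<nu>)" using assms by (simp add: Q_def src_e rng_e)
  moreover have "Q (\<mu>', \<nu>')" using assms eq \<open>deg \<nu> = deg \<nu>'\<close> by (simp add: Q_def src_e rng_e)
  ultimately have "(\<mu>, \<nu>) = (\<mu>', \<nu>')" by blast
  then show "\<mu> = \<mu>' \<and> \<nu> = \<nu>'" by simp
qed simp

lemma factorize:
  assumes "\<pi> \<in> M" "n \<le> deg \<pi>"
  obtains \<mu> \<nu> where "\<mu> \<in> M" "\<nu> \<in> M" "deg \<mu> = n" "deg \<nu> = deg \<pi> - n" "\<pi> = \<mu> \<cdot> \<nu>"
proof -
  have "deg \<pi> = n + (deg \<pi> - n)" using assms(2) by (simp add: vec_eq_iff less_eq_vec_def)
  then show ?thesis using ex1_implies_ex[OF factorization[OF assms(1)]] that by fastforce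
qed

end

section \<open>Norm consequences of the Cuntz-Krieger relations\<close>

locale ck_family = one_object_kgraph \<Lambda> e + cstar_seminormed "kg_mor \<Lambda>" q
  for \<Lambda> :: "('m, 'k::finite) kgraph_data" and e q +
  assumes relator: "r \<in> ck_relators \<Lambda> \<Longrightarrow> q r = 0"
begin

notation eqv (infix "\<asymp>" 50)

abbreviation "S \<equiv> fgen"
abbreviation "Sx \<mu> \<equiv> fadj (fgen \<mu>)"

lemma S_F: "\<mu> \<in> M \<Longrightarrow> S \<mu> \<in> F"
  by (rule fgen_free_star_alg)

lemma Sx_F: "\<mu> \<in> M \<Longrightarrow> Sx \<mu> \<in> F"
  by (simp add: S_F F_closed)

lemma E_F: "S e \<in> F"
  by (simp add: S_F e_M)

lemma S_mult: "\<mu> \<in> M \<Longrightarrow> \<nu> \<in> M \<Longrightarrow> S \<mu> * S \<nu> \<asymp> S (\<mu> \<cdot> \<nu>)"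
  by (intro eqvI relator F_closed S_F comp_M; (assumption)?) (auto simp: ck_relators_def src_e rng_e)

lemma Sx_mult: assumes "\<mu> \<in> M" "\<nu> \<in> M" shows "Sx \<nu> * Sx \<mu> \<asymp> Sx (\<mu> \<cdot> \<nu>)"
  using eqv_fadj[OF S_mult[OF assms]] by (simp add: fadj_mult)

lemma Sx_S: "\<mu> \<in> M \<Longrightarrow> Sx \<mu> * S \<mu> \<asymp> S e"
  using ck_relators_src[of \<mu> \<Lambda>] by (intro eqvI relator F_closed S_F e_M) (auto simp: src_e)

lemma E_adj: "fadj (S e) \<asymp> S e"
  by (intro eqvI relator F_closed S_F e_M ck_relators_adj) (simp add: obj)

lemma S_sum: "(\<Sum>\<mu>\<in>L n. S \<mu> * Sx \<mu>) \<asymp> S e"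
proof (rule eqv_sym, rule eqvI)
  have "{\<mu> \<in> M. deg \<mu> = n \<and> kg_rng \<Lambda> \<mu> = e} = L n" by (auto simp: L_def rng_e)
  then have "S e - (\<Sum>\<mu>\<in>L n. S \<mu> * Sx \<mu>) \<in> ck_relators \<Lambda>"
    unfolding ck_relators_def by (intro UnI2 CollectI exI[of _ e] exI[of _ n] conjI) (simp_all add: obj)
  then show "q (S e - (\<Sum>\<mu>\<in>L n. S \<mu> * Sx \<mu>)) = 0" by (rule relator)
qed (auto intro!: sum_F simp: F_closed S_F e_M L_iff)

lemma F_sum_induct [consumes 1, case_names monom scale add zero]:
  assumes "x \<in> F"
    and "\<And>w. w \<noteq> [] \<Longrightarrow> fst ` set w \<subseteq> M \<Longrightarrow> P (star_monom w)"
    and "\<And>c x. x \<in> F \<Longrightarrow> P x \<Longrightarrow> P (fscale c x)"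
    and "\<And>x y. x \<in> F \<Longrightarrow> y \<in> F \<Longrightarrow> P x \<Longrightarrow> P y \<Longrightarrow> P (x + y)" and "P 0"
  shows "P x"
proof -
  have "(\<Sum>w\<in>W. fscale (Poly_Mapping.lookup x w) (star_monom (star_letters w))) \<in> F \<and>
      P (\<Sum>w\<in>W. fscale (Poly_Mapping.lookup x w) (star_monom (star_letters w)))"
    if "finite W" "W \<subseteq> Poly_Mapping.keys x" for W
    using that
  proof (induction W rule: finite_induct)
    case (insert w W)
    then have "star_letters w \<noteq> []" "fst ` set (star_letters w) \<subseteq> M"
      using assms(1) by (auto simp: free_star_alg_def)
    with insert show ?case by (auto intro!: assms(2,3,4) F_closed star_monom_in_free)
  qed (simp add: assms zero_free_star_alg)
  from this[OF finite_keys subset_refl] show ?thesis unfolding star_poly_sum[of x, symmetric] ..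
qed

text \<open>Only the first letter of a word meets s_e, and an adjoint letter is absorbed because s_e
  is self-adjoint modulo the null space.\<close>

lemma E_left: assumes "x \<in> F" shows "S e * x \<asymp> x"
  using assms
proof (induction x rule: F_sum_induct)
  case (monom w)
  then obtain \<mu> b v where w: "w = (\<mu>, b) # v" by (cases w) auto
  with monom have \<mu>: "\<mu> \<in> M" and v: "v = [] \<or> star_monom v \<in> F" by (auto intro: star_monom_in_free)
  let ?l = "if b then Sx \<mu> else S \<mu>"
  have "S e * Sx \<mu> \<asymp> fadj (S e) * Sx \<mu>"
    using \<mu> by (intro eqv_mult[OF eqv_sym[OF E_adj] eqv_refl] Sx_F)
  also have "\<dots> \<asymp> Sx \<mu>" using Sx_mult[OF \<mu> e_M] by (simp add: comp_e \<mu>)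
  finally have "S e * ?l \<asymp> ?l" using S_mult[OF e_M \<mu>] by (simp add: e_comp \<mu>)
  then have "S e * ?l * star_monom v \<asymp> ?l * star_monom v"
    using v eqv_mult[OF _ eqv_refl, of "S e * ?l" ?l "star_monom v"]
    by (elim disjE) (simp_all only: star_monom_Nil mult_1_right)
  then show ?case by (simp only: w star_monom_Cons mult.assoc)
next
  case (scale c x)
  then show ?case by (simp add: fscale_mult_right eqv_fscale)
next
  case (add x y)
  then show ?case by (simp add: distrib_left eqv_add)
qed (simp add: eqv_refl zero_free_star_alg)

lemma E_right: assumes "x \<in> F" shows "x * S e \<asymp> x"
proof -
  have "x * S e \<asymp> x * fadj (S e)" using assms by (intro eqv_mult eqv_refl eqv_sym[OF E_adj])
  also have "\<dots> = fadj (S e * fadj x)" by (simp add: fadj_mult fadj_simps)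
  also have "\<dots> \<asymp> x" using eqv_fadj[OF E_left, of "fadj x"] assms by (simp add: F_closed fadj_simps)
  finally show ?thesis .
qed

lemma q_S: "\<mu> \<in> M \<Longrightarrow> q (S \<mu>) \<le> 1"
  using ck_word_bound[OF kgraph_axioms cstar_seminorm, of "[(\<mu>, False)]"] relator
  by (simp add: fgen_def)

lemma q_Sx: "\<mu> \<in> M \<Longrightarrow> q (Sx \<mu>) \<le> 1"
  using q_S by (simp add: q_adj S_F)

lemma q_mult_le: assumes "x \<in> F" "y \<in> F" "q x \<le> 1" shows "q (x * y) \<le> q y" "q (y * x) \<le> q y"
proof -
  have "q (x * y) \<le> q x * q y" "q (y * x) \<le> q y * q x" using assms by (auto intro: q_mult)
  moreover have "q x * q y \<le> 1 * q y" using assms q_nonneg by (intro mult_right_mono) auto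
  ultimately show "q (x * y) \<le> q y" "q (y * x) \<le> q y" by (simp_all add: mult.commute)
qed

text \<open>For the range projection P and z = y - P y, idempotence and self-adjointness of P give
  z^* z = y^* z, so the square of q z is at most q y times q z.\<close>

lemma q_range_compl:
  assumes \<mu>: "\<mu> \<in> M" and y: "y \<in> F"
  shows "q (y - S \<mu> * Sx \<mu> * y) \<le> q y"
proof -
  let ?P = "S \<mu> * Sx \<mu>"
  let ?z = "y - ?P * y"
  note [simp] = F_closed S_F Sx_F \<mu> y
  have PP: "?P * ?P \<asymp> ?P"
  proof -
    have "?P * ?P = S \<mu> * (Sx \<mu> * S \<mu>) * Sx \<mu>" by (simp add: mult.assoc)
    also have "\<dots> \<asymp> S \<mu> * S e * Sx \<mu>" by (intro eqv_mult eqv_refl Sx_S) simp_all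
    also have "\<dots> \<asymp> ?P" by (intro eqv_mult eqv_refl E_right) simp_all
    finally show ?thesis .
  qed
  have "fadj ?z * ?z = fadj y * ?z - (fadj y * ?P * y - fadj y * (?P * ?P) * y)"
    by (simp add: fadj_simps fadj_mult algebra_simps)
  also have "\<dots> \<asymp> fadj y * ?z - (fadj y * ?P * y - fadj y * ?P * y)"
    by (intro eqv_diff eqv_mult eqv_refl PP) simp_all
  finally have "(q ?z)\<^sup>2 = q (fadj y * ?z)" using q_adj_mult[of ?z] q_eqv by simp
  then have "q ?z * q ?z \<le> q y * q ?z" using q_mult[of "fadj y" ?z] by (simp add: power2_eq_square q_adj)
  then show ?thesis
    using q_nonneg[of ?z] q_nonneg[of y] by (cases "q ?z = 0") (auto intro: mult_right_le_imp_le)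
qed

text \<open>No order on the algebra is available, so positivity is expressed by norms: the elements
  \<open>h \<kappa> = s\<^sub>\<nu>\<^sup>* s\<^sub>\<kappa> s\<^sub>\<kappa>\<^sup>* s\<^sub>\<nu>\<close> satisfy \<open>\<parallel>1 - h \<kappa>\<parallel> \<le> 1\<close>.  Those with \<open>\<kappa> \<noteq> \<nu>\<close> sum to zero, so a
  multiple of \<open>h \<mu>\<close> is a bicontraction.\<close>

lemma S_orthogonal:
  assumes "\<mu> \<in> M" "\<nu> \<in> M" "deg \<mu> = deg \<nu>" "\<mu> \<noteq> \<nu>"
  shows "Sx \<mu> * S \<nu> \<asymp> 0"
proof -
  define n where "n = deg \<nu>"
  define h where "h \<kappa> = Sx \<nu> * (S \<kappa> * Sx \<kappa>) * S \<nu>" for \<kappa>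
  note [simp] = F_closed S_F Sx_F
  have h_F [simp]: "h \<kappa> \<in> F" if "\<kappa> \<in> M" for \<kappa> using that assms by (simp add: h_def)
  \<comment> \<open>1 - h \<kappa> is the compression of the contraction 1 - s_\<kappa> s_\<kappa>^*
    by the isometry s_\<nu>.\<close>
  have contr: "q (x - h \<kappa> * x) \<le> q x" if "\<kappa> \<in> M" "x \<in> F" for \<kappa> x
  proof -
    have "Sx \<nu> * (S \<nu> * x - S \<kappa> * Sx \<kappa> * (S \<nu> * x)) = Sx \<nu> * S \<nu> * x - h \<kappa> * x"
      by (simp add: h_def algebra_simps)
    also have "\<dots> \<asymp> S e * x - h \<kappa> * x"
      using that assms by (intro eqv_diff eqv_mult Sx_S eqv_refl) simp_all
    also have "\<dots> \<asymp> x - h \<kappa> * x" using that assms by (intro eqv_diff E_left eqv_refl) simp_all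
    finally have "q (x - h \<kappa> * x) = q (Sx \<nu> * (S \<nu> * x - S \<kappa> * Sx \<kappa> * (S \<nu> * x)))" using q_eqv by simp
    also have "\<dots> \<le> q (S \<nu> * x - S \<kappa> * Sx \<kappa> * (S \<nu> * x))"
      using that assms q_Sx by (intro q_mult_le) simp_all
    also have "\<dots> \<le> q (S \<nu> * x)" using that assms by (intro q_range_compl) simp_all
    also have "\<dots> \<le> q x" using that assms q_S by (intro q_mult_le) simp_all
    finally show ?thesis .
  qed
  have L: "\<mu> \<in> L n" "\<nu> \<in> L n" "\<And>\<kappa>. \<kappa> \<in> L n \<Longrightarrow> \<kappa> \<in> M" using assms by (auto simp: L_iff n_def)
  have "(\<Sum>\<kappa>\<in>L n. h \<kappa>) = Sx \<nu> * (\<Sum>\<kappa>\<in>L n. S \<kappa> * Sx \<kappa>) * S \<nu>"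
    by (simp add: h_def sum_distrib_left sum_distrib_right)
  also have "\<dots> \<asymp> Sx \<nu> * S e * S \<nu>" using assms by (intro eqv_mult S_sum eqv_refl) simp_all
  also have "\<dots> \<asymp> Sx \<nu> * S \<nu>" using assms by (intro eqv_mult E_right eqv_refl) simp_all
  also have "\<dots> \<asymp> S e" using assms by (intro Sx_S)
  finally have sum: "(\<Sum>\<kappa>\<in>L n. h \<kappa>) \<asymp> S e" .
  have "h \<nu> = Sx \<nu> * S \<nu> * (Sx \<nu> * S \<nu>)" by (simp add: h_def mult.assoc)
  also have "\<dots> \<asymp> S e * S e" using assms by (intro eqv_mult Sx_S)
  also have "\<dots> \<asymp> S e" by (intro E_left E_F)
  finally have h_\<nu>: "h \<nu> \<asymp> S e" .
  define J where "J = L n - {\<mu>, \<nu>}"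
  have J: "finite J" "\<And>\<kappa>. \<kappa> \<in> J \<Longrightarrow> \<kappa> \<in> M" by (auto simp: J_def finite_L L_iff)
  have "L n = insert \<mu> (insert \<nu> J)" "\<mu> \<notin> J" "\<nu> \<notin> J" using L by (auto simp: J_def)
  then have "(\<Sum>\<kappa>\<in>L n. h \<kappa>) = h \<mu> + (h \<nu> + (\<Sum>\<kappa>\<in>J. h \<kappa>))"
    using J(1) assms(4) by simp
  then have "h \<mu> + (h \<nu> + (\<Sum>\<kappa>\<in>J. h \<kappa>)) - h \<nu> - (\<Sum>\<kappa>\<in>J. h \<kappa>) \<asymp> S e - S e - (\<Sum>\<kappa>\<in>J. h \<kappa>)"
    using sum J assms by (intro eqv_diff eqv_refl h_\<nu> sum_F) auto
  then have h_\<mu>: "h \<mu> \<asymp> - (\<Sum>\<kappa>\<in>J. h \<kappa>)" by (simp add: algebra_simps)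
  \<comment> \<open>Since h \<mu> is minus the sum of the h \<kappa> over J, t + h \<mu> is 1 plus
    the sum of all 1 - h \<kappa> with \<kappa> in J, a sum of card J + 1 contractions; this fixes
    t. For t - h \<mu> = (t - 1) + (1 - h \<mu>) the bound is immediate.\<close>
  define t :: real where "t = real (card J) + 1"
  define g where "g = fscale (1 / t) (h \<mu>)"
  have t: "t \<ge> 1" by (simp add: t_def)
  have le: "q (x + c) \<le> q x" if "x \<in> F" "c \<in> F" "q (fscale t x + fscale t c) \<le> t * q x" for x c
  proof -
    have "t * q (x + c) = q (fscale t (x + c))" using that t by (simp add: q_scale)
    also have "\<dots> \<le> t * q x" using that by (simp add: fscale_simps(4))
    finally show ?thesis using t by simp
  qed
  have plus: "q (x + g * x) \<le> q x" if x: "x \<in> F" for x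
  proof (rule le)
    have "fscale t (g * x) = h \<mu> * x" using t by (simp add: g_def fscale_simps(1,2) fscale_mult_left)
    also have "\<dots> \<asymp> - (\<Sum>\<kappa>\<in>J. h \<kappa>) * x" by (rule eqv_mult[OF h_\<mu> eqv_refl[OF x]])
    finally have "fscale t x + fscale t (g * x) \<asymp> fscale t x + - (\<Sum>\<kappa>\<in>J. h \<kappa>) * x"
      using x by (intro eqv_add eqv_refl) simp_all
    also have "fscale t x + - (\<Sum>\<kappa>\<in>J. h \<kappa>) * x = x + (\<Sum>\<kappa>\<in>J. x - h \<kappa> * x)"
    proof -
      have "fscale (of_nat k) x = of_nat k * x" for k
        by (induction k) (simp_all add: fscale_simps algebra_simps)
      then have "fscale t x = x + of_nat (card J) * x"
        using fscale_simps(5)[of 1 "of_nat (card J)" x] by (simp add: t_def fscale_simps add.commute)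
      then show ?thesis by (simp add: sum_subtractf sum_distrib_right)
    qed
    finally have "q (fscale t x + fscale t (g * x)) = q (x + (\<Sum>\<kappa>\<in>J. x - h \<kappa> * x))" by (rule q_eqv)
    also have "\<dots> \<le> q x + q (\<Sum>\<kappa>\<in>J. x - h \<kappa> * x)" using x J by (intro q_add sum_F) simp_all
    also have "\<dots> \<le> q x + (\<Sum>\<kappa>\<in>J. q (x - h \<kappa> * x))" using x J by (intro add_left_mono q_sum) simp_all
    also have "\<dots> \<le> q x + (\<Sum>\<kappa>\<in>J. q x)" using x J by (intro add_left_mono sum_mono contr) simp_all
    also have "\<dots> = t * q x" by (simp add: t_def algebra_simps)
    finally show "q (fscale t x + fscale t (g * x)) \<le> t * q x" .
  qed (use x assms in \<open>simp_all add: g_def\<close>)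
  have minus: "q (x - g * x) \<le> q x" if x: "x \<in> F" for x
  proof -
    have "q (x + fscale (-1) (g * x)) \<le> q x"
    proof (rule le)
      have "fscale t (fscale (-1) (g * x)) = - (h \<mu> * x)"
        using t by (simp add: g_def fscale_mult_left fscale_simps(2,3))
      then have "fscale t x + fscale t (fscale (-1) (g * x)) = fscale (t - 1) x + (x - h \<mu> * x)"
        using fscale_simps(5)[of "t - 1" 1 x] by (simp add: fscale_simps(1))
      then have "q (fscale t x + fscale t (fscale (-1) (g * x))) \<le> q (fscale (t - 1) x) + q (x - h \<mu> * x)"
        using x assms by (simp add: q_add)
      also have "\<dots> \<le> (t - 1) * q x + q x"
      proof (rule add_mono[OF _ contr])
        show "q (fscale (complex_of_real (t - 1)) x) \<le> (t - 1) * q x"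
          unfolding q_scale[OF x] norm_of_real using t by simp
      qed (use x assms in simp_all)
      finally show "q (fscale t x + fscale t (fscale (-1) (g * x))) \<le> t * q x" by (simp add: algebra_simps)
    qed (use x assms in \<open>simp_all add: g_def\<close>)
    then show ?thesis by (simp add: fscale_simps)
  qed
  have "bicontraction g" unfolding bicontraction_def using plus minus assms by (simp add: g_def)
  \<comment> \<open>Only products g x with x in \<open>F\<close> are known to be null; taking for x
    the adjoint of g lets the C*-identity conclude that g itself is null. Then so is h \<mu>, which
    is y^* y for y = s_\<mu>^* s_\<nu>.\<close>
  then have "q (g * fadj g) = 0" by (rule bicontraction_zero) (use assms in \<open>simp add: g_def\<close>)
  then have "q (fadj g) = 0"
    using q_adj_mult[of "fadj g"] assms by (simp add: fadj_simps g_def)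
  then have "q (h \<mu>) = 0" using t assms by (simp add: g_def q_adj q_scale)
  then have "fadj (Sx \<mu> * S \<nu>) * (Sx \<mu> * S \<nu>) \<asymp> 0"
    using assms by (simp add: h_def fadj_mult fadj_simps mult.assoc flip: q_eqv_zero)
  then show ?thesis by (rule eqv_zero_star[rotated]) (simp add: assms)
qed

end

section \<open>Grading and core\<close>

definition int_vec :: "nat ^ 'k \<Rightarrow> int ^ 'k::finite" where
  "int_vec n = (\<chi> i. int (n $ i))"

lemma int_vec_simps: "int_vec (m + n) = int_vec m + int_vec n" "int_vec m = int_vec n \<longleftrightarrow> m = n"
  "int_vec m $ i = int (m $ i)"
  by (simp_all add: int_vec_def vec_eq_iff)

section \<open>The Z^k-grading of the free *-algebra\<close>

context one_object_kgraph
begin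

definition letter_deg :: "'m \<times> bool \<Rightarrow> int ^ 'k" where
  "letter_deg l = (if snd l then - int_vec (deg (fst l)) else int_vec (deg (fst l)))"

definition sdeg :: "'m star_word \<Rightarrow> int ^ 'k" where
  "sdeg w = sum_list (map letter_deg (star_letters w))"

text \<open>Signs are ignored: a generator of at least this degree is long enough for every adjoint
  letter of the word to find a full prefix to remove.\<close>

definition total_deg :: "('m \<times> bool) list \<Rightarrow> nat ^ 'k" where
  "total_deg w = sum_list (map (\<lambda>l. deg (fst l)) w)"

lemma sdeg_Cons: "sdeg (Star_Word (l # w)) = letter_deg l + sdeg (Star_Word w)"
  by (simp add: sdeg_def)

lemma sdeg_plus: "sdeg (v + w) = sdeg v + sdeg w"
  by (simp add: sdeg_def plus_star_word_def)

lemma sdeg_adj: "sdeg (adj_word w) = - sdeg w"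
proof -
  have "sum_list (map letter_deg (rev (map (\<lambda>(\<mu>, b). (\<mu>, \<not> b)) w))) = - sum_list (map letter_deg w)" for w
    by (induction w) (auto simp: letter_deg_def)
  then show ?thesis by (simp add: sdeg_def adj_word_def)
qed

lemma sdeg_ge_total: "- int_vec (total_deg w) $ i \<le> sdeg (Star_Word w) $ i"
  by (induction w) (auto simp: sdeg_def total_deg_def letter_deg_def int_vec_simps)

definition separating :: "nat ^ 'k \<Rightarrow> 'm \<Rightarrow> bool" where
  "separating N \<alpha> \<longleftrightarrow> \<alpha> \<in> M \<and> (\<forall>\<kappa>\<in>M. \<forall>\<mu>\<in>M. deg \<kappa> \<le> N \<longrightarrow> deg \<mu> \<le> N \<longrightarrow> deg \<kappa> \<noteq> deg \<mu> \<longrightarrow>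
     (\<forall>\<beta>\<in>M. \<forall>\<gamma>\<in>M. \<kappa> \<cdot> \<alpha> \<cdot> \<beta> \<noteq> \<mu> \<cdot> \<alpha> \<cdot> \<gamma>))"

definition homogeneous :: "int ^ 'k \<Rightarrow> 'm star_poly \<Rightarrow> bool" where
  "homogeneous d x \<longleftrightarrow> (\<forall>w\<in>Poly_Mapping.keys x. sdeg w = d)"

text \<open>The Fourier component for the gauge action, formed on words of the free algebra, where
  it exists before any continuity is known.\<close>

definition part :: "int ^ 'k \<Rightarrow> 'm star_poly \<Rightarrow> 'm star_poly" where
  "part d x = (\<Sum>w | w \<in> Poly_Mapping.keys x \<and> sdeg w = d.
     fscale (Poly_Mapping.lookup x w) (star_monom (star_letters w)))"

lemma lookup_part: "Poly_Mapping.lookup (part d x) w = (if sdeg w = d then Poly_Mapping.lookup x w else 0)"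
proof -
  have "Poly_Mapping.lookup (part d x) w
    = (\<Sum>v | v \<in> Poly_Mapping.keys x \<and> sdeg v = d. if v = w then Poly_Mapping.lookup x v else 0)"
    unfolding part_def lookup_sum star_monom_def
    by (intro sum.cong) (auto simp: lookup_single when_def)
  then show ?thesis by (auto simp: in_keys_iff)
qed

lemma keys_part: "Poly_Mapping.keys (part d x) = {w \<in> Poly_Mapping.keys x. sdeg w = d}"
  by (auto simp: in_keys_iff lookup_part split: if_splits)

lemma homogeneous_part: "homogeneous d (part d x)"
  by (simp add: homogeneous_def keys_part)

lemma part_homogeneous: "homogeneous d x \<Longrightarrow> part d x = x"
  by (rule poly_mapping_eqI) (auto simp: lookup_part homogeneous_def in_keys_iff)

lemma part_F: "x \<in> free_star_alg M \<Longrightarrow> part d x \<in> free_star_alg M"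
  by (auto simp: free_star_alg_def keys_part)

lemma part_add: "part d (x + y) = part d x + part d y"
  by (rule poly_mapping_eqI) (simp add: lookup_part lookup_add)

lemma sum_part: "x = (\<Sum>d\<in>sdeg ` Poly_Mapping.keys x. part d x)"
proof (rule poly_mapping_eqI)
  fix w
  show "Poly_Mapping.lookup x w = Poly_Mapping.lookup (\<Sum>d\<in>sdeg ` Poly_Mapping.keys x. part d x) w"
    by (auto simp: lookup_sum lookup_part in_keys_iff)
qed

lemma homogeneous_mult: "homogeneous c x \<Longrightarrow> homogeneous d y \<Longrightarrow> homogeneous (c + d) (x * y)"
  using keys_mult[of x y] by (fastforce simp: homogeneous_def sdeg_plus)

lemma homogeneous_fadj: "homogeneous d x \<Longrightarrow> homogeneous (- d) (fadj x)"
  unfolding homogeneous_def by (metis complex_cnj_zero in_keys_iff lookup_fadj sdeg_adj add.inverse_inverse)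

text \<open>The other components of \<open>x\<close> have degrees different from \<open>d\<close>
  and contribute only in nonzero degrees. This lets a bound in degree 0 control every
  degree.\<close>

lemma part_fadj_mult: "part 0 (fadj (part d x) * x) = fadj (part d x) * part d x"
proof -
  define u where "u = part d x"
  define v where "v = x - u"
  have v: "sdeg w \<noteq> d" if "w \<in> Poly_Mapping.keys v" for w
    using that by (auto simp: v_def u_def in_keys_iff lookup_minus lookup_part split: if_splits)
  have u: "homogeneous (- d) (fadj u)" "homogeneous d u"
    by (simp_all add: u_def homogeneous_part homogeneous_fadj)
  have "part 0 (fadj u * v) = 0"
  proof -
    have "sdeg w \<noteq> 0" if "w \<in> Poly_Mapping.keys (fadj u * v)" for w
      using keys_mult[of "fadj u" v] that u(1) v by (fastforce simp: homogeneous_def sdeg_plus)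
    then show ?thesis by (intro poly_mapping_eqI) (auto simp: lookup_part in_keys_iff)
  qed
  moreover have "part 0 (fadj u * u) = fadj u * u"
    using homogeneous_mult[OF u] by (intro part_homogeneous) simp
  moreover have "fadj u * x = fadj u * u + fadj u * v" by (simp add: v_def algebra_simps)
  ultimately show ?thesis by (simp add: part_add flip: u_def)
qed

definition deg_bounded :: "nat \<Rightarrow> 'm star_poly \<Rightarrow> bool" where
  "deg_bounded K x \<longleftrightarrow> (\<forall>w\<in>Poly_Mapping.keys x. \<forall>i. \<bar>sdeg w $ i\<bar> \<le> int K)"

lemma deg_bounded_mult: "deg_bounded K x \<Longrightarrow> deg_bounded K' y \<Longrightarrow> deg_bounded (K + K') (x * y)"
  unfolding deg_bounded_def
proof (intro ballI allI)
  fix w i assume "w \<in> Poly_Mapping.keys (x * y)"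
    and *: "\<forall>w\<in>Poly_Mapping.keys x. \<forall>i. \<bar>sdeg w $ i\<bar> \<le> int K"
      "\<forall>w\<in>Poly_Mapping.keys y. \<forall>i. \<bar>sdeg w $ i\<bar> \<le> int K'"
  then obtain u v where "w = u + v" "u \<in> Poly_Mapping.keys x" "v \<in> Poly_Mapping.keys y"
    using keys_mult[of x y] by blast
  then have "sdeg w $ i = sdeg u $ i + sdeg v $ i" "\<bar>sdeg u $ i\<bar> \<le> int K" "\<bar>sdeg v $ i\<bar> \<le> int K'"
    using * by (simp_all add: sdeg_plus)
  then show "\<bar>sdeg w $ i\<bar> \<le> int (K + K')" by linarith
qed

lemma deg_bounded_exists: "\<exists>K. deg_bounded K x"
proof -
  let ?D = "(\<lambda>(w, i). nat \<bar>sdeg w $ i\<bar>) ` (Poly_Mapping.keys x \<times> (UNIV :: 'k set))"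
  have "nat \<bar>sdeg w $ i\<bar> \<le> Max ?D" if "w \<in> Poly_Mapping.keys x" for w i
    using that by (intro Max_ge) force+
  then have "deg_bounded (Max ?D) x" unfolding deg_bounded_def by (simp add: nat_le_iff)
  then show ?thesis ..
qed

lemma card_degrees:
  assumes "deg_bounded K x"
  shows "card (sdeg ` Poly_Mapping.keys x) \<le> (2 * K + 1) ^ CARD('k)"
proof -
  let ?D = "sdeg ` Poly_Mapping.keys x"
  have "card ?D \<le> card (PiE (UNIV :: 'k set) (\<lambda>_. {- int K..int K}))"
  proof (rule card_inj_on_le[of vec_nth])
    show "inj_on vec_nth ?D" by (auto intro!: inj_onI simp: vec_eq_iff)
    show "vec_nth ` ?D \<subseteq> PiE UNIV (\<lambda>_. {- int K..int K})"
    proof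
      fix f assume "f \<in> vec_nth ` ?D"
      then obtain w where w: "w \<in> Poly_Mapping.keys x" and f: "f = vec_nth (sdeg w)" by auto
      have "f i \<in> {- int K..int K}" for i
      proof -
        have "\<bar>sdeg w $ i\<bar> \<le> int K" using assms w by (simp add: deg_bounded_def)
        then show ?thesis unfolding f by (simp add: abs_le_iff)
      qed
      then show "f \<in> PiE UNIV (\<lambda>_. {- int K..int K})" by (simp add: PiE_UNIV_domain)
    qed
  qed (auto intro: finite_PiE)
  also have "\<dots> = (2 * K + 1) ^ CARD('k)"
  proof -
    have "nat (int K + 1 + int K) = 2 * K + 1" by simp
    then show ?thesis by (simp only: card_PiE finite prod_constant card_atLeastAtMost_int) (simp add: algebra_simps)
  qed
  finally show ?thesis .
qed

end

section \<open>Matrix levels and compression\<close>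

context ck_family
begin

text \<open>Write \<mu> = \<kappa> \<beta> with \<kappa> of the degree of \<nu>; orthogonality then
  decides between \<kappa> = \<nu> and zero.\<close>

lemma Sx_S_cases:
  assumes \<nu>: "\<nu> \<in> M" and \<mu>: "\<mu> \<in> M" and le: "deg \<nu> \<le> deg \<mu>"
  shows "Sx \<nu> * S \<mu> \<asymp> 0 \<or> (\<exists>\<beta>\<in>M. \<mu> = \<nu> \<cdot> \<beta> \<and> Sx \<nu> * S \<mu> \<asymp> S \<beta>)"
proof -
  note [simp] = F_closed S_F Sx_F
  obtain \<kappa> \<beta> where f: "\<kappa> \<in> M" "\<beta> \<in> M" "deg \<kappa> = deg \<nu>" "\<mu> = \<kappa> \<cdot> \<beta>" using factorize[OF \<mu> le] by metis
  have "Sx \<nu> * S \<mu> \<asymp> Sx \<nu> * (S \<kappa> * S \<beta>)"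
    unfolding f(4) using f \<nu> by (intro eqv_mult eqv_refl eqv_sym[OF S_mult]) simp_all
  then have eq: "Sx \<nu> * S \<mu> \<asymp> Sx \<nu> * S \<kappa> * S \<beta>" by (simp add: mult.assoc)
  show ?thesis
  proof (cases "\<kappa> = \<nu>")
    case True
    have "Sx \<nu> * S \<kappa> * S \<beta> \<asymp> S e * S \<beta>" unfolding True using \<nu> f by (intro eqv_mult Sx_S eqv_refl) simp_all
    also have "\<dots> \<asymp> S \<beta>" using f by (intro E_left) simp_all
    finally show ?thesis using eq f True eqv_trans by blast
  next
    case False
    then have "Sx \<nu> * S \<kappa> * S \<beta> \<asymp> 0" using \<nu> f by (intro eqv_zero_left[OF S_orthogonal]) auto
    with eq show ?thesis using eqv_trans by blast
  qed
qed

text \<open>Letters act from the right end of the word. The current degree never falls below that of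
  \<mu> minus the total degree already used, so an adjoint letter always meets a generator at least
  as long as itself and \<open>Sx_S_cases\<close> applies.\<close>

lemma star_monom_S:
  assumes "fst ` set w \<subseteq> M" "\<mu> \<in> M" "total_deg w \<le> deg \<mu>"
  shows "star_monom w * S \<mu> \<asymp> 0 \<or>
    (\<exists>\<nu>\<in>M. star_monom w * S \<mu> \<asymp> S \<nu> \<and> int_vec (deg \<nu>) = int_vec (deg \<mu>) + sdeg (Star_Word w))"
  using assms
proof (induction w)
  case Nil
  then show ?case by (auto simp: star_monom_Nil sdeg_def intro!: eqv_refl S_F bexI[of _ \<mu>])
next
  case (Cons l w)
  obtain \<kappa> b where l: "l = (\<kappa>, b)" by (cases l)
  have \<kappa>: "\<kappa> \<in> M" using Cons.prems l by simp
  let ?l = "if b then Sx \<kappa> else S \<kappa>"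
  have lF: "?l \<in> F" using \<kappa> by (simp add: S_F Sx_F)
  have total: "total_deg (l # w) $ i = deg \<kappa> $ i + total_deg w $ i" for i by (simp add: total_deg_def l)
  have le: "deg \<kappa> $ i + total_deg w $ i \<le> deg \<mu> $ i" for i
    using Cons.prems(3) total by (simp add: less_eq_vec_def)
  then have "total_deg w \<le> deg \<mu>" unfolding less_eq_vec_def by (meson add_leE)
  then have IH: "star_monom w * S \<mu> \<asymp> 0 \<or> (\<exists>\<nu>\<in>M. star_monom w * S \<mu> \<asymp> S \<nu> \<and>
      int_vec (deg \<nu>) = int_vec (deg \<mu>) + sdeg (Star_Word w))"
    using Cons by simp
  have eq: "star_monom (l # w) * S \<mu> = ?l * (star_monom w * S \<mu>)"
    by (simp add: l star_monom_Cons mult.assoc)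
  show ?case
    using IH
  proof
    assume 0: "star_monom w * S \<mu> \<asymp> 0"
    show ?thesis unfolding eq by (rule disjI1) (rule eqv_zero_right[OF 0 lF])
  next
    assume "\<exists>\<nu>\<in>M. star_monom w * S \<mu> \<asymp> S \<nu> \<and> int_vec (deg \<nu>) = int_vec (deg \<mu>) + sdeg (Star_Word w)"
    then obtain \<nu> where \<nu>: "\<nu> \<in> M" "star_monom w * S \<mu> \<asymp> S \<nu>"
      and d\<nu>: "int_vec (deg \<nu>) = int_vec (deg \<mu>) + sdeg (Star_Word w)" by blast
    have eqv: "star_monom (l # w) * S \<mu> \<asymp> ?l * S \<nu>"
      unfolding eq by (intro eqv_mult eqv_refl lF \<nu>)
    show ?thesis
    proof (cases b)
      case False
      have "star_monom (l # w) * S \<mu> \<asymp> S (\<kappa> \<cdot> \<nu>)" using eqv_trans[OF eqv] S_mult[OF \<kappa> \<nu>(1)] False by simp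
      moreover have "int_vec (deg (\<kappa> \<cdot> \<nu>)) = int_vec (deg \<mu>) + sdeg (Star_Word (l # w))"
        using d\<nu> \<kappa> \<nu> False by (simp add: deg_comp' int_vec_simps sdeg_Cons letter_deg_def l)
      ultimately show ?thesis using comp_M[OF \<kappa> \<nu>(1)] by blast
    next
      case True
      have "deg \<kappa> \<le> deg \<nu>"
        unfolding less_eq_vec_def
      proof
        fix i
        have "int (deg \<nu> $ i) = int (deg \<mu> $ i) + sdeg (Star_Word w) $ i"
          using d\<nu> by (simp add: vec_eq_iff int_vec_def)
        then show "deg \<kappa> $ i \<le> deg \<nu> $ i" using le[of i] sdeg_ge_total[of w i] by (simp add: int_vec_simps)
      qed
      from Sx_S_cases[OF \<kappa> \<nu>(1) this] show ?thesis
      proof (elim disjE bexE conjE)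
        assume "Sx \<kappa> * S \<nu> \<asymp> 0"
        then show ?thesis using eqv_trans[OF eqv] True by simp
      next
        fix \<beta> assume \<beta>: "\<beta> \<in> M" "\<nu> = \<kappa> \<cdot> \<beta>" "Sx \<kappa> * S \<nu> \<asymp> S \<beta>"
        have "star_monom (l # w) * S \<mu> \<asymp> S \<beta>" using eqv_trans[OF eqv] \<beta> True by simp
        moreover have "int_vec (deg \<beta>) = int_vec (deg \<mu>) + sdeg (Star_Word (l # w))"
          using d\<nu> \<kappa> \<beta> True by (simp add: deg_comp' int_vec_simps sdeg_Cons letter_deg_def l algebra_simps)
        ultimately show ?thesis using \<beta> by blast
      qed
    qed
  qed
qed

text \<open>Insert the unit as a sum of range projections at a level above both degrees: a morphism
  of that level can begin with \<rho> or with \<sigma>, but not with both.\<close>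

lemma S_no_common_extension:
  assumes \<rho>: "\<rho> \<in> M" and \<sigma>: "\<sigma> \<in> M" and no: "\<And>\<beta> \<gamma>. \<beta> \<in> M \<Longrightarrow> \<gamma> \<in> M \<Longrightarrow> \<rho> \<cdot> \<beta> \<noteq> \<sigma> \<cdot> \<gamma>"
  shows "Sx \<rho> * S \<sigma> \<asymp> 0"
proof -
  note [simp] = F_closed S_F Sx_F
  define N where "N = deg \<rho> + deg \<sigma>"
  have "Sx \<rho> * S \<sigma> \<asymp> Sx \<rho> * S e * S \<sigma>"
    using \<rho> \<sigma> by (intro eqv_mult eqv_sym[OF E_right] eqv_refl) simp_all
  also have "\<dots> \<asymp> Sx \<rho> * (\<Sum>\<mu>\<in>L N. S \<mu> * Sx \<mu>) * S \<sigma>"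
    using \<rho> \<sigma> by (intro eqv_mult eqv_sym[OF S_sum] eqv_refl) simp_all
  also have "\<dots> = (\<Sum>\<mu>\<in>L N. (Sx \<rho> * S \<mu>) * (Sx \<mu> * S \<sigma>))"
    by (simp add: sum_distrib_left sum_distrib_right mult.assoc)
  also have "\<dots> \<asymp> (\<Sum>\<mu>\<in>L N. 0)"
  proof (rule eqv_sum)
    fix \<mu> assume "\<mu> \<in> L N"
    then have \<mu>: "\<mu> \<in> M" "deg \<rho> \<le> deg \<mu>" "deg \<sigma> \<le> deg \<mu>" by (auto simp: L_iff N_def less_eq_vec_def)
    have "Sx \<rho> * S \<mu> \<asymp> 0 \<or> Sx \<sigma> * S \<mu> \<asymp> 0"
      using Sx_S_cases[OF \<rho> \<mu>(1,2)] Sx_S_cases[OF \<sigma> \<mu>(1,3)] no by blast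
    then show "(Sx \<rho> * S \<mu>) * (Sx \<mu> * S \<sigma>) \<asymp> 0"
    proof
      assume "Sx \<rho> * S \<mu> \<asymp> 0"
      then show ?thesis by (rule eqv_zero_left) (use \<rho> \<sigma> \<mu> in simp)
    next
      assume "Sx \<sigma> * S \<mu> \<asymp> 0"
      from eqv_fadj[OF this] have "Sx \<mu> * S \<sigma> \<asymp> 0" by (simp add: fadj_mult fadj_simps)
      then show ?thesis by (rule eqv_zero_right) (use \<rho> \<sigma> \<mu> in simp)
    qed
  qed
  finally show ?thesis by simp
qed

lemma Sx_S_same_degree:
  assumes "\<kappa> \<in> L n" "\<mu> \<in> L n" shows "Sx \<kappa> * S \<mu> \<asymp> (if \<kappa> = \<mu> then S e else 0)"
  using assms S_orthogonal[of \<kappa> \<mu>] Sx_S[of \<kappa>] by (auto simp: L_iff)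

text \<open>Matrix entry of \<open>x\<close> with respect to the isometries of one level;
  \<open>sum_cells\<close> is the expansion in matrix units.\<close>

definition cell :: "'m \<Rightarrow> 'm \<Rightarrow> 'm star_poly \<Rightarrow> 'm star_poly" where
  "cell \<kappa> \<mu> x = Sx \<kappa> * x * S \<mu>"

lemma cell_F: "\<kappa> \<in> M \<Longrightarrow> \<mu> \<in> M \<Longrightarrow> x \<in> F \<Longrightarrow> cell \<kappa> \<mu> x \<in> F"
  by (simp add: cell_def F_closed S_F Sx_F)

lemma sum_cells:
  assumes x: "x \<in> F"
  shows "x \<asymp> (\<Sum>\<kappa>\<in>L n. \<Sum>\<mu>\<in>L n. S \<kappa> * cell \<kappa> \<mu> x * Sx \<mu>)"
proof -
  have "(\<Sum>\<kappa>\<in>L n. \<Sum>\<mu>\<in>L n. S \<kappa> * cell \<kappa> \<mu> x * Sx \<mu>)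
      = (\<Sum>\<kappa>\<in>L n. S \<kappa> * Sx \<kappa>) * x * (\<Sum>\<mu>\<in>L n. S \<mu> * Sx \<mu>)"
    by (simp add: cell_def sum_distrib_left sum_distrib_right mult.assoc) (rule sum.swap)
  also have "\<dots> \<asymp> S e * x * S e" by (intro eqv_mult S_sum eqv_refl x)
  also have "\<dots> \<asymp> S e * x" by (intro E_right F_closed E_F x)
  also have "\<dots> \<asymp> x" by (intro E_left x)
  finally show ?thesis by (rule eqv_sym)
qed

text \<open>Preimage of the matrix algebra of level \<open>n\<close>. It is described by scalar
  entries rather than as a span, so closure under products is matrix multiplication.\<close>

definition core :: "nat ^ 'k \<Rightarrow> 'm star_poly set" where
  "core n = {x \<in> F. \<forall>\<kappa>\<in>L n. \<forall>\<mu>\<in>L n. \<exists>c. cell \<kappa> \<mu> x \<asymp> fscale c (S e)}"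

text \<open>A word of degree 0 sends each generator of level \<open>n\<close> to zero or to a
  generator of the same level, so its entries are 0 or 1.\<close>

lemma core_star_monom:
  assumes "w \<noteq> []" "fst ` set w \<subseteq> M" "sdeg (Star_Word w) = 0" "total_deg w \<le> n"
  shows "star_monom w \<in> core n"
proof -
  have F: "star_monom w \<in> F" using assms by (intro star_monom_in_free)
  have "\<exists>c. cell \<kappa> \<mu> (star_monom w) \<asymp> fscale c (S e)" if "\<kappa> \<in> L n" "\<mu> \<in> L n" for \<kappa> \<mu>
  proof -
    have M: "\<kappa> \<in> M" "\<mu> \<in> M" "deg \<mu> = n" using that by (auto simp: L_iff)
    from star_monom_S[OF assms(2) M(2)] assms(3,4) M
    have "star_monom w * S \<mu> \<asymp> 0 \<or> (\<exists>\<nu>\<in>L n. star_monom w * S \<mu> \<asymp> S \<nu>)"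
      by (auto simp: int_vec_simps L_iff)
    then have "\<exists>c. Sx \<kappa> * (star_monom w * S \<mu>) \<asymp> fscale c (S e)"
    proof (elim disjE bexE)
      assume "star_monom w * S \<mu> \<asymp> 0"
      then have "Sx \<kappa> * (star_monom w * S \<mu>) \<asymp> fscale 0 (S e)"
        unfolding fscale_simps(8) by (rule eqv_zero_right) (use M in \<open>simp add: Sx_F\<close>)
      then show ?thesis ..
    next
      fix \<nu> assume \<nu>: "\<nu> \<in> L n" "star_monom w * S \<mu> \<asymp> S \<nu>"
      have "Sx \<kappa> * (star_monom w * S \<mu>) \<asymp> Sx \<kappa> * S \<nu>" using \<nu> M by (intro eqv_mult eqv_refl Sx_F)
      also have "\<dots> \<asymp> fscale (if \<kappa> = \<nu> then 1 else 0) (S e)"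
        using Sx_S_same_degree[OF that(1) \<nu>(1)] by (cases "\<kappa> = \<nu>") (simp_all add: fscale_simps(1,8))
      finally show ?thesis ..
    qed
    then show ?thesis by (simp add: cell_def mult.assoc)
  qed
  with F show ?thesis by (simp add: core_def)
qed

lemma core_add: assumes "x \<in> core n" "y \<in> core n" shows "x + y \<in> core n"
proof -
  have "\<exists>c. cell \<kappa> \<mu> (x + y) \<asymp> fscale c (S e)" if \<kappa>: "\<kappa> \<in> L n" "\<mu> \<in> L n" for \<kappa> \<mu>
  proof -
    obtain a b where "cell \<kappa> \<mu> x \<asymp> fscale a (S e)" "cell \<kappa> \<mu> y \<asymp> fscale b (S e)"
      using assms \<kappa> unfolding core_def by blast
    then have "cell \<kappa> \<mu> x + cell \<kappa> \<mu> y \<asymp> fscale (a + b) (S e)" unfolding fscale_simps(5) by (rule eqv_add)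
    then show ?thesis by (auto simp: cell_def algebra_simps)
  qed
  then show ?thesis using assms by (simp add: core_def F_closed)
qed

lemma core_fscale: assumes "x \<in> core n" shows "fscale b x \<in> core n"
proof -
  have "\<exists>c. cell \<kappa> \<mu> (fscale b x) \<asymp> fscale c (S e)" if \<kappa>: "\<kappa> \<in> L n" "\<mu> \<in> L n" for \<kappa> \<mu>
  proof -
    obtain a where "cell \<kappa> \<mu> x \<asymp> fscale a (S e)"
      using assms \<kappa> unfolding core_def by blast
    then have "fscale b (cell \<kappa> \<mu> x) \<asymp> fscale b (fscale a (S e))" by (rule eqv_fscale)
    then show ?thesis
      unfolding cell_def fscale_mult_right fscale_mult_left fscale_simps(2) by blast
  qed
  then show ?thesis using assms by (simp add: core_def F_closed)
qed

lemma core_fadj: assumes "x \<in> core n" shows "fadj x \<in> core n"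
proof -
  have "\<exists>c. cell \<kappa> \<mu> (fadj x) \<asymp> fscale c (S e)" if \<kappa>: "\<kappa> \<in> L n" "\<mu> \<in> L n" for \<kappa> \<mu>
  proof -
    obtain a where "cell \<mu> \<kappa> x \<asymp> fscale a (S e)"
      using assms \<kappa> unfolding core_def by blast
    then have "fadj (cell \<mu> \<kappa> x) \<asymp> fadj (fscale a (S e))" by (rule eqv_fadj)
    also have "\<dots> \<asymp> fscale (cnj a) (S e)" unfolding fadj_simps(5) by (rule eqv_fscale[OF E_adj])
    finally have "fadj (cell \<mu> \<kappa> x) \<asymp> fscale (cnj a) (S e)" .
    then show ?thesis by (auto simp: cell_def fadj_mult fadj_simps mult.assoc)
  qed
  then show ?thesis using assms by (simp add: core_def F_closed)
qed

lemma core_mult: assumes "x \<in> core n" "y \<in> core n" shows "x * y \<in> core n"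
proof -
  note [simp] = F_closed S_F Sx_F E_F L_iff
  have F: "x \<in> F" "y \<in> F" using assms by (auto simp: core_def)
  have "\<exists>c. cell \<kappa> \<mu> (x * y) \<asymp> fscale c (S e)" if \<kappa>: "\<kappa> \<in> L n" "\<mu> \<in> L n" for \<kappa> \<mu>
  proof -
    have "\<forall>\<rho>\<in>L n. \<exists>c. cell \<kappa> \<rho> x \<asymp> fscale c (S e)" "\<forall>\<rho>\<in>L n. \<exists>c. cell \<rho> \<mu> y \<asymp> fscale c (S e)"
      using assms \<kappa> by (auto simp only: core_def mem_Collect_eq)
    then obtain a b where a: "\<And>\<rho>. \<rho> \<in> L n \<Longrightarrow> cell \<kappa> \<rho> x \<asymp> fscale (a \<rho>) (S e)"
      and b: "\<And>\<rho>. \<rho> \<in> L n \<Longrightarrow> cell \<rho> \<mu> y \<asymp> fscale (b \<rho>) (S e)"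
      unfolding bchoice_iff by blast
    have "cell \<kappa> \<mu> (x * y) = Sx \<kappa> * x * (y * S \<mu>)" by (simp add: cell_def mult.assoc)
    also have "\<dots> \<asymp> Sx \<kappa> * x * S e * (y * S \<mu>)"
      using F \<kappa> by (intro eqv_mult eqv_sym[OF E_right] eqv_refl) simp_all
    also have "\<dots> \<asymp> Sx \<kappa> * x * (\<Sum>\<rho>\<in>L n. S \<rho> * Sx \<rho>) * (y * S \<mu>)"
      using F \<kappa> by (intro eqv_mult eqv_sym[OF S_sum] eqv_refl) simp_all
    also have "\<dots> = (\<Sum>\<rho>\<in>L n. cell \<kappa> \<rho> x * cell \<rho> \<mu> y)"
      by (simp add: cell_def sum_distrib_left sum_distrib_right mult.assoc)
    also have "\<dots> \<asymp> (\<Sum>\<rho>\<in>L n. fscale (a \<rho> * b \<rho>) (S e))"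
    proof (rule eqv_sum)
      fix \<rho> assume \<rho>: "\<rho> \<in> L n"
      have "cell \<kappa> \<rho> x * cell \<rho> \<mu> y \<asymp> fscale (a \<rho>) (S e) * fscale (b \<rho>) (S e)"
        using a[OF \<rho>] b[OF \<rho>] by (rule eqv_mult)
      also have "\<dots> = fscale (a \<rho>) (fscale (b \<rho>) (S e * S e))"
        by (simp only: fscale_mult_left fscale_mult_right[of "S e" _ "S e"])
      also have "\<dots> \<asymp> fscale (a \<rho>) (fscale (b \<rho>) (S e))" by (intro eqv_fscale E_left E_F)
      finally show "cell \<kappa> \<rho> x * cell \<rho> \<mu> y \<asymp> fscale (a \<rho> * b \<rho>) (S e)" unfolding fscale_simps(2) .
    qed
    also have "\<dots> = fscale (\<Sum>\<rho>\<in>L n. a \<rho> * b \<rho>) (S e)"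
      by (rule poly_mapping_eqI) (simp add: lookup_sum sum_distrib_right)
    finally show ?thesis ..
  qed
  then show ?thesis using F by (simp add: core_def)
qed

text \<open>Modulo the null space, an isometry that inserts \<alpha> after the first
  \<open>n\<close> steps of a path.\<close>

definition compressor :: "nat ^ 'k \<Rightarrow> 'm \<Rightarrow> 'm star_poly" where
  "compressor n \<alpha> = (\<Sum>\<kappa>\<in>L n. S \<kappa> * S \<alpha> * Sx \<kappa>)"

lemma compressor_F: "\<alpha> \<in> M \<Longrightarrow> compressor n \<alpha> \<in> F"
  by (auto simp: compressor_def L_iff F_closed S_F Sx_F intro!: sum_F)

lemma fadj_compressor: "fadj (compressor n \<alpha>) = (\<Sum>\<kappa>\<in>L n. S \<kappa> * Sx \<alpha> * Sx \<kappa>)"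
  by (simp add: compressor_def sum_fadj fadj_mult fadj_simps mult.assoc)

lemma compress:
  "fadj (compressor n \<alpha>) * x * compressor n \<alpha>
    = (\<Sum>\<kappa>\<in>L n. \<Sum>\<mu>\<in>L n. S \<kappa> * (Sx \<alpha> * cell \<kappa> \<mu> x * S \<alpha>) * Sx \<mu>)"
  unfolding fadj_compressor
  by (simp add: compressor_def cell_def sum_distrib_left sum_distrib_right mult.assoc) (rule sum.swap)

text \<open>The entries of \<open>x\<close> are scalars c, and s_\<alpha>^* c s_\<alpha> =
  c.\<close>

lemma compress_core:
  assumes "x \<in> core n" "\<alpha> \<in> M"
  shows "fadj (compressor n \<alpha>) * x * compressor n \<alpha> \<asymp> x"
proof -
  note [simp] = F_closed S_F Sx_F E_F cell_F
  have x: "x \<in> F" using assms by (simp add: core_def)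
  have "(\<Sum>\<kappa>\<in>L n. \<Sum>\<mu>\<in>L n. S \<kappa> * (Sx \<alpha> * cell \<kappa> \<mu> x * S \<alpha>) * Sx \<mu>)
      \<asymp> (\<Sum>\<kappa>\<in>L n. \<Sum>\<mu>\<in>L n. S \<kappa> * cell \<kappa> \<mu> x * Sx \<mu>)"
  proof (intro eqv_sum)
    fix \<kappa> \<mu> assume L: "\<kappa> \<in> L n" "\<mu> \<in> L n"
    then have M: "\<kappa> \<in> M" "\<mu> \<in> M" by (simp_all add: L_iff)
    obtain c where c: "cell \<kappa> \<mu> x \<asymp> fscale c (S e)" using assms(1) L unfolding core_def by blast
    have "Sx \<alpha> * cell \<kappa> \<mu> x * S \<alpha> \<asymp> Sx \<alpha> * fscale c (S e) * S \<alpha>"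
      using assms(2) by (intro eqv_mult c eqv_refl) simp_all
    also have "\<dots> = fscale c (Sx \<alpha> * S e * S \<alpha>)" unfolding fscale_mult_left fscale_mult_right ..
    also have "\<dots> \<asymp> fscale c (Sx \<alpha> * S \<alpha>)"
      using assms(2) by (intro eqv_fscale eqv_mult E_right eqv_refl) simp_all
    also have "\<dots> \<asymp> fscale c (S e)" using assms(2) by (intro eqv_fscale Sx_S)
    also have "\<dots> \<asymp> cell \<kappa> \<mu> x" by (rule eqv_sym[OF c])
    finally show "S \<kappa> * (Sx \<alpha> * cell \<kappa> \<mu> x * S \<alpha>) * Sx \<mu> \<asymp> S \<kappa> * cell \<kappa> \<mu> x * Sx \<mu>"
      using M by (intro eqv_mult eqv_refl) simp_all
  qed
  also have "\<dots> \<asymp> x" by (rule eqv_sym[OF sum_cells[OF x]])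
  finally show ?thesis unfolding compress .
qed

lemma q_compressor: assumes "\<alpha> \<in> M" shows "q (compressor n \<alpha>) \<le> 1"
proof -
  note [simp] = F_closed S_F Sx_F E_F compressor_F
  \<comment> \<open>Applied to the unit, \<open>compress_core\<close> says that the compressor is an
    isometry, hence of norm at most 1.\<close>
  have "S e \<in> core n"
    unfolding core_def
  proof (intro CollectI conjI ballI)
    fix \<kappa> \<mu> assume L: "\<kappa> \<in> L n" "\<mu> \<in> L n"
    then have "cell \<kappa> \<mu> (S e) \<asymp> Sx \<kappa> * S \<mu>"
      unfolding cell_def by (intro eqv_mult E_right eqv_refl) (simp_all add: L_iff)
    also have "\<dots> \<asymp> fscale (if \<kappa> = \<mu> then 1 else 0) (S e)"
      using Sx_S_same_degree[OF L] by (cases "\<kappa> = \<mu>") (simp_all add: fscale_simps(1,8))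
    finally show "\<exists>c. cell \<kappa> \<mu> (S e) \<asymp> fscale c (S e)" ..
  qed simp
  from compress_core[OF this assms]
  have "fadj (compressor n \<alpha>) * S e * compressor n \<alpha> \<asymp> S e" .
  moreover have "fadj (compressor n \<alpha>) * S e * compressor n \<alpha> \<asymp> fadj (compressor n \<alpha>) * compressor n \<alpha>"
    using assms by (intro eqv_mult E_right eqv_refl) simp_all
  ultimately have "fadj (compressor n \<alpha>) * compressor n \<alpha> \<asymp> S e" using eqv_sym eqv_trans by blast
  then have "(q (compressor n \<alpha>))\<^sup>2 \<le> 1" using q_adj_mult[of "compressor n \<alpha>"] q_eqv q_S[OF e_M] assms by simp
  then show ?thesis using q_nonneg[of "compressor n \<alpha>"] assms by (simp add: power_le_one_iff abs_square_le_1)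
qed

text \<open>If the word turns s_\<mu> into s_\<nu>, the compressed entry is the adjoint of
  s_{\<kappa>\<alpha>} times s_{\<nu>\<alpha>}. The degrees of \<kappa> and \<nu> differ by the
  nonzero degree of the word and stay below \<open>n + total_deg w\<close>, so separation kills the
  entry.\<close>

lemma compress_star_monom:
  assumes "w \<noteq> []" "fst ` set w \<subseteq> M" "sdeg (Star_Word w) \<noteq> 0" "total_deg w \<le> n"
    and sep: "separating (n + total_deg w) \<alpha>"
  shows "fadj (compressor n \<alpha>) * star_monom w * compressor n \<alpha> \<asymp> 0"
proof -
  note [simp] = F_closed S_F Sx_F E_F cell_F
  have \<alpha>: "\<alpha> \<in> M" using sep by (simp add: separating_def)
  have F: "star_monom w \<in> F" using assms by (intro star_monom_in_free)
  have "(\<Sum>\<kappa>\<in>L n. \<Sum>\<mu>\<in>L n. S \<kappa> * (Sx \<alpha> * cell \<kappa> \<mu> (star_monom w) * S \<alpha>) * Sx \<mu>)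
      \<asymp> (\<Sum>\<kappa>\<in>L n. \<Sum>\<mu>\<in>L n. 0)"
  proof (intro eqv_sum)
    fix \<kappa> \<mu> assume L: "\<kappa> \<in> L n" "\<mu> \<in> L n"
    then have M: "\<kappa> \<in> M" "\<mu> \<in> M" and d: "deg \<kappa> = n" "deg \<mu> = n" by (simp_all add: L_iff)
    have "Sx \<alpha> * cell \<kappa> \<mu> (star_monom w) * S \<alpha> = (Sx \<alpha> * Sx \<kappa>) * (star_monom w * S \<mu>) * S \<alpha>"
      by (simp add: cell_def mult.assoc)
    also have "\<dots> \<asymp> 0"
      using star_monom_S[OF assms(2) M(2) assms(4)[folded d(2)]]
    proof (elim disjE bexE conjE)
      assume 0: "star_monom w * S \<mu> \<asymp> 0"
      show ?thesis
        by (rule eqv_zero_left[OF eqv_zero_right[OF 0]]) (use M \<alpha> in simp_all)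
    next
      fix \<nu> assume \<nu>: "\<nu> \<in> M" "star_monom w * S \<mu> \<asymp> S \<nu>"
        and deg: "int_vec (deg \<nu>) = int_vec (deg \<mu>) + sdeg (Star_Word w)"
      have le: "deg \<nu> \<le> n + total_deg w"
      proof -
        have "sdeg (Star_Word w) $ i \<le> int_vec (total_deg w) $ i" for i
          by (induction w) (auto simp: sdeg_def total_deg_def letter_deg_def int_vec_simps)
        moreover have "int (deg \<nu> $ i) = int (n $ i) + sdeg (Star_Word w) $ i" for i
          using deg d by (simp add: vec_eq_iff int_vec_def)
        ultimately have "int (deg \<nu> $ i) \<le> int (n $ i + total_deg w $ i)" for i
          by (simp add: int_vec_simps)
        then have "deg \<nu> $ i \<le> n $ i + total_deg w $ i" for i
          by (simp only: of_nat_le_iff)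
        then show ?thesis by (simp add: less_eq_vec_def)
      qed
      have "n \<le> n + total_deg w" by (simp add: less_eq_vec_def)
      moreover have "deg \<kappa> \<noteq> deg \<nu>" using deg d assms(3) by auto
      ultimately have no: "\<kappa> \<cdot> \<alpha> \<cdot> \<beta> \<noteq> \<nu> \<cdot> \<alpha> \<cdot> \<gamma>" if "\<beta> \<in> M" "\<gamma> \<in> M" for \<beta> \<gamma>
        using sep that M(1) \<nu>(1) le d(1) unfolding separating_def by blast
      have "Sx \<alpha> * Sx \<kappa> * (star_monom w * S \<mu>) * S \<alpha> \<asymp> Sx \<alpha> * Sx \<kappa> * S \<nu> * S \<alpha>"
        using M \<alpha> by (intro eqv_mult \<nu> eqv_refl) simp_all
      also have "\<dots> = (Sx \<alpha> * Sx \<kappa>) * (S \<nu> * S \<alpha>)" by (simp add: mult.assoc)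
      also have "\<dots> \<asymp> Sx (\<kappa> \<cdot> \<alpha>) * S (\<nu> \<cdot> \<alpha>)"
        using M \<alpha> \<nu> by (intro eqv_mult Sx_mult S_mult)
      also have "\<dots> \<asymp> 0" using M \<alpha> \<nu> no by (intro S_no_common_extension comp_M)
      finally show ?thesis .
    qed
    finally have 0: "Sx \<alpha> * cell \<kappa> \<mu> (star_monom w) * S \<alpha> \<asymp> 0" .
    show "S \<kappa> * (Sx \<alpha> * cell \<kappa> \<mu> (star_monom w) * S \<alpha>) * Sx \<mu> \<asymp> 0"
      by (rule eqv_zero_left[OF eqv_zero_right[OF 0]]) (use M in simp_all)
  qed
  then show ?thesis unfolding compress by simp
qed

end

section \<open>Uniqueness of the seminorm\<close>

text \<open>If a were larger than b, the quantity (a/b)^(2^j) would outgrow every fixed power of c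
  2^j.\<close>

lemma le_if_power_le:
  fixes a b :: real
  assumes "0 \<le> a" "0 \<le> b" "0 < k" and le: "\<And>j. a ^ (2 ^ j) \<le> (c * 2 ^ j) ^ k * b ^ (2 ^ j)"
  shows "a \<le> b"
proof (rule ccontr)
  assume "\<not> a \<le> b"
  then have ab: "b < a" by simp
  have b: "0 < b"
  proof (rule ccontr)
    assume "\<not> 0 < b"
    then have "b = 0" using assms(2) by simp
    then show False using le[of 0] ab by simp
  qed
  define r where "r = a / b"
  have r: "1 < r" using ab b by (simp add: r_def)
  have 1: "1 \<le> (c * 2 ^ j) ^ k / r ^ (2 ^ j)" for j
  proof -
    have "r ^ (2 ^ j) \<le> (c * 2 ^ j) ^ k"
      using le[of j] b by (simp add: r_def power_divide pos_divide_le_eq)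
    then show ?thesis using r by simp
  qed
  \<comment> \<open>The k-th root turns (c n)^k / r^n into (c n s^n)^k, so it suffices that n s^n
    tends to 0; the limit is then restricted to n = 2^j.\<close>
  define s where "s = root k (1 / r)"
  have "\<bar>s\<bar> < 1" using r assms(3) by (simp add: s_def)
  then have "(\<lambda>n. (c * (real n * s ^ n)) ^ k) \<longlonglongrightarrow> (c * 0) ^ k"
    by (intro tendsto_power tendsto_mult_left powser_times_n_limit_0) simp
  moreover have "(c * (real n * s ^ n)) ^ k = (c * real n) ^ k / r ^ n" for n
  proof -
    have "(s ^ n) ^ k = (s ^ k) ^ n" by (simp flip: power_mult add: mult.commute)
    also have "\<dots> = 1 / r ^ n" using r assms(3) by (simp add: s_def power_one_over)
    finally show ?thesis by (simp add: power_mult_distrib)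
  qed
  ultimately have "(\<lambda>n. (c * real n) ^ k / r ^ n) \<longlonglongrightarrow> 0" using assms(3) by (simp add: zero_power)
  from LIMSEQ_subseq_LIMSEQ[OF this, of "\<lambda>j. 2 ^ j"]
  have "(\<lambda>j. (c * 2 ^ j) ^ k / r ^ (2 ^ j)) \<longlonglongrightarrow> 0"
    by (simp add: o_def strict_mono_def)
  then have "(1::real) \<le> 0" using 1 by (intro LIMSEQ_le_const) auto
  then show False by simp
qed

section \<open>Comparison of a nonzero Cuntz-Krieger seminorm with the largest one\<close>

locale ck_pair = one_object_kgraph \<Lambda> e + q: cstar_seminormed "kg_mor \<Lambda>" q
  for \<Lambda> :: "('m, 'k::finite) kgraph_data" and e q +
  assumes relator: "r \<in> ck_relators \<Lambda> \<Longrightarrow> q r = 0"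
    and unit_nonzero: "q (fgen e) \<noteq> 0"
    and separating: "\<exists>\<alpha>. separating N \<alpha>"
begin

abbreviation "p \<equiv> ck_seminorm \<Lambda>"

sublocale p: ck_family \<Lambda> e p
  by unfold_locales (use cstar_seminorm_ck_seminorm[OF kgraph_axioms] ck_seminorm_relator[OF kgraph_axioms] in auto)

notation p.eqv (infix "\<asymp>" 50)

lemma q_le: "x \<in> p.F \<Longrightarrow> q x \<le> p x"
  using ck_seminorm_upper[OF kgraph_axioms _ q.cstar_seminorm] relator by blast

lemma q_eqv: assumes "x \<asymp> y" shows "q x = q y"
proof -
  have "\<bar>q x - q y\<bar> \<le> q (x - y)" using assms p.eqv_F by (intro q.q_abs_diff) auto
  also have "\<dots> \<le> p (x - y)" using assms p.eqv_F by (intro q_le p.F_closed) auto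
  finally show ?thesis using assms by (simp add: p.eqv_def)
qed

lemma q_unit: "q (fgen e) = 1"
proof -
  have "fadj (fgen e) * fgen e \<asymp> fgen e" by (intro p.Sx_S e_M)
  then have "(q (fgen e))\<^sup>2 = q (fgen e)" using q.q_adj_mult[OF p.E_F] q_eqv by simp
  then show ?thesis using unit_nonzero by (simp add: power2_eq_square)
qed

lemma q_mult_le: assumes "x \<in> p.F" "y \<in> p.F" "p y \<le> 1" shows "q (x * y) \<le> q x" "q (y * x) \<le> q x"
proof -
  have "q y \<le> 1" using q_le[OF assms(2)] assms by simp
  then have "q x * q y \<le> q x * 1" using assms q.q_nonneg by (intro mult_left_mono) auto
  moreover have "q (x * y) \<le> q x * q y" "q (y * x) \<le> q y * q x" using assms by (auto intro: q.q_mult)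
  ultimately show "q (x * y) \<le> q x" "q (y * x) \<le> q x" by (simp_all add: mult.commute)
qed

text \<open>Each entry is a scalar multiple of s_e, on which \<open>q\<close> is the modulus of the
  scalar and \<open>p\<close> is at most that. The crude factor counts the entries; taking powers
  removes it later.\<close>

lemma p_core_bound:
  assumes x: "x \<in> p.core n"
  shows "p x \<le> (real (card (L n)))\<^sup>2 * q x"
proof -
  note [simp] = p.F_closed p.S_F p.Sx_F p.E_F
  have F: "x \<in> p.F" using x by (simp add: p.core_def)
  have cell: "p (fgen \<kappa> * p.cell \<kappa> \<mu> x * fadj (fgen \<mu>)) \<le> q x" if L: "\<kappa> \<in> L n" "\<mu> \<in> L n" for \<kappa> \<mu>
  proof -
    have M: "\<kappa> \<in> M" "\<mu> \<in> M" using L by (simp_all add: L_iff)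
    obtain c where c: "p.cell \<kappa> \<mu> x \<asymp> fscale c (fgen e)" using x L unfolding p.core_def by blast
    have "q (p.cell \<kappa> \<mu> x) = cmod c" using q_eqv[OF c] by (simp add: q.q_scale q_unit)
    moreover have "p (p.cell \<kappa> \<mu> x) \<le> cmod c"
      using p.q_eqv[OF c] p.q_S[OF e_M] by (simp add: p.q_scale mult_left_le)
    moreover have "q (p.cell \<kappa> \<mu> x) \<le> q x"
    proof -
      have "q (p.cell \<kappa> \<mu> x) \<le> q (fadj (fgen \<kappa>) * x)"
        unfolding p.cell_def using M F by (intro q_mult_le p.q_S) simp_all
      also have "\<dots> \<le> q x" using M F by (intro q_mult_le p.q_Sx) simp_all
      finally show ?thesis .
    qed
    moreover have "p (fgen \<kappa> * p.cell \<kappa> \<mu> x * fadj (fgen \<mu>)) \<le> p (p.cell \<kappa> \<mu> x)"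
    proof -
      have "p (fgen \<kappa> * p.cell \<kappa> \<mu> x * fadj (fgen \<mu>)) \<le> p (fgen \<kappa> * p.cell \<kappa> \<mu> x)"
        using M F by (intro p.q_mult_le p.q_Sx) (simp_all add: p.cell_F)
      also have "\<dots> \<le> p (p.cell \<kappa> \<mu> x)" using M F by (intro p.q_mult_le p.q_S) (simp_all add: p.cell_F)
      finally show ?thesis .
    qed
    ultimately show ?thesis by simp
  qed
  have "p x = p (\<Sum>\<kappa>\<in>L n. \<Sum>\<mu>\<in>L n. fgen \<kappa> * p.cell \<kappa> \<mu> x * fadj (fgen \<mu>))"
    by (rule p.q_eqv[OF p.sum_cells[OF F]])
  also have "\<dots> \<le> (\<Sum>\<kappa>\<in>L n. p (\<Sum>\<mu>\<in>L n. fgen \<kappa> * p.cell \<kappa> \<mu> x * fadj (fgen \<mu>)))"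
    using F by (intro p.q_sum p.sum_F) (simp add: L_iff p.cell_F)
  also have "\<dots> \<le> (\<Sum>\<kappa>\<in>L n. \<Sum>\<mu>\<in>L n. p (fgen \<kappa> * p.cell \<kappa> \<mu> x * fadj (fgen \<mu>)))"
    using F by (intro sum_mono p.q_sum) (simp add: L_iff p.cell_F)
  also have "\<dots> \<le> (\<Sum>\<kappa>\<in>L n. \<Sum>\<mu>\<in>L n. q x)" by (intro sum_mono cell)
  finally show ?thesis by (simp add: power2_eq_square)
qed

text \<open>Spectral radius argument: by the \<open>C\<^sup>*\<close>-identity the norm of \<open>x\<close> is determined by the growth of
  the norms of \<open>(x\<^sup>* x)\<close> to the power \<open>2\<^sup>j\<close>, so subexponential factors do not matter.\<close>

primrec star_power :: "'m star_poly \<Rightarrow> nat \<Rightarrow> 'm star_poly" where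
  "star_power x 0 = fadj x * x"
| "star_power x (Suc j) = star_power x j * star_power x j"

lemma star_power_F: "x \<in> p.F \<Longrightarrow> star_power x j \<in> p.F"
  by (induction j) (simp_all add: p.F_closed)

lemma fadj_star_power: "fadj (star_power x j) = star_power x j"
  by (induction j) (simp_all add: fadj_mult fadj_simps)

lemma seminorm_star_power:
  assumes "cstar_seminorm M r" "x \<in> p.F"
  shows "r (star_power x j) = (r x ^ 2) ^ (2 ^ j)"
proof (induction j)
  case 0
  show ?case using cstar_seminormed.q_adj_mult[OF cstar_seminormed.intro] assms by simp
next
  case (Suc j)
  have "r (star_power x (Suc j)) = r (fadj (star_power x j) * star_power x j)"
    by (simp add: fadj_star_power)
  also have "\<dots> = (r (star_power x j))\<^sup>2"
    using cstar_seminormed.q_adj_mult[OF cstar_seminormed.intro] assms star_power_F by blast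
  finally show ?case unfolding Suc by (simp flip: power_mult add: mult.commute mult.left_commute)
qed

lemma p_le_q_if_growth:
  assumes "x \<in> p.F" "0 < k" "\<And>j. p (star_power x j) \<le> (c * 2 ^ j) ^ k * q (star_power x j)"
  shows "p x \<le> q x"
proof -
  have "(p x ^ 2) \<le> (q x ^ 2)"
  proof (rule le_if_power_le)
    show "(p x ^ 2) ^ 2 ^ j \<le> (c * 2 ^ j) ^ k * (q x ^ 2) ^ 2 ^ j" for j
      using assms(3)[of j]
      unfolding seminorm_star_power[OF p.cstar_seminorm assms(1)] seminorm_star_power[OF q.cstar_seminorm assms(1)] .
  qed (simp_all add: assms(2))
  then show ?thesis using q.q_nonneg[OF assms(1)] by (rule power2_le_imp_le)
qed

text \<open>The core of level \<open>n\<close> is closed under products and adjoints, so all powers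
  satisfy \<open>p_core_bound\<close> with one and the same factor; the extra \<open>2 ^ j\<close>
  brings it into the form of the growth lemma.\<close>

lemma p_le_q_core: assumes x: "x \<in> p.core n" shows "p x \<le> q x"
proof (rule p_le_q_if_growth[OF _ zero_less_one])
  show F: "x \<in> p.F" using x by (simp add: p.core_def)
  fix j
  have "star_power x j \<in> p.core n"
    by (induction j) (simp_all add: p.core_mult p.core_fadj x)
  then have "p (star_power x j) \<le> (real (card (L n)))\<^sup>2 * q (star_power x j)" by (rule p_core_bound)
  also have "\<dots> \<le> ((real (card (L n)))\<^sup>2 * 2 ^ j) ^ 1 * q (star_power x j)"
    using q.q_nonneg[OF star_power_F[OF F]] mult_left_mono[of 1 "2 ^ j" "(real (card (L n)))\<^sup>2"]
    by (intro mult_right_mono) simp_all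
  finally show "p (star_power x j) \<le> ((real (card (L n)))\<^sup>2 * 2 ^ j) ^ 1 * q (star_power x j)" .
qed

text \<open>A common coordinatewise bound for the total degrees of the words of \<open>x\<close>;
  summing them gives one without a maximum over vectors.\<close>

definition level :: "'m star_poly \<Rightarrow> nat ^ 'k" where
  "level x = (\<Sum>w\<in>Poly_Mapping.keys x. total_deg (star_letters w))"

lemma total_deg_le_level: "w \<in> Poly_Mapping.keys x \<Longrightarrow> total_deg (star_letters w) \<le> level x"
  unfolding level_def less_eq_vec_def sum_component by (auto intro: member_le_sum)

lemma part_core:
  assumes x: "x \<in> p.F" shows "part 0 x \<in> p.core (level x)"
proof -
  have "(\<Sum>w\<in>W. fscale (Poly_Mapping.lookup x w) (star_monom (star_letters w))) \<in> p.core (level x)"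
    if "finite W" "W \<subseteq> {w \<in> Poly_Mapping.keys x. sdeg w = 0}" for W
    using that
  proof (induction W rule: finite_induct)
    case empty
    have "0 \<in> p.core (level x)"
      unfolding p.core_def p.cell_def
      by (auto simp: zero_free_star_alg fscale_simps(8) intro!: exI[of _ 0] p.eqv_refl)
    then show ?case by simp
  next
    case (insert w W)
    have "star_letters w \<noteq> []" "fst ` set (star_letters w) \<subseteq> M"
      using x insert by (auto simp: free_star_alg_def)
    then have "star_monom (star_letters w) \<in> p.core (level x)"
      using insert by (intro p.core_star_monom total_deg_le_level) auto
    then show ?case using insert by (simp add: p.core_add p.core_fscale)
  qed
  from this[OF _ subset_refl] show ?thesis by (simp add: part_def)
qed

lemma q_part_zero: assumes x: "x \<in> p.F" shows "q (part 0 x) \<le> q x"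
proof -
  note [simp] = p.F_closed
  define n where "n = level x"
  \<comment> \<open>Killing a word needs separation up to n plus its total degree, and that is at
    most n + n.\<close>
  obtain \<alpha> where sep: "separating (n + n) \<alpha>" using separating by blast
  then have \<alpha>: "\<alpha> \<in> M" by (simp add: separating_def)
  define W where "W = p.compressor n \<alpha>"
  have W: "W \<in> p.F" "p W \<le> 1" by (simp_all add: W_def p.compressor_F p.q_compressor \<alpha>)
  have "fadj W * (x - part 0 x) * W \<asymp> 0"
  proof -
    have "x - part 0 x = (\<Sum>w | w \<in> Poly_Mapping.keys x \<and> sdeg w \<noteq> 0.
        fscale (Poly_Mapping.lookup x w) (star_monom (star_letters w)))" (is "_ = ?s")
    proof (rule poly_mapping_eqI)
      fix v
      have "Poly_Mapping.lookup ?s v = (\<Sum>w | w \<in> Poly_Mapping.keys x \<and> sdeg w \<noteq> 0. if w = v then Poly_Mapping.lookup x w else 0)"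
        unfolding lookup_sum star_monom_def
        by (intro sum.cong) (auto simp: lookup_single when_def)
      then show "Poly_Mapping.lookup (x - part 0 x) v = Poly_Mapping.lookup ?s v"
        by (auto simp: lookup_minus lookup_part in_keys_iff)
    qed
    then have "fadj W * (x - part 0 x) * W = (\<Sum>w | w \<in> Poly_Mapping.keys x \<and> sdeg w \<noteq> 0.
        fscale (Poly_Mapping.lookup x w) (fadj W * star_monom (star_letters w) * W))"
      by (simp add: sum_distrib_left sum_distrib_right fscale_mult_left fscale_mult_right)
    also have "\<dots> \<asymp> (\<Sum>w | w \<in> Poly_Mapping.keys x \<and> sdeg w \<noteq> 0. 0)"
    proof (rule p.eqv_sum)
      fix w assume w: "w \<in> {w \<in> Poly_Mapping.keys x. sdeg w \<noteq> 0}"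
      have le: "total_deg (star_letters w) \<le> n" using w by (simp add: n_def total_deg_le_level)
      have "separating (n + total_deg (star_letters w)) \<alpha>"
      proof -
        have "n + total_deg (star_letters w) \<le> n + n" using le by (simp add: less_eq_vec_def)
        then show ?thesis using sep unfolding separating_def by (meson order_trans)
      qed
      then have "fadj W * star_monom (star_letters w) * W \<asymp> 0"
        unfolding W_def using w x le by (intro p.compress_star_monom) (auto simp: free_star_alg_def)
      from p.eqv_fscale[OF this]
      show "fscale (Poly_Mapping.lookup x w) (fadj W * star_monom (star_letters w) * W) \<asymp> 0"
        by (simp add: fscale_simps(7))
    qed
    finally show ?thesis by simp
  qed
  moreover have "fadj W * part 0 x * W \<asymp> part 0 x"
    unfolding W_def n_def by (intro p.compress_core part_core x \<alpha>)
  ultimately have "fadj W * part 0 x * W + fadj W * (x - part 0 x) * W \<asymp> part 0 x + 0"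
    by (intro p.eqv_add)
  then have "fadj W * x * W \<asymp> part 0 x" by (simp add: algebra_simps)
  then have "q (part 0 x) = q (fadj W * x * W)" by (simp add: q_eqv)
  also have "\<dots> \<le> q (fadj W * x)" using x W by (intro q_mult_le) simp_all
  also have "\<dots> \<le> q x" using x W by (intro q_mult_le) (simp_all add: p.q_adj)
  finally show ?thesis .
qed

text \<open>For the part y, the product y^* y has degree 0, where \<open>p\<close> is bounded by
  \<open>q\<close>, so p y \<le> q y by the C*-identity. It is also the degree 0 part of y^* x, so
  the square of q y is at most q y times q x.\<close>

lemma p_part_le_q: assumes x: "x \<in> p.F" shows "p (part d x) \<le> q x"
proof -
  let ?y = "part d x"
  have y: "?y \<in> p.F" by (rule part_F[OF x])
  have "homogeneous 0 (fadj ?y * ?y)"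
    using homogeneous_mult[OF homogeneous_fadj[OF homogeneous_part[of d x]] homogeneous_part[of d x]] by simp
  then have "fadj ?y * ?y = part 0 (fadj ?y * ?y)" by (simp add: part_homogeneous)
  then have "fadj ?y * ?y \<in> p.core (level (fadj ?y * ?y))"
    using part_core[of "fadj ?y * ?y"] y by (simp add: p.F_closed)
  from p_le_q_core[OF this] have py: "p ?y \<le> q ?y"
    using y p.q_nonneg q.q_nonneg by (simp add: p.q_adj_mult q.q_adj_mult)
  have "(q ?y)\<^sup>2 = q (part 0 (fadj ?y * x))"
    unfolding part_fadj_mult using q.q_adj_mult[OF y] by simp
  also have "\<dots> \<le> q (fadj ?y * x)" by (intro q_part_zero p.F_closed y x)
  also have "\<dots> \<le> q ?y * q x" using q.q_mult[of "fadj ?y" x] y x by (simp add: q.q_adj p.F_closed)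
  finally have "q ?y * q ?y \<le> q ?y * q x" by (simp add: power2_eq_square)
  then have "q ?y \<le> q x"
    using q.q_nonneg[OF y] q.q_nonneg[OF x] by (cases "q ?y = 0") (auto intro: mult_left_le_imp_le)
  with py show ?thesis by simp
qed

theorem seminorm_unique: assumes x: "x \<in> p.F" shows "p x = q x"
proof (rule antisym[OF _ q_le[OF x]])
  obtain K where K: "deg_bounded K (star_power x 0)" using deg_bounded_exists by blast
  \<comment> \<open>Each squaring doubles the range of degrees, so their number is bounded by a k-th
    power of a multiple of 2^j.\<close>
  have bounded: "deg_bounded (K * 2 ^ j) (star_power x j)" for j
  proof (induction j)
    case (Suc j)
    from deg_bounded_mult[OF Suc Suc] show ?case by (simp add: mult_2 algebra_simps)
  qed (use K in simp)
  show "p x \<le> q x"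
  proof (rule p_le_q_if_growth[OF x zero_less_card_finite])
    fix j
    let ?y = "star_power x j"
    let ?D = "sdeg ` Poly_Mapping.keys ?y"
    have y: "?y \<in> p.F" by (rule star_power_F[OF x])
    have "p ?y = p (\<Sum>d\<in>?D. part d ?y)" by (subst sum_part) simp
    also have "\<dots> \<le> (\<Sum>d\<in>?D. p (part d ?y))" by (intro p.q_sum part_F y)
    also have "\<dots> \<le> (\<Sum>d\<in>?D. q ?y)" by (intro sum_mono p_part_le_q y)
    also have "\<dots> = real (card ?D) * q ?y" by simp
    also have "\<dots> \<le> (real (2 * K + 1) * 2 ^ j) ^ CARD('k) * q ?y"
    proof (rule mult_right_mono[OF _ q.q_nonneg[OF y]])
      have "card ?D \<le> (2 * (K * 2 ^ j) + 1) ^ CARD('k)" by (rule card_degrees[OF bounded])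
      also have "\<dots> \<le> ((2 * K + 1) * 2 ^ j) ^ CARD('k)" by (intro power_mono) (simp_all add: algebra_simps)
      finally have "real (card ?D) \<le> real (((2 * K + 1) * 2 ^ j) ^ CARD('k))" by (rule of_nat_mono)
      then show "real (card ?D) \<le> (real (2 * K + 1) * 2 ^ j) ^ CARD('k)"
        by (simp only: of_nat_power of_nat_mult of_nat_numeral)
    qed
    finally show "p ?y \<le> (real (2 * K + 1) * 2 ^ j) ^ CARD('k) * q ?y" .
  qed
qed

end

section \<open>Quotients of unital \<open>C\<^sup>*\<close>-algebras\<close>

context cstar_algebra
begin

lemma Banach_fixedpoint:
  assumes f: "\<And>x. x \<in> carrier B \<Longrightarrow> f x \<in> carrier B" and k: "k < 1"
    and con: "\<And>x y. \<lbrakk>x \<in> carrier B; y \<in> carrier B\<rbrakk> \<Longrightarrow> cdist B (f x) (f y) \<le> k * cdist B x y"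
  obtains x where "x \<in> carrier B" "f x = x"
proof -
  \<comment> \<open>\<open>Metric_space\<close> asks for symmetry and nonnegativity on the whole
    type, hence the default 0 outside the carrier.\<close>
  define d where "d x y = (if x \<in> carrier B \<and> y \<in> carrier B then cdist B x y else 0)" for x y
  interpret D: Metric_space "carrier B" d
    by unfold_locales (auto simp: d_def dist_nonneg dist_commute dist_zero_iff intro: dist_triangle)
  have "D.mcomplete"
    unfolding D.mcomplete_def
  proof (intro allI impI)
    fix s assume s: "D.MCauchy s"
    then have c: "s n \<in> carrier B" for n by (auto simp: D.MCauchy_def)
    have "\<exists>x\<in>carrier B. (\<lambda>n. cdist B (s n) x) \<longlonglongrightarrow> 0"
    proof (rule complete[OF c])
      fix e :: real assume "0 < e"
      then show "\<exists>N. \<forall>m\<ge>N. \<forall>n\<ge>N. cdist B (s m) (s n) < e"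
        using s c unfolding D.MCauchy_def by (auto simp: d_def)
    qed
    then obtain x where x: "x \<in> carrier B" "(\<lambda>n. cdist B (s n) x) \<longlonglongrightarrow> 0" by blast
    have "limitin D.mtopology s x sequentially"
      unfolding D.limit_metric_sequentially
      using x c LIMSEQ_D[OF x(2)] by (auto simp: d_def dist_nonneg)
    then show "\<exists>x. limitin D.mtopology s x sequentially" ..
  qed
  then show thesis
    by (rule D.Banach_fixedpoint_thm[of f k]) (use assms zero_closed that in \<open>auto simp: d_def\<close>)
qed

definition minus :: "'a \<Rightarrow> 'a \<Rightarrow> 'a" where
  "minus x y = cadd B x (cscale B (-1) y)"

lemma minus_closed: "\<lbrakk>x \<in> carrier B; y \<in> carrier B\<rbrakk> \<Longrightarrow> minus x y \<in> carrier B"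
  by (simp add: minus_def closed)

lemma dist_minus: "cdist B x y = cnorm B (minus x y)"
  by (simp add: cdist_def minus_def)

lemma add_minus_cancel: "\<lbrakk>x \<in> carrier B; y \<in> carrier B\<rbrakk> \<Longrightarrow> cadd B (minus x y) y = x"
  using add_commute[of "cscale B (-1) y" y] by (simp add: minus_def add_assoc closed add_neg add_zero)

lemma minus_eqI: "\<lbrakk>x \<in> carrier B; y \<in> carrier B; z \<in> carrier B; x = cadd B z y\<rbrakk> \<Longrightarrow> minus x y = z"
  by (simp add: minus_def add_assoc closed add_neg add_zero)

lemma add_cancel: "\<lbrakk>x \<in> carrier B; y \<in> carrier B; z \<in> carrier B; cadd B x y = cadd B x z\<rbrakk> \<Longrightarrow> y = z"
  by (metis cancel_left(1))

lemma scale_zero: assumes "x \<in> carrier B" shows "cscale B 0 x = czero B"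
  using scale_add_left[OF assms, of 0 0] add_cancel[of "cscale B 0 x" "cscale B 0 x" "czero B"] assms
  by (simp add: closed add_zero)

lemma norm_minus: "\<lbrakk>x \<in> carrier B; y \<in> carrier B\<rbrakk> \<Longrightarrow> cnorm B (minus x y) \<le> cnorm B x + cnorm B y"
  using norm_triangle[of x "cscale B (-1) y"] by (simp add: minus_def closed norm_neg)

end

section \<open>Inverses and resolvents in a unital C*-algebra\<close>

locale unital_cstar_algebra = cstar_algebra B for B :: "('a, 'x) cstar_data_scheme" +
  fixes u :: 'a
  assumes unit_closed: "u \<in> carrier B"
    and unit_left: "x \<in> carrier B \<Longrightarrow> cmult B u x = x"
    and unit_right: "x \<in> carrier B \<Longrightarrow> cmult B x u = x"
begin

lemma adj_unit: "cadj B u = u"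
  by (metis adj_adj adj_closed adj_mult unit_closed unit_left unit_right)

lemma norm_unit: "cnorm B u \<le> 1"
proof -
  have "(cnorm B u)\<^sup>2 = cnorm B u"
    using cstar_identity[OF unit_closed] by (simp add: adj_unit unit_left unit_closed)
  then show ?thesis by (cases "cnorm B u = 0") (auto simp: power2_eq_square)
qed

text \<open>The Neumann series, obtained as the fixed point of the map from x to 1 - y x, which
  contracts by \<parallel>y\<parallel>.\<close>

lemma right_inverse:
  assumes y: "y \<in> carrier B" and le: "cnorm B y < 1"
  obtains z where "z \<in> carrier B" "cmult B (cadd B u y) z = u"
proof -
  note [simp] = closed unit_closed y
  define f where "f x = cadd B u (cscale B (-1) (cmult B y x))" for x
  obtain z where z: "z \<in> carrier B" "f z = z"
  proof (rule Banach_fixedpoint[OF _ le, of f])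
    fix x w assume [simp]: "x \<in> carrier B" "w \<in> carrier B"
    have "minus (f x) (f w) = cscale B (-1) (cmult B y (minus x w))"
      by (rule minus_eqI) (simp_all add: minus_closed f_def minus_def mult_add_right mult_scale_right
          scale_add_right add_assoc add_left_commute scale_scale scale_one add_neg add_zero cancel_left
          add_commute[of "cmult B y w" "cscale B (-1) (cmult B y w)"])
    then have "cdist B (f x) (f w) = cnorm B (cmult B y (minus x w))"
      by (simp add: dist_minus norm_neg minus_closed)
    also have "\<dots> \<le> cnorm B y * cdist B x w" unfolding dist_minus by (intro norm_mult y minus_closed) simp_all
    finally show "cdist B (f x) (f w) \<le> cnorm B y * cdist B x w" .
  qed (simp_all add: f_def)
  have "cmult B (cadd B u y) z = cadd B (f z) (cmult B y z)"
    using z by (simp add: mult_add_left unit_left)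
  also have "\<dots> = u" using z(1) add_commute[of "cscale B (-1) (cmult B y z)" "cmult B y z"]
    by (simp add: f_def add_assoc add_neg add_zero)
  finally show thesis using that z(1) by blast
qed

text \<open>For self-adjoint \<open>b\<close> the Cayley transform of the pencil is unitary, which bounds the inverse of
  the pencil by \<open>1\<close>.\<close>

definition pencil :: "'a \<Rightarrow> real \<Rightarrow> 'a" where
  "pencil b r = cadd B u (cscale B (\<i> * of_real r) b)"

lemma pencil_closed: "b \<in> carrier B \<Longrightarrow> pencil b r \<in> carrier B"
  by (simp add: pencil_def closed unit_closed)

lemma adj_pencil: "\<lbrakk>b \<in> carrier B; cadj B b = b\<rbrakk> \<Longrightarrow> cadj B (pencil b r) = pencil b (- r)"
  by (simp add: pencil_def closed unit_closed adj_add adj_scale adj_unit)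

lemma pencil_add:
  assumes "b \<in> carrier B" shows "cadd B (pencil b r) (pencil b (- r)) = cscale B 2 u"
proof -
  have 0: "cadd B (cscale B (\<i> * of_real r) b) (cscale B (- (\<i> * of_real r)) b) = czero B"
    using assms by (simp add: scale_zero flip: scale_add_left)
  have "cadd B (pencil b r) (pencil b (- r))
      = cadd B (cadd B u u) (cadd B (cscale B (\<i> * of_real r) b) (cscale B (- (\<i> * of_real r)) b))"
    using assms by (simp add: pencil_def closed unit_closed add_assoc add_left_commute)
  also have "\<dots> = cscale B (1 + 1) u"
    unfolding 0 scale_add_left[OF unit_closed] by (simp add: closed unit_closed add_zero scale_one)
  finally show ?thesis by simp
qed

lemma pencil_commute:
  assumes "b \<in> carrier B" shows "cmult B (pencil b r) (pencil b s) = cmult B (pencil b s) (pencil b r)"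
proof -
  have *: "cmult B (pencil b r) (pencil b s) = cadd B u (cadd B (cscale B (\<i> * of_real r + \<i> * of_real s) b)
      (cscale B (\<i> * of_real s * (\<i> * of_real r)) (cmult B b b)))" for r s
    using assms by (simp add: pencil_def closed unit_closed mult_add_left mult_add_right mult_scale_left
        mult_scale_right scale_scale unit_left unit_right scale_add_left scale_add_right add_assoc add_left_commute)
  show ?thesis unfolding * by (simp add: mult_ac add.commute)
qed

lemma resolvent_bound:
  assumes b: "b \<in> carrier B" "cadj B b = b" and d: "d \<in> carrier B"
    and inv: "cmult B (pencil b r) d = u"
  shows "cnorm B d \<le> 1"
proof -
  note [simp] = closed unit_closed pencil_closed b d
  let ?c = "pencil b r"
  let ?c' = "pencil b (- r)"
  define U where "U = cmult B ?c' d"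
  have U: "U \<in> carrier B" by (simp add: U_def)
  have "cmult B (cadj B U) U = cmult B (cadj B d) (cmult B (cmult B ?c ?c') d)"
    by (simp add: U_def adj_mult adj_pencil mult_assoc)
  also have "\<dots> = cmult B (cmult B (cadj B d) ?c') (cmult B ?c d)"
    unfolding pencil_commute[OF b(1), of r] by (simp add: mult_assoc)
  also have "cmult B (cadj B d) ?c' = cadj B (cmult B ?c d)"
    by (simp add: adj_mult adj_pencil)
  finally have "cmult B (cadj B U) U = u" by (simp add: inv adj_unit unit_left)
  then have "(cnorm B U)\<^sup>2 \<le> 1" using cstar_identity[OF U] norm_unit by simp
  then have normU: "cnorm B U \<le> 1" using norm_nonneg[OF U] by (simp add: power_le_one_iff abs_square_le_1)
  \<comment> \<open>The pencils at r and -r add up to 2, so d = (1 + U) / 2 is the mean of two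
    contractions.\<close>
  have "cadd B u U = cmult B (cadd B ?c ?c') d" by (simp add: U_def mult_add_left inv)
  also have "\<dots> = cscale B 2 d" unfolding pencil_add[OF b(1)] by (simp add: mult_scale_left unit_left)
  finally have "2 * cnorm B d = cnorm B (cadd B u U)" by (simp add: norm_scale)
  also have "\<dots> \<le> 1 + 1" using norm_triangle[of u U] norm_unit normU by (simp add: U)
  finally show ?thesis by simp
qed

text \<open>Continuation in steps of \<delta>: the resolvent has norm at most 1 wherever it exists,
  so \<delta> \<parallel>b\<parallel> < 1 always permits one more Neumann step and the step size
  need not shrink.\<close>

lemma resolvent_exists:
  assumes "b \<in> carrier B" "cadj B b = b" "0 \<le> \<delta>" "\<delta> * cnorm B b < 1"
  shows "\<exists>d\<in>carrier B. cmult B (pencil b (real n * \<delta>)) d = u \<and> cmult B d (pencil b (real n * \<delta>)) = u"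
proof -
  have "\<exists>d\<in>carrier B. cmult B (pencil b (real n * \<delta>)) d = u \<and> cmult B d (pencil b (real n * \<delta>)) = u"
    if "b \<in> carrier B" "cadj B b = b" "\<delta> * cnorm B b < 1" for b
    using that
  proof (induction n arbitrary: b)
    case 0
    then have "pencil b (real 0 * \<delta>) = u" by (simp add: pencil_def scale_zero add_zero unit_closed)
    then show ?case using unit_left unit_closed by auto
  next
    case (Suc n)
    have right: "\<exists>d\<in>carrier B. cmult B (pencil b (real (Suc n) * \<delta>)) d = u"
      if b: "b \<in> carrier B" "cadj B b = b" "\<delta> * cnorm B b < 1" for b
    proof -
      note [simp] = closed unit_closed pencil_closed b
      obtain d where d: "d \<in> carrier B" "cmult B (pencil b (real n * \<delta>)) d = u" using Suc.IH[OF b] by blast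
      define y where "y = cscale B (\<i> * of_real \<delta>) (cmult B d b)"
      have y: "y \<in> carrier B" using d by (simp add: y_def)
      have "cnorm B y \<le> \<delta> * (1 * cnorm B b)"
      proof -
        have "cnorm B y = \<delta> * cnorm B (cmult B d b)"
          unfolding y_def using d assms(3) by (simp add: norm_scale Real_Vector_Spaces.norm_mult)
        also have "\<dots> \<le> \<delta> * (cnorm B d * cnorm B b)" using d assms(3) by (intro mult_left_mono norm_mult) simp_all
        also have "\<dots> \<le> \<delta> * (1 * cnorm B b)"
          using d assms(3) resolvent_bound[OF b(1,2) d] by (intro mult_left_mono mult_right_mono norm_nonneg) simp_all
        finally show ?thesis .
      qed
      then obtain z where z: "z \<in> carrier B" "cmult B (cadd B u y) z = u"
        using right_inverse[OF y] b(3) by auto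
      have "cmult B (pencil b (real n * \<delta>)) (cadd B u y)
          = cadd B (pencil b (real n * \<delta>)) (cscale B (\<i> * of_real \<delta>) (cmult B (cmult B (pencil b (real n * \<delta>)) d) b))"
        using d by (simp add: y_def mult_add_right mult_scale_right unit_right flip: mult_assoc)
      also have "\<dots> = pencil b (real (Suc n) * \<delta>)"
        unfolding d(2) using scale_add_left[OF b(1), of "\<i> * of_real (real n * \<delta>)" "\<i> * of_real \<delta>"]
        by (simp add: pencil_def unit_left add_assoc algebra_simps)
      finally have eq: "cmult B (pencil b (real n * \<delta>)) (cadd B u y) = pencil b (real (Suc n) * \<delta>)" .
      have "cmult B (pencil b (real (Suc n) * \<delta>)) (cmult B z d)
          = cmult B (cmult B (pencil b (real n * \<delta>)) (cmult B (cadd B u y) z)) d"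
        unfolding eq[symmetric] using d(1) z(1) y by (simp add: mult_assoc)
      also have "\<dots> = u" unfolding z(2) using d by (simp add: unit_right)
      finally show ?thesis using mult_closed[OF z(1) d(1)] by blast
    qed
    note b = Suc.prems
    note [simp] = closed unit_closed pencil_closed b(1,2)
    \<comment> \<open>The adjoint of the pencil of b is the pencil of -b, so a right inverse for -b
      becomes, after taking adjoints, a left inverse for b. For this reason the induction runs over
      all b at once.\<close>
    let ?b' = "cscale B (-1) b"
    obtain d where d: "d \<in> carrier B" "cmult B (pencil b (real (Suc n) * \<delta>)) d = u" using right[OF b] by blast
    have "cadj B ?b' = ?b'" "\<delta> * cnorm B ?b' < 1" using b by (simp_all add: adj_scale norm_neg)
    from right[OF _ this] obtain d' where d': "d' \<in> carrier B" "cmult B (pencil ?b' (real (Suc n) * \<delta>)) d' = u"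
      by auto
    have "pencil ?b' (real (Suc n) * \<delta>) = cadj B (pencil b (real (Suc n) * \<delta>))"
      by (simp add: adj_pencil) (simp add: pencil_def scale_scale)
    with d' have "cadj B (cmult B (cadj B (pencil b (real (Suc n) * \<delta>))) d') = u" by (simp add: adj_unit)
    then have left: "cmult B (cadj B d') (pencil b (real (Suc n) * \<delta>)) = u"
      using d'(1) by (simp add: adj_mult adj_adj)
    have "cadj B d' = cmult B (cadj B d') (cmult B (pencil b (real (Suc n) * \<delta>)) d)"
      unfolding d(2) using d'(1) by (simp add: unit_right)
    also have "\<dots> = d"
      unfolding mult_assoc[OF adj_closed[OF d'(1)] pencil_closed[OF b(1)] d(1), symmetric] left
      using d(1) by (rule unit_left)
    finally show ?case using d left by blast
  qed
  then show ?thesis using assms by blast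
qed

text \<open>From 1 - d = i r b d the norm of b d is at most 2 / r, hence small for large r. The last
  equation places 1 - d in the ideal generated by b.\<close>

lemma small_resolvent:
  assumes b: "b \<in> carrier B" "cadj B b = b" and e: "0 < e"
  obtains r d where "d \<in> carrier B" "cnorm B d \<le> 1" "cnorm B (cmult B b d) \<le> e"
    "u = cadd B d (cscale B (\<i> * of_real r) (cmult B d b))"
proof -
  note [simp] = closed unit_closed pencil_closed b
  define \<delta> where "\<delta> = 1 / (cnorm B b + 1)"
  have \<delta>: "0 < \<delta>" "\<delta> * cnorm B b < 1" using norm_nonneg[OF b(1)] by (simp_all add: \<delta>_def)
  obtain n :: nat where n: "2 / (e * \<delta>) < real n" using reals_Archimedean2 by blast
  define r where "r = real n * \<delta>"
  have r: "2 < e * r" using n \<delta> e by (simp add: r_def divide_less_eq mult_ac)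
  then have "0 < e * r" by simp
  then have "0 < r" using e by (simp add: zero_less_mult_iff)
  obtain d where d: "d \<in> carrier B" "cmult B (pencil b r) d = u" "cmult B d (pencil b r) = u"
    using resolvent_exists[OF b less_imp_le[OF \<delta>(1)] \<delta>(2), of n] unfolding r_def by blast
  have d1: "cnorm B d \<le> 1" by (rule resolvent_bound[OF b d(1,2)])
  have "cmult B d (pencil b r) = cadd B d (cscale B (\<i> * of_real r) (cmult B d b))"
    using d(1) by (simp add: pencil_def mult_add_right mult_scale_right unit_right)
  then have eq: "u = cadd B d (cscale B (\<i> * of_real r) (cmult B d b))" unfolding d(3) .
  have "cmult B (pencil b r) d = cadd B (cscale B (\<i> * of_real r) (cmult B b d)) d"
    using d(1) by (simp add: pencil_def mult_add_left mult_scale_left unit_left add_commute)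
  then have "minus u d = cscale B (\<i> * of_real r) (cmult B b d)"
    unfolding d(2) using d(1) by (intro minus_eqI) simp_all
  then have "r * cnorm B (cmult B b d) = cnorm B (minus u d)"
    using d(1) \<open>0 < r\<close> by (simp add: norm_scale Real_Vector_Spaces.norm_mult)
  also have "\<dots> \<le> 1 + 1" using norm_minus[of u d] d1 d(1) norm_unit by simp
  also have "\<dots> < r * e" using r by (simp add: mult.commute)
  finally have "cnorm B (cmult B b d) \<le> e" using \<open>0 < r\<close> by simp
  from that[OF d(1) d1 this eq] show thesis .
qed

text \<open>The norm of the quotient by \<open>I\<close>, pulled back to the algebra.\<close>

definition ideal_dist :: "'a set \<Rightarrow> 'a \<Rightarrow> real" where
  "ideal_dist I x = (INF i\<in>I. cnorm B (minus x i))"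

section \<open>The quotient norm is a C*-seminorm\<close>

context
  fixes I assumes I: "closed_ideal I B"
begin

lemma ideal_closed: "i \<in> I \<Longrightarrow> i \<in> carrier B" "czero B \<in> I"
  "i \<in> I \<Longrightarrow> j \<in> I \<Longrightarrow> cadd B i j \<in> I" "i \<in> I \<Longrightarrow> cscale B c i \<in> I"
  "i \<in> I \<Longrightarrow> x \<in> carrier B \<Longrightarrow> cmult B i x \<in> I" "i \<in> I \<Longrightarrow> x \<in> carrier B \<Longrightarrow> cmult B x i \<in> I"
  using I unfolding closed_ideal_def by blast+

lemma ideal_dist_le:
  assumes "x \<in> carrier B" "i \<in> I" shows "ideal_dist I x \<le> cnorm B (minus x i)"
  unfolding ideal_dist_def
proof (rule cINF_lower[OF _ assms(2)])
  show "bdd_below ((\<lambda>i. cnorm B (minus x i)) ` I)"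
    using assms ideal_closed by (intro bdd_belowI[of _ 0]) (auto intro!: norm_nonneg minus_closed)
qed

lemma ideal_dist_approx:
  assumes "x \<in> carrier B" "0 < e" obtains i where "i \<in> I" "cnorm B (minus x i) < ideal_dist I x + e"
proof -
  have "\<exists>y\<in>(\<lambda>i. cnorm B (minus x i)) ` I. y < ideal_dist I x + e"
    unfolding ideal_dist_def using assms ideal_closed(2) by (intro cInf_lessD) auto
  then show thesis using that by blast
qed

lemma ideal_dist_nonneg: "x \<in> carrier B \<Longrightarrow> 0 \<le> ideal_dist I x"
  unfolding ideal_dist_def using ideal_closed(1,2)
  by (intro cINF_greatest norm_nonneg minus_closed) auto

lemma ideal_dist_eq_zero: assumes "i \<in> I" shows "ideal_dist I i = 0"
  using ideal_dist_le[OF ideal_closed(1)[OF assms] assms] ideal_dist_nonneg[OF ideal_closed(1)[OF assms]] assms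
    norm_eq_zero[OF zero_closed] ideal_closed(1)
  by (simp add: minus_def add_neg)

lemma ideal_dist_add:
  assumes "x \<in> carrier B" "y \<in> carrier B"
  shows "ideal_dist I (cadd B x y) \<le> ideal_dist I x + ideal_dist I y"
proof (rule field_le_epsilon)
  fix e :: real assume "0 < e"
  then obtain i j where ij: "i \<in> I" "cnorm B (minus x i) < ideal_dist I x + e / 2"
    "j \<in> I" "cnorm B (minus y j) < ideal_dist I y + e / 2"
    using ideal_dist_approx assms half_gt_zero by metis
  note [simp] = assms ideal_closed(1)[OF ij(1)] ideal_closed(1)[OF ij(3)] closed
  have "minus (cadd B x y) (cadd B i j) = cadd B (minus x i) (minus y j)"
    by (simp add: minus_def scale_add_right add_assoc add_left_commute)
  then have "ideal_dist I (cadd B x y) \<le> cnorm B (cadd B (minus x i) (minus y j))"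
    using ideal_dist_le[of "cadd B x y" "cadd B i j"] ideal_closed(3)[OF ij(1,3)] by simp
  also have "\<dots> \<le> cnorm B (minus x i) + cnorm B (minus y j)"
    by (intro norm_triangle minus_closed) simp_all
  finally show "ideal_dist I (cadd B x y) \<le> ideal_dist I x + ideal_dist I y + e" using ij by simp
qed

lemma ideal_dist_scale_le:
  assumes "x \<in> carrier B" shows "ideal_dist I (cscale B c x) \<le> cmod c * ideal_dist I x"
proof (rule field_le_epsilon)
  fix e :: real assume e: "0 < e"
  then have "0 < e / (cmod c + 1)" by (simp add: add_nonneg_pos)
  then obtain i where i: "i \<in> I" "cnorm B (minus x i) < ideal_dist I x + e / (cmod c + 1)"
    using ideal_dist_approx assms by blast
  note [simp] = assms ideal_closed(1)[OF i(1)] closed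
  have "minus (cscale B c x) (cscale B c i) = cscale B c (minus x i)"
    by (simp add: minus_def scale_add_right scale_scale mult.commute)
  then have "ideal_dist I (cscale B c x) \<le> cmod c * cnorm B (minus x i)"
    using ideal_dist_le[of "cscale B c x" "cscale B c i"] ideal_closed(4)[OF i(1)]
    by (simp add: norm_scale minus_closed)
  also have "\<dots> \<le> cmod c * (ideal_dist I x + e / (cmod c + 1))" using i by (intro mult_left_mono) auto
  also have "\<dots> \<le> cmod c * ideal_dist I x + e"
    using e by (simp add: distrib_left divide_le_eq add_nonneg_pos mult.commute)
  finally show "ideal_dist I (cscale B c x) \<le> cmod c * ideal_dist I x + e" .
qed

lemma ideal_dist_scale:
  assumes "x \<in> carrier B" shows "ideal_dist I (cscale B c x) = cmod c * ideal_dist I x"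
proof (cases "c = 0")
  case True
  then show ?thesis using ideal_dist_eq_zero[OF ideal_closed(2)] assms by (simp add: scale_zero)
next
  case False
  have "cmod c * ideal_dist I x = cmod c * ideal_dist I (cscale B (1 / c) (cscale B c x))"
    using assms False by (simp add: scale_scale scale_one)
  also have "\<dots> \<le> cmod c * (cmod (1 / c) * ideal_dist I (cscale B c x))"
    using assms by (intro mult_left_mono ideal_dist_scale_le) (simp_all add: closed)
  also have "\<dots> = ideal_dist I (cscale B c x)" using False by (simp add: norm_divide)
  finally show ?thesis using ideal_dist_scale_le[OF assms, of c] by simp
qed

lemma ideal_dist_mult:
  assumes "x \<in> carrier B" "y \<in> carrier B"
  shows "ideal_dist I (cmult B x y) \<le> ideal_dist I x * ideal_dist I y"
proof -
  have "ideal_dist I (cmult B x y) \<le> (ideal_dist I x + e) * (ideal_dist I y + e)" if e: "0 < e" for e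
  proof -
    from e obtain i j where ij: "i \<in> I" "cnorm B (minus x i) < ideal_dist I x + e"
      "j \<in> I" "cnorm B (minus y j) < ideal_dist I y + e"
      using ideal_dist_approx assms by metis
    note [simp] = assms ideal_closed(1)[OF ij(1)] ideal_closed(1)[OF ij(3)] closed minus_closed
    \<comment> \<open>Chosen so that x y - k = (x - i) (y - j).\<close>
    define k where "k = cadd B (cmult B i (minus y j)) (cmult B x j)"
    have k: "k \<in> I" unfolding k_def using ij by (intro ideal_closed(3,5,6)) simp_all
    have "cmult B x y = cadd B (cmult B (minus x i) (minus y j)) k"
    proof -
      have "cadd B (cmult B (minus x i) (minus y j)) k = cadd B (cmult B (cadd B (minus x i) i) (minus y j)) (cmult B x j)"
        by (simp add: k_def mult_add_left add_assoc)
      also have "\<dots> = cmult B x (cadd B (minus y j) j)" by (simp add: add_minus_cancel flip: mult_add_right)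
      finally show ?thesis by (simp add: add_minus_cancel)
    qed
    then have "minus (cmult B x y) k = cmult B (minus x i) (minus y j)"
      using k ideal_closed(1) by (intro minus_eqI) simp_all
    then have "ideal_dist I (cmult B x y) \<le> cnorm B (cmult B (minus x i) (minus y j))"
      using ideal_dist_le[OF _ k, of "cmult B x y"] by simp
    also have "\<dots> \<le> cnorm B (minus x i) * cnorm B (minus y j)" by (intro norm_mult) simp_all
    also have "\<dots> \<le> (ideal_dist I x + e) * (ideal_dist I y + e)"
      using ij e ideal_dist_nonneg[OF assms(1)] by (intro mult_mono) (auto intro: norm_nonneg)
    finally show ?thesis .
  qed
  then have "\<forall>\<^sub>F e in at_right 0. ideal_dist I (cmult B x y) \<le> (ideal_dist I x + e) * (ideal_dist I y + e)"
    by (auto simp: eventually_at_right_less eventually_at_filter)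
  moreover have "((\<lambda>e. (ideal_dist I x + e) * (ideal_dist I y + e)) \<longlongrightarrow> (ideal_dist I x + 0) * (ideal_dist I y + 0)) (at_right 0)"
    by (intro tendsto_intros)
  ultimately show ?thesis using tendsto_lowerbound by fastforce
qed

text \<open>An element \<open>i\<close> of the ideal that is close to \<open>x\<^sup>* x\<close> is almost annihilated by the resolvent \<open>d\<close> of
  \<open>i\<^sup>* i\<close>, and \<open>x\<close> differs from \<open>x d\<close> by an element of the ideal.\<close>

lemma ideal_dist_square_le:
  assumes x: "x \<in> carrier B"
  shows "(ideal_dist I x)\<^sup>2 \<le> ideal_dist I (cmult B (cadj B x) x)"
proof (rule field_le_epsilon)
  fix e :: real assume e: "0 < e"
  have xx: "cmult B (cadj B x) x \<in> carrier B" using x by (simp add: closed)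
  obtain i where i: "i \<in> I" "cnorm B (minus (cmult B (cadj B x) x) i) < ideal_dist I (cmult B (cadj B x) x) + e / 2"
    using ideal_dist_approx[OF xx half_gt_zero[OF e]] by blast
  have i': "i \<in> carrier B" using i ideal_closed by blast
  define b where "b = cmult B (cadj B i) i"
  have b: "b \<in> carrier B" "cadj B b = b" using i' by (simp_all add: b_def closed adj_mult adj_adj)
  have bI: "b \<in> I" unfolding b_def using i i' by (intro ideal_closed(6)) (simp_all add: closed)
  \<comment> \<open>The square anticipates that \<parallel>i d\<parallel>^2 = \<parallel>d^* b
    d\<parallel> \<le> \<parallel>b d\<parallel>, which then bounds \<parallel>i d\<parallel> by e /
    2.\<close>
  have "0 < (e / 2)\<^sup>2" using e by simp
  then obtain r d where d: "d \<in> carrier B" "cnorm B d \<le> 1" "cnorm B (cmult B b d) \<le> (e / 2)\<^sup>2"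
    "u = cadd B d (cscale B (\<i> * of_real r) (cmult B d b))"
    using small_resolvent[OF b] by metis
  note [simp] = closed minus_closed x i' b d(1)
  have adj_d: "cnorm B (cadj B d) \<le> 1" using d by (simp add: norm_adj)
  define j where "j = cmult B x (cscale B (\<i> * of_real r) (cmult B d b))"
  have j: "j \<in> I" unfolding j_def using bI by (intro ideal_closed(4,6)) simp_all
  have "x = cmult B x u" by (simp add: unit_right)
  also have "\<dots> = cadd B (cmult B x d) j" by (subst d(4)) (simp add: j_def mult_add_right)
  finally have "minus x j = cmult B x d" using j ideal_closed(1) by (intro minus_eqI) simp_all
  then have "ideal_dist I x \<le> cnorm B (cmult B x d)" using ideal_dist_le[OF x j] by simp
  then have "(ideal_dist I x)\<^sup>2 \<le> (cnorm B (cmult B x d))\<^sup>2"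
    by (intro power_mono ideal_dist_nonneg x)
  also have "\<dots> = cnorm B (cmult B (cadj B d) (cmult B (cmult B (cadj B x) x) d))"
    by (simp add: adj_mult mult_assoc flip: cstar_identity)
  also have "cmult B (cmult B (cadj B x) x) d
      = cadd B (cmult B (minus (cmult B (cadj B x) x) i) d) (cmult B i d)"
    by (simp add: add_minus_cancel flip: mult_add_left)
  also have "cnorm B (cmult B (cadj B d) (cadd B (cmult B (minus (cmult B (cadj B x) x) i) d) (cmult B i d)))
      \<le> 1 * cnorm B (cadd B (cmult B (minus (cmult B (cadj B x) x) i) d) (cmult B i d))"
    using adj_d by (intro order_trans[OF norm_mult] mult_right_mono norm_nonneg) simp_all
  also have "\<dots> \<le> cnorm B (cmult B (minus (cmult B (cadj B x) x) i) d) + cnorm B (cmult B i d)"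
    by (simp add: norm_triangle)
  also have "\<dots> \<le> cnorm B (minus (cmult B (cadj B x) x) i) * 1 + e / 2"
  proof (rule add_mono)
    show "cnorm B (cmult B (minus (cmult B (cadj B x) x) i) d) \<le> cnorm B (minus (cmult B (cadj B x) x) i) * 1"
      using d(2) by (intro order_trans[OF norm_mult] mult_left_mono norm_nonneg) simp_all
    have "(cnorm B (cmult B i d))\<^sup>2 = cnorm B (cmult B (cadj B d) (cmult B b d))"
      by (simp add: b_def adj_mult mult_assoc flip: cstar_identity)
    also have "\<dots> \<le> 1 * cnorm B (cmult B b d)"
      using adj_d by (intro order_trans[OF norm_mult] mult_right_mono norm_nonneg) simp_all
    also have "\<dots> \<le> (e / 2)\<^sup>2" using d by simp
    finally show "cnorm B (cmult B i d) \<le> e / 2" by (rule power2_le_imp_le) (use e in simp)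
  qed
  finally show "(ideal_dist I x)\<^sup>2 \<le> ideal_dist I (cmult B (cadj B x) x) + e" using i by simp
qed

lemma ideal_dist_cstar_identity:
  assumes x: "x \<in> carrier B"
  shows "ideal_dist I (cmult B (cadj B x) x) = (ideal_dist I x)\<^sup>2"
proof -
  have adj: "ideal_dist I y \<le> ideal_dist I (cadj B y)" if y: "y \<in> carrier B" for y
  proof -
    have "ideal_dist I y * ideal_dist I y \<le> ideal_dist I (cadj B y) * ideal_dist I y"
      using ideal_dist_square_le[OF y] ideal_dist_mult[of "cadj B y" y] y by (simp add: power2_eq_square closed)
    then show ?thesis
      using ideal_dist_nonneg[OF y] ideal_dist_nonneg[of "cadj B y"] y
      by (cases "ideal_dist I y = 0") (auto simp: closed intro: mult_right_le_imp_le)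
  qed
  have "ideal_dist I (cmult B (cadj B x) x) \<le> ideal_dist I (cadj B x) * ideal_dist I x"
    using x by (intro ideal_dist_mult) (simp_all add: closed)
  also have "\<dots> \<le> ideal_dist I x * ideal_dist I x"
    using adj[of "cadj B x"] x by (intro mult_right_mono ideal_dist_nonneg) (simp_all add: closed adj_adj)
  finally show ?thesis using ideal_dist_square_le[OF x] by (simp add: power2_eq_square)
qed

lemma ideal_dist_zeroD:
  assumes x: "x \<in> carrier B" and 0: "ideal_dist I x = 0" shows "x \<in> I"
proof -
  have "\<exists>i\<in>I. cnorm B (minus x i) < inverse (real (Suc n))" for n
    using ideal_dist_approx[OF x, of "inverse (real (Suc n))"] 0 by (auto intro: bexI)
  then obtain i where i: "\<And>n. i n \<in> I" "\<And>n. cnorm B (minus x (i n)) < inverse (real (Suc n))" by metis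
  have "(\<lambda>n. cdist B (i n) x) \<longlonglongrightarrow> 0"
  proof (rule tendsto_sandwich[OF _ _ tendsto_const LIMSEQ_inverse_real_of_nat])
    show "\<forall>\<^sub>F n in sequentially. 0 \<le> cdist B (i n) x" using i x ideal_closed(1) by (simp add: dist_nonneg)
    have "cdist B (i n) x \<le> inverse (real (Suc n))" for n
      using i(2)[of n] dist_commute[OF ideal_closed(1)[OF i(1)] x, of n] by (simp add: dist_minus)
    then show "\<forall>\<^sub>F n in sequentially. cdist B (i n) x \<le> inverse (real (Suc n))" by simp
  qed
  then show ?thesis using I i x unfolding closed_ideal_def by blast
qed

end
end

section \<open>Representations on path spaces\<close>

text \<open>For every degree the ranges of the injections \<open>s \<mu>\<close> partition
  \<open>X\<close>; this is what the Cuntz-Krieger relations require of the associated operators on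
  functions.\<close>

locale kgraph_set = one_object_kgraph \<Lambda> e for \<Lambda> :: "('m, 'k::finite) kgraph_data" and e +
  fixes X :: "'x set" and s :: "'m \<Rightarrow> 'x \<Rightarrow> 'x"
  assumes X_nonempty: "X \<noteq> {}"
    and s_X: "\<mu> \<in> M \<Longrightarrow> x \<in> X \<Longrightarrow> s \<mu> x \<in> X"
    and s_e: "x \<in> X \<Longrightarrow> s e x = x"
    and s_comp: "\<mu> \<in> M \<Longrightarrow> \<nu> \<in> M \<Longrightarrow> x \<in> X \<Longrightarrow> s (\<mu> \<cdot> \<nu>) x = s \<mu> (s \<nu> x)"
    and s_cover: "x \<in> X \<Longrightarrow> \<exists>\<mu>\<in>L n. \<exists>y\<in>X. x = s \<mu> y"
    and s_eqD: "\<lbrakk>\<mu> \<in> L n; \<nu> \<in> L n; x \<in> X; y \<in> X; s \<mu> x = s \<nu> y\<rbrakk> \<Longrightarrow> \<mu> = \<nu> \<and> x = y"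
begin

lemma inj_s: "\<mu> \<in> M \<Longrightarrow> inj_on (s \<mu>) X"
  using s_eqD[of \<mu> "deg \<mu>" \<mu>] by (auto simp: inj_on_def L_iff)

text \<open>The finitely supported functions inside the square-summable ones. All operators involved
  preserve this dense subspace, so every sum stays finite.\<close>

definition H :: "('x \<Rightarrow> complex) set" where
  "H = {\<xi>. finite {x. \<xi> x \<noteq> 0} \<and> {x. \<xi> x \<noteq> 0} \<subseteq> X}"

lemma H_I: "finite S \<Longrightarrow> S \<subseteq> X \<Longrightarrow> (\<And>x. x \<notin> S \<Longrightarrow> \<xi> x = 0) \<Longrightarrow> \<xi> \<in> H"
  unfolding H_def using finite_subset[of "{x. \<xi> x \<noteq> 0}" S] by blast

lemma H_support: "\<xi> \<in> H \<Longrightarrow> \<exists>S. finite S \<and> S \<subseteq> X \<and> (\<forall>x. x \<notin> S \<longrightarrow> \<xi> x = 0)"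
  unfolding H_def by (intro exI[of _ "{x. \<xi> x \<noteq> 0}"]) auto

lemma H_outside: "\<xi> \<in> H \<Longrightarrow> x \<notin> X \<Longrightarrow> \<xi> x = 0"
  by (auto simp: H_def)

lemma H_zero: "(\<lambda>_. 0) \<in> H"
  by (simp add: H_def)

lemma H_add: assumes "\<xi> \<in> H" "\<eta> \<in> H" shows "(\<lambda>x. \<xi> x + \<eta> x) \<in> H"
proof -
  obtain S T where "finite S" "S \<subseteq> X" "\<And>x. x \<notin> S \<Longrightarrow> \<xi> x = 0" "finite T" "T \<subseteq> X" "\<And>x. x \<notin> T \<Longrightarrow> \<eta> x = 0"
    using H_support[OF assms(1)] H_support[OF assms(2)] by blast
  then show ?thesis by (intro H_I[of "S \<union> T"]) auto
qed

lemma H_scale: "\<xi> \<in> H \<Longrightarrow> (\<lambda>x. c * \<xi> x) \<in> H"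
  using finite_subset[of "{x. c * \<xi> x \<noteq> 0}" "{x. \<xi> x \<noteq> 0}"] by (auto simp: H_def)

definition ip :: "('x \<Rightarrow> complex) \<Rightarrow> ('x \<Rightarrow> complex) \<Rightarrow> complex" where
  "ip \<xi> \<eta> = (\<Sum>x | \<xi> x * cnj (\<eta> x) \<noteq> 0. \<xi> x * cnj (\<eta> x))"

lemma ip_eq:
  assumes "finite S" "\<And>x. x \<notin> S \<Longrightarrow> \<xi> x * cnj (\<eta> x) = 0"
  shows "ip \<xi> \<eta> = (\<Sum>x\<in>S. \<xi> x * cnj (\<eta> x))"
  unfolding ip_def using assms by (intro sum.mono_neutral_left) auto

definition nrm :: "('x \<Rightarrow> complex) \<Rightarrow> real" where
  "nrm \<xi> = L2_set (\<lambda>x. cmod (\<xi> x)) {x. \<xi> x \<noteq> 0}"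

lemma nrm_eq:
  assumes "finite S" "\<And>x. x \<notin> S \<Longrightarrow> \<xi> x = 0"
  shows "nrm \<xi> = L2_set (\<lambda>x. cmod (\<xi> x)) S"
  unfolding nrm_def L2_set_def using assms
  by (intro arg_cong[of _ _ sqrt] sum.mono_neutral_left) auto

lemma nrm_nonneg: "0 \<le> nrm \<xi>"
  by (simp add: nrm_def)

lemma nrm_square: assumes "\<xi> \<in> H" shows "ip \<xi> \<xi> = of_real ((nrm \<xi>)\<^sup>2)"
proof -
  obtain S where S: "finite S" "S \<subseteq> X" "\<And>x. x \<notin> S \<Longrightarrow> \<xi> x = 0" using H_support[OF assms] by blast
  then have "ip \<xi> \<xi> = (\<Sum>x\<in>S. of_real ((cmod (\<xi> x))\<^sup>2))"
    by (subst ip_eq[of S]) (simp_all add: complex_norm_square[symmetric] flip: of_real_power)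
  then show ?thesis using S by (subst nrm_eq[of S]) (auto simp: L2_set_def sum_nonneg)
qed

lemma Cauchy_Schwarz:
  assumes "\<xi> \<in> H" "\<eta> \<in> H" shows "cmod (ip \<xi> \<eta>) \<le> nrm \<xi> * nrm \<eta>"
proof -
  obtain S where S: "finite S" "S \<subseteq> X" "\<And>x. x \<notin> S \<Longrightarrow> \<xi> x = 0" using H_support[OF assms(1)] by blast
  obtain T where T: "finite T" "T \<subseteq> X" "\<And>x. x \<notin> T \<Longrightarrow> \<eta> x = 0" using H_support[OF assms(2)] by blast
  have "ip \<xi> \<eta> = (\<Sum>x\<in>S \<union> T. \<xi> x * cnj (\<eta> x))" using S T by (intro ip_eq) auto
  then have "cmod (ip \<xi> \<eta>) \<le> (\<Sum>x\<in>S \<union> T. \<bar>cmod (\<xi> x)\<bar> * \<bar>cmod (\<eta> x)\<bar>)"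
    by (auto intro: order_trans[OF norm_sum] simp: norm_mult)
  also have "\<dots> \<le> L2_set (\<lambda>x. cmod (\<xi> x)) (S \<union> T) * L2_set (\<lambda>x. cmod (\<eta> x)) (S \<union> T)"
    by (rule L2_set_mult_ineq)
  also have "L2_set (\<lambda>x. cmod (\<xi> x)) (S \<union> T) = nrm \<xi>" using S T by (intro nrm_eq[symmetric]) auto
  also have "L2_set (\<lambda>x. cmod (\<eta> x)) (S \<union> T) = nrm \<eta>" using S T by (intro nrm_eq[symmetric]) auto
  finally show ?thesis .
qed

lemma nrm_add: assumes "\<xi> \<in> H" "\<eta> \<in> H" shows "nrm (\<lambda>x. \<xi> x + \<eta> x) \<le> nrm \<xi> + nrm \<eta>"
proof -
  obtain S where S: "finite S" "S \<subseteq> X" "\<And>x. x \<notin> S \<Longrightarrow> \<xi> x = 0" using H_support[OF assms(1)] by blast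
  obtain T where T: "finite T" "T \<subseteq> X" "\<And>x. x \<notin> T \<Longrightarrow> \<eta> x = 0" using H_support[OF assms(2)] by blast
  have "nrm (\<lambda>x. \<xi> x + \<eta> x) = L2_set (\<lambda>x. cmod (\<xi> x + \<eta> x)) (S \<union> T)"
    using S T by (intro nrm_eq) auto
  also have "\<dots> \<le> L2_set (\<lambda>x. cmod (\<xi> x) + cmod (\<eta> x)) (S \<union> T)"
    by (intro L2_set_mono norm_triangle_ineq) simp_all
  also have "\<dots> \<le> L2_set (\<lambda>x. cmod (\<xi> x)) (S \<union> T) + L2_set (\<lambda>x. cmod (\<eta> x)) (S \<union> T)"
    by (rule L2_set_triangle_ineq)
  also have "L2_set (\<lambda>x. cmod (\<xi> x)) (S \<union> T) = nrm \<xi>" using S T by (intro nrm_eq[symmetric]) auto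
  also have "L2_set (\<lambda>x. cmod (\<eta> x)) (S \<union> T) = nrm \<eta>" using S T by (intro nrm_eq[symmetric]) auto
  finally show ?thesis .
qed

lemma nrm_scale: assumes "\<xi> \<in> H" shows "nrm (\<lambda>x. c * \<xi> x) = cmod c * nrm \<xi>"
proof -
  obtain S where S: "finite S" "S \<subseteq> X" "\<And>x. x \<notin> S \<Longrightarrow> \<xi> x = 0" using H_support[OF assms] by blast
  then show ?thesis by (simp add: nrm_eq[of S] norm_mult L2_set_right_distrib)
qed

text \<open>With flag \<open>False\<close> the isometry that carries the point mass at x to the one
  at s \<mu> x, with flag \<open>True\<close> its adjoint.\<close>

definition shift_op :: "'m \<times> bool \<Rightarrow> ('x \<Rightarrow> complex) \<Rightarrow> 'x \<Rightarrow> complex" where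
  "shift_op l \<xi> x =
    (if snd l then if x \<in> X then \<xi> (s (fst l) x) else 0
     else if x \<in> s (fst l) ` X then \<xi> (inv_into X (s (fst l)) x) else 0)"

lemma shift_op_s:
  assumes "\<mu> \<in> M" "y \<in> X"
  shows "shift_op (\<mu>, False) \<xi> (s \<mu> y) = \<xi> y"
  using assms by (simp add: shift_op_def inv_into_f_f inj_s)

lemma shift_op_add: "shift_op l (\<lambda>x. \<xi> x + \<eta> x) = (\<lambda>x. shift_op l \<xi> x + shift_op l \<eta> x)"
  by (simp add: shift_op_def fun_eq_iff)

lemma shift_op_scale: "shift_op l (\<lambda>x. c * \<xi> x) = (\<lambda>x. c * shift_op l \<xi> x)"
  by (simp add: shift_op_def fun_eq_iff)

lemma shift_op_H_nrm:
  assumes "fst l \<in> M" "\<xi> \<in> H" shows "shift_op l \<xi> \<in> H" "nrm (shift_op l \<xi>) \<le> nrm \<xi>"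
proof -
  obtain S where S: "finite S" "S \<subseteq> X" "\<And>x. x \<notin> S \<Longrightarrow> \<xi> x = 0" using H_support[OF assms(2)] by blast
  obtain \<mu> b where l: "l = (\<mu>, b)" by (cases l)
  have \<mu>: "\<mu> \<in> M" using assms l by simp
  have "shift_op l \<xi> \<in> H \<and> nrm (shift_op l \<xi>) \<le> nrm \<xi>"
  proof (cases b)
    case True
    define T where "T = {x \<in> X. s \<mu> x \<in> S}"
    have inj: "inj_on (s \<mu>) T" using inj_s[OF \<mu>] by (rule inj_on_subset) (auto simp: T_def)
    have sub: "s \<mu> ` T \<subseteq> S" by (auto simp: T_def)
    have T: "finite T" "T \<subseteq> X" using inj_on_finite[OF inj sub S(1)] by (auto simp: T_def)
    have 0: "shift_op l \<xi> x = 0" if "x \<notin> T" for x using that S(3) by (auto simp: l True shift_op_def T_def)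
    have "(\<Sum>x\<in>T. (cmod (shift_op l \<xi> x))\<^sup>2) = (\<Sum>x\<in>T. (cmod (\<xi> (s \<mu> x)))\<^sup>2)"
      using T by (intro sum.cong) (auto simp: l True shift_op_def)
    also have "\<dots> = (\<Sum>y\<in>s \<mu> ` T. (cmod (\<xi> y))\<^sup>2)" by (simp add: sum.reindex[OF inj])
    also have "\<dots> \<le> (\<Sum>y\<in>S. (cmod (\<xi> y))\<^sup>2)" using S(1) sub by (intro sum_mono2) auto
    finally have "nrm (shift_op l \<xi>) \<le> nrm \<xi>"
      using nrm_eq[OF T(1) 0] nrm_eq[OF S(1,3)] by (simp add: L2_set_def)
    moreover have "shift_op l \<xi> \<in> H" by (rule H_I[OF T 0])
    ultimately show ?thesis by blast
  next
    case False
    have inj: "inj_on (s \<mu>) S" using inj_s[OF \<mu>] S(2) by (rule inj_on_subset)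
    have T: "finite (s \<mu> ` S)" "s \<mu> ` S \<subseteq> X" using S \<mu> by (auto intro: s_X)
    have 0: "shift_op l \<xi> x = 0" if "x \<notin> s \<mu> ` S" for x
    proof (cases "x \<in> s \<mu> ` X")
      case True
      then obtain y where "y \<in> X" "x = s \<mu> y" by blast
      then show ?thesis using that S(3)[of y] shift_op_s[OF \<mu>] by (auto simp: l False)
    qed (simp add: l False shift_op_def)
    have "(\<Sum>x\<in>s \<mu> ` S. (cmod (shift_op l \<xi> x))\<^sup>2) = (\<Sum>y\<in>S. (cmod (shift_op l \<xi> (s \<mu> y)))\<^sup>2)"
      by (simp add: sum.reindex[OF inj])
    also have "\<dots> = (\<Sum>y\<in>S. (cmod (\<xi> y))\<^sup>2)"
      using S \<mu> by (intro sum.cong) (auto simp: l False shift_op_s subset_iff)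
    finally have "nrm (shift_op l \<xi>) \<le> nrm \<xi>"
      using nrm_eq[OF T(1) 0] nrm_eq[OF S(1,3)] by (simp add: L2_set_def)
    moreover have "shift_op l \<xi> \<in> H" by (rule H_I[OF T 0])
    ultimately show ?thesis by blast
  qed
  then show "shift_op l \<xi> \<in> H" "nrm (shift_op l \<xi>) \<le> nrm \<xi>" by auto
qed

lemma ip_shift_op:
  assumes \<mu>: "\<mu> \<in> M" and "\<xi> \<in> H" "\<eta> \<in> H"
  shows "ip (shift_op (\<mu>, False) \<xi>) \<eta> = ip \<xi> (shift_op (\<mu>, True) \<eta>)"
proof -
  obtain S where S: "finite S" "S \<subseteq> X" "\<And>x. x \<notin> S \<Longrightarrow> \<xi> x = 0" using H_support[OF assms(2)] by blast
  have inj: "inj_on (s \<mu>) S" using inj_s[OF \<mu>] S(2) by (rule inj_on_subset)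
  have 0: "shift_op (\<mu>, False) \<xi> x = 0" if "x \<notin> s \<mu> ` S" for x
  proof (cases "x \<in> s \<mu> ` X")
    case True
    then obtain y where "y \<in> X" "x = s \<mu> y" by blast
    then show ?thesis using that S(3)[of y] shift_op_s[OF \<mu>] by auto
  qed (simp add: shift_op_def)
  have "ip (shift_op (\<mu>, False) \<xi>) \<eta> = (\<Sum>x\<in>s \<mu> ` S. shift_op (\<mu>, False) \<xi> x * cnj (\<eta> x))"
    using S 0 by (intro ip_eq) auto
  also have "\<dots> = (\<Sum>y\<in>S. shift_op (\<mu>, False) \<xi> (s \<mu> y) * cnj (\<eta> (s \<mu> y)))"
    by (simp add: sum.reindex[OF inj])
  also have "\<dots> = (\<Sum>y\<in>S. \<xi> y * cnj (shift_op (\<mu>, True) \<eta> y))"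
    using S \<mu> by (intro sum.cong) (auto simp: shift_op_s shift_op_def[of "(\<mu>, True)"] subset_iff)
  also have "\<dots> = ip \<xi> (shift_op (\<mu>, True) \<eta>)"
    using S by (intro ip_eq[symmetric]) auto
  finally show ?thesis .
qed

lemma cnj_ip: "cnj (ip \<xi> \<eta>) = ip \<eta> \<xi>"
proof -
  have "{x. \<xi> x * cnj (\<eta> x) \<noteq> 0} = {x. \<eta> x * cnj (\<xi> x) \<noteq> 0}" by auto
  then show ?thesis by (simp add: ip_def mult.commute)
qed

lemma ip_shift_op':
  assumes "fst l \<in> M" "\<xi> \<in> H" "\<eta> \<in> H"
  shows "ip (shift_op l \<xi>) \<eta> = ip \<xi> (shift_op (fst l, \<not> snd l) \<eta>)"
proof (cases "snd l")
  case True
  have "ip (shift_op (fst l, False) \<eta>) \<xi> = ip \<eta> (shift_op (fst l, True) \<xi>)"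
    using assms by (intro ip_shift_op)
  from arg_cong[OF this, of cnj] show ?thesis
    using True by (cases l) (simp add: cnj_ip)
next
  case False
  then show ?thesis using ip_shift_op[of "fst l" \<xi> \<eta>] assms by (cases l) simp
qed

lemma ip_add:
  assumes "\<xi> \<in> H" "\<xi>' \<in> H" "\<eta> \<in> H"
  shows "ip (\<lambda>x. \<xi> x + \<xi>' x) \<eta> = ip \<xi> \<eta> + ip \<xi>' \<eta>" "ip \<eta> (\<lambda>x. \<xi> x + \<xi>' x) = ip \<eta> \<xi> + ip \<eta> \<xi>'"
proof -
  obtain S where "finite S" "\<And>x. x \<notin> S \<Longrightarrow> \<eta> x = 0" using H_support[OF assms(3)] by blast
  then show "ip (\<lambda>x. \<xi> x + \<xi>' x) \<eta> = ip \<xi> \<eta> + ip \<xi>' \<eta>" "ip \<eta> (\<lambda>x. \<xi> x + \<xi>' x) = ip \<eta> \<xi> + ip \<eta> \<xi>'"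
    by (simp_all add: ip_eq[of S] sum.distrib algebra_simps)
qed

lemma ip_scale:
  assumes "\<xi> \<in> H" "\<eta> \<in> H"
  shows "ip (\<lambda>x. c * \<xi> x) \<eta> = c * ip \<xi> \<eta>" "ip \<eta> (\<lambda>x. c * \<xi> x) = cnj c * ip \<eta> \<xi>"
proof -
  obtain S where "finite S" "\<And>x. x \<notin> S \<Longrightarrow> \<eta> x = 0" using H_support[OF assms(2)] by blast
  then show "ip (\<lambda>x. c * \<xi> x) \<eta> = c * ip \<xi> \<eta>" "ip \<eta> (\<lambda>x. c * \<xi> x) = cnj c * ip \<eta> \<xi>"
    by (simp_all add: ip_eq[of S] sum_distrib_left algebra_simps)
qed

primrec word_op :: "('m \<times> bool) list \<Rightarrow> ('x \<Rightarrow> complex) \<Rightarrow> 'x \<Rightarrow> complex" where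
  "word_op [] \<xi> = \<xi>"
| "word_op (l # w) \<xi> = shift_op l (word_op w \<xi>)"

lemma word_op_append: "word_op (v @ w) \<xi> = word_op v (word_op w \<xi>)"
  by (induction v) simp_all

lemma word_op_add: "word_op w (\<lambda>x. \<xi> x + \<eta> x) = (\<lambda>x. word_op w \<xi> x + word_op w \<eta> x)"
  by (induction w) (simp_all add: shift_op_add)

lemma word_op_scale: "word_op w (\<lambda>x. c * \<xi> x) = (\<lambda>x. c * word_op w \<xi> x)"
  by (induction w) (simp_all add: shift_op_scale)

lemma word_op_H_nrm:
  assumes "fst ` set w \<subseteq> M" "\<xi> \<in> H" shows "word_op w \<xi> \<in> H" "nrm (word_op w \<xi>) \<le> nrm \<xi>"
proof -
  have "word_op w \<xi> \<in> H \<and> nrm (word_op w \<xi>) \<le> nrm \<xi>"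
    using assms by (induction w) (auto intro: shift_op_H_nrm order_trans[OF shift_op_H_nrm(2)])
  then show "word_op w \<xi> \<in> H" "nrm (word_op w \<xi>) \<le> nrm \<xi>" by auto
qed

lemma ip_word_op:
  assumes "fst ` set w \<subseteq> M" "\<xi> \<in> H" "\<eta> \<in> H"
  shows "ip (word_op w \<xi>) \<eta> = ip \<xi> (word_op (rev (map (\<lambda>(\<mu>, b). (\<mu>, \<not> b)) w)) \<eta>)"
  using assms
proof (induction w arbitrary: \<eta>)
  case (Cons l w)
  have "ip (word_op (l # w) \<xi>) \<eta> = ip (word_op w \<xi>) (shift_op (fst l, \<not> snd l) \<eta>)"
    using Cons.prems by (simp add: ip_shift_op' word_op_H_nrm)
  also have "\<dots> = ip \<xi> (word_op (rev (map (\<lambda>(\<mu>, b). (\<mu>, \<not> b)) w)) (shift_op (fst l, \<not> snd l) \<eta>))"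
    using Cons by (simp add: shift_op_H_nrm)
  finally show ?case by (simp add: word_op_append case_prod_unfold)
qed simp

section \<open>The representation of *-polynomials and its operator norm\<close>

definition rep :: "'m star_poly \<Rightarrow> ('x \<Rightarrow> complex) \<Rightarrow> 'x \<Rightarrow> complex" where
  "rep a \<xi> x = (\<Sum>w\<in>Poly_Mapping.keys a. Poly_Mapping.lookup a w * word_op (star_letters w) \<xi> x)"

lemma rep_eq:
  assumes "finite W" "Poly_Mapping.keys a \<subseteq> W"
  shows "rep a \<xi> x = (\<Sum>w\<in>W. Poly_Mapping.lookup a w * word_op (star_letters w) \<xi> x)"
  unfolding rep_def using assms by (intro sum.mono_neutral_left) (auto simp: in_keys_iff)

lemma rep_add: "rep (a + b) \<xi> x = rep a \<xi> x + rep b \<xi> x"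
proof -
  let ?W = "Poly_Mapping.keys a \<union> Poly_Mapping.keys b"
  have "rep (a + b) \<xi> x = (\<Sum>w\<in>?W. Poly_Mapping.lookup (a + b) w * word_op (star_letters w) \<xi> x)"
    using Poly_Mapping.keys_add[of a b] by (intro rep_eq) auto
  also have "\<dots> = rep a \<xi> x + rep b \<xi> x"
    by (simp add: rep_eq[of ?W] lookup_add distrib_right sum.distrib)
  finally show ?thesis .
qed

lemma rep_fscale: "rep (fscale c a) \<xi> x = c * rep a \<xi> x"
proof -
  have "rep (fscale c a) \<xi> x = (\<Sum>w\<in>Poly_Mapping.keys a. Poly_Mapping.lookup (fscale c a) w * word_op (star_letters w) \<xi> x)"
    by (intro rep_eq) (auto simp: in_keys_iff)
  then show ?thesis by (simp add: rep_def sum_distrib_left mult.assoc)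
qed

lemma rep_zero: "rep 0 \<xi> x = 0"
  by (simp add: rep_def)

lemma rep_diff: "rep (a - b) \<xi> x = rep a \<xi> x - rep b \<xi> x"
  using rep_add[of "a - b" b \<xi> x] by simp

lemma rep_sum: "rep (sum f I) \<xi> x = (\<Sum>i\<in>I. rep (f i) \<xi> x)"
  by (induction I rule: infinite_finite_induct) (simp_all add: rep_zero rep_add)

lemma rep_single: "rep (Poly_Mapping.single w c) \<xi> x = c * word_op (star_letters w) \<xi> x"
  by (cases "c = 0") (simp_all add: rep_def)

lemma rep_add_vec: "rep a (\<lambda>x. \<xi> x + \<eta> x) x = rep a \<xi> x + rep a \<eta> x"
  by (simp add: rep_def word_op_add distrib_left sum.distrib)

lemma rep_scale_vec: "rep a (\<lambda>x. c * \<xi> x) x = c * rep a \<xi> x"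
  by (simp add: rep_def word_op_scale sum_distrib_left mult.left_commute)

lemma rep_mult: "rep (a * b) \<xi> = rep a (rep b \<xi>)"
proof (induction a rule: star_poly_induct)
  case zero
  show ?case by (simp add: rep_zero fun_eq_iff)
next
  case (add_single f u c)
  have "rep (Poly_Mapping.single u c * b) \<xi> = rep (Poly_Mapping.single u c) (rep b \<xi>)"
  proof (induction b rule: star_poly_induct)
    case zero
    show ?case using rep_scale_vec[of _ 0] by (simp add: rep_zero fun_eq_iff)
  next
    case (add_single g v d)
    have "rep (g + Poly_Mapping.single v d) \<xi> = (\<lambda>x. rep g \<xi> x + d * word_op (star_letters v) \<xi> x)"
      by (simp add: fun_eq_iff rep_add rep_single)
    with add_single.IH show ?case
      by (simp add: fun_eq_iff distrib_left rep_add mult_single rep_single rep_add_vec rep_scale_vec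
          plus_star_word_def word_op_append)
  qed
  with add_single.IH show ?case by (simp add: fun_eq_iff distrib_right rep_add)
qed

lemma rep_H: assumes "a \<in> free_star_alg M" "\<xi> \<in> H" shows "rep a \<xi> \<in> H"
proof -
  have "(\<lambda>x. \<Sum>w\<in>W. Poly_Mapping.lookup a w * word_op (star_letters w) \<xi> x) \<in> H"
    if "finite W" "W \<subseteq> Poly_Mapping.keys a" for W
    using that
  proof (induction W rule: finite_induct)
    case (insert w W)
    then have "fst ` set (star_letters w) \<subseteq> M" using assms(1) by (auto simp: free_star_alg_def)
    then show ?case using insert assms(2) by (simp add: H_add H_scale word_op_H_nrm)
  qed (simp add: H_zero)
  from this[OF finite_keys subset_refl] show ?thesis by (simp add: rep_def[abs_def])
qed

lemma rep_bounded:
  assumes "a \<in> free_star_alg M" shows "\<exists>C. \<forall>\<xi>\<in>H. nrm (rep a \<xi>) \<le> C * nrm \<xi>"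
proof -
  have "nrm (\<lambda>x. \<Sum>w\<in>W. Poly_Mapping.lookup a w * word_op (star_letters w) \<xi> x)
      \<le> (\<Sum>w\<in>W. cmod (Poly_Mapping.lookup a w)) * nrm \<xi> \<and>
      (\<lambda>x. \<Sum>w\<in>W. Poly_Mapping.lookup a w * word_op (star_letters w) \<xi> x) \<in> H"
    if "finite W" "W \<subseteq> Poly_Mapping.keys a" and \<xi>: "\<xi> \<in> H" for W \<xi>
    using that(1,2)
  proof (induction W rule: finite_induct)
    case empty
    show ?case using nrm_eq[of "{}" "\<lambda>_. 0"] by (simp add: H_zero)
  next
    case (insert w W)
    then have w: "fst ` set (star_letters w) \<subseteq> M" using assms(1) by (auto simp: free_star_alg_def)
    let ?f = "\<lambda>x. Poly_Mapping.lookup a w * word_op (star_letters w) \<xi> x"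
    let ?g = "\<lambda>x. \<Sum>w\<in>W. Poly_Mapping.lookup a w * word_op (star_letters w) \<xi> x"
    have H: "?f \<in> H" "?g \<in> H" using insert w \<xi> by (simp_all add: H_scale word_op_H_nrm)
    have "nrm ?f \<le> cmod (Poly_Mapping.lookup a w) * nrm \<xi>"
      using w \<xi> by (simp add: nrm_scale word_op_H_nrm mult_left_mono)
    moreover have "nrm ?g \<le> (\<Sum>w\<in>W. cmod (Poly_Mapping.lookup a w)) * nrm \<xi>" using insert by simp
    ultimately show ?case
      using nrm_add[OF H] H_add[OF H] insert by (simp add: distrib_right)
  qed
  from this[OF finite_keys subset_refl] show ?thesis by (auto simp: rep_def[abs_def])
qed

lemma ip_rep:
  assumes "a \<in> free_star_alg M" "\<xi> \<in> H" "\<eta> \<in> H"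
  shows "ip (rep a \<xi>) \<eta> = ip \<xi> (rep (fadj a) \<eta>)"
  using assms(1)
proof (induction a rule: star_poly_induct)
  case zero
  show ?case by (simp add: rep_def[abs_def] fadj_simps ip_def)
next
  case (add_single f w c)
  have "Poly_Mapping.keys (f + Poly_Mapping.single w c) = insert w (Poly_Mapping.keys f)"
    using add_single by (auto simp: in_keys_iff lookup_add lookup_single when_def split: if_splits)
  then have f: "f \<in> free_star_alg M" and w: "star_letters w \<noteq> []" "fst ` set (star_letters w) \<subseteq> M"
    using add_single.prems by (auto simp: free_star_alg_def)
  have adj: "fst ` set (star_letters (adj_word w)) \<subseteq> M"
    using w(2) by (auto simp: adj_word_def)
  have "ip (rep (f + Poly_Mapping.single w c) \<xi>) \<eta>
      = ip (rep f \<xi>) \<eta> + c * ip (word_op (star_letters w) \<xi>) \<eta>"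
    using f w assms by (simp add: rep_add[abs_def] rep_single ip_add ip_scale rep_H H_scale word_op_H_nrm)
  also have "\<dots> = ip \<xi> (rep (fadj f) \<eta>) + c * ip \<xi> (word_op (star_letters (adj_word w)) \<eta>)"
    using add_single.IH[OF f] ip_word_op[OF w(2) assms(2,3)] by (simp add: adj_word_def)
  also have "\<dots> = ip \<xi> (rep (fadj (f + Poly_Mapping.single w c)) \<eta>)"
    using f w adj assms free_star_alg_closed(5)[OF f]
    by (simp add: fadj_simps fadj_single rep_add[abs_def] rep_single ip_add ip_scale rep_H H_scale word_op_H_nrm)
  finally show ?case .
qed

definition rep_norm :: "'m star_poly \<Rightarrow> real" where
  "rep_norm a = (SUP \<xi>\<in>{\<xi>\<in>H. nrm \<xi> \<le> 1}. nrm (rep a \<xi>))"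

lemma nrm_rep_le:
  assumes a: "a \<in> free_star_alg M" and \<xi>: "\<xi> \<in> H" shows "nrm (rep a \<xi>) \<le> rep_norm a * nrm \<xi>"
proof -
  obtain C where C: "\<And>\<xi>. \<xi> \<in> H \<Longrightarrow> nrm (rep a \<xi>) \<le> C * nrm \<xi>" using rep_bounded[OF a] by blast
  have upper: "nrm (rep a \<eta>) \<le> rep_norm a" if "\<eta> \<in> H" "nrm \<eta> \<le> 1" for \<eta>
    unfolding rep_norm_def
  proof (rule cSUP_upper)
    have "nrm (rep a \<xi>) \<le> \<bar>C\<bar>" if "\<xi> \<in> H" "nrm \<xi> \<le> 1" for \<xi>
    proof -
      have "C * nrm \<xi> \<le> \<bar>C\<bar> * 1" using that nrm_nonneg by (intro mult_mono) auto
      then show ?thesis using C[OF that(1)] by simp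
    qed
    then show "bdd_above ((\<lambda>\<xi>. nrm (rep a \<xi>)) ` {\<xi> \<in> H. nrm \<xi> \<le> 1})" by (intro bdd_aboveI[of _ "\<bar>C\<bar>"]) auto
  qed (use that in simp)
  show ?thesis
  proof (cases "nrm \<xi> = 0")
    case True
    then show ?thesis using C[OF \<xi>] by simp
  next
    case False
    then have pos: "0 < nrm \<xi>" using nrm_nonneg[of \<xi>] by simp
    define \<eta> where "\<eta> = (\<lambda>x. complex_of_real (1 / nrm \<xi>) * \<xi> x)"
    have \<eta>: "\<eta> \<in> H" "nrm \<eta> = 1" using \<xi> pos by (simp_all add: \<eta>_def H_scale nrm_scale norm_divide del: of_real_divide)
    have "rep a \<eta> = (\<lambda>x. complex_of_real (1 / nrm \<xi>) * rep a \<xi> x)"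
      unfolding \<eta>_def by (rule ext) (rule rep_scale_vec)
    then have "nrm (rep a \<eta>) = nrm (rep a \<xi>) / nrm \<xi>"
      using nrm_scale[OF rep_H[OF a \<xi>], of "complex_of_real (1 / nrm \<xi>)"] pos by (simp add: norm_divide)
    then show ?thesis using upper[of \<eta>] \<eta> pos by (simp add: pos_divide_le_eq)
  qed
qed

lemma rep_norm_least:
  assumes "\<And>\<xi>. \<xi> \<in> H \<Longrightarrow> nrm (rep a \<xi>) \<le> C * nrm \<xi>" "0 \<le> C" shows "rep_norm a \<le> C"
  unfolding rep_norm_def
proof (rule cSUP_least)
  have "nrm (\<lambda>_. 0) = 0" using nrm_eq[of "{}" "\<lambda>_. 0"] by simp
  then show "{\<xi> \<in> H. nrm \<xi> \<le> 1} \<noteq> {}" using H_zero by (intro ex_in_conv[THEN iffD1]) fastforce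
  fix \<xi> assume "\<xi> \<in> {\<xi> \<in> H. nrm \<xi> \<le> 1}"
  then show "nrm (rep a \<xi>) \<le> C"
    using assms(1)[of \<xi>] mult_left_le[of "nrm \<xi>" C] assms(2) by simp
qed

lemma rep_norm_nonneg: assumes a: "a \<in> free_star_alg M" shows "0 \<le> rep_norm a"
proof -
  obtain x where x: "x \<in> X" using X_nonempty by blast
  let ?\<xi> = "\<lambda>y. if y = x then 1 else 0 :: complex"
  have "?\<xi> \<in> H" using x by (intro H_I[of "{x}"]) auto
  moreover have "nrm ?\<xi> = 1" using nrm_eq[of "{x}" ?\<xi>] by (simp add: L2_set_def)
  ultimately show ?thesis using nrm_rep_le[OF a, of ?\<xi>] nrm_nonneg[of "rep a ?\<xi>"] by simp
qed

lemma rep_norm_scale_le: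
  assumes a: "a \<in> free_star_alg M" shows "rep_norm (fscale c a) \<le> cmod c * rep_norm a"
proof (rule rep_norm_least)
  fix \<xi> assume \<xi>: "\<xi> \<in> H"
  have "nrm (rep (fscale c a) \<xi>) = cmod c * nrm (rep a \<xi>)"
    using nrm_scale[OF rep_H[OF a \<xi>], of c] by (simp add: rep_fscale[abs_def])
  also have "\<dots> \<le> cmod c * (rep_norm a * nrm \<xi>)" by (intro mult_left_mono nrm_rep_le a \<xi>) simp
  finally show "nrm (rep (fscale c a) \<xi>) \<le> cmod c * rep_norm a * nrm \<xi>" by (simp add: mult.assoc)
qed (simp add: rep_norm_nonneg a)

lemma cstar_seminorm_rep_norm: "cstar_seminorm M rep_norm"
proof -
  note [simp] = free_star_alg_closed[of _ M]
  have scale: "rep_norm (fscale c a) = cmod c * rep_norm a" if a: "a \<in> free_star_alg M" for c a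
  proof (cases "c = 0")
    case True
    have "rep_norm (fscale c a) \<le> 0" using rep_norm_scale_le[OF a, of c] True by simp
    then show ?thesis using rep_norm_nonneg[of "fscale c a"] a True by simp
  next
    case False
    have "cmod c * rep_norm a = cmod c * rep_norm (fscale (1 / c) (fscale c a))"
      using False by (simp add: fscale_simps(1,2))
    also have "\<dots> \<le> cmod c * (cmod (1 / c) * rep_norm (fscale c a))"
      using a by (intro mult_left_mono rep_norm_scale_le) simp_all
    also have "\<dots> = rep_norm (fscale c a)" using False by (simp add: norm_divide)
    finally show ?thesis using rep_norm_scale_le[OF a, of c] by simp
  qed
  have add: "rep_norm (a + b) \<le> rep_norm a + rep_norm b" if a: "a \<in> free_star_alg M" "b \<in> free_star_alg M" for a b
  proof (rule rep_norm_least)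
    fix \<xi> assume \<xi>: "\<xi> \<in> H"
    have "nrm (rep (a + b) \<xi>) \<le> nrm (rep a \<xi>) + nrm (rep b \<xi>)"
      using nrm_add[OF rep_H[OF a(1) \<xi>] rep_H[OF a(2) \<xi>]] by (simp add: rep_add[abs_def])
    also have "\<dots> \<le> (rep_norm a + rep_norm b) * nrm \<xi>"
      using nrm_rep_le[OF a(1) \<xi>] nrm_rep_le[OF a(2) \<xi>] by (simp add: distrib_right)
    finally show "nrm (rep (a + b) \<xi>) \<le> (rep_norm a + rep_norm b) * nrm \<xi>" .
  qed (simp add: rep_norm_nonneg a)
  have mult: "rep_norm (a * b) \<le> rep_norm a * rep_norm b" if a: "a \<in> free_star_alg M" "b \<in> free_star_alg M" for a b
  proof (rule rep_norm_least)
    fix \<xi> assume \<xi>: "\<xi> \<in> H"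
    have "nrm (rep (a * b) \<xi>) \<le> rep_norm a * nrm (rep b \<xi>)"
      unfolding rep_mult by (intro nrm_rep_le rep_H a \<xi>)
    also have "\<dots> \<le> rep_norm a * (rep_norm b * nrm \<xi>)"
      by (intro mult_left_mono nrm_rep_le rep_norm_nonneg a \<xi>)
    finally show "nrm (rep (a * b) \<xi>) \<le> rep_norm a * rep_norm b * nrm \<xi>" by (simp add: mult.assoc)
  qed (simp add: rep_norm_nonneg a)
  have star: "(rep_norm a)\<^sup>2 \<le> rep_norm (fadj a * a)" if a: "a \<in> free_star_alg M" for a
  proof -
    have nn: "0 \<le> rep_norm (fadj a * a)" using a by (intro rep_norm_nonneg) simp
    have "rep_norm a \<le> sqrt (rep_norm (fadj a * a))"
    proof (rule rep_norm_least)
      fix \<xi> assume \<xi>: "\<xi> \<in> H"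
      have H: "rep a \<xi> \<in> H" "rep (fadj a * a) \<xi> \<in> H" using a \<xi> by (simp_all add: rep_H)
      have "(nrm (rep a \<xi>))\<^sup>2 = cmod (ip (rep a \<xi>) (rep a \<xi>))"
        unfolding nrm_square[OF H(1)] norm_of_real by simp
      also have "\<dots> = cmod (ip \<xi> (rep (fadj a * a) \<xi>))" using ip_rep[OF a \<xi> H(1)] by (simp add: rep_mult)
      also have "\<dots> \<le> nrm \<xi> * nrm (rep (fadj a * a) \<xi>)" by (rule Cauchy_Schwarz[OF \<xi> H(2)])
      also have "\<dots> \<le> nrm \<xi> * (rep_norm (fadj a * a) * nrm \<xi>)"
        using a \<xi> by (intro mult_left_mono nrm_rep_le nrm_nonneg) simp_all
      also have "\<dots> = (sqrt (rep_norm (fadj a * a)) * nrm \<xi>)\<^sup>2"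
        using nn by (simp add: power_mult_distrib power2_eq_square[of "nrm \<xi>"])
      finally show "nrm (rep a \<xi>) \<le> sqrt (rep_norm (fadj a * a)) * nrm \<xi>"
        by (rule power2_le_imp_le) (simp add: nn nrm_nonneg)
    qed (simp add: nn)
    then have "(rep_norm a)\<^sup>2 \<le> (sqrt (rep_norm (fadj a * a)))\<^sup>2"
      by (intro power_mono rep_norm_nonneg a)
    then show ?thesis using nn by simp
  qed
  have adj: "rep_norm a \<le> rep_norm (fadj a)" if a: "a \<in> free_star_alg M" for a
  proof -
    have "rep_norm a * rep_norm a \<le> rep_norm (fadj a) * rep_norm a"
      using star[OF a] mult[of "fadj a" a] a by (simp add: power2_eq_square)
    then show ?thesis
      using rep_norm_nonneg[OF a] rep_norm_nonneg[of "fadj a"] a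
      by (cases "rep_norm a = 0") (auto intro: mult_right_le_imp_le)
  qed
  have "rep_norm (fadj a * a) = (rep_norm a)\<^sup>2" if a: "a \<in> free_star_alg M" for a
  proof -
    have "rep_norm (fadj a) \<le> rep_norm a" using adj[of "fadj a"] a by (simp add: fadj_simps)
    then have "rep_norm (fadj a) * rep_norm a \<le> rep_norm a * rep_norm a"
      by (intro mult_right_mono rep_norm_nonneg a)
    then show ?thesis using star[OF a] mult[of "fadj a" a] a by (simp add: power2_eq_square)
  qed
  then show ?thesis unfolding cstar_seminorm_def using rep_norm_nonneg scale add mult by blast
qed

lemma rep_fgen: "rep (fgen \<mu>) \<xi> = shift_op (\<mu>, False) \<xi>"
  by (simp add: fun_eq_iff fgen_def rep_single)

lemma rep_fadj_fgen: "rep (fadj (fgen \<mu>)) \<xi> = shift_op (\<mu>, True) \<xi>"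
  by (simp add: fun_eq_iff fgen_def fadj_single rep_single adj_word_def)

lemma shift_op_e: assumes "\<xi> \<in> H" shows "shift_op (e, b) \<xi> = \<xi>"
proof
  fix x
  show "shift_op (e, b) \<xi> x = \<xi> x"
  proof (cases "x \<in> X")
    case True
    then show ?thesis using s_e shift_op_s[OF e_M True, of \<xi>] by (cases b) (simp_all add: shift_op_def[of "(e, True)"])
  next
    case False
    then have "x \<notin> s e ` X" using s_X[OF e_M] by blast
    with False show ?thesis using H_outside[OF assms False] by (simp add: shift_op_def)
  qed
qed

lemma shift_op_outside: "\<mu> \<in> M \<Longrightarrow> x \<notin> X \<Longrightarrow> shift_op (\<mu>, b) \<xi> x = 0"
  using s_X by (auto simp: shift_op_def)

lemma rep_relator:
  assumes "r \<in> ck_relators \<Lambda>" "\<xi> \<in> H" shows "rep r \<xi> = (\<lambda>_. 0)"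
proof -
  have comp: "shift_op (\<mu>, False) (shift_op (\<nu>, False) \<xi>) = shift_op (\<mu> \<cdot> \<nu>, False) \<xi>"
    if M: "\<mu> \<in> M" "\<nu> \<in> M" for \<mu> \<nu>
  proof
    fix x
    have eq: "shift_op (\<mu> \<cdot> \<nu>, False) \<xi> (s \<mu> (s \<nu> z)) = \<xi> z" if "z \<in> X" for z
      using shift_op_s[OF comp_M[OF M] that, of \<xi>] s_comp[OF M that] by simp
    show "shift_op (\<mu>, False) (shift_op (\<nu>, False) \<xi>) x = shift_op (\<mu> \<cdot> \<nu>, False) \<xi> x"
    proof (cases "\<exists>y\<in>X. x = s \<mu> y")
      case True
      then obtain y where y: "y \<in> X" "x = s \<mu> y" by blast
      show ?thesis
      proof (cases "\<exists>z\<in>X. y = s \<nu> z")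
        case True
        then show ?thesis using y M eq by (auto simp: shift_op_s s_X)
      next
        case False
        have "x \<notin> s (\<mu> \<cdot> \<nu>) ` X"
        proof
          assume "x \<in> s (\<mu> \<cdot> \<nu>) ` X"
          then obtain z where "z \<in> X" "s \<mu> y = s \<mu> (s \<nu> z)" using y M by (auto simp: s_comp)
          then show False using inj_onD[OF inj_s[OF M(1)] _ y(1) s_X[OF M(2)]] False by blast
        qed
        moreover have "shift_op (\<nu>, False) \<xi> y = 0" using False by (auto simp: shift_op_def)
        ultimately show ?thesis using y M by (simp add: shift_op_s) (simp add: shift_op_def)
      qed
    next
      case False
      then have "x \<notin> s (\<mu> \<cdot> \<nu>) ` X" using M by (auto simp: s_comp s_X)
      then show ?thesis using False by (auto simp: shift_op_def)
    qed
  qed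
  have star: "shift_op (\<mu>, True) (shift_op (\<mu>, False) \<xi>) = \<xi>" if "\<mu> \<in> M" for \<mu>
  proof
    fix x show "shift_op (\<mu>, True) (shift_op (\<mu>, False) \<xi>) x = \<xi> x"
      using shift_op_s[OF that, of x] H_outside[OF assms(2)]
      by (cases "x \<in> X") (simp_all add: shift_op_def[of "(\<mu>, True)"])
  qed
  \<comment> \<open>For x in X exactly one morphism of degree n has x in its range, so exactly one
    summand survives.\<close>
  have sum: "(\<Sum>\<mu>\<in>L n. shift_op (\<mu>, False) (shift_op (\<mu>, True) \<xi>) x) = \<xi> x" for n x
  proof (cases "x \<in> X")
    case True
    then obtain \<nu> y where \<nu>: "\<nu> \<in> L n" "y \<in> X" "x = s \<nu> y" using s_cover by blast
    have "shift_op (\<mu>, False) (shift_op (\<mu>, True) \<xi>) x = (if \<mu> = \<nu> then \<xi> x else 0)" if "\<mu> \<in> L n" for \<mu>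
    proof (cases "\<mu> = \<nu>")
      case True
      then show ?thesis using \<nu> by (simp add: shift_op_s L_iff) (simp add: shift_op_def)
    next
      case False
      then have "x \<notin> s \<mu> ` X" using s_eqD[OF that \<nu>(1) _ \<nu>(2)] \<nu>(3) by blast
      then show ?thesis using False by (simp add: shift_op_def[of "(\<mu>, False)"])
    qed
    then show ?thesis using \<nu>(1) finite_L by simp
  next
    case False
    then show ?thesis using H_outside[OF assms(2)] by (simp add: shift_op_outside L_iff)
  qed
  have L: "{\<mu> \<in> M. deg \<mu> = n \<and> kg_rng \<Lambda> \<mu> = e} = L n" for n by (auto simp: L_def rng_e)
  show ?thesis
    using assms(1) unfolding ck_relators_def obj
  proof (elim UnE CollectE exE conjE)
    fix v assume "r = fadj (fgen v) - fgen v" "v \<in> {e}"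
    then show ?thesis using assms(2) by (simp add: fun_eq_iff rep_diff rep_fgen rep_fadj_fgen shift_op_e)
  next
    fix v assume "r = fgen v * fgen v - fgen v" "v \<in> {e}"
    then show ?thesis using assms(2) by (simp add: fun_eq_iff rep_diff rep_mult rep_fgen shift_op_e)
  next
    fix v w assume "v \<in> {e}" "w \<in> {e}" "v \<noteq> w"
    then show ?thesis by simp
  next
    fix \<mu> \<nu> assume "r = fgen \<mu> * fgen \<nu> - fgen (\<mu> \<cdot> \<nu>)" "\<mu> \<in> M" "\<nu> \<in> M"
    then show ?thesis by (simp add: fun_eq_iff rep_diff rep_mult rep_fgen comp)
  next
    fix \<mu> assume "r = fadj (fgen \<mu>) * fgen \<mu> - fgen (kg_src \<Lambda> \<mu>)" "\<mu> \<in> M"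
    then show ?thesis
      using assms(2) by (simp add: fun_eq_iff rep_diff rep_mult rep_fgen rep_fadj_fgen star src_e shift_op_e)
  next
    fix v n assume "r = fgen v - (\<Sum>\<mu> | \<mu> \<in> M \<and> deg \<mu> = n \<and> kg_rng \<Lambda> \<mu> = v. fgen \<mu> * fadj (fgen \<mu>))" "v \<in> {e}"
    then have "r = fgen e - (\<Sum>\<mu>\<in>L n. fgen \<mu> * fadj (fgen \<mu>))" using L by simp
    then show ?thesis
      using assms(2) by (simp add: fun_eq_iff rep_diff rep_sum rep_mult rep_fgen rep_fadj_fgen sum shift_op_e)
  qed
qed

text \<open>Bounds the largest seminorm from below at the unit, so the universal algebra is not
  zero.\<close>

theorem nonzero_ck_seminorm:
  "cstar_seminorm M rep_norm" "r \<in> ck_relators \<Lambda> \<Longrightarrow> rep_norm r = 0" "rep_norm (fgen e) \<noteq> 0"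
proof -
  show "cstar_seminorm M rep_norm" by (rule cstar_seminorm_rep_norm)
  show "rep_norm r = 0" if r: "r \<in> ck_relators \<Lambda>"
  proof (rule antisym)
    have "nrm (\<lambda>_. 0) = 0" using nrm_eq[of "{}" "\<lambda>_. 0"] by simp
    then show "rep_norm r \<le> 0" using rep_relator[OF r] by (intro rep_norm_least) auto
    show "0 \<le> rep_norm r" using ck_relators_subset[OF kgraph_axioms] r by (intro rep_norm_nonneg) blast
  qed
  obtain x where x: "x \<in> X" using X_nonempty by blast
  let ?\<xi> = "\<lambda>y. if y = x then 1 else 0 :: complex"
  have \<xi>: "?\<xi> \<in> H" using x by (intro H_I[of "{x}"]) auto
  have 1: "nrm ?\<xi> = 1" using nrm_eq[of "{x}" ?\<xi>] by (simp add: L2_set_def)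
  show "rep_norm (fgen e) \<noteq> 0"
    using nrm_rep_le[OF fgen_free_star_alg[OF e_M] \<xi>] \<xi> 1 by (auto simp: rep_fgen shift_op_e)
qed

end

section \<open>Simplicity\<close>

text \<open>The tail classes below are the infinite words \<open>\<mu> \<theta> \<theta> \<theta> \<dots>\<close>, on which the category acts by
  prefixing.\<close>

context one_object_kgraph
begin

primrec iter :: "'m \<Rightarrow> nat \<Rightarrow> 'm" where
  "iter \<theta> 0 = e"
| "iter \<theta> (Suc a) = \<theta> \<cdot> iter \<theta> a"

lemma iter_M: "\<theta> \<in> M \<Longrightarrow> iter \<theta> a \<in> M"
  by (induction a) (simp_all add: e_M comp_M)

lemma iter_add: "\<theta> \<in> M \<Longrightarrow> iter \<theta> (a + b) = iter \<theta> a \<cdot> iter \<theta> b"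
  by (induction a) (simp_all add: e_comp comp_assoc' iter_M)

definition tail_class :: "'m \<Rightarrow> 'm \<Rightarrow> 'm set" where
  "tail_class \<theta> \<mu> = {\<nu> \<in> M. \<exists>a b. \<mu> \<cdot> iter \<theta> a = \<nu> \<cdot> iter \<theta> b}"

lemma tail_class_eq:
  assumes \<theta>: "\<theta> \<in> M" and \<mu>: "\<mu> \<in> M" and \<nu>: "\<nu> \<in> M"
  shows "tail_class \<theta> \<mu> = tail_class \<theta> \<nu> \<longleftrightarrow> (\<exists>a b. \<mu> \<cdot> iter \<theta> a = \<nu> \<cdot> iter \<theta> b)"
proof
  assume "tail_class \<theta> \<mu> = tail_class \<theta> \<nu>"
  moreover have "\<nu> \<in> tail_class \<theta> \<nu>" using \<nu> by (auto simp: tail_class_def)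
  ultimately have "\<nu> \<in> tail_class \<theta> \<mu>" by simp
  then show "\<exists>a b. \<mu> \<cdot> iter \<theta> a = \<nu> \<cdot> iter \<theta> b" by (simp add: tail_class_def)
next
  \<comment> \<open>Padding both equations with further copies of \<theta> makes their middle terms
    equal.\<close>
  have trans: "\<exists>a b. \<kappa> \<cdot> iter \<theta> a = \<sigma> \<cdot> iter \<theta> b"
    if M: "\<kappa> \<in> M" "\<rho> \<in> M" "\<sigma> \<in> M" and eq: "\<kappa> \<cdot> iter \<theta> a = \<rho> \<cdot> iter \<theta> b" "\<rho> \<cdot> iter \<theta> c = \<sigma> \<cdot> iter \<theta> d"
    for \<kappa> \<rho> \<sigma> a b c d
  proof -
    have "\<kappa> \<cdot> iter \<theta> (a + c) = \<rho> \<cdot> iter \<theta> b \<cdot> iter \<theta> c"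
      using M \<theta> by (simp add: iter_add iter_M flip: eq(1)) (simp add: comp_assoc' iter_M)
    also have "\<dots> = \<rho> \<cdot> iter \<theta> (c + b)"
      using M \<theta> by (simp add: comp_assoc' iter_M add.commute flip: iter_add)
    also have "\<dots> = \<sigma> \<cdot> iter \<theta> (d + b)"
      using M \<theta> eq(2) by (simp add: iter_add iter_M flip: comp_assoc')
    finally show ?thesis by blast
  qed
  assume "\<exists>a b. \<mu> \<cdot> iter \<theta> a = \<nu> \<cdot> iter \<theta> b"
  then obtain a b where ab: "\<mu> \<cdot> iter \<theta> a = \<nu> \<cdot> iter \<theta> b" by blast
  have "(\<exists>c d. \<mu> \<cdot> iter \<theta> c = \<rho> \<cdot> iter \<theta> d) \<longleftrightarrow> (\<exists>c d. \<nu> \<cdot> iter \<theta> c = \<rho> \<cdot> iter \<theta> d)" if "\<rho> \<in> M" for \<rho>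
    using trans[OF \<mu> \<nu> that ab] trans[OF \<nu> \<mu> that ab[symmetric]] by blast
  then show "tail_class \<theta> \<mu> = tail_class \<theta> \<nu>" unfolding tail_class_def by (intro Collect_cong conj_cong refl)
qed

definition prefix :: "'m \<Rightarrow> 'm \<Rightarrow> 'm set \<Rightarrow> 'm set" where
  "prefix \<theta> \<mu> x = tail_class \<theta> (\<mu> \<cdot> (SOME \<nu>. \<nu> \<in> M \<and> x = tail_class \<theta> \<nu>))"

lemma prefix_tail_class:
  assumes "\<theta> \<in> M" "\<mu> \<in> M" "\<nu> \<in> M"
  shows "prefix \<theta> \<mu> (tail_class \<theta> \<nu>) = tail_class \<theta> (\<mu> \<cdot> \<nu>)"
proof -
  define \<rho> where "\<rho> = (SOME \<rho>. \<rho> \<in> M \<and> tail_class \<theta> \<nu> = tail_class \<theta> \<rho>)"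
  have "\<rho> \<in> M \<and> tail_class \<theta> \<nu> = tail_class \<theta> \<rho>"
    unfolding \<rho>_def by (rule someI[of _ \<nu>]) (use assms in simp)
  then have \<rho>: "\<rho> \<in> M" "tail_class \<theta> \<nu> = tail_class \<theta> \<rho>" by auto
  obtain a b where "\<nu> \<cdot> iter \<theta> a = \<rho> \<cdot> iter \<theta> b"
    using \<rho>(2) unfolding tail_class_eq[OF assms(1,3) \<rho>(1)] by blast
  then have "\<mu> \<cdot> \<rho> \<cdot> iter \<theta> b = \<mu> \<cdot> \<nu> \<cdot> iter \<theta> a"
    using assms \<rho>(1) by (simp add: comp_assoc' iter_M)
  then have "tail_class \<theta> (\<mu> \<cdot> \<rho>) = tail_class \<theta> (\<mu> \<cdot> \<nu>)"
    unfolding tail_class_eq[OF assms(1) comp_M[OF assms(2) \<rho>(1)] comp_M[OF assms(2,3)]] by blast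
  then show ?thesis by (simp add: prefix_def \<rho>_def)
qed

lemma kgraph_set_tails:
  assumes \<theta>: "\<theta> \<in> M" and pos: "\<And>i. 0 < deg \<theta> $ i"
  shows "kgraph_set \<Lambda> e (tail_class \<theta> ` M) (prefix \<theta>)"
proof
  note P = prefix_tail_class[OF \<theta>]
  show "tail_class \<theta> ` M \<noteq> {}" using e_M by blast
  show "prefix \<theta> \<mu> x \<in> tail_class \<theta> ` M" if "\<mu> \<in> M" "x \<in> tail_class \<theta> ` M" for \<mu> x
    using that by (auto simp: P comp_M)
  show "prefix \<theta> e x = x" if "x \<in> tail_class \<theta> ` M" for x
    using that by (auto simp: P e_M e_comp)
  show "prefix \<theta> (\<mu> \<cdot> \<nu>) x = prefix \<theta> \<mu> (prefix \<theta> \<nu> x)"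
    if "\<mu> \<in> M" "\<nu> \<in> M" "x \<in> tail_class \<theta> ` M" for \<mu> \<nu> x
    using that by (auto simp: P comp_M comp_assoc')
  show "\<exists>\<mu>\<in>L n. \<exists>y\<in>tail_class \<theta> ` M. x = prefix \<theta> \<mu> y" if "x \<in> tail_class \<theta> ` M" for n x
  proof -
    obtain \<nu> where \<nu>: "\<nu> \<in> M" "x = tail_class \<theta> \<nu>" using \<open>x \<in> tail_class \<theta> ` M\<close> by blast
    \<comment> \<open>Every repetition of \<theta> adds at least 1 in each coordinate, so this many
      repetitions dominate n.\<close>
    define a where "a = (\<Sum>i\<in>UNIV. n $ i)"
    have iter: "b \<le> deg (iter \<theta> b) $ i" for b i
    proof (induction b)
      case (Suc b)
      then show ?case using pos[of i] by (simp add: deg_comp' \<theta> iter_M)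
    qed simp
    have "n $ i \<le> deg (\<nu> \<cdot> iter \<theta> a) $ i" for i
      using iter[of a i] member_le_sum[of i UNIV "vec_nth n"] \<nu> \<theta> by (simp add: deg_comp' iter_M a_def)
    then have "n \<le> deg (\<nu> \<cdot> iter \<theta> a)" by (simp add: less_eq_vec_def)
    then obtain \<mu> \<rho> where \<mu>: "\<mu> \<in> M" "\<rho> \<in> M" "deg \<mu> = n" "\<nu> \<cdot> iter \<theta> a = \<mu> \<cdot> \<rho>"
      using factorize[OF comp_M[OF \<nu>(1) iter_M[OF \<theta>]]] by metis
    have "tail_class \<theta> \<nu> = tail_class \<theta> (\<nu> \<cdot> iter \<theta> a)"
    proof (subst tail_class_eq)
      have "\<nu> \<cdot> iter \<theta> a = \<nu> \<cdot> iter \<theta> a \<cdot> iter \<theta> 0" using \<nu> \<theta> by (simp add: comp_e comp_M iter_M)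
      then show "\<exists>b c. \<nu> \<cdot> iter \<theta> b = \<nu> \<cdot> iter \<theta> a \<cdot> iter \<theta> c" by blast
    qed (use \<nu> \<theta> in \<open>simp_all add: comp_M iter_M\<close>)
    then have "x = prefix \<theta> \<mu> (tail_class \<theta> \<rho>)" using \<mu> \<nu> by (simp add: P)
    then show ?thesis using \<mu> by (auto simp: L_iff)
  qed
  show "\<mu> = \<nu> \<and> x = y"
    if L: "\<mu> \<in> L n" "\<nu> \<in> L n" and xy: "x \<in> tail_class \<theta> ` M" "y \<in> tail_class \<theta> ` M"
      and eq: "prefix \<theta> \<mu> x = prefix \<theta> \<nu> y" for \<mu> \<nu> n x y
  proof -
    have M: "\<mu> \<in> M" "\<nu> \<in> M" "deg \<mu> = deg \<nu>" using L by (auto simp: L_iff)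
    obtain \<rho> \<sigma> where \<rho>: "\<rho> \<in> M" "x = tail_class \<theta> \<rho>" and \<sigma>: "\<sigma> \<in> M" "y = tail_class \<theta> \<sigma>" using xy by blast
    have "tail_class \<theta> (\<mu> \<cdot> \<rho>) = tail_class \<theta> (\<nu> \<cdot> \<sigma>)" using eq M \<rho> \<sigma> by (simp add: P)
    then obtain a b where "\<mu> \<cdot> \<rho> \<cdot> iter \<theta> a = \<nu> \<cdot> \<sigma> \<cdot> iter \<theta> b"
      unfolding tail_class_eq[OF \<theta> comp_M[OF M(1) \<rho>(1)] comp_M[OF M(2) \<sigma>(1)]] by blast
    then have "\<mu> \<cdot> (\<rho> \<cdot> iter \<theta> a) = \<nu> \<cdot> (\<sigma> \<cdot> iter \<theta> b)" using M \<rho> \<sigma> \<theta> by (simp add: comp_assoc' iter_M)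
    then have "\<mu> = \<nu> \<and> \<rho> \<cdot> iter \<theta> a = \<sigma> \<cdot> iter \<theta> b"
      using M \<rho> \<sigma> \<theta> by (subst (asm) comp_eq_iff) (simp_all add: comp_M iter_M)
    then show ?thesis unfolding \<rho>(2) \<sigma>(2) tail_class_eq[OF \<theta> \<rho>(1) \<sigma>(1)] by blast
  qed
qed

theorem simple_kgraph_cstar:
  assumes \<theta>: "\<theta> \<in> M" "\<And>i. 0 < deg \<theta> $ i" and sep: "\<And>N. \<exists>\<alpha>. separating N \<alpha>"
  shows "simple_cstar_algebra (kgraph_cstar \<Lambda>)"
proof -
  define B where "B = kgraph_cstar \<Lambda>"
  define p where "p = ck_seminorm \<Lambda>"
  define E where "E = kgraph_cstar_of \<Lambda> (fgen e)"
  interpret p: ck_family \<Lambda> e p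
    unfolding p_def
    by unfold_locales (use cstar_seminorm_ck_seminorm[OF kgraph_axioms] ck_seminorm_relator[OF kgraph_axioms] in auto)
  have B_eq: "B = p.B" by (simp add: B_def kgraph_cstar_def p_def)
  have of_eq: "kgraph_cstar_of \<Lambda> = (\<lambda>x. p.cls (\<lambda>n. x))"
    by (simp add: kgraph_cstar_of_def p_def fun_eq_iff)
  interpret B: cstar_algebra B unfolding B_eq by (rule p.cstar_algebra_completion)
  have unit: "cmult B E Y = Y" "cmult B Y E = Y" if "Y \<in> carrier B" for Y
  proof -
    obtain v where v: "v \<in> p.C" "Y = p.cls v" using \<open>Y \<in> carrier B\<close> unfolding B_eq by (rule p.carrier_cases)
    note C = p.C_mult[OF p.C_const[OF p.E_F] v(1)] p.C_mult[OF v(1) p.C_const[OF p.E_F]]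
    have "p (fgen e * v n - v n) = 0" "p (v n * fgen e - v n) = 0" for n
      using p.E_left[OF p.C_F[OF v(1)]] p.E_right[OF p.C_F[OF v(1)]] by (simp_all add: p.eqv_def)
    then show "cmult B E Y = Y" "cmult B Y E = Y"
      unfolding E_def of_eq B_eq v(2) p.cls_mult[OF p.C_const[OF p.E_F] v(1)] p.cls_mult[OF v(1) p.C_const[OF p.E_F]]
      by (simp_all add: p.cls_eq_iff C v(1))
  qed
  have of: "kgraph_cstar_of \<Lambda> x \<in> carrier B" "cnorm B (kgraph_cstar_of \<Lambda> x) = p x"
    "kgraph_cstar_of \<Lambda> (fscale c x) = cscale B c (kgraph_cstar_of \<Lambda> x)"
    "kgraph_cstar_of \<Lambda> (fadj x) = cadj B (kgraph_cstar_of \<Lambda> x)" if "x \<in> p.F" for x c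
    using that p.cls_closed[OF p.C_const[OF that]] p.cls_norm_eqI[OF p.C_const[OF that], of "p x"]
    by (simp_all add: of_eq B_eq p.cls_scale p.cls_adj p.C_const)
  have of2: "kgraph_cstar_of \<Lambda> (x + y) = cadd B (kgraph_cstar_of \<Lambda> x) (kgraph_cstar_of \<Lambda> y)"
    "kgraph_cstar_of \<Lambda> (x * y) = cmult B (kgraph_cstar_of \<Lambda> x) (kgraph_cstar_of \<Lambda> y)"
    if "x \<in> p.F" "y \<in> p.F" for x y
    using that by (simp_all add: of_eq B_eq p.cls_add p.cls_mult p.C_const)
  interpret B: unital_cstar_algebra B E
    by unfold_locales (use unit of(1)[OF p.E_F] in \<open>auto simp: E_def\<close>)
  interpret tails: kgraph_set \<Lambda> e "tail_class \<theta> ` M" "prefix \<theta>" by (rule kgraph_set_tails[OF \<theta>])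
  have "tails.rep_norm (fgen e) \<le> p (fgen e)"
    unfolding p_def using tails.nonzero_ck_seminorm(1,2)
    by (intro ck_seminorm_upper[OF kgraph_axioms p.E_F]) blast+
  then have "0 < p (fgen e)" using tails.nonzero_ck_seminorm(3) tails.rep_norm_nonneg[OF p.E_F] by linarith
  then have E0: "E \<noteq> czero B" using B.norm_eq_zero[OF B.unit_closed] of(2)[OF p.E_F] by (auto simp: E_def)
  have "I = {czero B}" if I: "closed_ideal I B" and proper: "I \<noteq> carrier B" for I
  proof -
    have "E \<notin> I"
    proof
      assume "E \<in> I"
      then have "Y \<in> I" if "Y \<in> carrier B" for Y
        using B.ideal_closed(5)[OF I _ that, of E] unit that by simp
      then show False using proper B.ideal_closed(1)[OF I] by blast
    qed
    define q where "q x = B.ideal_dist I (kgraph_cstar_of \<Lambda> x)" for x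
    have cs: "cstar_seminorm M q"
      unfolding cstar_seminorm_def q_def
      using B.ideal_dist_nonneg[OF I] B.ideal_dist_cstar_identity[OF I] B.ideal_dist_scale[OF I]
        B.ideal_dist_add[OF I] B.ideal_dist_mult[OF I]
      by (simp add: of of2 p.F_closed)
    interpret q: ck_pair \<Lambda> e q
    proof
      show "cstar_seminorm M q" by (rule cs)
      show "q r = 0" if "r \<in> ck_relators \<Lambda>" for r
      proof -
        have "kgraph_cstar_of \<Lambda> r = czero B"
          using kgraph_cstar_relations(2)[OF kgraph_axioms that] by (simp add: B_def)
        then show ?thesis using B.ideal_dist_eq_zero[OF I B.ideal_closed(2)[OF I]] by (simp add: q_def)
      qed
      show "q (fgen e) \<noteq> 0"
        using B.ideal_dist_zeroD[OF I B.unit_closed] \<open>E \<notin> I\<close> by (auto simp: q_def E_def)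
      show "\<exists>\<alpha>. separating N \<alpha>" for N by (rule sep)
    qed
    have "Y = czero B" if Y: "Y \<in> I" for Y
    proof -
      have Yc: "Y \<in> carrier B" using B.ideal_closed(1)[OF I Y] .
      \<comment> \<open>For x within d of Y, \<parallel>Y\<parallel> is at most d + p x, and p x = q
        x is the distance from x to the ideal, hence at most the distance from x to Y.\<close>
      have le: "cnorm B Y \<le> 2 * d" if d: "0 < d" for d
      proof -
        obtain x where x: "x \<in> p.F" "cdist B Y (kgraph_cstar_of \<Lambda> x) \<le> d"
          using kgraph_cstar_relations(3)[OF kgraph_axioms Yc[unfolded B_def] d] unfolding B_def by blast
        have "p x = q x" unfolding p_def by (rule q.seminorm_unique[OF x(1)])
        also have "\<dots> \<le> cdist B (kgraph_cstar_of \<Lambda> x) Y"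
          unfolding q_def B.dist_minus by (rule B.ideal_dist_le[OF I of(1)[OF x(1)] Y])
        also have "\<dots> \<le> d" using x(2) B.dist_commute[OF Yc of(1)[OF x(1)]] by simp
        finally have "cnorm B (kgraph_cstar_of \<Lambda> x) \<le> d" using of(2)[OF x(1)] by simp
        then show ?thesis using B.norm_le_dist[OF Yc of(1)[OF x(1)]] x(2) by simp
      qed
      have "cnorm B Y \<le> 0 + d" if "0 < d" for d using le[of "d / 2"] that by simp
      then have "cnorm B Y \<le> 0" by (rule field_le_epsilon)
      then show ?thesis using B.norm_eq_zero[OF Yc] B.norm_nonneg[OF Yc] by simp
    qed
    then show ?thesis using B.ideal_closed(2)[OF I] by blast
  qed
  then show ?thesis
    unfolding simple_cstar_algebra_def B_def[symmetric]
    using B.cstar_algebra_axioms E0 B.unit_closed by blast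
qed

end

section \<open>The group acting on the product of trees\<close>

text \<open>The coordinate \<open>c i g\<close> stands for the i-th component of the vertex g base.
  The action factors through the trees by \<open>coord_translate\<close>, edges lift to every vertex
  over the same tree vertex by \<open>coord_lift\<close>, and G is identified with the full product
  by \<open>coord_inject\<close> and \<open>coord_surj\<close>.\<close>

locale tree_coordinates = group G for G (structure) +
  fixes A :: "'k::finite \<Rightarrow> 'a set" and c :: "'k \<Rightarrow> 'a \<Rightarrow> 't"
  assumes A_carrier: "A i \<subseteq> carrier G"
    and A_finite: "finite (A i)"
    and A_nonempty: "A i \<noteq> {}"
    and A_inv: "a \<in> A i \<Longrightarrow> inv a \<in> A i"
    and A_inv_free: "a \<in> A i \<Longrightarrow> inv a \<noteq> a"
    and coord_step: "\<lbrakk>g \<in> carrier G; a \<in> A j; j \<noteq> i\<rbrakk> \<Longrightarrow> c i (g \<otimes> a) = c i g"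
    and coord_inject: "\<lbrakk>g \<in> carrier G; h \<in> carrier G; \<And>i. c i g = c i h\<rbrakk> \<Longrightarrow> g = h"
    and coord_translate: "\<lbrakk>k \<in> carrier G; g \<in> carrier G; h \<in> carrier G; c i g = c i h\<rbrakk>
      \<Longrightarrow> c i (k \<otimes> g) = c i (k \<otimes> h)"
    and coord_lift: "\<lbrakk>g \<in> carrier G; h \<in> carrier G; a \<in> A i; c i g = c i h\<rbrakk>
      \<Longrightarrow> \<exists>a'\<in>A i. c i (h \<otimes> a') = c i (g \<otimes> a)"
    and coord_surj: "(\<And>i. f i \<in> carrier G) \<Longrightarrow> \<exists>g\<in>carrier G. \<forall>i. c i g = c i (f i)"

section \<open>Tree coordinates from the action\<close>

context one_vertex_cube_complex
begin

interpretation action: group_action G "tree_prod V" \<phi>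
  by (rule action)

lemma tree_prod_upd: "x \<in> tree_prod V \<Longrightarrow> v \<in> V j \<Longrightarrow> x(j := v) \<in> tree_prod V"
  by (simp add: tree_prod_def)

lemma action_closed: "g \<in> carrier G \<Longrightarrow> x \<in> tree_prod V \<Longrightarrow> \<phi> g x \<in> tree_prod V"
  by (rule action.element_image[OF _ _ refl])

lemma action_mult: "\<lbrakk>g \<in> carrier G; h \<in> carrier G; x \<in> tree_prod V\<rbrakk> \<Longrightarrow> \<phi> (g \<otimes> h) x = \<phi> g (\<phi> h x)"
  using action.composition_rule by simp

lemma action_one: "x \<in> tree_prod V \<Longrightarrow> \<phi> \<one> x = x"
  using fun_cong[OF action.id_eq_one, of x] by simp

text \<open>Move from x j to v along a path in tree j: each step is an edge of colour j, the action
  preserves it, and such an edge leaves coordinate i fixed.\<close>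

lemma action_one_coord:
  assumes k: "k \<in> carrier G" and x: "x \<in> tree_prod V" and v: "v \<in> V j" and ij: "i \<noteq> j"
  shows "\<phi> k (x(j := v)) i = \<phi> k x i"
proof -
  have "(x j, v) \<in> (E j)\<^sup>*" using tree[of j] x v by (auto simp: is_tree_def tree_prod_def)
  then have "\<phi> k (x(j := v)) i = \<phi> k x i \<and> v \<in> V j"
  proof (induction rule: rtrancl_induct)
    case base
    then show ?case using x by (simp add: tree_prod_def)
  next
    case (step v w)
    have w: "w \<in> V j" using tree[of j] step.hyps by (auto simp: is_tree_def)
    have "colour_adj E j (x(j := v)) (x(j := w))" using step.hyps by (simp add: colour_adj_def)
    then have "colour_adj E j (\<phi> k (x(j := v))) (\<phi> k (x(j := w)))"
      using action_colour_adj[OF k] tree_prod_upd[OF x] step.IH w by blast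
    then have "\<phi> k (x(j := v)) i = \<phi> k (x(j := w)) i" using ij unfolding colour_adj_def by blast
    with step.IH w show ?case by (simp only:)
  qed
  then show ?thesis by simp
qed

text \<open>There are finitely many colours, so the other coordinates can be exchanged one at a
  time.\<close>

lemma action_coord:
  assumes k: "k \<in> carrier G" and x: "x \<in> tree_prod V" and y: "y \<in> tree_prod V" and eq: "x i = y i"
  shows "\<phi> k x i = \<phi> k y i"
proof -
  have "\<phi> k x i = \<phi> k y i" if "finite S" "i \<notin> S" "x \<in> tree_prod V" "\<And>j. j \<notin> S \<Longrightarrow> x j = y j" for S x
    using that
  proof (induction S arbitrary: x rule: finite_induct)
    case empty
    then have "x = y" by (simp add: fun_eq_iff)
    then show ?case by simp
  next
    case (insert l S)
    have yl: "y l \<in> V l" using y by (simp add: tree_prod_def)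
    have "\<phi> k (x(l := y l)) i = \<phi> k y i"
      using insert.prems yl by (intro insert.IH tree_prod_upd) auto
    then show ?case using action_one_coord[OF k insert.prems(2) yl] insert.prems(1) by auto
  qed
  from this[of "UNIV - {i}" x] show ?thesis using x eq by auto
qed

abbreviation coord :: "'c \<Rightarrow> 'a \<Rightarrow> 'd" where
  "coord i g \<equiv> \<phi> g base i"

lemma adj_translate:
  assumes "g \<in> carrier G" "a \<in> A i" shows "colour_adj E i (\<phi> g base) (\<phi> (g \<otimes> a) base)"
proof -
  have a: "a \<in> carrier G" using assms A_carrier by blast
  have "\<phi> a base \<in> {y \<in> tree_prod V. colour_adj E i base y}" unfolding edge_labels using assms by blast
  then have "colour_adj E i (\<phi> g base) (\<phi> g (\<phi> a base))" using action_colour_adj[OF assms(1) base] by blast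
  then show ?thesis using action_mult[OF assms(1) a base] by simp
qed

theorem tree_coordinates: "tree_coordinates G A coord"
proof
  fix i
  show "A i \<subseteq> carrier G" "finite (A i)" "A i \<noteq> {}"
    by (rule A_carrier A_finite A_nonempty)+
  show "inv a \<in> A i" "inv a \<noteq> a" if "a \<in> A i" for a
    using that by (rule A_inv A_inv_free)+
  show "coord i (g \<otimes> a) = coord i g" if "g \<in> carrier G" "a \<in> A j" "j \<noteq> i" for g a j
    using adj_translate[OF that(1,2)] that(3) by (simp add: colour_adj_def)
  show "coord i (k \<otimes> g) = coord i (k \<otimes> h)"
    if "k \<in> carrier G" "g \<in> carrier G" "h \<in> carrier G" "coord i g = coord i h" for k g h
    unfolding action_mult[OF that(1,2) base] action_mult[OF that(1,3) base]
    by (rule action_coord[OF that(1) action_closed[OF that(2) base] action_closed[OF that(3) base] that(4)])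
  show "\<exists>a'\<in>A i. coord i (h \<otimes> a') = coord i (g \<otimes> a)"
    if g: "g \<in> carrier G" and h: "h \<in> carrier G" and a: "a \<in> A i" and eq: "coord i g = coord i h" for g h a
  proof -
    have ga: "g \<otimes> a \<in> carrier G" using g a A_carrier by blast
    \<comment> \<open>The neighbour of h base in direction i over the prescribed tree vertex.
      Translated by the inverse of h it becomes a neighbour of the base, whose label is the required
      a'.\<close>
    define y where "y = (\<phi> h base)(i := coord i (g \<otimes> a))"
    have hb: "\<phi> h base \<in> tree_prod V" "\<phi> (g \<otimes> a) base \<in> tree_prod V"
      using h ga base action_closed by auto
    then have y: "y \<in> tree_prod V" unfolding y_def by (intro tree_prod_upd) (auto simp: tree_prod_def)
    have "colour_adj E i (\<phi> h base) y"
      using adj_translate[OF g a] eq by (simp add: colour_adj_def y_def)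
    then have "colour_adj E i (\<phi> (inv h) (\<phi> h base)) (\<phi> (inv h) y)"
      using action_colour_adj[of "inv h"] h hb y by simp
    moreover have "\<phi> (inv h) (\<phi> h base) = base"
      using action_mult[of "inv h" h base] action_one h base by simp
    moreover have "\<phi> (inv h) y \<in> tree_prod V" using action_closed h y by simp
    ultimately have "\<phi> (inv h) y \<in> (\<lambda>a. \<phi> a base) ` A i" unfolding edge_labels[symmetric] by simp
    then obtain a' where a': "a' \<in> A i" "\<phi> (inv h) y = \<phi> a' base" by blast
    then have "a' \<in> carrier G" using A_carrier by blast
    then have "\<phi> (h \<otimes> a') base = \<phi> h (\<phi> (inv h) y)" using a' h base by (simp add: action_mult)
    also have "\<dots> = y" using action_mult[of h "inv h" y] action_one h y by simp
    finally show ?thesis by (intro bexI[OF _ a'(1)]) (simp add: y_def)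
  qed
next
  fix g h assume g: "g \<in> carrier G" and h: "h \<in> carrier G" and eq: "\<And>i. coord i g = coord i h"
  have "\<phi> g base = \<phi> h base" using eq by (simp add: fun_eq_iff)
  then show "g = h" using simply_transitive[OF base action_closed[OF h base]] g h by blast
next
  fix f :: "'c \<Rightarrow> 'a" assume f: "\<And>i. f i \<in> carrier G"
  have "(\<lambda>i. coord i (f i)) \<in> tree_prod V"
    using action_closed[OF f base] by (simp add: tree_prod_def)
  from simply_transitive[OF base this] obtain g where g: "g \<in> carrier G" "\<phi> g base = (\<lambda>i. coord i (f i))"
    by blast
  then have "\<forall>i. coord i g = coord i (f i)" by simp
  with g(1) show "\<exists>g\<in>carrier G. \<forall>i. coord i g = coord i (f i)" by blast
qed

end

section \<open>The square congruence on words\<close>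

lemma square_cong_refl: "(w, w) \<in> square_cong G A"
  by (simp add: square_cong_def)

lemma square_cong_trans: "(u, v) \<in> square_cong G A \<Longrightarrow> (v, w) \<in> square_cong G A \<Longrightarrow> (u, w) \<in> square_cong G A"
  unfolding square_cong_def by (rule rtrancl_trans)

lemma square_cong_sym: assumes "(u, v) \<in> square_cong G A" shows "(v, u) \<in> square_cong G A"
proof -
  have "sym (square_steps G A \<union> (square_steps G A)\<inverse>)" by (auto simp: sym_def)
  from sym_rtrancl[OF this] show ?thesis using assms by (auto simp: square_cong_def sym_def)
qed

lemma square_steps_context:
  assumes "(u, v) \<in> square_steps G A" "x \<in> lists (cube_letters A)" "y \<in> lists (cube_letters A)"
  shows "(x @ u @ y, x @ v @ y) \<in> square_steps G A"
proof -
  from assms(1) obtain u' v' i j a a' b b' where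
    eq: "u = u' @ [(j, b), (i, a)] @ v'" "v = u' @ [(i, a'), (j, b')] @ v'"
    and s: "u' \<in> lists (cube_letters A)" "v' \<in> lists (cube_letters A)" "i \<noteq> j"
      "a \<in> A i" "a' \<in> A i" "b \<in> A j" "b' \<in> A j" "a \<otimes>\<^bsub>G\<^esub> b = b' \<otimes>\<^bsub>G\<^esub> a'"
    unfolding square_steps_def by blast
  show ?thesis
    unfolding square_steps_def
  proof (intro CollectI exI conjI)
    show "(x @ u @ y, x @ v @ y) = ((x @ u') @ [(j, b), (i, a)] @ (v' @ y), (x @ u') @ [(i, a'), (j, b')] @ (v' @ y))"
      by (simp add: eq)
  qed (use s assms in auto)
qed

lemma square_cong_context:
  assumes "(u, v) \<in> square_cong G A" "x \<in> lists (cube_letters A)" "y \<in> lists (cube_letters A)"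
  shows "(x @ u @ y, x @ v @ y) \<in> square_cong G A"
  using assms(1) unfolding square_cong_def
proof (induction rule: rtrancl_induct)
  case (step v w)
  then have "(x @ v @ y, x @ w @ y) \<in> square_steps G A \<union> (square_steps G A)\<inverse>"
    using square_steps_context[OF _ assms(2,3)] by blast
  with step.IH show ?case by (rule rtrancl_into_rtrancl)
qed simp

section \<open>Words as tuples of walks in the trees\<close>

context tree_coordinates
begin

abbreviation "Lt \<equiv> cube_letters A"
abbreviation "W \<equiv> lists Lt"
abbreviation "cong \<equiv> square_cong G A"

lemma letter_iff: "(i, a) \<in> Lt \<longleftrightarrow> a \<in> A i"
  by (simp add: cube_letters_def)

lemma A_carrierD: "a \<in> A i \<Longrightarrow> a \<in> carrier G"
  using A_carrier by blast

lemma coord_cancel: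
  assumes g: "g \<in> carrier G" and a: "a \<in> A i" "b \<in> A i" and eq: "c i (g \<otimes> a) = c i (g \<otimes> b)"
  shows "a = b"
proof -
  have ab: "a \<in> carrier G" "b \<in> carrier G" using a A_carrierD by auto
  have "c j (g \<otimes> a) = c j (g \<otimes> b)" for j
    using eq coord_step[OF g a(1), of j] coord_step[OF g a(2), of j] by (cases "j = i") auto
  then have "g \<otimes> a = g \<otimes> b" using g ab by (intro coord_inject) auto
  then show ?thesis using g ab by simp
qed

text \<open>The edge b at a is lifted to the identity, which is possible because a and 1 agree in
  tree j; this gives b'. The edge a at 1 is lifted to b', giving a'. The two products then have the
  same coordinates.\<close>

lemma square:
  assumes ij: "i \<noteq> j" and a: "a \<in> A i" and b: "b \<in> A j"
  shows "\<exists>!p. p \<in> A j \<times> A i \<and> a \<otimes> b = fst p \<otimes> snd p"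
proof -
  have G: "a \<in> carrier G" "b \<in> carrier G" using a b A_carrierD by auto
  have "c j a = c j \<one>" using coord_step[OF one_closed a, of j] ij G by simp
  then obtain b' where b': "b' \<in> A j" "c j b' = c j (a \<otimes> b)"
    using coord_lift[OF G(1) one_closed b] A_carrierD by fastforce
  have "c i \<one> = c i b'" using coord_step[OF one_closed b'(1), of i] ij A_carrierD[OF b'(1)] by simp
  then obtain a' where a': "a' \<in> A i" "c i (b' \<otimes> a') = c i a"
    using coord_lift[OF one_closed A_carrierD[OF b'(1)] a] G by auto
  have G': "b' \<in> carrier G" "a' \<in> carrier G" using a' b' A_carrierD by auto
  have "a \<otimes> b = b' \<otimes> a'"
  proof (rule coord_inject)
    fix l
    show "c l (a \<otimes> b) = c l (b' \<otimes> a')"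
      using a' b' ij coord_step[OF G(1) b, of l] coord_step[OF G'(1) a'(1), of l]
        coord_step[OF one_closed a, of l] coord_step[OF one_closed b'(1), of l] G G'
      by (cases "l = i"; cases "l = j") auto
  qed (use G G' in auto)
  moreover have "(b'', a'') = (b', a')" if "b'' \<in> A j" "a'' \<in> A i" "a \<otimes> b = b'' \<otimes> a''" for a'' b''
  proof -
    have G'': "b'' \<in> carrier G" "a'' \<in> carrier G" using that A_carrierD by auto
    have "c j (\<one> \<otimes> b'') = c j (\<one> \<otimes> b')"
      using coord_step[OF G''(1) that(2), of j] ij G'' G' that(3) b'(2) by auto
    then have "b'' = b'" by (rule coord_cancel[OF one_closed that(1) b'(1)])
    then show ?thesis using that(3) \<open>a \<otimes> b = b' \<otimes> a'\<close> G' G'' by simp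
  qed
  ultimately show ?thesis using a' b' by (intro ex1I[of _ "(b', a')"]) auto
qed

text \<open>A word is read from left to right as a walk in the Cayley graph that follows the inverses of
  its letters.  In the product of trees it is a tuple of walks in the factors, and this tuple
  determines the morphism represented by the word.\<close>

primrec endpoint :: "'a \<Rightarrow> ('k \<times> 'a) list \<Rightarrow> 'a" where
  "endpoint g [] = g"
| "endpoint g (l # w) = endpoint (g \<otimes> inv (snd l)) w"

primrec track :: "'k \<Rightarrow> 'a \<Rightarrow> ('k \<times> 'a) list \<Rightarrow> 't list" where
  "track i g [] = []"
| "track i g (l # w) = (if fst l = i then c i (g \<otimes> inv (snd l)) # track i (g \<otimes> inv (snd l)) w
     else track i (g \<otimes> inv (snd l)) w)"

lemma W_simps: "[] \<in> W" "(i, a) # w \<in> W \<longleftrightarrow> a \<in> A i \<and> w \<in> W" "u @ v \<in> W \<longleftrightarrow> u \<in> W \<and> v \<in> W"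
  by (auto simp: letter_iff)

lemma W_induct [consumes 1, case_names Nil Cons]:
  assumes "w \<in> W" "P []" "\<And>i a w. a \<in> A i \<Longrightarrow> w \<in> W \<Longrightarrow> P w \<Longrightarrow> P ((i, a) # w)"
  shows "P w"
  using assms(1)
proof (induction w)
  case (Cons l w)
  then show ?case using assms(3)[of "snd l" "fst l" w] W_simps(2)[of "fst l" "snd l" w] by simp
qed (rule assms)

lemma step_closed: "g \<in> carrier G \<Longrightarrow> a \<in> A i \<Longrightarrow> g \<otimes> inv a \<in> carrier G"
  using A_carrierD by auto

lemma endpoint_closed: "w \<in> W \<Longrightarrow> g \<in> carrier G \<Longrightarrow> endpoint g w \<in> carrier G"
  by (induction w arbitrary: g rule: W_induct) (simp_all add: step_closed)

lemma track_append: "track i g (u @ v) = track i g u @ track i (endpoint g u) v"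
  by (induction u arbitrary: g) simp_all

lemma length_track: "length (track i g w) = word_deg w $ i"
  by (induction w arbitrary: g) (simp_all add: word_deg_def)

lemma coord_endpoint:
  "w \<in> W \<Longrightarrow> g \<in> carrier G \<Longrightarrow> c i (endpoint g w) = last (c i g # track i g w)"
proof (induction w arbitrary: g rule: W_induct)
  case (Cons j a w)
  have "c i (g \<otimes> inv a) = c i g" if "j \<noteq> i"
    using coord_step[OF Cons.prems A_inv[OF Cons.hyps(1)] that] .
  then show ?case using Cons.IH[OF step_closed[OF Cons.prems Cons.hyps(1)]] by auto
qed simp

lemma endpoint_eq:
  assumes "u \<in> W" "v \<in> W" "g \<in> carrier G" "\<And>i. track i g u = track i g v"
  shows "endpoint g u = endpoint g v"
  using assms by (intro coord_inject endpoint_closed) (simp_all add: coord_endpoint)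

text \<open>The action of \<open>k\<close> on the i-th tree; by \<open>coord_translate\<close> the
  chosen representative does not matter.\<close>

definition translate :: "'a \<Rightarrow> 'k \<Rightarrow> 't \<Rightarrow> 't" where
  "translate k i t = c i (k \<otimes> (SOME g. g \<in> carrier G \<and> c i g = t))"

lemma translate_coord:
  assumes "k \<in> carrier G" "g \<in> carrier G" shows "translate k i (c i g) = c i (k \<otimes> g)"
proof -
  have "(SOME h. h \<in> carrier G \<and> c i h = c i g) \<in> carrier G \<and> c i (SOME h. h \<in> carrier G \<and> c i h = c i g) = c i g"
    by (rule someI[of _ g]) (use assms in simp)
  then show ?thesis unfolding translate_def using assms by (intro coord_translate) auto
qed

lemma track_translate:
  assumes "w \<in> W" "k \<in> carrier G" "g \<in> carrier G"
  shows "track i (k \<otimes> g) w = map (translate k i) (track i g w)"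
  using assms(1,3)
proof (induction w arbitrary: g rule: W_induct)
  case (Cons j a w)
  have a: "inv a \<in> carrier G" using Cons.hyps A_carrierD by auto
  have "k \<otimes> g \<otimes> inv a = k \<otimes> (g \<otimes> inv a)" using assms(2) Cons.prems a by (rule m_assoc)
  then show ?case
    using Cons.IH[of "g \<otimes> inv a"] Cons.prems a assms(2) by (simp add: translate_coord)
qed simp

lemma track_base_eq:
  assumes "u \<in> W" "v \<in> W" "g \<in> carrier G" "h \<in> carrier G" "track i g u = track i g v"
  shows "track i h u = track i h v"
proof -
  have "h = (h \<otimes> inv g) \<otimes> g" using assms by (simp add: m_assoc)
  then show ?thesis using track_translate[of _ "h \<otimes> inv g" g i] assms by (metis inv_closed m_closed)
qed

definition track_eq :: "('k \<times> 'a) list \<Rightarrow> ('k \<times> 'a) list \<Rightarrow> bool" where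
  "track_eq u v \<longleftrightarrow> (\<forall>i. track i \<one> u = track i \<one> v)"

lemma track_eqD: "track_eq u v \<Longrightarrow> u \<in> W \<Longrightarrow> v \<in> W \<Longrightarrow> g \<in> carrier G \<Longrightarrow> track i g u = track i g v"
  unfolding track_eq_def using track_base_eq[OF _ _ one_closed] by blast

lemma track_eqI: "u \<in> W \<Longrightarrow> v \<in> W \<Longrightarrow> g \<in> carrier G \<Longrightarrow> (\<And>i. track i g u = track i g v) \<Longrightarrow> track_eq u v"
  unfolding track_eq_def using track_base_eq[OF _ _ _ one_closed] by blast

lemma track_eq_word_deg: "track_eq u v \<Longrightarrow> word_deg u = word_deg v"
  unfolding track_eq_def vec_eq_iff by (metis length_track)

lemma track_eq_append:
  assumes "track_eq u u'" "track_eq v v'" "u \<in> W" "u' \<in> W" "v \<in> W" "v' \<in> W"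
  shows "track_eq (u @ v) (u' @ v')"
proof -
  have "endpoint \<one> u = endpoint \<one> u'" using assms by (intro endpoint_eq) (auto simp: track_eq_def)
  moreover have "track i (endpoint \<one> u) v = track i (endpoint \<one> u) v'" for i
    using assms by (intro track_eqD endpoint_closed) auto
  ultimately show ?thesis using assms(1) by (simp add: track_eq_def track_append)
qed

text \<open>The degrees fix where the tracks are cut, and the endpoints of the first parts agree
  because their coordinates do. This is the uniqueness half of the factorization.\<close>

lemma track_eq_append_cancel:
  assumes "track_eq (u @ v) (u' @ v')" "u \<in> W" "u' \<in> W" "v \<in> W" "v' \<in> W" "word_deg u = word_deg u'"
  shows "track_eq u u'" "track_eq v v'"
proof -
  have eq: "track i \<one> u = track i \<one> u' \<and> track i (endpoint \<one> u) v = track i (endpoint \<one> u') v'" for i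
    using assms(1,6) by (simp add: track_eq_def track_append append_eq_append_conv length_track)
  then show u: "track_eq u u'" by (simp add: track_eq_def)
  have "endpoint \<one> u = endpoint \<one> u'" using assms eq by (intro endpoint_eq) auto
  then show "track_eq v v'"
    using eq assms by (intro track_eqI[of v v' "endpoint \<one> u"]) (simp_all add: endpoint_closed)
qed

text \<open>Inverting a b = b' a' gives an equation between the inverses in the order in which the
  words are read; this is why walks follow inverse letters.\<close>

lemma track_square:
  assumes ij: "i \<noteq> j" and a: "a \<in> A i" "a' \<in> A i" and b: "b \<in> A j" "b' \<in> A j"
  shows "track_eq [(j, b), (i, a)] [(i, a'), (j, b')] \<longleftrightarrow> a \<otimes> b = b' \<otimes> a'"
proof -
  have G: "a \<in> carrier G" "a' \<in> carrier G" "b \<in> carrier G" "b' \<in> carrier G" using a b A_carrierD by auto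
  have W: "[(j, b), (i, a)] \<in> W" "[(i, a'), (j, b')] \<in> W" using a b by (simp_all add: letter_iff)
  have "a \<otimes> b = b' \<otimes> a' \<longleftrightarrow> inv (a \<otimes> b) = inv (b' \<otimes> a')" using G by (metis inv_inv m_closed)
  then have inv: "a \<otimes> b = b' \<otimes> a' \<longleftrightarrow> inv b \<otimes> inv a = inv a' \<otimes> inv b'" using G by (simp add: inv_mult_group)
  show ?thesis
    unfolding inv
  proof
    assume "track_eq [(j, b), (i, a)] [(i, a'), (j, b')]"
    then have "endpoint \<one> [(j, b), (i, a)] = endpoint \<one> [(i, a'), (j, b')]"
      using W by (intro endpoint_eq) (auto simp: track_eq_def)
    then show "inv b \<otimes> inv a = inv a' \<otimes> inv b'" using G by simp
  next
    assume eq: "inv b \<otimes> inv a = inv a' \<otimes> inv b'"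
    have "c i (inv b \<otimes> inv a) = c i (inv a')"
      unfolding eq using ij G b by (intro coord_step[of _ _ j] A_inv) auto
    moreover have "c j (inv b) = c j (inv a' \<otimes> inv b')"
      unfolding eq[symmetric] using ij G a by (intro coord_step[of _ _ i, symmetric] A_inv) auto
    ultimately show "track_eq [(j, b), (i, a)] [(i, a'), (j, b')]"
      using ij G by (auto simp: track_eq_def)
  qed
qed

lemma square_steps_track:
  assumes "(u, v) \<in> square_steps G A" shows "u \<in> W \<and> v \<in> W \<and> track_eq u v"
proof -
  from assms obtain x y i j a a' b b' where
    eq: "u = x @ [(j, b), (i, a)] @ y" "v = x @ [(i, a'), (j, b')] @ y"
    and s: "x \<in> W" "y \<in> W" "i \<noteq> j"
      "a \<in> A i" "a' \<in> A i" "b \<in> A j" "b' \<in> A j" "a \<otimes> b = b' \<otimes> a'"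
    unfolding square_steps_def by blast
  have "track_eq [(j, b), (i, a)] [(i, a'), (j, b')]" using s track_square by blast
  then show ?thesis
    unfolding eq using s
    by (intro conjI track_eq_append) (auto simp: letter_iff track_eq_def)
qed

lemma cong_track:
  assumes "(u, v) \<in> cong" "u \<in> W" shows "v \<in> W \<and> track_eq u v"
  using assms(1) unfolding square_cong_def
proof (induction rule: rtrancl_induct)
  case base
  then show ?case using assms(2) by (simp add: track_eq_def)
next
  case (step v w)
  then have "track_eq v w \<and> w \<in> W"
    using square_steps_track[of v w] square_steps_track[of w v] by (auto simp: track_eq_def)
  then show ?case using step.IH by (simp add: track_eq_def)
qed

text \<open>A letter of colour i is carried to the front through squares with the letters before
  it.\<close>

lemma cong_extract:
  assumes "v \<in> W" "word_deg v $ i \<noteq> 0"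
  shows "\<exists>b w. b \<in> A i \<and> w \<in> W \<and> (v, (i, b) # w) \<in> cong"
  using assms
proof (induction v rule: W_induct)
  case Nil
  then show ?case by (simp add: word_deg_def)
next
  case (Cons j d v)
  show ?case
  proof (cases "j = i")
    case True
    then show ?thesis using Cons square_cong_refl by blast
  next
    case False
    then have "word_deg v $ i \<noteq> 0" using Cons.prems by (simp add: word_deg_def)
    then obtain b w where bw: "b \<in> A i" "w \<in> W" "(v, (i, b) # w) \<in> cong" using Cons.IH by blast
    obtain d' b' where db: "d' \<in> A j" "b' \<in> A i" "b \<otimes> d = d' \<otimes> b'"
      using square[of i j b d] False bw(1) Cons.hyps(1) by (auto simp: Ex1_def)
    have "((j, d) # v, (j, d) # (i, b) # w) \<in> cong"
      using square_cong_context[OF bw(3), of "[(j, d)]" "[]"] Cons.hyps by (simp add: letter_iff)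
    moreover have "((j, d) # (i, b) # w, (i, b') # (j, d') # w) \<in> square_steps G A"
      unfolding square_steps_def
    proof (intro CollectI exI conjI)
      show "((j, d) # (i, b) # w, (i, b') # (j, d') # w)
          = ([] @ [(j, d), (i, b)] @ w, [] @ [(i, b'), (j, d')] @ w)" by simp
    qed (use False bw db Cons.hyps in auto)
    then have "((j, d) # (i, b) # w, (i, b') # (j, d') # w) \<in> cong"
      unfolding square_cong_def by blast
    ultimately have "((j, d) # v, (i, b') # (j, d') # w) \<in> cong" by (rule square_cong_trans)
    then show ?thesis using db bw by (intro exI[of _ b'] exI[of _ "(j, d') # w"]) (simp add: letter_iff)
  qed
qed

text \<open>For completeness, bring to the front of v a letter with the colour of the first letter
  of u. Equal tracks force these two letters to coincide and leave tails with equal tracks.\<close>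

theorem cong_iff_track_eq:
  assumes "u \<in> W" "v \<in> W" shows "(u, v) \<in> cong \<longleftrightarrow> track_eq u v"
proof
  show "(u, v) \<in> cong \<Longrightarrow> track_eq u v" using cong_track assms by blast
  show "track_eq u v \<Longrightarrow> (u, v) \<in> cong"
    using assms
  proof (induction u arbitrary: v rule: W_induct)
    case Nil
    from track_eq_word_deg[OF Nil.prems(1)]
    have "word_deg v = word_deg ([] :: ('k \<times> 'a) list)" by (rule sym)
    then have 0: "count_list (map fst v) i = 0" for i by (simp add: word_deg_def vec_eq_iff)
    have "v = []"
    proof (cases v)
      case (Cons l w)
      then show ?thesis using 0[of "fst l"] by simp
    qed simp
    then show ?case by (simp add: square_cong_refl)
  next
    case (Cons i a u)
    have "word_deg v = word_deg ((i, a) # u)" using track_eq_word_deg[OF Cons.prems(1)] by simp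
    then have "word_deg v $ i \<noteq> 0" by (simp add: word_deg_def)
    then obtain b w where bw: "b \<in> A i" "w \<in> W" "(v, (i, b) # w) \<in> cong"
      using cong_extract[OF Cons.prems(2)] by blast
    have "track_eq ((i, a) # u) ((i, b) # w)"
      using Cons.prems(1) cong_track[OF bw(3) Cons.prems(2)] by (simp add: track_eq_def)
    then have eq: "track_eq ([(i, a)] @ u) ([(i, b)] @ w)" by simp
    have W: "[(i, a)] \<in> W" "[(i, b)] \<in> W" using Cons.hyps bw by (simp_all add: letter_iff)
    have deg: "word_deg [(i, a)] = word_deg [(i, b)]" by (simp add: word_deg_def)
    have "track_eq [(i, a)] [(i, b)]" "track_eq u w"
      using track_eq_append_cancel[OF eq W Cons.hyps(2) bw(2) deg] by auto
    then have "track i \<one> [(i, a)] = track i \<one> [(i, b)]" by (simp only: track_eq_def)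
    then have "c i (\<one> \<otimes> inv a) = c i (\<one> \<otimes> inv b)" by simp
    then have "inv a = inv b"
      using Cons.hyps bw A_inv by (intro coord_cancel[OF one_closed]) auto
    then have "inv (inv a) = inv (inv b)" by simp
    then have "a = b" using A_carrierD[OF Cons.hyps(1)] A_carrierD[OF bw(1)] by simp
    moreover have "(u, w) \<in> cong" using Cons.IH \<open>track_eq u w\<close> bw(2) by blast
    ultimately have "((i, a) # u, (i, b) # w) \<in> cong"
      using square_cong_context[of u w G A "[(i, a)]" "[]"] Cons.hyps by (simp add: letter_iff)
    then show ?case using square_cong_sym[OF bw(3)] square_cong_trans by blast
  qed
qed

end

section \<open>Unique factorization and rigidity\<close>

lemma ex1_unique: "\<exists>!x. P x \<Longrightarrow> P x \<Longrightarrow> P y \<Longrightarrow> x = y"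
  by blast

context tree_coordinates
begin

abbreviation "\<Lambda> \<equiv> cube_kgraph G A"
abbreviation "cls w \<equiv> cong `` {w}"

lemma cls_eq: "w \<in> W \<Longrightarrow> cls w = {v \<in> W. track_eq w v}"
  using cong_track cong_iff_track_eq by blast

lemma cls_eq_iff: assumes "u \<in> W" "v \<in> W" shows "cls u = cls v \<longleftrightarrow> track_eq u v"
  unfolding cls_eq[OF assms(1)] cls_eq[OF assms(2)] using assms by (auto simp: track_eq_def)

lemma kg_mor_cube: "kg_mor \<Lambda> = (\<lambda>w. cls w) ` W"
  by (auto simp: cube_kgraph_def quotient_def)

lemma kg_src_cube: "kg_src \<Lambda> \<mu> = cls []" and kg_rng_cube: "kg_rng \<Lambda> \<mu> = cls []"
  by (simp_all add: cube_kgraph_def)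

lemma kg_comp_cube:
  assumes "u \<in> W" "v \<in> W" shows "kg_comp \<Lambda> (cls u) (cls v) = cls (u @ v)"
proof -
  have "cls (x @ y) = cls (u @ v)" if "x \<in> cls u" "y \<in> cls v" for x y
  proof -
    have "x \<in> W" "y \<in> W" "track_eq u x" "track_eq v y" using that assms by (auto simp: cls_eq)
    then have "track_eq (x @ y) (u @ v)" using assms by (intro track_eq_append) (auto simp: track_eq_def)
    then show ?thesis using assms \<open>x \<in> W\<close> \<open>y \<in> W\<close> by (subst cls_eq_iff) simp_all
  qed
  moreover have "u \<in> cls u" "v \<in> cls v" by (simp_all add: square_cong_refl)
  ultimately have "(\<Union>x\<in>cls u. \<Union>y\<in>cls v. cls (x @ y)) = cls (u @ v)" by blast
  then show ?thesis by (simp add: cube_kgraph_def)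
qed

lemma kg_deg_cube: assumes "w \<in> W" shows "kg_deg \<Lambda> (cls w) = word_deg w"
proof -
  have "(THE n. \<forall>v\<in>cls w. word_deg v = n) = word_deg w"
  proof (rule the_equality)
    show "\<forall>v\<in>cls w. word_deg v = word_deg w"
      unfolding cls_eq[OF assms] using track_eq_word_deg by (metis (mono_tags, lifting) mem_Collect_eq)
    show "n = word_deg w" if "\<forall>v\<in>cls w. word_deg v = n" for n
      using that square_cong_refl[of w G A] by auto
  qed
  then show ?thesis by (simp add: cube_kgraph_def)
qed

lemma word_deg_simps: "word_deg [] = 0" "word_deg (u @ v) = word_deg u + word_deg v"
  "word_deg ((i, a) # w) = axis i 1 + word_deg w"
  by (simp_all add: word_deg_def vec_eq_iff axis_def)

lemma word_deg_eq_zero: assumes "word_deg w = 0" shows "w = []"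
proof (cases w)
  case (Cons l v)
  have "count_list (map fst w) (fst l) = 0" using assms by (simp add: word_deg_def vec_eq_iff)
  then show ?thesis by (simp add: Cons)
qed

lemma kg_obj_cube: "kg_obj \<Lambda> = {cls []}"
  by (auto simp: kg_obj_def kg_mor_cube kg_src_cube kg_rng_cube)

lemma track_eq_cong: "(u, v) \<in> cong \<Longrightarrow> u \<in> W \<Longrightarrow> cls u = cls v"
  using cong_track cls_eq_iff by blast

text \<open>The existence half of the factorization: letters of the prescribed colours are brought
  to the front with \<open>cong_extract\<close>, one per unit of the total degree.\<close>

lemma split_word:
  assumes "w \<in> W" "m \<le> word_deg w"
  shows "\<exists>u\<in>W. \<exists>v\<in>W. word_deg u = m \<and> cls w = cls (u @ v)"
  using assms
proof (induction "\<Sum>i\<in>UNIV. m $ i" arbitrary: m w)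
  case 0
  then have "m = 0" by (simp add: vec_eq_iff)
  then show ?case using 0 by (intro bexI[of _ "[]"] bexI[of _ w]) (simp_all add: word_deg_simps)
next
  case (Suc n)
  obtain i where i: "m $ i \<noteq> 0" using Suc.hyps(2) by (cases "\<forall>i. m $ i = 0") auto
  have "m $ i \<le> word_deg w $ i" using Suc.prems(2) by (simp add: less_eq_vec_def)
  then have "word_deg w $ i \<noteq> 0" using i by simp
  then obtain b w' where b: "b \<in> A i" "w' \<in> W" "(w, (i, b) # w') \<in> cong"
    using cong_extract[OF Suc.prems(1)] by blast
  have W: "(i, b) # w' \<in> W" using b by (simp add: letter_iff)
  have deg: "word_deg w = axis i 1 + word_deg w'"
    using track_eq_word_deg[of w "(i, b) # w'"] cong_track[OF b(3) Suc.prems(1)] by (simp add: word_deg_simps)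
  define m' where "m' = m - axis i 1"
  have m: "m = axis i 1 + m'" using i by (auto simp: m'_def vec_eq_iff axis_def)
  have "(\<Sum>j\<in>UNIV. m $ j) = (\<Sum>j\<in>UNIV. axis i 1 $ j) + (\<Sum>j\<in>UNIV. m' $ j)"
    unfolding m by (simp add: sum.distrib)
  also have "(\<Sum>j\<in>UNIV. axis i (1::nat) $ j) = 1" by (simp add: axis_def)
  finally have "n = (\<Sum>j\<in>UNIV. m' $ j)" using Suc.hyps(2) by simp
  moreover have "m' \<le> word_deg w'" using Suc.prems(2) unfolding deg m by (simp add: less_eq_vec_def)
  ultimately obtain u v where uv: "u \<in> W" "v \<in> W" "word_deg u = m'" "cls w' = cls (u @ v)"
    using Suc.hyps(1) b(2) by blast
  have "cls w = cls ((i, b) # w')" by (rule track_eq_cong[OF b(3) Suc.prems(1)])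
  also have "\<dots> = kg_comp \<Lambda> (cls [(i, b)]) (cls w')"
    using kg_comp_cube[of "[(i, b)]" w'] b by (simp add: letter_iff)
  also have "\<dots> = cls (((i, b) # u) @ v)"
    unfolding uv(4) using kg_comp_cube[of "[(i, b)]" "u @ v"] b uv by (simp add: letter_iff)
  finally show ?case
    using b uv m by (intro bexI[of _ "(i, b) # u"] bexI[of _ v]) (auto simp: word_deg_simps letter_iff)
qed

lemma finite_Lt: "finite Lt"
  unfolding cube_letters_def using A_finite by (intro finite_SigmaI) auto

theorem kgraph_cube: "kgraph \<Lambda>"
proof
  note S = kg_mor_cube kg_src_cube kg_rng_cube kg_obj_cube
  have "countable W" using finite_Lt by (intro countable_lists countable_finite)
  then show "countable (kg_mor \<Lambda>)" unfolding kg_mor_cube by (rule countable_image)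
  have nil: "[] \<in> W" by simp
  fix \<mu> assume "\<mu> \<in> kg_mor \<Lambda>"
  then obtain u where u: "u \<in> W" "\<mu> = cls u" by (auto simp: kg_mor_cube)
  show "kg_src \<Lambda> \<mu> \<in> kg_obj \<Lambda>" "kg_rng \<Lambda> \<mu> \<in> kg_obj \<Lambda>" by (simp_all add: S)
  show "kg_comp \<Lambda> \<mu> (kg_src \<Lambda> \<mu>) = \<mu>" "kg_comp \<Lambda> (kg_rng \<Lambda> \<mu>) \<mu> = \<mu>"
    unfolding kg_src_cube kg_rng_cube u(2) using kg_comp_cube[OF u(1) nil] kg_comp_cube[OF nil u(1)] by simp_all
  {
    fix \<nu> assume "\<nu> \<in> kg_mor \<Lambda>"
    then obtain v where v: "v \<in> W" "\<nu> = cls v" by (auto simp: kg_mor_cube)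
    show "kg_comp \<Lambda> \<mu> \<nu> \<in> kg_mor \<Lambda>" unfolding u(2) v(2) kg_comp_cube[OF u(1) v(1)] kg_mor_cube
      using u v by (intro imageI) simp
    show "kg_src \<Lambda> (kg_comp \<Lambda> \<mu> \<nu>) = kg_src \<Lambda> \<nu>" "kg_rng \<Lambda> (kg_comp \<Lambda> \<mu> \<nu>) = kg_rng \<Lambda> \<mu>"
      by (simp_all add: S)
    show "kg_deg \<Lambda> (kg_comp \<Lambda> \<mu> \<nu>) = kg_deg \<Lambda> \<mu> + kg_deg \<Lambda> \<nu>"
      unfolding u(2) v(2) kg_comp_cube[OF u(1) v(1)] using u v by (simp add: kg_deg_cube word_deg_simps)
  }
  fix m n assume deg: "kg_deg \<Lambda> \<mu> = m + n"
  have dm: "word_deg u = m + n" using deg u by (simp add: kg_deg_cube)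
  then have "m \<le> word_deg u" by (simp add: less_eq_vec_def)
  then obtain x y where xy: "x \<in> W" "y \<in> W" "word_deg x = m" "\<mu> = cls (x @ y)"
    using split_word[OF u(1)] u(2) by metis
  have "word_deg (x @ y) = m + n" using deg xy by (simp add: kg_deg_cube)
  then have dy: "word_deg y = n" using xy by (simp add: word_deg_simps)
  show "\<exists>!p. p \<in> kg_mor \<Lambda> \<times> kg_mor \<Lambda> \<and> kg_src \<Lambda> (fst p) = kg_rng \<Lambda> (snd p) \<and>
      kg_deg \<Lambda> (fst p) = m \<and> kg_deg \<Lambda> (snd p) = n \<and> \<mu> = kg_comp \<Lambda> (fst p) (snd p)"
  proof (rule ex1I[of _ "(cls x, cls y)"], goal_cases)
    case 1
    show ?case using xy dy kg_comp_cube[OF xy(1,2)] by (auto simp: S kg_deg_cube)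
  next
    case (2 p)
    then obtain x' y' where p: "x' \<in> W" "y' \<in> W" "p = (cls x', cls y')" by (cases p) (auto simp: kg_mor_cube)
    have d: "word_deg x' = word_deg x" using 2 p xy by (simp add: kg_deg_cube)
    have "cls (x @ y) = cls (x' @ y')" using 2 p xy(4) kg_comp_cube[OF p(1,2)] by simp
    then have "track_eq (x @ y) (x' @ y')" using xy p by (subst (asm) cls_eq_iff) simp_all
    from track_eq_append_cancel[OF this xy(1) p(1) xy(2) p(2) d[symmetric]]
    show ?case using p xy by (simp add: cls_eq_iff) (simp add: track_eq_def)
  qed
next
  fix \<kappa> \<mu> \<nu> assume "\<kappa> \<in> kg_mor \<Lambda>" "\<mu> \<in> kg_mor \<Lambda>" "\<nu> \<in> kg_mor \<Lambda>"
  then obtain u v w where uvw: "u \<in> W" "v \<in> W" "w \<in> W" and eq: "\<kappa> = cls u" "\<mu> = cls v" "\<nu> = cls w"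
    unfolding kg_mor_cube by blast
  show "kg_comp \<Lambda> (kg_comp \<Lambda> \<kappa> \<mu>) \<nu> = kg_comp \<Lambda> \<kappa> (kg_comp \<Lambda> \<mu> \<nu>)"
    using uvw kg_comp_cube[of "u @ v" w] kg_comp_cube[of u "v @ w"] by (simp add: eq kg_comp_cube)
next
  fix v assume "v \<in> kg_obj \<Lambda>"
  then show "kg_deg \<Lambda> v = 0" using kg_deg_cube[of "[]"] by (simp add: kg_obj_cube word_deg_simps)
qed

lemma kg_edges_cube: "kg_edges \<Lambda> i = (\<lambda>a. cls [(i, a)]) ` A i"
proof
  show "kg_edges \<Lambda> i \<subseteq> (\<lambda>a. cls [(i, a)]) ` A i"
  proof
    fix \<mu> assume "\<mu> \<in> kg_edges \<Lambda> i"
    then have "\<mu> \<in> (\<lambda>w. cls w) ` W" and deg: "kg_deg \<Lambda> \<mu> = axis i 1"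
      by (simp_all only: kg_edges_def kg_mor_cube mem_Collect_eq)
    then obtain w where w: "w \<in> W" "\<mu> = cls w" by blast
    with deg have w_deg: "word_deg w = axis i 1" by (simp add: kg_deg_cube)
    have deg_i: "word_deg w $ l = (if l = i then 1 else 0)" for l using w_deg by (simp add: axis_def)
    have "w \<noteq> []" using deg_i[of i] by (auto simp: word_deg_simps)
    then obtain j a v where v: "w = (j, a) # v" by (cases w) auto
    have "word_deg w $ j = 1 + word_deg v $ j" by (simp add: v word_deg_simps axis_def)
    then have j: "j = i" using deg_i[of j] by (simp split: if_splits)
    have "word_deg v $ l = 0" for l
      using deg_i[of l] by (simp add: v j word_deg_simps axis_def split: if_splits)
    then have "v = []" by (intro word_deg_eq_zero) (simp add: vec_eq_iff)
    with v j w(1) have "a \<in> A i" "w = [(i, a)]" by (simp_all add: letter_iff)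
    then show "\<mu> \<in> (\<lambda>a. cls [(i, a)]) ` A i" unfolding w(2) by blast
  qed
  show "(\<lambda>a. cls [(i, a)]) ` A i \<subseteq> kg_edges \<Lambda> i"
  proof
    fix \<mu> assume "\<mu> \<in> (\<lambda>a. cls [(i, a)]) ` A i"
    then obtain a where a: "a \<in> A i" "\<mu> = cls [(i, a)]" by blast
    then have W: "[(i, a)] \<in> W" by (simp add: letter_iff)
    have "kg_deg \<Lambda> \<mu> = axis i 1" unfolding a(2) kg_deg_cube[OF W] by (simp add: word_deg_simps)
    then show "\<mu> \<in> kg_edges \<Lambda> i" using W by (simp add: kg_edges_def kg_mor_cube a(2))
  qed
qed

lemma cls_square:
  assumes "i \<noteq> j" "a \<in> A i" "a' \<in> A i" "b \<in> A j" "b' \<in> A j"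
  shows "kg_comp \<Lambda> (cls [(j, b)]) (cls [(i, a)]) = kg_comp \<Lambda> (cls [(i, a')]) (cls [(j, b')])
    \<longleftrightarrow> a \<otimes> b = b' \<otimes> a'"
proof -
  have W: "[(j, b)] \<in> W" "[(i, a)] \<in> W" "[(i, a')] \<in> W" "[(j, b')] \<in> W"
    "[(j, b), (i, a)] \<in> W" "[(i, a'), (j, b')] \<in> W" using assms by (simp_all add: letter_iff)
  show ?thesis
    using kg_comp_cube[OF W(1,2)] kg_comp_cube[OF W(3,4)] cls_eq_iff[OF W(5,6)] track_square[OF assms] by simp
qed

text \<open>The same geometric square read from an adjacent corner. It turns both rigidity
  statements into instances of \<open>square\<close>.\<close>

lemma square_transpose:
  assumes "a \<in> A i" "a' \<in> A i" "b \<in> A j" "b' \<in> A j"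
  shows "a \<otimes> b = b' \<otimes> a' \<longleftrightarrow> inv b' \<otimes> a = a' \<otimes> inv b"
proof -
  have G: "a \<in> carrier G" "a' \<in> carrier G" "b \<in> carrier G" "b' \<in> carrier G" using assms A_carrierD by auto
  have "inv b' \<otimes> a = a' \<otimes> inv b \<longleftrightarrow> a = b' \<otimes> (a' \<otimes> inv b)"
    using G inv_solve_left[of "a' \<otimes> inv b" b' a] by auto
  also have "\<dots> \<longleftrightarrow> a = (b' \<otimes> a') \<otimes> inv b" using G by (simp add: m_assoc)
  also have "\<dots> \<longleftrightarrow> b' \<otimes> a' = a \<otimes> b" using G inv_solve_right[of a "b' \<otimes> a'" b] by auto
  finally show ?thesis by auto
qed

theorem right_rigid_cube: "right_rigid \<Lambda>"
  unfolding right_rigid_def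
proof (intro allI impI ballI)
  fix i j :: 'k and x' y' assume ij: "i \<noteq> j" and "x' \<in> kg_edges \<Lambda> i" "y' \<in> kg_edges \<Lambda> j"
  then obtain a' b where a': "a' \<in> A i" "x' = cls [(i, a')]" and b: "b \<in> A j" "y' = cls [(j, b)]"
    by (auto simp: kg_edges_cube)
  have ex: "\<exists>!p. p \<in> A j \<times> A i \<and> a' \<otimes> inv b = fst p \<otimes> snd p"
    using ij a' b A_inv by (intro square) auto
  then obtain b' a where ba: "b' \<in> A j" "a \<in> A i" "a' \<otimes> inv b = b' \<otimes> a" by (auto simp: Ex1_def)
  show "\<exists>!p. p \<in> kg_edges \<Lambda> i \<times> kg_edges \<Lambda> j \<and> kg_comp \<Lambda> y' (fst p) = kg_comp \<Lambda> x' (snd p)"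
  proof (rule ex1I[of _ "(cls [(i, a)], cls [(j, inv b')])"], goal_cases)
    case 1
    have b'': "inv b' \<in> A j" "inv (inv b') = b'" using ba A_inv A_carrierD by auto
    then have "a \<otimes> b = inv b' \<otimes> a'"
      using square_transpose[OF ba(2) a'(1) b(1) b''(1)] ba(3) by simp
    then show ?case using ba b'' cls_square[OF ij ba(2) a'(1) b(1) b''(1)] by (simp add: kg_edges_cube a' b)
  next
    case (2 p)
    then obtain a2 b2 where p: "p = (cls [(i, a2)], cls [(j, b2)])" "a2 \<in> A i" "b2 \<in> A j"
      by (cases p) (auto simp: kg_edges_cube)
    have "a2 \<otimes> b = b2 \<otimes> a'"
      using 2 cls_square[OF ij p(2) a'(1) b(1) p(3)] by (simp add: p a' b)
    then have "a' \<otimes> inv b = inv b2 \<otimes> a2" using square_transpose[OF p(2) a'(1) b(1) p(3)] by simp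
    then have "(inv b2, a2) = (b', a)"
      by (intro ex1_unique[OF ex]) (simp_all add: p ba A_inv)
    then have "inv (inv b2) = inv b'" "a2 = a" by auto
    then show ?case using p A_carrierD[OF p(3)] by simp
  qed
qed

theorem left_rigid_cube: "left_rigid \<Lambda>"
  unfolding left_rigid_def
proof (intro allI impI ballI)
  fix i j :: 'k and x y assume ij: "i \<noteq> j" and "x \<in> kg_edges \<Lambda> i" "y \<in> kg_edges \<Lambda> j"
  then obtain a b' where a: "a \<in> A i" "x = cls [(i, a)]" and b': "b' \<in> A j" "y = cls [(j, b')]"
    by (auto simp: kg_edges_cube)
  have ex: "\<exists>!p. p \<in> A i \<times> A j \<and> inv b' \<otimes> a = fst p \<otimes> snd p"
    using ij a b' A_inv by (intro square) auto
  then obtain a' b where ba: "a' \<in> A i" "b \<in> A j" "inv b' \<otimes> a = a' \<otimes> b" by (auto simp: Ex1_def)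
  show "\<exists>!p. p \<in> kg_edges \<Lambda> i \<times> kg_edges \<Lambda> j \<and> kg_comp \<Lambda> (snd p) x = kg_comp \<Lambda> (fst p) y"
  proof (rule ex1I[of _ "(cls [(i, a')], cls [(j, inv b)])"], goal_cases)
    case 1
    have b'': "inv b \<in> A j" "inv (inv b) = b" using ba A_inv A_carrierD by auto
    then have "a \<otimes> inv b = b' \<otimes> a'"
      using square_transpose[OF a(1) ba(1) b''(1) b'(1)] ba(3) by simp
    then show ?case using ba b'' cls_square[OF ij a(1) ba(1) b''(1) b'(1)] by (simp add: kg_edges_cube a b')
  next
    case (2 p)
    then obtain a2 b2 where p: "p = (cls [(i, a2)], cls [(j, b2)])" "a2 \<in> A i" "b2 \<in> A j"
      by (cases p) (auto simp: kg_edges_cube)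
    have "a \<otimes> b2 = b' \<otimes> a2"
      using 2 cls_square[OF ij a(1) p(2,3) b'(1)] by (simp add: p a b')
    then have "inv b' \<otimes> a = a2 \<otimes> inv b2" using square_transpose[OF a(1) p(2,3) b'(1)] by simp
    then have "(a2, inv b2) = (a', b)"
      by (intro ex1_unique[OF ex]) (simp_all add: p ba A_inv)
    then have "inv (inv b2) = inv b" "a2 = a'" by auto
    then show ?case using p A_carrierD[OF p(3)] by simp
  qed
qed

end

section \<open>Aperiodic paths\<close>

text \<open>The walks below run back and forth along a generator and reverse their direction exactly at the
  squares.  The gaps between the squares grow, so the set of reversals is not periodic, not even
  eventually.\<close>

primrec zigzag_sign :: "nat \<Rightarrow> bool" where
  "zigzag_sign 0 = True"
| "zigzag_sign (Suc t) = (zigzag_sign t \<noteq> (\<exists>k. t = k * k))"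

text \<open>The next square after k^2 is k^2 + 2 k + 1, which lies beyond k^2 + d.\<close>

lemma not_square_add: assumes "0 < d" "d \<le> k" shows "k * k + d \<noteq> l * (l :: nat)"
proof
  assume eq: "k * k + d = l * l"
  show False
  proof (cases "l \<le> k")
    case True
    then have "l * l \<le> k * k" by (intro mult_mono) auto
    then show False using eq assms by simp
  next
    case False
    then have "Suc k * Suc k \<le> l * l" by (intro mult_mono) auto
    then show False using eq assms by simp
  qed
qed

context tree_coordinates
begin

definition zigzag_letter :: "'k \<Rightarrow> nat \<Rightarrow> 'a" where
  "zigzag_letter i t = (if zigzag_sign t then (SOME a. a \<in> A i) else inv (SOME a. a \<in> A i))"

lemma zigzag_letter_A: "zigzag_letter i t \<in> A i"
proof -
  have "(SOME a. a \<in> A i) \<in> A i" using A_nonempty[of i] by (simp add: some_in_eq)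
  then show ?thesis by (simp add: zigzag_letter_def A_inv)
qed

primrec vertex :: "'k \<Rightarrow> nat \<Rightarrow> 'a" where
  "vertex i 0 = \<one>"
| "vertex i (Suc t) = vertex i t \<otimes> zigzag_letter i t"

lemma vertex_closed: "vertex i t \<in> carrier G"
  by (induction t) (simp_all add: A_carrierD[OF zigzag_letter_A])

text \<open>Two steps return to the same vertex exactly if the letters at t and t + 1 are inverse to
  each other, that is, if the sign flips after t; equal letters cannot cancel because no generator
  is its own inverse.\<close>

lemma vertex_reversal: "c i (vertex i t) = c i (vertex i (Suc (Suc t))) \<longleftrightarrow> (\<exists>k. t = k * k)"
proof -
  define a where "a = (SOME a. a \<in> A i)"
  have a: "a \<in> A i" using A_nonempty[of i] by (simp add: a_def some_in_eq)
  have aG: "a \<in> carrier G" "inv a \<noteq> a" using a A_carrierD A_inv_free by auto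
  have G: "zigzag_letter i t \<in> carrier G" for t using zigzag_letter_A A_carrierD by blast
  have "vertex i t = vertex i (Suc (Suc t))" if "c i (vertex i t) = c i (vertex i (Suc (Suc t)))"
  proof (rule coord_inject)
    fix j
    show "c j (vertex i t) = c j (vertex i (Suc (Suc t)))"
      using that coord_step[OF vertex_closed[of i t] zigzag_letter_A[of i t], of j]
        coord_step[OF vertex_closed[of i "Suc t"] zigzag_letter_A[of i "Suc t"], of j]
      by (cases "j = i") simp_all
  qed (rule vertex_closed)+
  then have "c i (vertex i t) = c i (vertex i (Suc (Suc t))) \<longleftrightarrow> vertex i t = vertex i (Suc (Suc t))"
    by auto
  also have "\<dots> \<longleftrightarrow> zigzag_letter i t \<otimes> zigzag_letter i (Suc t) = \<one>"
    using vertex_closed[of i t] G by (simp add: m_assoc)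
  also have "\<dots> \<longleftrightarrow> zigzag_sign t \<noteq> zigzag_sign (Suc t)"
  proof -
    have "a \<otimes> a \<noteq> \<one>" using aG inv_equality by metis
    moreover have "inv a \<otimes> inv a \<noteq> \<one>" using aG inv_equality[of "inv a" "inv a"] by auto
    ultimately show ?thesis
      using aG unfolding zigzag_letter_def a_def[symmetric] by (auto simp del: zigzag_sign.simps)
  qed
  finally show ?thesis by auto
qed

definition position :: "nat ^ 'k \<Rightarrow> 'a" where
  "position m = (SOME g. g \<in> carrier G \<and> (\<forall>i. c i g = c i (vertex i (m $ i))))"

lemma position: "position m \<in> carrier G" "c i (position m) = c i (vertex i (m $ i))"
proof -
  have "\<exists>g. g \<in> carrier G \<and> (\<forall>i. c i g = c i (vertex i (m $ i)))"
    using coord_surj[of "\<lambda>i. vertex i (m $ i)"] vertex_closed by auto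
  then have "position m \<in> carrier G \<and> (\<forall>i. c i (position m) = c i (vertex i (m $ i)))"
    unfolding position_def by (rule someI_ex)
  then show "position m \<in> carrier G" "c i (position m) = c i (vertex i (m $ i))" by auto
qed

text \<open>Directly the set of all words whose walks follow the prescribed vertices; for m \<le> n
  it is one congruence class, hence already a morphism.\<close>

definition zigzag :: "nat ^ 'k \<Rightarrow> nat ^ 'k \<Rightarrow> ('k \<times> 'a) list set" where
  "zigzag m n = {w \<in> W. \<forall>i. track i (position m) w = map (\<lambda>t. c i (vertex i t)) [Suc (m $ i)..<Suc (n $ i)]}"

lemma zigzag_cls: assumes "w \<in> zigzag m n" shows "zigzag m n = cls w"
proof -
  have w: "w \<in> W" using assms by (simp add: zigzag_def)
  have "zigzag m n = {v \<in> W. \<forall>i. track i (position m) w = track i (position m) v}"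
    using assms unfolding zigzag_def by auto
  also have "\<dots> = {v \<in> W. track_eq w v}"
    using track_eqI[OF w _ position(1)] track_eqD[OF _ w _ position(1)] by blast
  finally show ?thesis by (simp add: cls_eq[OF w])
qed

lemma zigzag_endpoint:
  assumes "w \<in> zigzag m n" "m \<le> n" shows "endpoint (position m) w = position n"
proof (rule coord_inject)
  have w: "w \<in> W" using assms by (simp add: zigzag_def)
  then show "endpoint (position m) w \<in> carrier G" by (rule endpoint_closed[OF _ position(1)])
  fix i
  have "m $ i \<le> n $ i" using assms(2) by (simp add: less_eq_vec_def)
  then show "c i (endpoint (position m) w) = c i (position n)"
    using assms(1) by (cases "m $ i = n $ i")
      (simp_all add: coord_endpoint[OF w position(1)] zigzag_def position(2) last_map del: upt_Suc)
qed (rule position)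

lemma zigzag_append:
  assumes "u \<in> zigzag l m" "v \<in> zigzag m n" "l \<le> m" "m \<le> n"
  shows "u @ v \<in> zigzag l n"
proof -
  have "[Suc (l $ i)..<Suc (m $ i)] @ [Suc (m $ i)..<Suc (n $ i)] = [Suc (l $ i)..<Suc (n $ i)]" for i
    using assms(3,4) upt_add_eq_append[of "Suc (l $ i)" "Suc (m $ i)" "n $ i - m $ i"]
    by (simp add: less_eq_vec_def del: upt_Suc)
  then show ?thesis
    using assms zigzag_endpoint[OF assms(1,3)] by (simp add: zigzag_def track_append del: upt_Suc flip: map_append)
qed

lemma zigzag_nonempty: "m \<le> n \<Longrightarrow> \<exists>w. w \<in> zigzag m n"
proof (induction "\<Sum>i\<in>UNIV. n $ i - m $ i" arbitrary: m)
  case 0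
  then have "n $ i = m $ i" for i by (auto simp: less_eq_vec_def intro: antisym)
  then have "[] \<in> zigzag m n" by (simp add: zigzag_def)
  then show ?case ..
next
  case (Suc k)
  obtain i where i: "n $ i - m $ i \<noteq> 0" using Suc.hyps(2) by (cases "\<forall>i. n $ i - m $ i = 0") auto
  define m' where "m' = m + axis i 1"
  have m': "m' $ j = (if j = i then Suc (m $ i) else m $ j)" for j by (simp add: m'_def axis_def)
  have le: "m' \<le> n" using Suc.prems i by (auto simp: less_eq_vec_def m')
  have "(\<Sum>j\<in>UNIV. n $ j - m $ j) = (\<Sum>j\<in>UNIV. (n $ j - m' $ j) + axis i 1 $ j)"
    using i by (intro sum.cong) (auto simp: m' axis_def)
  also have "\<dots> = (\<Sum>j\<in>UNIV. n $ j - m' $ j) + 1" unfolding sum.distrib by (simp add: axis_def)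
  finally obtain w where w: "w \<in> zigzag m' n" using Suc.hyps le by auto
  obtain a where a: "a \<in> A i" "c i (position m \<otimes> a) = c i (vertex i (m $ i) \<otimes> zigzag_letter i (m $ i))"
    using coord_lift[OF vertex_closed position(1) zigzag_letter_A] position(2) by metis
  have aG: "a \<in> carrier G" using a A_carrierD by blast
  have eq: "position m \<otimes> a = position m'"
  proof (rule coord_inject)
    show "c j (position m \<otimes> a) = c j (position m')" for j
      using a coord_step[OF position(1) a(1), of j] by (cases "j = i") (auto simp: position(2) m')
  qed (use position aG in auto)
  \<comment> \<open>The letter is inverted because \<open>track\<close> multiplies by inverse
    letters.\<close>
  have "(i, inv a) # w \<in> zigzag m n"
    unfolding zigzag_def
  proof (intro CollectI conjI allI)
    show "(i, inv a) # w \<in> W" using w a A_inv by (simp add: zigzag_def letter_iff)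
    fix j
    have "track j (position m') w = map (\<lambda>t. c j (vertex j t)) [Suc (m' $ j)..<Suc (n $ j)]"
      using w by (simp add: zigzag_def del: upt_Suc)
    moreover have "[Suc (m $ i)..<Suc (n $ i)] = Suc (m $ i) # [Suc (Suc (m $ i))..<Suc (n $ i)]"
      using i by (intro upt_conv_Cons) linarith
    ultimately show "track j (position m) ((i, inv a) # w) = map (\<lambda>t. c j (vertex j t)) [Suc (m $ j)..<Suc (n $ j)]"
      using a aG by (cases "j = i") (simp_all add: eq position(2) m' del: upt_Suc)
  qed
  then show ?case ..
qed

lemma zigzag_mor: assumes "m \<le> n" shows "zigzag m n \<in> kg_mor \<Lambda>" "kg_deg \<Lambda> (zigzag m n) = n - m"
proof -
  obtain w where w: "w \<in> zigzag m n" using zigzag_nonempty assms by blast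
  then have W: "w \<in> W" by (simp add: zigzag_def)
  show "zigzag m n \<in> kg_mor \<Lambda>" unfolding zigzag_cls[OF w] kg_mor_cube using W by (rule imageI)
  have "word_deg w $ i = n $ i - m $ i" for i
    using w length_track[of i "position m" w] by (simp add: zigzag_def del: upt_Suc)
  then show "kg_deg \<Lambda> (zigzag m n) = n - m"
    unfolding zigzag_cls[OF w] kg_deg_cube[OF W] by (simp add: vec_eq_iff)
qed

lemma zigzag_self: "zigzag m m = cls []"
  by (rule zigzag_cls) (simp add: zigzag_def)

lemma infinite_path_zigzag: "infinite_path \<Lambda> (\<lambda>(m, n). zigzag m n)"
proof -
  have comp: "zigzag l n = kg_comp \<Lambda> (zigzag l m) (zigzag m n)" if le: "l \<le> m" "m \<le> n" for l m n
  proof -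
    obtain u v where uv: "u \<in> zigzag l m" "v \<in> zigzag m n" using zigzag_nonempty le by blast
    then have "u \<in> W" "v \<in> W" by (simp_all add: zigzag_def)
    then show ?thesis
      unfolding zigzag_cls[OF uv(1)] zigzag_cls[OF uv(2)] zigzag_cls[OF zigzag_append[OF uv le]]
      by (rule kg_comp_cube[symmetric])
  qed
  let ?\<omega> = "\<lambda>(m, n). zigzag m n"
  show ?thesis
    unfolding infinite_path_def
  proof (intro conjI ballI impI)
    fix \<mu> :: "(nat ^ 'k) \<times> (nat ^ 'k)" assume "\<mu> \<in> kg_mor Omega"
    then obtain m n where \<mu>: "\<mu> = (m, n)" "m \<le> n" by (auto simp: Omega_def)
    show "?\<omega> \<mu> \<in> kg_mor \<Lambda>" "kg_deg \<Lambda> (?\<omega> \<mu>) = kg_deg Omega \<mu>"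
      using zigzag_mor[OF \<mu>(2)] by (simp_all add: \<mu>(1) Omega_def)
    show "?\<omega> (kg_src Omega \<mu>) = kg_src \<Lambda> (?\<omega> \<mu>)" "?\<omega> (kg_rng Omega \<mu>) = kg_rng \<Lambda> (?\<omega> \<mu>)"
      unfolding kg_src_cube kg_rng_cube by (simp_all add: \<mu>(1) Omega_def zigzag_self)
  next
    fix \<mu> \<nu> :: "(nat ^ 'k) \<times> (nat ^ 'k)"
    assume "\<mu> \<in> kg_mor Omega" "\<nu> \<in> kg_mor Omega" "kg_src Omega \<mu> = kg_rng Omega \<nu>"
    then obtain l m n where "\<mu> = (l, m)" "\<nu> = (m, n)" "l \<le> m" "m \<le> n" by (auto simp: Omega_def)
    then show "?\<omega> (kg_comp Omega \<mu> \<nu>) = kg_comp \<Lambda> (?\<omega> \<mu>) (?\<omega> \<nu>)"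
      using comp[of l m n] by (simp add: Omega_def)
  qed
qed

text \<open>The starting vertex is included, so index s is the position after s steps and a reversal
  compares the indices s and s + 2.\<close>

definition walk :: "'k \<Rightarrow> 'a \<Rightarrow> ('k \<times> 'a) list \<Rightarrow> 't list" where
  "walk i g w = c i g # track i g w"

text \<open>A change of base point translates the whole walk, which preserves coincidences, so
  reversals can be read off a morphism wherever it is placed.\<close>

lemma walk_reversal_base:
  assumes "w \<in> W" "g \<in> carrier G" "h \<in> carrier G" "Suc (Suc s) \<le> word_deg w $ i"
  shows "walk i g w ! s = walk i g w ! Suc (Suc s) \<longleftrightarrow> walk i h w ! s = walk i h w ! Suc (Suc s)"
proof -
  have map: "walk i (k \<otimes> g) w = map (translate k i) (walk i g w)" if "k \<in> carrier G" "g \<in> carrier G" for k g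
    using that assms(1) by (simp add: walk_def track_translate translate_coord)
  have imp: "walk i h w ! s = walk i h w ! Suc (Suc s)"
    if g: "g \<in> carrier G" "h \<in> carrier G" and eq: "walk i g w ! s = walk i g w ! Suc (Suc s)" for g h
  proof -
    have h: "h = (h \<otimes> inv g) \<otimes> g" using g by (simp add: m_assoc)
    have "walk i h w = map (translate (h \<otimes> inv g) i) (walk i g w)"
      using map[of "h \<otimes> inv g" g] g by (simp flip: h)
    moreover have "Suc (Suc s) < length (walk i g w)" using assms(4) by (simp add: walk_def length_track)
    ultimately show ?thesis using eq by simp
  qed
  show ?thesis using imp[OF assms(2,3)] imp[OF assms(3,2)] by blast
qed

text \<open>The last vertex of the walk of u is the first one of the walk of v and must be counted
  once, hence the \<open>butlast\<close>.\<close>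

lemma walk_append_nth:
  assumes "s \<le> word_deg v $ i" "u \<in> W" "g \<in> carrier G"
  shows "walk i g (u @ v @ w) ! (word_deg u $ i + s) = walk i (endpoint g u) v ! s"
proof -
  have "walk i g (u @ v @ w) = butlast (walk i g u) @ walk i (endpoint g u) v @ track i (endpoint (endpoint g u) v) w"
  proof -
    have "walk i g u = butlast (walk i g u) @ [c i (endpoint g u)]"
      using append_butlast_last_id[of "walk i g u"] coord_endpoint[OF assms(2,3)] by (simp add: walk_def)
    moreover have "walk i g (u @ v @ w) = walk i g u @ track i (endpoint g u) v @ track i (endpoint (endpoint g u) v) w"
      by (simp add: walk_def track_append)
    ultimately show ?thesis by (simp add: walk_def)
  qed
  moreover have "length (butlast (walk i g u)) = word_deg u $ i"
    unfolding length_butlast by (simp add: walk_def length_track)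
  moreover have "s < length (walk i (endpoint g u) v)" using assms(1) by (simp add: walk_def length_track)
  ultimately show ?thesis by (simp add: nth_append)
qed

lemma zigzag_reversal:
  assumes w: "w \<in> zigzag m n" and s: "Suc (Suc s) \<le> n $ i - m $ i" and g: "g \<in> carrier G"
  shows "walk i g w ! s = walk i g w ! Suc (Suc s) \<longleftrightarrow> (\<exists>k. m $ i + s = k * k)"
proof -
  have W: "w \<in> W" using w by (simp add: zigzag_def)
  have len: "word_deg w $ i = n $ i - m $ i"
    using w length_track[of i "position m" w] by (simp add: zigzag_def del: upt_Suc)
  have "m $ i < Suc (n $ i)" using s by simp
  then have "walk i (position m) w = map (\<lambda>t. c i (vertex i t)) [m $ i..<Suc (n $ i)]"
    unfolding walk_def using w by (subst upt_conv_Cons) (simp_all add: zigzag_def position(2) del: upt_Suc)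
  then have "walk i (position m) w ! r = c i (vertex i (m $ i + r))" if "r \<le> n $ i - m $ i" for r
  proof -
    have "m $ i + r < Suc (n $ i)" "r < Suc (n $ i) - m $ i" using that s by linarith+
    then show ?thesis unfolding \<open>walk i (position m) w = _\<close> by (simp del: upt_Suc)
  qed
  then show ?thesis
    using walk_reversal_base[OF W g position(1)[of m], of s i] s len vertex_reversal[of i "m $ i + s"] by simp
qed

theorem aperiodicity_cube: "aperiodicity_condition \<Lambda>"
proof -
  have "aperiodic_path (\<lambda>(m, n). zigzag m n)"
    unfolding aperiodic_path_def
  proof (intro allI impI)
    fix q :: "nat ^ 'k" and p :: "int ^ 'k" assume "p \<noteq> 0"
    then obtain i where i: "p $ i \<noteq> 0" by (auto simp: vec_eq_iff)
    define m :: "nat ^ 'k" where "m = (\<chi> j. nat \<bar>p $ j\<bar>)"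
    define b where "b = m $ i + q $ i"
    define b' where "b' = nat (int (m $ i) + p $ i) + q $ i"
    define d where "d = nat \<bar>p $ i\<bar>"
    \<comment> \<open>k is at least d, so k^2 + d is no square, and k^2 is at least b and b', so the
      time k^2 lies in both segments. Segments of length k^2 + 2 leave the two further steps that a
      reversal at an index up to k^2 needs.\<close>
    define k where "k = b + b' + d"
    define n :: "nat ^ 'k" where "n = m + (\<chi> j. k * k + 2)"
    have d: "0 < d" "d \<le> k" using i by (auto simp: d_def k_def)
    have le: "m \<le> n" by (simp add: n_def less_eq_vec_def)
    have bb: "b' = b + d \<or> b = b' + d" by (auto simp: b_def b'_def d_def m_def)
    have kk: "b \<le> k * k" "b' \<le> k * k"
    proof -
      have "b \<le> k" "b' \<le> k" by (simp_all add: k_def)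
      then show "b \<le> k * k" "b' \<le> k * k" using le_square[of k] by linarith+
    qed
    have "zigzag (shift m p + q) (shift n p + q) \<noteq> zigzag (m + q) (n + q)"
    proof
      assume eq: "zigzag (shift m p + q) (shift n p + q) = zigzag (m + q) (n + q)"
      have "m + q \<le> n + q" using le by (simp add: less_eq_vec_def)
      then obtain w where w: "w \<in> zigzag (m + q) (n + q)" using zigzag_nonempty by blast
      have b: "(m + q) $ i = b" "(n + q) $ i = b + (k * k + 2)" by (simp_all add: b_def n_def)
      have "0 \<le> int (m $ i) + p $ i" by (simp add: m_def)
      then have "nat (int (m $ i + r) + p $ i) = nat (int (m $ i) + p $ i) + r" for r by linarith
      from this[of "k * k + 2"] have b': "(shift m p + q) $ i = b'" "(shift n p + q) $ i = b' + (k * k + 2)"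
        by (simp_all add: b'_def n_def shift_def)
      have sq: "(\<exists>l. b + s = l * l) \<longleftrightarrow> (\<exists>l. b' + s = l * l)" if "s \<le> k * k" for s
        using zigzag_reversal[OF w _ one_closed, of s i] zigzag_reversal[OF w[folded eq] _ one_closed, of s i] that
        unfolding b b' by simp
      show False
        using bb
      proof
        assume "b' = b + d"
        then show False using sq[of "k * k - b"] kk not_square_add[OF d] by (auto simp: add.commute)
      next
        assume "b = b' + d"
        then show False using sq[of "k * k - b'"] kk not_square_add[OF d] by (auto simp: add.commute)
      qed
    qed
    moreover have "0 \<le> int (m $ j) + p $ j" for j by (simp add: m_def)
    ultimately show "\<exists>m n. m \<le> n \<and> (\<forall>i. 0 \<le> int (m $ i) + p $ i) \<and>
        (case (shift m p + q, shift n p + q) of (m, n) \<Rightarrow> zigzag m n) \<noteq> (case (m + q, n + q) of (m, n) \<Rightarrow> zigzag m n)"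
      using le by (intro exI[of _ m] exI[of _ n]) auto
  qed
  moreover have "(\<lambda>(m, n). zigzag m n) (0, 0) = cls []" by (simp add: zigzag_self)
  ultimately show ?thesis
    unfolding aperiodicity_condition_def kg_obj_cube using infinite_path_zigzag by blast
qed

lemma one_object_kgraph_cube: "one_object_kgraph \<Lambda> (cls [])"
proof -
  have "finite {\<mu> \<in> kg_mor \<Lambda>. kg_deg \<Lambda> \<mu> = n}" for n
  proof (rule finite_subset)
    show "{\<mu> \<in> kg_mor \<Lambda>. kg_deg \<Lambda> \<mu> = n} \<subseteq> (\<lambda>w. cls w) ` {w. set w \<subseteq> Lt \<and> length w = (\<Sum>i\<in>UNIV. n $ i)}"
    proof
      fix \<mu> assume "\<mu> \<in> {\<mu> \<in> kg_mor \<Lambda>. kg_deg \<Lambda> \<mu> = n}"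
      then have "\<mu> \<in> (\<lambda>w. cls w) ` W" and deg: "kg_deg \<Lambda> \<mu> = n" by (simp_all only: kg_mor_cube mem_Collect_eq)
      then obtain w where w: "w \<in> W" "\<mu> = cls w" by blast
      with deg have "word_deg w = n" by (simp add: kg_deg_cube)
      then have "(\<Sum>i\<in>UNIV. n $ i) = (\<Sum>i\<in>UNIV. count_list (map fst w) i)" by (simp add: word_deg_def flip: \<open>word_deg w = n\<close>)
      also have "\<dots> = length (map fst w)" by (intro sum_count_set) auto
      finally have "length w = (\<Sum>i\<in>UNIV. n $ i)" by simp
      moreover have "set w \<subseteq> Lt" using w(1) by (simp add: in_lists_conv_set subset_iff)
      ultimately show "\<mu> \<in> (\<lambda>w. cls w) ` {w. set w \<subseteq> Lt \<and> length w = (\<Sum>i\<in>UNIV. n $ i)}" unfolding w(2) by blast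
    qed
  qed (intro finite_imageI finite_lists_length_eq finite_Lt)
  then show ?thesis
    by (intro one_object_kgraph.intro one_object_kgraph_axioms.intro kgraph_cube kg_obj_cube)
qed

text \<open>A common extension would contain the segment a at two offsets that differ by some d with
  0 < d \<le> K. Reversals of a at s and at d + s would then correspond, but K^2 is a square and K^2
  + d is not. The length K^2 + K + 2 leaves two steps after the time d + K^2.\<close>

lemma zigzag_no_common_extension:
  assumes a: "a \<in> zigzag 0 (\<chi> j. K * K + K + 2)" and W: "u \<in> W" "v \<in> W" "x \<in> W" "y \<in> W"
    and lt: "word_deg u $ i < word_deg v $ i" and le: "word_deg v $ i \<le> K"
  shows "cls (u @ a @ x) \<noteq> cls (v @ a @ y)"
proof
  assume "cls (u @ a @ x) = cls (v @ a @ y)"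
  have aW: "a \<in> W" using a by (simp add: zigzag_def)
  have "track_eq (u @ a @ x) (v @ a @ y)"
    using \<open>cls (u @ a @ x) = cls (v @ a @ y)\<close> W aW by (subst (asm) cls_eq_iff) simp_all
  then have walk: "walk i \<one> (u @ a @ x) = walk i \<one> (v @ a @ y)" by (simp add: walk_def track_eq_def)
  have deg_a: "word_deg a $ i = K * K + K + 2"
    using a length_track[of i "position 0" a] by (simp add: zigzag_def del: upt_Suc)
  define d where "d = word_deg v $ i - word_deg u $ i"
  have d: "0 < d" "d \<le> K" "word_deg v $ i = word_deg u $ i + d" using lt le by (auto simp: d_def)
  have nth: "walk i (endpoint \<one> u) a ! (d + s) = walk i (endpoint \<one> v) a ! s" if "d + s \<le> K * K + K + 2" for s
    using walk_append_nth[of "d + s" a i u \<one> x] walk_append_nth[of s a i v \<one> y] that W deg_a d walk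
    by (simp add: add.assoc)
  have "(\<exists>k. d + K * K = k * k) \<longleftrightarrow> (\<exists>k. K * K = k * k)"
    using zigzag_reversal[OF a _ endpoint_closed[OF W(1) one_closed], of "d + K * K" i]
      zigzag_reversal[OF a _ endpoint_closed[OF W(2) one_closed], of "K * K" i]
      nth[of "K * K"] nth[of "Suc (Suc (K * K))"] d(2) by simp
  then show False using not_square_add[OF d(1,2)] by (auto simp: add.commute)
qed

theorem simple_cube_cstar: "simple_cstar_algebra (kgraph_cstar \<Lambda>)"
proof -
  interpret one_object_kgraph \<Lambda> "cls []" by (rule one_object_kgraph_cube)
  have "0 \<le> (1 :: nat ^ 'k)" by (simp add: less_eq_vec_def)
  \<comment> \<open>A morphism of degree (1, ..., 1), whose powers exceed every given
    degree.\<close>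
  note \<theta> = zigzag_mor[OF this]
  show ?thesis
  proof (rule simple_kgraph_cstar[OF \<theta>(1)])
    show "0 < kg_deg \<Lambda> (zigzag 0 1) $ i" for i by (simp add: \<theta>(2))
    fix N :: "nat ^ 'k"
    define K where "K = (\<Sum>i\<in>UNIV. N $ i)"
    have K: "n $ i \<le> K" if "n \<le> N" for n i
    proof -
      have "n $ i \<le> N $ i" using that by (simp add: less_eq_vec_def)
      also have "\<dots> \<le> K" unfolding K_def by (rule member_le_sum) simp_all
      finally show ?thesis .
    qed
    have le: "0 \<le> (\<chi> j :: 'k. K * K + K + 2)" by (simp add: less_eq_vec_def)
    obtain a where a: "a \<in> zigzag 0 (\<chi> j. K * K + K + 2)" using zigzag_nonempty[OF le] by blast
    then have aW: "a \<in> W" by (simp add: zigzag_def)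
    have "separating N (cls a)"
      unfolding separating_def
    proof (intro conjI ballI impI)
      show "cls a \<in> kg_mor \<Lambda>" unfolding kg_mor_cube using aW by (rule imageI)
      fix \<kappa> \<mu> \<beta> \<gamma> assume "\<kappa> \<in> kg_mor \<Lambda>" "\<mu> \<in> kg_mor \<Lambda>" "\<beta> \<in> kg_mor \<Lambda>" "\<gamma> \<in> kg_mor \<Lambda>"
        and deg: "kg_deg \<Lambda> \<kappa> \<le> N" "kg_deg \<Lambda> \<mu> \<le> N" "kg_deg \<Lambda> \<kappa> \<noteq> kg_deg \<Lambda> \<mu>"
      then obtain u v x y where W: "u \<in> W" "v \<in> W" "x \<in> W" "y \<in> W"
        and eq: "\<kappa> = cls u" "\<mu> = cls v" "\<beta> = cls x" "\<gamma> = cls y"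
        unfolding kg_mor_cube by blast
      have d: "word_deg u \<le> N" "word_deg v \<le> N" "word_deg u \<noteq> word_deg v"
        using deg W by (simp_all add: eq kg_deg_cube)
      then obtain i where "word_deg u $ i \<noteq> word_deg v $ i" by (auto simp: vec_eq_iff)
      then have "cls (u @ a @ x) \<noteq> cls (v @ a @ y)"
        using zigzag_no_common_extension[OF a W _ K[OF d(2)]]
          zigzag_no_common_extension[OF a W(2,1,4,3) _ K[OF d(1)]]
        by (metis linorder_neqE_nat)
      then show "kg_comp \<Lambda> (kg_comp \<Lambda> \<kappa> (cls a)) \<beta> \<noteq> kg_comp \<Lambda> (kg_comp \<Lambda> \<mu> (cls a)) \<gamma>"
        using W aW kg_comp_cube[of "u @ a" x] kg_comp_cube[of "v @ a" y] by (simp add: eq kg_comp_cube)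
    qed
    then show "\<exists>\<alpha>. separating N \<alpha>" ..
  qed
qed

end

theorem corollary3p13:
  fixes G :: "('g, 'x) monoid_scheme"
    and A :: "'k::finite \<Rightarrow> 'g set"
    and V :: "'k \<Rightarrow> 't set"
    and E :: "'k \<Rightarrow> ('t \<times> 't) set"
    and \<phi> :: "'g \<Rightarrow> ('k \<Rightarrow> 't) \<Rightarrow> ('k \<Rightarrow> 't)"
    and base :: "'k \<Rightarrow> 't"
  assumes "2 \<le> CARD('k)"
    and "one_vertex_cube_complex G A V E \<phi> base"
  shows "kgraph (cube_kgraph G A) \<and>
         left_rigid (cube_kgraph G A) \<and> right_rigid (cube_kgraph G A) \<and>
         aperiodicity_condition (cube_kgraph G A) \<and>
         simple_cstar_algebra (kgraph_cstar (cube_kgraph G A))"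
proof -
  interpret tree_coordinates G A "\<lambda>i g. \<phi> g base i"
    by (rule one_vertex_cube_complex.tree_coordinates[OF assms(2)])
  show ?thesis
    by (intro conjI kgraph_cube left_rigid_cube right_rigid_cube aperiodicity_cube simple_cube_cstar)
qed

end
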